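(* Let $(R,\mathfrak m,k)$ be a local ring and set $A=\mathrm{gr}_{\mathfrak m}R$. Let $\boldsymbol x=x_1,\dots,x_c$ be elements in $\mathfrak m$, and let $\overline{\boldsymbol x}$ be their images in $A_1=\mathfrak m/\mathfrak m^2$. The following statements hold for each finitely generated $R$-module $M$. (a) If $\boldsymbol x$ is regular on $M$ and $M$ is Koszul, then $$\mathrm{ld}_R(M/\boldsymbol xM)=c-\mathrm{depth}_A(A\overline{\boldsymbol x};\,\mathrm{gr}_{\mathfrak m}M).$$ In particular, $M/\boldsymbol xM$ is Koszul if and only if $\overline{\boldsymbol x}$ is regular on $\mathrm{gr}_{\mathfrak m}M$. (b) If $\boldsymbol x$ is regular on $M$, and $M/\boldsymbol xM$ is Koszul, then $M$ is Koszul. (c) If $\overline{\boldsymbol x}$ is regular on $\mathrm{gr}_{\mathfrak m}M$, the $R$-modules $M$ and $M/\boldsymbol xM$ are Koszul simultaneously.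
   Context: Local rings are commutative noetherian. $\mathrm{gr}_{\mathfrak m}M=\bigoplus_i\mathfrak m^iM/\mathfrak m^{i+1}M$. "Regular on $M$" means being an $M$-regular sequence. $\mathrm{depth}_A(A\overline{\boldsymbol x};N)$ is the depth (grade) of the ideal $A\overline{\boldsymbol x}$ on $N$; equivalently $c-\sup\{i:H_i(K(\overline{\boldsymbol x};A)\otimes_AN)\ne0\}$, with $K(\overline{\boldsymbol x};A)$ the Koszul complex. A complex $F$ of finitely generated free $R$-modules is minimal if $\partial(F_n)\subseteq\mathfrak mF_{n-1}$ for all $n$. For such $F$, let $\mathcal F^iF\subseteq F$ be the subcomplex with $(\mathcal F^iF)_n=\mathfrak m^{i-n}F_n$ (with $\mathfrak m^j=R$ for $j\le0$); set $\mathrm{lin}^RF=\bigoplus_i\mathcal F^iF/\mathcal F^{i+1}F$. For a finitely generated $R$-module $M$ with minimal free resolution $F$, $\mathrm{ld}_RM=\sup\{i\in\mathbb Z:H_i(\mathrm{lin}^RF)\ne0\}$, and $M$ is Koszul if $\mathrm{ld}_RM=0$. *)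

theory Defs
  imports
    "HOL-Algebra.Module"
    "HOL-Algebra.Ideal_Product"
    "HOL-Algebra.Ring_Divisibility"
    "HOL-Library.Extended_Real"
begin

section \<open>Modules\<close>

definition noetherian_local_ring :: "('a, 'r) ring_scheme \<Rightarrow> 'a set \<Rightarrow> bool" where
  "noetherian_local_ring R \<mm> \<longleftrightarrow> cring R \<and> noetherian_ring R \<and>
     maximalideal \<mm> R \<and> (\<forall>J. maximalideal J R \<longrightarrow> J = \<mm>)"

definition module_span ::
  "('a, 'r) ring_scheme \<Rightarrow> ('a, 'b, 'n) module_scheme \<Rightarrow> 'b set \<Rightarrow> 'b set" where
  "module_span R M X = \<Inter>{H. submodule H R M \<and> X \<subseteq> H}"

definition fin_gen :: "('a, 'r) ring_scheme \<Rightarrow> ('a, 'b, 'n) module_scheme \<Rightarrow> bool" where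
  "fin_gen R M \<longleftrightarrow> (\<exists>X. finite X \<and> X \<subseteq> carrier M \<and> module_span R M X = carrier M)"

definition fin_gen_free :: "('a, 'r) ring_scheme \<Rightarrow> ('a, 'b, 'n) module_scheme \<Rightarrow> bool" where
  "fin_gen_free R M \<longleftrightarrow> (\<exists>B. finite B \<and> B \<subseteq> carrier M \<and>
     (\<forall>x \<in> carrier M. \<exists>!c. c \<in> B \<rightarrow>\<^sub>E carrier R \<and> x = (\<Oplus>\<^bsub>M\<^esub>b\<in>B. c b \<odot>\<^bsub>M\<^esub> b)))"

definition lin_maps ::
  "('a, 'r) ring_scheme \<Rightarrow> ('a, 'b, 'n) module_scheme \<Rightarrow> ('a, 'c, 'p) module_scheme \<Rightarrow> ('b \<Rightarrow> 'c) set" where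
  "lin_maps R M N = {f \<in> carrier M \<rightarrow> carrier N.
     (\<forall>x \<in> carrier M. \<forall>y \<in> carrier M. f (x \<oplus>\<^bsub>M\<^esub> y) = f x \<oplus>\<^bsub>N\<^esub> f y) \<and>
     (\<forall>a \<in> carrier R. \<forall>x \<in> carrier M. f (a \<odot>\<^bsub>M\<^esub> x) = a \<odot>\<^bsub>N\<^esub> f x)}"

text \<open>The records for modules extend those for rings; the fields for the multiplication and
  the unit play no role for modules and are left undefined.\<close>

definition quot_module ::
  "('a, 'b, 'n) module_scheme \<Rightarrow> 'b set \<Rightarrow> ('a, 'b set) module" where
  "quot_module M N = \<lparr>carrier = a_rcosets\<^bsub>M\<^esub> N, monoid.mult = undefined, monoid.one = undefined,
     zero = N, add = set_add M, smult = (\<lambda>a X. \<Union>x\<in>X. N +>\<^bsub>M\<^esub> (a \<odot>\<^bsub>M\<^esub> x))\<rparr>"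

definition direct_sum :: "('i \<Rightarrow> ('a, 'b) module) \<Rightarrow> ('a, 'i \<Rightarrow> 'b) module" where
  "direct_sum N = \<lparr>
     carrier = {f. (\<forall>i. f i \<in> carrier (N i)) \<and> finite {i. f i \<noteq> \<zero>\<^bsub>N i\<^esub>}},
     monoid.mult = undefined, monoid.one = undefined,
     zero = (\<lambda>i. \<zero>\<^bsub>N i\<^esub>), add = (\<lambda>f g i. f i \<oplus>\<^bsub>N i\<^esub> g i),
     smult = (\<lambda>a f i. a \<odot>\<^bsub>N i\<^esub> f i)\<rparr>"

definition self_module :: "('a, 'r) ring_scheme \<Rightarrow> ('a, 'a) module" where
  "self_module R = \<lparr>carrier = carrier R, monoid.mult = monoid.mult R, monoid.one = \<one>\<^bsub>R\<^esub>,
     zero = \<zero>\<^bsub>R\<^esub>, add = add R, smult = monoid.mult R\<rparr>"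

text \<open>For any subset \<open>S\<close> of \<open>R\<close> this is the submodule \<open>S M\<close>, which equals \<open>I M\<close> for the ideal
  \<open>I\<close> generated by \<open>S\<close>.\<close>

definition set_smult ::
  "('a, 'r) ring_scheme \<Rightarrow> ('a, 'b, 'n) module_scheme \<Rightarrow> 'a set \<Rightarrow> 'b set" where
  "set_smult R M S = module_span R M {a \<odot>\<^bsub>M\<^esub> z | a z. a \<in> S \<and> z \<in> carrier M}"

definition pow_smult ::
  "('a, 'r) ring_scheme \<Rightarrow> 'a set \<Rightarrow> ('a, 'b, 'n) module_scheme \<Rightarrow> nat \<Rightarrow> 'b set" where
  "pow_smult R \<mm> M n = set_smult R M (\<mm> [^]\<^bsub>ideals_set R\<^esub> n)"


section \<open>Regular sequences and grade\<close>

definition nonzerodivisor_on ::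
  "('a, 'b, 'n) module_scheme \<Rightarrow> 'a \<Rightarrow> bool" where
  "nonzerodivisor_on M a \<longleftrightarrow> (\<forall>z \<in> carrier M. a \<odot>\<^bsub>M\<^esub> z = \<zero>\<^bsub>M\<^esub> \<longrightarrow> z = \<zero>\<^bsub>M\<^esub>)"

definition regular_on ::
  "('a, 'r) ring_scheme \<Rightarrow> ('a, 'b, 'n) module_scheme \<Rightarrow> 'a list \<Rightarrow> bool" where
  "regular_on R M xs \<longleftrightarrow> set xs \<subseteq> carrier R \<and>
     (\<forall>i < length xs.
        nonzerodivisor_on (quot_module M (set_smult R M (set (take i xs)))) (xs ! i)) \<and>
     set_smult R M (set xs) \<noteq> carrier M"

text \<open>The usual convention for the grade is infinity if \<open>I M = M\<close>.\<close>

definition grade ::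
  "('a, 'r) ring_scheme \<Rightarrow> 'a set \<Rightarrow> ('a, 'b, 'n) module_scheme \<Rightarrow> ereal" where
  "grade R I M = (if set_smult R M I = carrier M then \<infinity>
     else Sup {ereal (real (length ys)) | ys. set ys \<subseteq> I \<and> regular_on R M ys})"


section \<open>Associated graded rings and modules\<close>

definition gr_comp ::
  "('a, 'r) ring_scheme \<Rightarrow> 'a set \<Rightarrow> ('a, 'b, 'n) module_scheme \<Rightarrow> nat \<Rightarrow> ('a, 'b set) module" where
  "gr_comp R \<mm> M i =
     quot_module (M\<lparr>carrier := pow_smult R \<mm> M i\<rparr>) (pow_smult R \<mm> M (Suc i))"

text \<open>The class of \<open>z\<close> in degree \<open>j\<close>, for \<open>z\<close> in the \<open>j\<close>-th step of the filtration.\<close>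

definition gr_class ::
  "('a, 'r) ring_scheme \<Rightarrow> 'a set \<Rightarrow> ('a, 'b, 'n) module_scheme \<Rightarrow> nat \<Rightarrow> 'b \<Rightarrow> nat \<Rightarrow> 'b set" where
  "gr_class R \<mm> M j z =
     (\<lambda>i. if i = j then pow_smult R \<mm> M (Suc j) +>\<^bsub>M\<^esub> z else \<zero>\<^bsub>gr_comp R \<mm> M i\<^esub>)"

definition gr_smult ::
  "('a, 'r) ring_scheme \<Rightarrow> 'a set \<Rightarrow> ('a, 'b, 'n) module_scheme \<Rightarrow>
   (nat \<Rightarrow> 'a set) \<Rightarrow> (nat \<Rightarrow> 'b set) \<Rightarrow> (nat \<Rightarrow> 'b set)" where
  "gr_smult R \<mm> M f g = (\<lambda>i. \<Oplus>\<^bsub>gr_comp R \<mm> M i\<^esub>j\<in>{..i}.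
     (\<Union>a \<in> f j. \<Union>z \<in> g (i - j). pow_smult R \<mm> M (Suc i) +>\<^bsub>M\<^esub> (a \<odot>\<^bsub>M\<^esub> z)))"

definition gr_ring :: "('a, 'r) ring_scheme \<Rightarrow> 'a set \<Rightarrow> (nat \<Rightarrow> 'a set) ring" where
  "gr_ring R \<mm> = (let S = self_module R; G = direct_sum (gr_comp R \<mm> S) in
     \<lparr>carrier = carrier G, monoid.mult = gr_smult R \<mm> S, monoid.one = gr_class R \<mm> S 0 \<one>\<^bsub>R\<^esub>,
      zero = zero G, add = add G\<rparr>)"

text \<open>This is a module over \<^term>\<open>gr_ring R \<mm>\<close>.\<close>

definition gr_module ::
  "('a, 'r) ring_scheme \<Rightarrow> 'a set \<Rightarrow> ('a, 'b, 'n) module_scheme \<Rightarrow>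
   (nat \<Rightarrow> 'a set, nat \<Rightarrow> 'b set) module" where
  "gr_module R \<mm> M = (let G = direct_sum (gr_comp R \<mm> M) in
     \<lparr>carrier = carrier G, monoid.mult = undefined, monoid.one = undefined,
      zero = zero G, add = add G, smult = gr_smult R \<mm> M\<rparr>)"


section \<open>Complexes and the linearity defect\<close>

text \<open>Complexes are indexed by the integers; \<open>d n\<close> maps \<open>F n\<close> to \<open>F (n - 1)\<close>.\<close>

definition chain_complex ::
  "('a, 'r) ring_scheme \<Rightarrow> (int \<Rightarrow> ('a, 'b) module) \<Rightarrow> (int \<Rightarrow> 'b \<Rightarrow> 'b) \<Rightarrow> bool" where
  "chain_complex R F d \<longleftrightarrow> (\<forall>n. module R (F n) \<and> d n \<in> lin_maps R (F n) (F (n - 1)) \<and>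
     (\<forall>x \<in> carrier (F n). d (n - 1) (d n x) = \<zero>\<^bsub>F (n - 2)\<^esub>))"

definition homology ::
  "(int \<Rightarrow> ('a, 'b) module) \<Rightarrow> (int \<Rightarrow> 'b \<Rightarrow> 'b) \<Rightarrow> int \<Rightarrow> ('a, 'b set) module" where
  "homology F d n =
     quot_module ((F n)\<lparr>carrier := {x \<in> carrier (F n). d n x = \<zero>\<^bsub>F (n - 1)\<^esub>}\<rparr>)
       (d (n + 1) ` carrier (F (n + 1)))"

definition minimal_complex ::
  "('a, 'r) ring_scheme \<Rightarrow> 'a set \<Rightarrow> (int \<Rightarrow> ('a, 'b) module) \<Rightarrow> (int \<Rightarrow> 'b \<Rightarrow> 'b) \<Rightarrow> bool" where
  "minimal_complex R \<mm> F d \<longleftrightarrow> chain_complex R F d \<and> (\<forall>n. fin_gen_free R (F n)) \<and>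
     (\<forall>n. d n ` carrier (F n) \<subseteq> set_smult R (F (n - 1)) \<mm>)"

definition minimal_free_resolution ::
  "('a, 'r) ring_scheme \<Rightarrow> 'a set \<Rightarrow> ('a, 'b, 'n) module_scheme \<Rightarrow>
   (int \<Rightarrow> ('a, 'c) module) \<Rightarrow> (int \<Rightarrow> 'c \<Rightarrow> 'c) \<Rightarrow> bool" where
  "minimal_free_resolution R \<mm> M F d \<longleftrightarrow> minimal_complex R \<mm> F d \<and>
     (\<forall>n < 0. carrier (F n) = {\<zero>\<^bsub>F n\<^esub>}) \<and>
     (\<forall>n > 0. carrier (homology F d n) = {\<zero>\<^bsub>homology F d n\<^esub>}) \<and>
     (\<exists>\<epsilon> \<in> lin_maps R (F 0) M. \<epsilon> ` carrier (F 0) = carrier M \<and>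
        {x \<in> carrier (F 0). \<epsilon> x = \<zero>\<^bsub>M\<^esub>} = d 1 ` carrier (F 1))"

text \<open>The \<open>n\<close>-th module of the \<open>i\<close>-th filtration step.  Since \<^const>\<open>nat\<close> sends negative
  integers to \<open>0\<close>, nonpositive powers of \<open>\<mm>\<close> are the whole ring.\<close>

definition lin_filt ::
  "('a, 'r) ring_scheme \<Rightarrow> 'a set \<Rightarrow> (int \<Rightarrow> ('a, 'b) module) \<Rightarrow> int \<Rightarrow> int \<Rightarrow> 'b set" where
  "lin_filt R \<mm> F i n = pow_smult R \<mm> (F n) (nat (i - n))"

definition lin_module ::
  "('a, 'r) ring_scheme \<Rightarrow> 'a set \<Rightarrow> (int \<Rightarrow> ('a, 'b) module) \<Rightarrow> int \<Rightarrow> ('a, int \<Rightarrow> 'b set) module" where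
  "lin_module R \<mm> F n = direct_sum (\<lambda>i.
     quot_module ((F n)\<lparr>carrier := lin_filt R \<mm> F i n\<rparr>) (lin_filt R \<mm> F (i + 1) n))"

definition lin_diff ::
  "('a, 'r) ring_scheme \<Rightarrow> 'a set \<Rightarrow> (int \<Rightarrow> ('a, 'b) module) \<Rightarrow> (int \<Rightarrow> 'b \<Rightarrow> 'b) \<Rightarrow>
   int \<Rightarrow> (int \<Rightarrow> 'b set) \<Rightarrow> (int \<Rightarrow> 'b set)" where
  "lin_diff R \<mm> F d n f =
     (\<lambda>i. \<Union>z \<in> f i. lin_filt R \<mm> F (i + 1) (n - 1) +>\<^bsub>F (n - 1)\<^esub> d n z)"

definition lin_defect_complex ::
  "('a, 'r) ring_scheme \<Rightarrow> 'a set \<Rightarrow> (int \<Rightarrow> ('a, 'b) module) \<Rightarrow> (int \<Rightarrow> 'b \<Rightarrow> 'b) \<Rightarrow> ereal" where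
  "lin_defect_complex R \<mm> F d = (let H = homology (lin_module R \<mm> F) (lin_diff R \<mm> F d) in
     Sup {ereal (real_of_int i) | i. carrier (H i) \<noteq> {\<zero>\<^bsub>H i\<^esub>}})"

text \<open>The minimal free resolution is unique up to isomorphism.  Every finitely generated free
  module is isomorphic to one whose elements are of type \<^typ>\<open>nat \<Rightarrow> 'a\<close> (coordinate vectors),
  so fixing this type in the choice is no restriction.  The linearity defect of the zero
  module is \<open>-\<infinity>\<close>, the supremum of the empty set.\<close>

definition lin_defect ::
  "('a, 'r) ring_scheme \<Rightarrow> 'a set \<Rightarrow> ('a, 'b, 'n) module_scheme \<Rightarrow> ereal" where
  "lin_defect R \<mm> M = (case
     (SOME (F :: int \<Rightarrow> ('a, nat \<Rightarrow> 'a) module, d). minimal_free_resolution R \<mm> M F d)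
     of (F, d) \<Rightarrow> lin_defect_complex R \<mm> F d)"

definition koszul_module ::
  "('a, 'r) ring_scheme \<Rightarrow> 'a set \<Rightarrow> ('a, 'b, 'n) module_scheme \<Rightarrow> bool" where
  "koszul_module R \<mm> M \<longleftrightarrow> lin_defect R \<mm> M = 0"

end

theory Submission imports Defs begin

text \<open>
Let F be a minimal free resolution of M, N the associated graded module of M over the associated
graded ring A, and x a sequence that is regular on M. The iterated mapping cone of the
multiplications by the \<open>x\<^sub>i\<close> on F is a minimal free resolution of M/xM (\<open>coord_res_cones\<close>), and its
filtration is that of F, shifted by one on the second half of each cone. So its linear part is the
Koszul complex of the initial forms of x with coefficients in the linear part of F.

No quotient complex is formed. For families \<open>\<Phi>\<close>, \<open>\<Psi>\<close> of subcomplexes, \<open>exact_mod \<Phi> \<Psi> d n i\<close> says for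
elements that \<open>\<Phi>/\<Psi>\<close> is exact in degree n at the index i. If \<open>\<Phi>\<close> is the filtration of F and \<open>\<Psi>\<close>
the next step, this is the vanishing of the homology of the linear part (\<open>lin_defect_eq\<close>, \<open>lin_exact_iff\<close>).

(a) If M is Koszul, the linear part of F resolves N. Hence \<open>\<Psi>\<close> may be replaced by the kernel of
\<open>F \<rightarrow> N\<close> (\<open>aug_filt_exact\<close>, \<open>exact_mod_compare\<close>), and the cones then compute the Koszul homology of the
initial forms on N (\<open>lifts_exact\<close>). So the linearity defect of M/xM is the largest degree in which this
Koszul homology is not zero, and the formula is the depth sensitivity of the Koszul complex (\<open>grade_eq\<close>):
\<open>koszul_exact_up\<close> and \<open>koszul_exact_down\<close> relate N to N/yN, and \<open>homogeneous_avoidance\<close> supplies the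
next element of a regular sequence. If M/xM is Koszul, the Koszul homology is zero in positive
degrees, also for each initial segment (\<open>cones_exact_mod_rev\<close>); in degree one this is regularity.

(b) Multiplication by \<open>x\<^sub>i\<close> raises the index of the filtration, and the indices are bounded below.
Therefore exactness of a cone in positive degrees descends, by a Nakayama argument, to the complex
(\<open>cone_exact_mod_rev\<close>), so from M/xM to M.

(c) If the initial forms are regular on N, then x is regular on M (\<open>regular_of_gr_regular\<close>), and (a)
and (b) apply.
\<close>

section \<open>Submodules, quotients and linear maps\<close>

text \<open>Lighter input forms of the operations of a given structure.\<close>

abbreviation (input) add_in ("(_ \<oplus>\<^sub>_/ _)" [65, 1000, 66] 65) where "x \<oplus>\<^sub>M y \<equiv> x \<oplus>\<^bsub>M\<^esub> y"
abbreviation (input) minus_in ("(_ \<ominus>\<^sub>_/ _)" [65, 1000, 66] 65) where "x \<ominus>\<^sub>M y \<equiv> x \<ominus>\<^bsub>M\<^esub> y"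
abbreviation (input) neg_in ("(\<ominus>\<^sub>_/ _)" [1000, 81] 80) where "\<ominus>\<^sub>M y \<equiv> \<ominus>\<^bsub>M\<^esub> y"
abbreviation (input) zero_in ("\<zero>\<^sub>_" [1000] 1000) where "\<zero>\<^sub>M \<equiv> \<zero>\<^bsub>M\<^esub>"
abbreviation (input) smult_in ("(_ \<odot>\<^sub>_/ _)" [70, 1000, 71] 70) where "a \<odot>\<^sub>M y \<equiv> a \<odot>\<^bsub>M\<^esub> y"

context abelian_group begin

lemma minus_eq_iff: "\<lbrakk>x \<in> carrier G; y \<in> carrier G; z \<in> carrier G\<rbrakk> \<Longrightarrow> (x \<ominus> y = z) = (x = z \<oplus> y)"
  by (metis a_minus_def add.inv_closed add.inv_solve_right)

lemma eq_minus_iff: "\<lbrakk>x \<in> carrier G; y \<in> carrier G; z \<in> carrier G\<rbrakk> \<Longrightarrow> (z = x \<ominus> y) = (z \<oplus> y = x)"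
  by (metis minus_eq_iff)

lemma add_minus1: "\<lbrakk>a \<in> carrier G; b \<in> carrier G; c \<in> carrier G\<rbrakk> \<Longrightarrow> a \<oplus> (b \<ominus> c) = (a \<oplus> b) \<ominus> c"
  by (simp add: a_minus_def a_assoc)
lemma add_minus2: "\<lbrakk>a \<in> carrier G; b \<in> carrier G; c \<in> carrier G\<rbrakk> \<Longrightarrow> (a \<ominus> b) \<oplus> c = (a \<oplus> c) \<ominus> b"
  by (simp add: a_minus_def a_ac)
lemma minus_minus1: "\<lbrakk>a \<in> carrier G; b \<in> carrier G; c \<in> carrier G\<rbrakk> \<Longrightarrow> a \<ominus> (b \<ominus> c) = (a \<oplus> c) \<ominus> b"
  by (simp add: a_minus_def a_ac minus_add)
lemma minus_minus2: "\<lbrakk>a \<in> carrier G; b \<in> carrier G; c \<in> carrier G\<rbrakk> \<Longrightarrow> (a \<ominus> b) \<ominus> c = a \<ominus> (b \<oplus> c)"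
  by (simp add: a_minus_def a_ac minus_add)
lemma neg_add1: "\<lbrakk>a \<in> carrier G; b \<in> carrier G\<rbrakk> \<Longrightarrow> \<ominus> a \<oplus> b = b \<ominus> a"
  by (simp add: a_minus_def a_ac)
lemma neg_add2: "\<lbrakk>a \<in> carrier G; b \<in> carrier G\<rbrakk> \<Longrightarrow> b \<oplus> \<ominus> a = b \<ominus> a"
  by (simp add: a_minus_def)
lemma neg_minus1: "\<lbrakk>a \<in> carrier G; b \<in> carrier G\<rbrakk> \<Longrightarrow> \<ominus> (a \<ominus> b) = b \<ominus> a"
  by (simp add: a_minus_def a_ac minus_add)
lemma minus_neg1: "\<lbrakk>a \<in> carrier G; b \<in> carrier G\<rbrakk> \<Longrightarrow> a \<ominus> \<ominus> b = a \<oplus> b"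
  by (simp add: a_minus_def)
lemma neg_minus2: "\<lbrakk>a \<in> carrier G; b \<in> carrier G\<rbrakk> \<Longrightarrow> \<ominus> a \<ominus> b = \<ominus> (a \<oplus> b)"
  by (simp add: a_minus_def a_ac minus_add)
lemma minus_zero: "x \<in> carrier G \<Longrightarrow> x \<ominus> \<zero> = x"
  by (simp add: minus_eq_iff)
lemma neg_eq: "\<lbrakk>a \<in> carrier G; b \<in> carrier G\<rbrakk> \<Longrightarrow> (\<ominus> a = b) = (\<zero> = a \<oplus> b)"
  by (metis add.inv_equality add.m_comm r_neg)
lemma neg_eq': "\<lbrakk>a \<in> carrier G; b \<in> carrier G\<rbrakk> \<Longrightarrow> (b = \<ominus> a) = (a \<oplus> b = \<zero>)"
  by (metis neg_eq)

text \<open>Rewriting with these clears the differences from an equation.\<close>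

lemmas move_minus = minus_eq_iff eq_minus_iff add_minus1 add_minus2 minus_minus1 minus_minus2
  neg_add1 neg_add2 neg_minus1 neg_minus2 minus_neg1 neg_eq neg_eq' a_ac

end

context module begin

lemma submod_carrier: "submodule H R M \<Longrightarrow> x \<in> H \<Longrightarrow> x \<in> carrier M"
  using submoduleE(1) by blast
lemma submod_add: "submodule H R M \<Longrightarrow> x \<in> H \<Longrightarrow> y \<in> H \<Longrightarrow> x \<oplus>\<^sub>M y \<in> H"
  using submoduleE(5) by blast
lemma submod_neg: "submodule H R M \<Longrightarrow> x \<in> H \<Longrightarrow> \<ominus>\<^sub>M x \<in> H"
  using submoduleE(3) by blast
lemma submod_diff: "submodule H R M \<Longrightarrow> x \<in> H \<Longrightarrow> y \<in> H \<Longrightarrow> x \<ominus>\<^sub>M y \<in> H"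
  by (simp add: a_minus_def submod_add submod_neg)
lemma submod_smult: "submodule H R M \<Longrightarrow> a \<in> carrier R \<Longrightarrow> x \<in> H \<Longrightarrow> a \<odot>\<^sub>M x \<in> H"
  using submoduleE(4) by blast
lemma submod_zero: "submodule H R M \<Longrightarrow> \<zero>\<^sub>M \<in> H"
  using subgroup.one_closed[OF submodule.axioms(1)] by fastforce

lemmas submod_closed = submod_add submod_neg submod_diff submod_smult submod_zero

lemma submod_cancel: "submodule H R M \<Longrightarrow> x \<oplus>\<^sub>M y \<in> H \<Longrightarrow> y \<in> H \<Longrightarrow> x \<in> carrier M \<Longrightarrow> x \<in> H"
proof -
  assume a: "submodule H R M" "x \<oplus>\<^sub>M y \<in> H" "y \<in> H" "x \<in> carrier M"
  have "x = (x \<oplus>\<^sub>M y) \<ominus>\<^sub>M y" using a submod_carrier[OF a(1,3)] by (simp add: M.move_minus)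
  thus ?thesis using submod_diff[OF a(1,2,3)] by simp
qed

text \<open>Closure under negation follows from the action of \<open>-1\<close>.\<close>

lemma submodI:
  assumes "H \<subseteq> carrier M" "\<zero>\<^sub>M \<in> H" "\<And>a b. \<lbrakk>a \<in> H; b \<in> H\<rbrakk> \<Longrightarrow> a \<oplus>\<^sub>M b \<in> H"
    "\<And>a x. \<lbrakk>a \<in> carrier R; x \<in> H\<rbrakk> \<Longrightarrow> a \<odot>\<^sub>M x \<in> H"
  shows "submodule H R M"
proof (rule submoduleI)
  fix a assume a: "a \<in> H"
  have "\<ominus>\<^sub>M a = (\<ominus> \<one>) \<odot>\<^sub>M a" using assms(1) a by (subst smult_l_minus) auto
  thus "\<ominus>\<^sub>M a \<in> H" using assms(4)[OF _ a] by simp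
qed (use assms in auto)

lemma zero_submodule: "submodule {\<zero>\<^sub>M} R M"
  by (rule submodI) auto

lemma submodule_Int: "submodule H R M \<Longrightarrow> submodule K R M \<Longrightarrow> submodule (H \<inter> K) R M"
  by (rule submodI) (auto simp: submod_carrier intro: submod_closed)

lemma submodule_INT: "(\<And>i. i \<in> I \<Longrightarrow> submodule (H i) R M) \<Longrightarrow> I \<noteq> {} \<Longrightarrow> submodule (\<Inter>i\<in>I. H i) R M"
  by (rule submodI) (auto dest: submod_carrier intro: submod_closed)

lemma submodule_chain_UN:
  assumes "\<And>i::nat. submodule (H i) R M" "\<And>i. H i \<subseteq> H (Suc i)"
  shows "submodule (\<Union>i. H i) R M"
proof -
  have mono: "H i \<subseteq> H j" if "i \<le> j" for i j using lift_Suc_mono_le[of H, OF assms(2) that] .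
  show ?thesis
  proof (rule submodI)
    fix a b assume "a \<in> (\<Union>i. H i)" "b \<in> (\<Union>i. H i)"
    then obtain i j where "a \<in> H i" "b \<in> H j" by auto
    hence "a \<in> H (max i j)" "b \<in> H (max i j)" using mono[of i "max i j"] mono[of j "max i j"] by auto
    thus "a \<oplus>\<^sub>M b \<in> (\<Union>i. H i)" using submod_add[OF assms(1)] by blast
  qed (use assms in \<open>auto dest: submod_carrier intro: submod_closed\<close>)
qed

definition msum :: "'c set \<Rightarrow> 'c set \<Rightarrow> 'c set" where
  "msum H K = {h \<oplus>\<^sub>M k | h k. h \<in> H \<and> k \<in> K}"

lemma msum_submodule: assumes "submodule H R M" "submodule K R M" shows "submodule (msum H K) R M"
proof (rule submodI)
  show "msum H K \<subseteq> carrier M" using assms by (auto simp: msum_def dest: submod_carrier)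
  have "\<zero>\<^sub>M = \<zero>\<^sub>M \<oplus>\<^sub>M \<zero>\<^sub>M" by simp
  thus "\<zero>\<^sub>M \<in> msum H K" unfolding msum_def using submod_zero[OF assms(1)] submod_zero[OF assms(2)] by blast
next
  fix a b assume "a \<in> msum H K" "b \<in> msum H K"
  then obtain h k h' k' where *: "a = h \<oplus>\<^sub>M k" "b = h' \<oplus>\<^sub>M k'" "h \<in> H" "h' \<in> H" "k \<in> K" "k' \<in> K"
    by (auto simp: msum_def)
  have "a \<oplus>\<^sub>M b = (h \<oplus>\<^sub>M h') \<oplus>\<^sub>M (k \<oplus>\<^sub>M k')"
    using * assms submod_carrier by (simp add: M.a_ac)
  thus "a \<oplus>\<^sub>M b \<in> msum H K" using * assms submod_add unfolding msum_def by blast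
next
  fix a x assume a: "a \<in> carrier R" "x \<in> msum H K"
  then obtain h k where *: "x = h \<oplus>\<^sub>M k" "h \<in> H" "k \<in> K" by (auto simp: msum_def)
  have "a \<odot>\<^sub>M x = a \<odot>\<^sub>M h \<oplus>\<^sub>M a \<odot>\<^sub>M k" using a * assms submod_carrier by (simp add: smult_r_distr)
  thus "a \<odot>\<^sub>M x \<in> msum H K" using * a assms submod_smult unfolding msum_def by blast
qed

lemma msum_mono: "H \<subseteq> H' \<Longrightarrow> K \<subseteq> K' \<Longrightarrow> msum H K \<subseteq> msum H' K'"
  by (auto simp: msum_def)

lemma msum_upper: assumes "submodule H R M" "submodule K R M"
  shows "H \<subseteq> msum H K" "K \<subseteq> msum H K"
proof -
  show "H \<subseteq> msum H K"
  proof
    fix h assume "h \<in> H"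
    moreover have "h = h \<oplus>\<^sub>M \<zero>\<^sub>M" using submod_carrier[OF assms(1) \<open>h \<in> H\<close>] by simp
    ultimately show "h \<in> msum H K" using submod_zero[OF assms(2)] unfolding msum_def by blast
  qed
  show "K \<subseteq> msum H K"
  proof
    fix h assume "h \<in> K"
    moreover have "h = \<zero>\<^sub>M \<oplus>\<^sub>M h" using submod_carrier[OF assms(2) \<open>h \<in> K\<close>] by simp
    ultimately show "h \<in> msum H K" using submod_zero[OF assms(1)] unfolding msum_def by blast
  qed
qed

lemma msum_least: "submodule H R M \<Longrightarrow> A \<subseteq> H \<Longrightarrow> B \<subseteq> H \<Longrightarrow> msum A B \<subseteq> H"
  by (auto simp: msum_def intro!: submod_add)

lemma span_submodule: "X \<subseteq> carrier M \<Longrightarrow> submodule (module_span R M X) R M"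
  unfolding module_span_def
  using submodule_INT[of "{H. submodule H R M \<and> X \<subseteq> H}" id] carrier_is_submodule by auto

lemma span_superset: "X \<subseteq> module_span R M X"
  by (auto simp: module_span_def)

lemma span_least: "submodule H R M \<Longrightarrow> X \<subseteq> H \<Longrightarrow> module_span R M X \<subseteq> H"
  by (auto simp: module_span_def)

lemma set_smult_submodule: "S \<subseteq> carrier R \<Longrightarrow> submodule (set_smult R M S) R M"
  unfolding set_smult_def by (rule span_submodule) auto

lemma set_smult_mem: "a \<in> S \<Longrightarrow> z \<in> carrier M \<Longrightarrow> a \<odot>\<^sub>M z \<in> set_smult R M S"
  unfolding set_smult_def by (rule subsetD[OF span_superset]) auto

lemma set_smult_least: "submodule H R M \<Longrightarrow> (\<And>a z. a \<in> S \<Longrightarrow> z \<in> carrier M \<Longrightarrow> a \<odot>\<^sub>M z \<in> H)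
    \<Longrightarrow> set_smult R M S \<subseteq> H"
  unfolding set_smult_def by (rule span_least) auto

lemma set_smult_mono: "S \<subseteq> T \<Longrightarrow> T \<subseteq> carrier R \<Longrightarrow> set_smult R M S \<subseteq> set_smult R M T"
  by (rule set_smult_least) (auto intro: set_smult_submodule set_smult_mem)

lemma smult_image_submodule: assumes "x \<in> carrier R" "submodule H R M"
  shows "submodule {x \<odot>\<^sub>M z | z. z \<in> H} R M"
proof (rule submodI)
  show "\<zero>\<^sub>M \<in> {x \<odot>\<^sub>M z |z. z \<in> H}"
    using smult_r_null[OF assms(1)] submod_zero[OF assms(2)] by (metis (mono_tags, lifting) mem_Collect_eq)
next
  fix a b assume "a \<in> {x \<odot>\<^sub>M z |z. z \<in> H}" "b \<in> {x \<odot>\<^sub>M z |z. z \<in> H}"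
  then obtain z w where *: "a = x \<odot>\<^sub>M z" "b = x \<odot>\<^sub>M w" "z \<in> H" "w \<in> H" by auto
  have "a \<oplus>\<^sub>M b = x \<odot>\<^sub>M (z \<oplus>\<^sub>M w)" using * assms submod_carrier by (simp add: smult_r_distr)
  thus "a \<oplus>\<^sub>M b \<in> {x \<odot>\<^sub>M z |z. z \<in> H}" using * submod_add[OF assms(2)] by blast
next
  fix a b assume "a \<in> carrier R" "b \<in> {x \<odot>\<^sub>M z |z. z \<in> H}"
  then obtain z where *: "b = x \<odot>\<^sub>M z" "z \<in> H" by auto
  have "a \<odot>\<^sub>M b = x \<odot>\<^sub>M (a \<odot>\<^sub>M z)" using * assms \<open>a \<in> carrier R\<close> submod_carrier
    by (simp add: smult_assoc1[symmetric] R.m_comm)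
  thus "a \<odot>\<^sub>M b \<in> {x \<odot>\<^sub>M z |z. z \<in> H}" using * submod_smult[OF assms(2) \<open>a \<in> carrier R\<close>] by blast
qed (use assms submod_carrier in auto)

lemma set_smult_empty: "set_smult R M {} = {\<zero>\<^sub>M}"
  using set_smult_least[OF zero_submodule, of "{}"] submod_zero[OF set_smult_submodule, of "{}"] by auto

lemma set_smult_insert:
  assumes "S \<subseteq> carrier R" "x \<in> carrier R"
  shows "set_smult R M (insert x S) = msum (set_smult R M S) {x \<odot>\<^sub>M z | z. z \<in> carrier M}"
proof -
  let ?K = "{x \<odot>\<^sub>M z | z. z \<in> carrier M}"
  have K: "submodule ?K R M" by (rule smult_image_submodule[OF assms(2) carrier_is_submodule])
  have H: "submodule (set_smult R M S) R M" by (rule set_smult_submodule[OF assms(1)])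
  note * = msum_submodule[OF H K] msum_upper[OF H K]
  show ?thesis
  proof
    show "set_smult R M (insert x S) \<subseteq> msum (set_smult R M S) ?K"
      by (rule set_smult_least[OF *(1)]) (use *(2,3) set_smult_mem in blast)
    show "msum (set_smult R M S) ?K \<subseteq> set_smult R M (insert x S)"
      using assms set_smult_mono[of S "insert x S"]
      by (intro msum_least set_smult_submodule) (auto intro: set_smult_mem)
  qed
qed

lemma coset_mem: "submodule H R M \<Longrightarrow> x \<in> carrier M \<Longrightarrow> y \<in> H +>\<^bsub>M\<^esub> x \<longleftrightarrow> y \<in> carrier M \<and> y \<ominus>\<^sub>M x \<in> H"
proof
  assume H: "submodule H R M" and x: "x \<in> carrier M"
  { assume "y \<in> H +>\<^bsub>M\<^esub> x"
    then obtain h where h: "h \<in> H" "y = h \<oplus>\<^sub>M x" by (auto simp: a_r_coset_def')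
    have "y \<ominus>\<^sub>M x = h" using h x submod_carrier[OF H] by (simp add: M.move_minus)
    thus "y \<in> carrier M \<and> y \<ominus>\<^sub>M x \<in> H" using h x submod_carrier[OF H] by auto }
  { assume y: "y \<in> carrier M \<and> y \<ominus>\<^sub>M x \<in> H"
    have "y = (y \<ominus>\<^sub>M x) \<oplus>\<^sub>M x" using x y by (simp add: M.move_minus)
    thus "y \<in> H +>\<^bsub>M\<^esub> x" using y by (auto simp: a_r_coset_def') }
qed

lemma coset_self: "submodule H R M \<Longrightarrow> x \<in> carrier M \<Longrightarrow> x \<in> H +>\<^bsub>M\<^esub> x"
  by (simp add: coset_mem M.r_neg a_minus_def submod_zero)

lemma coset_eq:
  assumes H: "submodule H R M" and x: "x \<in> carrier M" and y: "y \<in> carrier M"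
  shows "H +>\<^bsub>M\<^esub> x = H +>\<^bsub>M\<^esub> y \<longleftrightarrow> x \<ominus>\<^sub>M y \<in> H"
proof
  assume "H +>\<^bsub>M\<^esub> x = H +>\<^bsub>M\<^esub> y"
  thus "x \<ominus>\<^sub>M y \<in> H" using coset_self[OF H x] coset_mem[OF H y] by auto
next
  assume a: "x \<ominus>\<^sub>M y \<in> H"
  have "z \<in> H +>\<^bsub>M\<^esub> x \<longleftrightarrow> z \<in> H +>\<^bsub>M\<^esub> y" for z
  proof -
    have "z \<ominus>\<^sub>M y = (z \<ominus>\<^sub>M x) \<oplus>\<^sub>M (x \<ominus>\<^sub>M y)" "z \<ominus>\<^sub>M x = (z \<ominus>\<^sub>M y) \<ominus>\<^sub>M (x \<ominus>\<^sub>M y)" if "z \<in> carrier M"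
      using that x y by (simp_all add: M.move_minus)
    thus ?thesis using coset_mem[OF H x] coset_mem[OF H y] submod_add[OF H _ a] submod_diff[OF H _ a] by metis
  qed
  thus "H +>\<^bsub>M\<^esub> x = H +>\<^bsub>M\<^esub> y" by blast
qed

lemma coset_zero: "submodule H R M \<Longrightarrow> H +>\<^bsub>M\<^esub> \<zero>\<^sub>M = H"
  by (rule M.a_coset_add_zero) (auto dest: submod_carrier)

lemma coset_eq_H: "submodule H R M \<Longrightarrow> x \<in> carrier M \<Longrightarrow> H +>\<^bsub>M\<^esub> x = H \<longleftrightarrow> x \<in> H"
  using coset_eq[of H x "\<zero>\<^sub>M"] by (simp add: coset_zero M.minus_zero)

lemma coset_add: assumes H: "submodule H R M" and x: "x \<in> carrier M" and y: "y \<in> carrier M"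
  shows "(H +>\<^bsub>M\<^esub> x) <+>\<^bsub>M\<^esub> (H +>\<^bsub>M\<^esub> y) = H +>\<^bsub>M\<^esub> (x \<oplus>\<^sub>M y)"
proof -
  have "abelian_subgroup H M"
    using H by (intro abelian_subgroupI3 M.abelian_group_axioms additive_subgroupI submodule.axioms(1))
  thus ?thesis using x y by (rule abelian_subgroup.a_rcos_sum)
qed

lemma coset_smult: assumes H: "submodule H R M" and x: "x \<in> carrier M" and a: "a \<in> carrier R"
  shows "(\<Union>z\<in>H +>\<^bsub>M\<^esub> x. H +>\<^bsub>M\<^esub> (a \<odot>\<^sub>M z)) = H +>\<^bsub>M\<^esub> (a \<odot>\<^sub>M x)"
proof -
  have "H +>\<^bsub>M\<^esub> (a \<odot>\<^sub>M z) = H +>\<^bsub>M\<^esub> (a \<odot>\<^sub>M x)" if "z \<in> H +>\<^bsub>M\<^esub> x" for z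
  proof -
    have z: "z \<in> carrier M" "z \<ominus>\<^sub>M x \<in> H" using that coset_mem[OF H x] by auto
    have "a \<odot>\<^sub>M z \<ominus>\<^sub>M a \<odot>\<^sub>M x = a \<odot>\<^sub>M (z \<ominus>\<^sub>M x)" using z(1) x a by (simp add: a_minus_def smult_r_distr smult_r_minus)
    thus ?thesis using z x a H by (simp add: coset_eq submod_smult)
  qed
  thus ?thesis using coset_self[OF H x] by blast
qed

lemma quot_carrier: "X \<in> carrier (quot_module M H) \<longleftrightarrow> (\<exists>x\<in>carrier M. X = H +>\<^bsub>M\<^esub> x)"
  by (auto simp: quot_module_def A_RCOSETS_def')

lemma quot_simps: "submodule H R M \<Longrightarrow> x \<in> carrier M \<Longrightarrow> y \<in> carrier M \<Longrightarrow>
     (H +>\<^bsub>M\<^esub> x) \<oplus>\<^sub>(quot_module M H) (H +>\<^bsub>M\<^esub> y) = H +>\<^bsub>M\<^esub> (x \<oplus>\<^sub>M y)"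
  "submodule H R M \<Longrightarrow> x \<in> carrier M \<Longrightarrow> a \<in> carrier R \<Longrightarrow>
     a \<odot>\<^sub>(quot_module M H) (H +>\<^bsub>M\<^esub> x) = H +>\<^bsub>M\<^esub> (a \<odot>\<^sub>M x)"
  "\<zero>\<^sub>(quot_module M H) = H"
  by (simp_all add: quot_module_def coset_add coset_smult)

lemma quot_mem [simp]: "x \<in> carrier M \<Longrightarrow> H +>\<^bsub>M\<^esub> x \<in> carrier (quot_module M H)"
  by (auto simp: quot_carrier)

lemma quot_module_module:
  assumes H: "submodule H R M" shows "module R (quot_module M H)"
proof (rule moduleI)
  show "cring R" by (rule R.is_cring)
  have z: "H = H +>\<^bsub>M\<^esub> \<zero>\<^sub>M" using coset_zero[OF H] by simp
  show "abelian_group (quot_module M H)"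
  proof (rule abelian_groupI)
    fix X assume "X \<in> carrier (quot_module M H)"
    then obtain x where x: "x \<in> carrier M" "X = H +>\<^bsub>M\<^esub> x" by (auto simp: quot_carrier)
    hence "(H +>\<^bsub>M\<^esub> (\<ominus>\<^sub>M x)) \<oplus>\<^sub>(quot_module M H) X = \<zero>\<^sub>(quot_module M H)"
      by (simp add: quot_simps H M.l_neg coset_zero)
    thus "\<exists>y\<in>carrier (quot_module M H). y \<oplus>\<^sub>(quot_module M H) X = \<zero>\<^sub>(quot_module M H)"
      using x by (metis M.a_inv_closed quot_mem)
    show "\<zero>\<^sub>(quot_module M H) \<oplus>\<^sub>(quot_module M H) X = X"
      using x by (subst quot_simps(3), subst z) (simp add: quot_simps H)
  next
    show "\<zero>\<^sub>(quot_module M H) \<in> carrier (quot_module M H)"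
      using quot_mem[of "\<zero>\<^sub>M" H] by (simp add: quot_simps coset_zero H)
  qed (auto simp: quot_carrier quot_simps H M.a_ac intro!: bexI)
qed (auto simp: quot_carrier quot_simps H smult_l_distr smult_r_distr smult_assoc1 intro!: bexI)

lemma nonzerodivisor_on_quot:
  assumes H: "submodule H R M" and a: "a \<in> carrier R"
  shows "nonzerodivisor_on (quot_module M H) a \<longleftrightarrow> (\<forall>z\<in>carrier M. a \<odot>\<^sub>M z \<in> H \<longrightarrow> z \<in> H)"
proof -
  have "nonzerodivisor_on (quot_module M H) a \<longleftrightarrow> (\<forall>z\<in>carrier M. a \<odot>\<^sub>(quot_module M H) (H +>\<^bsub>M\<^esub> z) = H \<longrightarrow> H +>\<^bsub>M\<^esub> z = H)"
    unfolding nonzerodivisor_on_def Ball_def by (simp add: quot_carrier quot_simps(3)) blast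
  also have "\<dots> \<longleftrightarrow> (\<forall>z\<in>carrier M. a \<odot>\<^sub>M z \<in> H \<longrightarrow> z \<in> H)"
    by (simp add: quot_simps H a coset_eq_H)
  finally show ?thesis .
qed

text \<open>Regularity without the quotient modules.\<close>

lemma regular_on_iff:
  assumes "set xs \<subseteq> carrier R"
  shows "regular_on R M xs \<longleftrightarrow> (\<forall>i<length xs. \<forall>z\<in>carrier M.
     xs ! i \<odot>\<^sub>M z \<in> set_smult R M (set (take i xs)) \<longrightarrow> z \<in> set_smult R M (set (take i xs))) \<and>
     set_smult R M (set xs) \<noteq> carrier M"
proof -
  have "nonzerodivisor_on (quot_module M (set_smult R M (set (take i xs)))) (xs ! i) \<longleftrightarrow> (\<forall>z\<in>carrier M.
     xs ! i \<odot>\<^sub>M z \<in> set_smult R M (set (take i xs)) \<longrightarrow> z \<in> set_smult R M (set (take i xs)))"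
    if "i < length xs" for i
    using that assms set_take_subset[of i xs] nth_mem[OF that]
    by (intro nonzerodivisor_on_quot set_smult_submodule) auto
  thus ?thesis unfolding regular_on_def using assms by simp
qed

end

lemma lin_mapsD:
  assumes "f \<in> lin_maps R M N"
  shows "x \<in> carrier M \<Longrightarrow> f x \<in> carrier N"
    "x \<in> carrier M \<Longrightarrow> y \<in> carrier M \<Longrightarrow> f (x \<oplus>\<^sub>M y) = f x \<oplus>\<^sub>N f y"
    "a \<in> carrier R \<Longrightarrow> x \<in> carrier M \<Longrightarrow> f (a \<odot>\<^sub>M x) = a \<odot>\<^sub>N f x"
  using assms by (auto simp: lin_maps_def)

locale lin_map = M: module R M + N: module R N for R (structure) and M and N +
  fixes f assumes lin: "f \<in> lin_maps R M N"
begin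

lemma closed [simp]: "x \<in> carrier M \<Longrightarrow> f x \<in> carrier N" using lin_mapsD[OF lin] by simp
lemma add [simp]: "x \<in> carrier M \<Longrightarrow> y \<in> carrier M \<Longrightarrow> f (x \<oplus>\<^sub>M y) = f x \<oplus>\<^sub>N f y"
  using lin_mapsD[OF lin] by simp
lemma smult [simp]: "a \<in> carrier R \<Longrightarrow> x \<in> carrier M \<Longrightarrow> f (a \<odot>\<^sub>M x) = a \<odot>\<^sub>N f x"
  using lin_mapsD[OF lin] by simp
lemma zero [simp]: "f \<zero>\<^sub>M = \<zero>\<^sub>N"
  using smult[of "\<zero>" "\<zero>\<^sub>M"] by simp
lemma neg [simp]: "x \<in> carrier M \<Longrightarrow> f (\<ominus>\<^sub>M x) = \<ominus>\<^sub>N f x"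
  using smult[of "\<ominus> \<one>" x] by (simp add: M.smult_l_minus N.smult_l_minus)
lemma diff [simp]: "x \<in> carrier M \<Longrightarrow> y \<in> carrier M \<Longrightarrow> f (x \<ominus>\<^sub>M y) = f x \<ominus>\<^sub>N f y"
  by (simp add: a_minus_def)

lemma vimage_submodule: "submodule H R N \<Longrightarrow> submodule {x \<in> carrier M. f x \<in> H} R M"
  by (rule M.submodI) (auto intro: N.submod_closed)

lemma image_submodule: assumes H: "submodule H R M" shows "submodule (f ` H) R N"
proof (rule N.submodI)
  show "f ` H \<subseteq> carrier N" using M.submod_carrier[OF H] by auto
  show "\<zero>\<^sub>N \<in> f ` H" using M.submod_zero[OF H] zero by (metis image_eqI)
next
  fix a b assume "a \<in> f ` H" "b \<in> f ` H"
  thus "a \<oplus>\<^sub>N b \<in> f ` H" using M.submod_carrier[OF H] M.submod_add[OF H] by (auto simp: add[symmetric] simp del: add)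
next
  fix a b assume "a \<in> carrier R" "b \<in> f ` H"
  thus "a \<odot>\<^sub>N b \<in> f ` H" using M.submod_carrier[OF H] M.submod_smult[OF H] by (auto simp: smult[symmetric] simp del: smult)
qed

end

lemma lin_mapI: "module R M \<Longrightarrow> module R N \<Longrightarrow> f \<in> lin_maps R M N \<Longrightarrow> lin_map R M N f"
  by (simp add: lin_map_def lin_map_axioms_def)

section \<open>The powers of the maximal ideal\<close>

lemma (in cring) SR_module: "module R (self_module R)"
proof (rule moduleI)
  show "abelian_group (self_module R)"
    by (rule abelian_groupI) (auto simp: self_module_def a_ac intro!: bexI[of _ "\<ominus> x" for x] l_neg)
qed (auto simp: self_module_def l_distr r_distr m_assoc intro: is_cring)

lemma self_module_simps [simp]: "carrier (self_module R) = carrier R" "smult (self_module R) = monoid.mult R"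
  "add (self_module R) = add R" "zero (self_module R) = zero R"
  by (simp_all add: self_module_def)

lemma (in cring) self_module_minus [simp]: "x \<in> carrier R \<Longrightarrow> \<ominus>\<^sub>(self_module R) x = \<ominus> x"
proof -
  interpret S: module R "self_module R" by (rule SR_module)
  assume x: "x \<in> carrier R"
  have "\<ominus> x = \<ominus>\<^sub>(self_module R) x"
    using S.M.minus_equality[of "\<ominus> x" x] x by (simp add: l_neg)
  thus ?thesis by simp
qed

lemma (in cring) submodule_self_iff: "submodule H R (self_module R) \<longleftrightarrow> ideal H R"
proof -
  interpret S: module R "self_module R" by (rule SR_module)
  show ?thesis
  proof
    assume H: "submodule H R (self_module R)"
    show "ideal H R"
    proof (rule idealI)
      show "subgroup H (add_monoid R)"
        by (rule add.subgroupI) (use H S.submod_carrier[OF H] S.submod_add[OF H] S.submod_neg[OF H] S.submod_zero[OF H] in auto)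
      show *: "x \<otimes> a \<in> H" if "a \<in> H" "x \<in> carrier R" for a x using S.submod_smult[OF H that(2,1)] by simp
      show "a \<otimes> x \<in> H" if "a \<in> H" "x \<in> carrier R" for a x using that S.submod_carrier[OF H that(1)] *[OF that] by (simp add: m_comm)
    qed (rule ring_axioms)
  next
    assume "ideal H R"
    then interpret ideal H R .
    show "submodule H R (self_module R)"
      by (rule S.submodI) (use a_subset in \<open>auto intro: I_l_closed\<close>)
  qed
qed

lemma (in cring) submodule_idealI:
  assumes "H \<subseteq> carrier R" "\<zero> \<in> H" "\<And>a b. a \<in> H \<Longrightarrow> b \<in> H \<Longrightarrow> a \<oplus> b \<in> H"
    "\<And>a b. a \<in> carrier R \<Longrightarrow> b \<in> H \<Longrightarrow> a \<otimes> b \<in> H"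
  shows "ideal H R"
proof -
  interpret S: module R "self_module R" by (rule SR_module)
  show ?thesis unfolding submodule_self_iff[symmetric]
    by (rule S.submodI) (use assms in auto)
qed

locale noeth_local = fixes R (structure) and \<mm> assumes noeth_local: "noetherian_local_ring R \<mm>"

sublocale noeth_local \<subseteq> noetherian_ring R
  using noeth_local by (simp add: noetherian_local_ring_def)
sublocale noeth_local \<subseteq> cring R
  using noeth_local by (simp add: noetherian_local_ring_def)
sublocale noeth_local \<subseteq> mm: maximalideal \<mm> R
  using noeth_local by (simp add: noetherian_local_ring_def)

context noeth_local begin

lemma one_notin: "\<one> \<notin> \<mm>"
  using mm.one_imp_carrier mm.I_notcarr by auto

text \<open>A proper principal ideal lies in a maximal ideal, which can only be \<open>\<mm>\<close>.\<close>

lemma unit_or: assumes "a \<in> carrier R" "a \<notin> \<mm>" shows "a \<in> Units R"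
proof (rule ccontr)
  assume na: "a \<notin> Units R"
  let ?A = "{I. ideal I R \<and> a \<in> I \<and> \<one> \<notin> I}"
  have "\<one> \<notin> PIdl a"
  proof
    assume "\<one> \<in> PIdl a"
    then obtain b where "b \<in> carrier R" "\<one> = b \<otimes> a" by (auto simp: cgenideal_def)
    thus False using na assms(1) using m_comm unfolding Units_def by fastforce
  qed
  hence "PIdl a \<in> ?A" using cgenideal_ideal cgenideal_self assms by auto
  hence ne: "?A \<noteq> {}" by blast
  have "\<exists>J\<in>?A. \<forall>X\<in>?A. J \<subseteq> X \<longrightarrow> X = J"
  proof (rule subset_Zorn_nonempty[OF ne])
    fix C assume C: "C \<noteq> {}" "subset.chain ?A C"
    hence "subset.chain {I. ideal I R} C" by (auto simp: pred_on.chain_def)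
    from ideal_chain_is_trivial[OF C(1) this] C show "\<Union>C \<in> ?A" by (auto simp: pred_on.chain_def)
  qed
  then obtain J where J: "J \<in> ?A" "\<And>X. X \<in> ?A \<Longrightarrow> J \<subseteq> X \<Longrightarrow> X = J" by auto
  have "maximalideal J R"
  proof (rule maximalidealI)
    show "ideal J R" "carrier R \<noteq> J" using J(1) one_closed by auto
    fix X assume X: "ideal X R" "J \<subseteq> X" "X \<subseteq> carrier R"
    show "X = J \<or> X = carrier R"
    proof (cases "\<one> \<in> X")
      case True thus ?thesis using ideal.one_imp_carrier[OF X(1)] by blast
    next
      case False thus ?thesis using J X by auto
    qed
  qed
  hence "J = \<mm>" using noeth_local by (auto simp: noetherian_local_ring_def)
  thus False using J(1) assms(2) by auto
qed

definition mp where "mp n = \<mm> [^]\<^bsub>ideals_set R\<^esub> (n::nat)"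

lemma mp_0 [simp]: "mp 0 = carrier R"
  by (simp add: mp_def nat_pow_def ideals_set_def)

lemma mp_Suc: "mp (Suc n) = mp n \<cdot> \<mm>"
  by (simp add: mp_def nat_pow_def ideals_set_def)

lemma mp_ideal: "ideal (mp n) R"
  by (induction n) (auto simp: mp_Suc oneideal intro: ideal_prod_is_ideal mm.is_ideal)

lemma mp_carrier: "a \<in> mp n \<Longrightarrow> a \<in> carrier R"
  using ideal.Icarr[OF mp_ideal] .

lemma mp_closed: "\<zero> \<in> mp n" "a \<in> mp n \<Longrightarrow> b \<in> mp n \<Longrightarrow> a \<oplus> b \<in> mp n"
  "a \<in> mp n \<Longrightarrow> r \<in> carrier R \<Longrightarrow> r \<otimes> a \<in> mp n" "a \<in> mp n \<Longrightarrow> \<ominus> a \<in> mp n"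
  using mp_ideal[of n] by (auto simp: ideal_def additive_subgroup.zero_closed additive_subgroup.a_closed additive_subgroup.a_inv_closed
    ideal_axioms_def)

lemma mp_Suc_sub: "mp (Suc n) \<subseteq> mp n"
  unfolding mp_Suc using ideal_prod_inter[OF mp_ideal mm.is_ideal] by auto

lemma mp_antimono: "i \<le> j \<Longrightarrow> mp j \<subseteq> mp i"
  using lift_Suc_antimono_le[of mp, OF mp_Suc_sub] .

lemma mp_1 [simp]: "mp (Suc 0) = \<mm>"
  unfolding mp_Suc mp_0 using ideal_prod_one[OF mm.is_ideal] ideal_prod_commute[OF oneideal mm.is_ideal] by simp

lemma mp_mult: "a \<in> mp i \<Longrightarrow> b \<in> mp j \<Longrightarrow> a \<otimes> b \<in> mp (i + j)"
proof (induction j arbitrary: b)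
  case 0 thus ?case using mp_closed(3)[of a i b] mp_carrier by (simp add: m_comm)
next
  case (Suc j)
  note a = mp_carrier[OF Suc.prems(1)]
  from Suc.prems(2) show ?case unfolding mp_Suc
  proof (induct b rule: ideal_prod.induct)
    case (prod x y)
    have "(a \<otimes> x) \<otimes> y \<in> mp (Suc (i + j))" unfolding mp_Suc
      by (rule ideal_prod.prod) (use prod Suc in auto)
    thus ?case using prod a mp_carrier mm.Icarr by (simp add: m_assoc)
  next
    case (sum x y)
    have xy: "x \<in> carrier R" "y \<in> carrier R" using sum mp_carrier[of _ "Suc j"] by (auto simp: mp_Suc)
    have "a \<otimes> (x \<oplus> y) = a \<otimes> x \<oplus> a \<otimes> y" using a xy by (simp add: r_distr)
    thus ?case using mp_closed(2)[OF sum(2,4)] by simp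
  qed
qed

abbreviation W where "W M n \<equiv> pow_smult R \<mm> M n"

lemma W_def: "W M n = set_smult R M (mp n)"
  by (simp add: pow_smult_def mp_def)

lemma mp_sub: "mp n \<subseteq> carrier R" using mp_carrier by blast

lemma W_submodule: "module R M \<Longrightarrow> submodule (W M n) R M"
  unfolding W_def by (rule module.set_smult_submodule) (auto dest: mp_carrier)

lemma W_carrier: "module R M \<Longrightarrow> x \<in> W M n \<Longrightarrow> x \<in> carrier M"
  using module.submod_carrier[OF _ W_submodule] .

lemma W_mem: "module R M \<Longrightarrow> a \<in> mp n \<Longrightarrow> z \<in> carrier M \<Longrightarrow> a \<odot>\<^sub>M z \<in> W M n"
  unfolding W_def by (rule module.set_smult_mem)

lemma W_0: assumes "module R M" shows "W M 0 = carrier M"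
proof -
  interpret module R M by fact
  have "z \<in> W M 0" if "z \<in> carrier M" for z
    using W_mem[OF assms, of \<one> 0 z] that by simp
  thus ?thesis using W_carrier[OF assms] by blast
qed

lemma W_antimono: "module R M \<Longrightarrow> i \<le> j \<Longrightarrow> W M j \<subseteq> W M i"
  unfolding W_def by (rule module.set_smult_mono) (auto simp: mp_sub mp_antimono)

lemma W_Suc_sub: "module R M \<Longrightarrow> x \<in> W M (Suc n) \<Longrightarrow> x \<in> W M n"
  using W_antimono[of M n "Suc n"] by auto

lemma W_mult: assumes "module R M" "a \<in> mp i" "z \<in> W M j" shows "a \<odot>\<^sub>M z \<in> W M (i + j)"
proof -
  interpret module R M by fact
  have a: "a \<in> carrier R" using mp_carrier assms by auto
  have "W M j \<subseteq> {z \<in> carrier M. a \<odot>\<^sub>M z \<in> W M (i + j)}" unfolding W_def[of M j]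
  proof (rule set_smult_least)
    show "submodule {z \<in> carrier M. a \<odot>\<^sub>M z \<in> W M (i + j)} R M"
    proof (rule submodI)
      fix b x assume "b \<in> carrier R" and x: "x \<in> {z \<in> carrier M. a \<odot>\<^sub>M z \<in> W M (i + j)}"
      hence "a \<odot>\<^sub>M (b \<odot>\<^sub>M x) = b \<odot>\<^sub>M (a \<odot>\<^sub>M x)" using a by (simp add: smult_assoc1[symmetric] m_comm)
      thus "b \<odot>\<^sub>M x \<in> {z \<in> carrier M. a \<odot>\<^sub>M z \<in> W M (i + j)}"
        using x \<open>b \<in> carrier R\<close> submod_smult[OF W_submodule[OF assms(1)]] by auto
    qed (use a in \<open>auto simp: smult_r_distr intro: submod_closed W_submodule[OF assms(1)]\<close>)
    fix b z assume "b \<in> mp j" "z \<in> carrier M"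
    thus "b \<odot>\<^sub>M z \<in> {z \<in> carrier M. a \<odot>\<^sub>M z \<in> W M (i + j)}"
      using a mp_carrier W_mem[OF assms(1) mp_mult[OF assms(2)]] by (auto simp: smult_assoc1[symmetric])
  qed
  thus ?thesis using assms(3) by auto
qed

lemma W_mult1: "module R M \<Longrightarrow> a \<in> \<mm> \<Longrightarrow> z \<in> W M j \<Longrightarrow> a \<odot>\<^sub>M z \<in> W M (Suc j)"
  using W_mult[of M a 1 z j] by simp

lemma W_Suc_least:
  assumes M: "module R M" and H: "submodule H R M" and c: "\<And>t z. t \<in> \<mm> \<Longrightarrow> z \<in> W M n \<Longrightarrow> t \<odot>\<^sub>M z \<in> H"
  shows "W M (Suc n) \<subseteq> H"
proof -
  interpret module R M by fact
  show ?thesis unfolding W_def mp_Suc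
  proof (rule set_smult_least[OF H])
    fix a z assume "a \<in> mp n \<cdot> \<mm>" and z: "z \<in> carrier M"
    thus "a \<odot>\<^sub>M z \<in> H"
    proof (induct a rule: ideal_prod.induct)
      case (prod i j)
      thus ?case using c[of j "i \<odot>\<^sub>M z"] W_mem[OF M, of i n z] mm.Icarr mp_carrier[of i]
        by (simp add: m_comm[of i j] smult_assoc1)
    next
      case (sum x y)
      have xy: "x \<in> carrier R" "y \<in> carrier R" using sum mp_carrier[of _ "Suc n"] by (auto simp: mp_Suc)
      thus ?case using sum submod_add[OF H] by (simp add: smult_l_distr)
    qed
  qed
qed

text \<open>The scalars that map \<open>\<mm>\<^sup>n M\<close> into H form an ideal, so generators of \<open>\<mm>\<close> suffice.\<close>

lemma W_Suc_gens:
  assumes M: "module R M" and H: "submodule H R M" and T: "T \<subseteq> carrier R" "\<mm> = Idl T"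
    and c: "\<And>t z. t \<in> T \<Longrightarrow> z \<in> W M n \<Longrightarrow> t \<odot>\<^sub>M z \<in> H"
  shows "W M (Suc n) \<subseteq> H"
proof -
  interpret module R M by fact
  let ?I = "{a \<in> carrier R. \<forall>z\<in>W M n. a \<odot>\<^sub>M z \<in> H}"
  have "ideal ?I R"
    by (rule submodule_idealI)
       (auto simp: smult_l_distr smult_assoc1 W_carrier[OF M] submod_zero[OF H] submod_add[OF H] submod_smult[OF H])
  hence "\<mm> \<subseteq> ?I" unfolding T(2) by (rule genideal_minimal) (use c T in auto)
  thus ?thesis by (intro W_Suc_least[OF M H]) blast
qed

lemma W_self: "W (self_module R) n = mp n"
proof -
  interpret S: module R "self_module R" by (rule SR_module)
  have "W (self_module R) n \<subseteq> mp n" unfolding W_def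
    by (rule S.set_smult_least) (auto simp: submodule_self_iff mp_ideal intro: ideal.I_r_closed[OF mp_ideal])
  moreover have "a \<in> W (self_module R) n" if "a \<in> mp n" for a
    using W_mem[OF SR_module that, of \<one>] mp_carrier[OF that] by simp
  ultimately show ?thesis by blast
qed

lemma W_lin: assumes "module R M" "module R N" "f \<in> lin_maps R M N" "f ` carrier M \<subseteq> W N k" "z \<in> W M n"
  shows "f z \<in> W N (n + k)"
proof -
  interpret lin_map R M N f using assms by (intro lin_mapI)
  have "W M n \<subseteq> {x \<in> carrier M. f x \<in> W N (n + k)}" unfolding W_def[of M]
    by (rule M.set_smult_least, rule vimage_submodule, rule W_submodule, fact)
       (use assms(4) mp_carrier in \<open>auto intro!: W_mult[OF assms(2)]\<close>)
  thus ?thesis using assms by auto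
qed

lemma W_lin0: assumes "module R M" "module R N" "f \<in> lin_maps R M N" "z \<in> W M n"
  shows "f z \<in> W N n"
  using W_lin[OF assms(1-3), of 0] assms lin_mapsD(1)[OF assms(3)] by (auto simp: W_0 image_subset_iff)

lemma W_surj: assumes "module R M" "module R N" "f \<in> lin_maps R M N" "f ` carrier M = carrier N"
  shows "W N n = f ` W M n"
proof -
  interpret lin_map R M N f using assms by (intro lin_mapI)
  have "W N n \<subseteq> f ` W M n" unfolding W_def[of N]
  proof (rule N.set_smult_least)
    show "submodule (f ` W M n) R N" by (rule image_submodule[OF W_submodule[OF assms(1)]])
    fix a z assume a: "a \<in> mp n" and "z \<in> carrier N"
    then obtain w where "w \<in> carrier M" "z = f w" using assms(4) by blast
    hence "a \<odot>\<^sub>N z = f (a \<odot>\<^sub>M w)" "a \<odot>\<^sub>M w \<in> W M n" using a mp_carrier W_mem[OF assms(1) a] by auto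
    thus "a \<odot>\<^sub>N z \<in> f ` W M n" by blast
  qed
  thus ?thesis using W_lin0[OF assms(1-3)] by blast
qed

end

section \<open>Coordinate vectors and free modules\<close>

text \<open>All terms of all complexes below live in one such module, so that they have the same type; finite
  supports cut the free modules of finite rank out of it.\<close>

definition fun_mod :: "('a, 'b, 'n) module_scheme \<Rightarrow> ('a, nat \<Rightarrow> 'b) module" where
  "fun_mod M = \<lparr>carrier = {f. \<forall>k. f k \<in> carrier M}, monoid.mult = undefined, monoid.one = undefined,
     zero = (\<lambda>k. \<zero>\<^sub>M), add = (\<lambda>f g k. f k \<oplus>\<^sub>M g k), smult = (\<lambda>a f k. a \<odot>\<^sub>M f k)\<rparr>"

lemma fun_mod_simps [simp]: "f \<in> carrier (fun_mod M) \<longleftrightarrow> (\<forall>k. f k \<in> carrier M)"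
  "add (fun_mod M) = (\<lambda>f g k. f k \<oplus>\<^sub>M g k)" "smult (fun_mod M) = (\<lambda>a f k. a \<odot>\<^sub>M f k)"
  "zero (fun_mod M) = (\<lambda>k. \<zero>\<^sub>M)"
  by (simp_all add: fun_mod_def)

context module begin

lemma fun_mod_module: "module R (fun_mod M)"
proof (rule moduleI)
  show "abelian_group (fun_mod M)"
  proof (rule abelian_groupI)
    fix f assume "f \<in> carrier (fun_mod M)"
    thus "\<exists>y\<in>carrier (fun_mod M). y \<oplus>\<^sub>(fun_mod M) f = \<zero>\<^sub>(fun_mod M)"
      by (intro bexI[of _ "\<lambda>k. \<ominus>\<^sub>M f k"]) (auto simp: M.l_neg)
  qed (auto simp: M.a_ac fun_eq_iff)
qed (auto simp: smult_l_distr smult_r_distr smult_assoc1 fun_eq_iff intro: R.is_cring)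

lemma fun_mod_neg: "f \<in> carrier (fun_mod M) \<Longrightarrow> \<ominus>\<^sub>(fun_mod M) f = (\<lambda>k. \<ominus>\<^sub>M f k)"
proof -
  interpret U: module R "fun_mod M" by (rule fun_mod_module)
  assume "f \<in> carrier (fun_mod M)"
  thus ?thesis by (intro U.M.minus_equality) (auto simp: M.l_neg)
qed

lemma fun_mod_minus: "f \<in> carrier (fun_mod M) \<Longrightarrow> g \<in> carrier (fun_mod M) \<Longrightarrow> f \<ominus>\<^sub>(fun_mod M) g = (\<lambda>k. f k \<ominus>\<^sub>M g k)"
  by (simp add: a_minus_def fun_mod_neg)

end

lemma carrier_update_coset [simp]: "a_r_coset (M\<lparr>carrier := C\<rparr>) = a_r_coset M"
  by (intro ext) (simp add: a_r_coset_def')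

lemma (in module) submodule_module: "submodule H R M \<Longrightarrow> module R (M\<lparr>carrier := H\<rparr>)"
  using submodule.submodule_is_module module_axioms by blast

lemma (in module) neg_carrier_update [simp]:
  assumes "submodule H R M" "x \<in> H" shows "\<ominus>\<^bsub>M\<lparr>carrier := H\<rparr>\<^esub> x = \<ominus>\<^sub>M x"
proof -
  interpret N: module R "M\<lparr>carrier := H\<rparr>" by (rule submodule_module[OF assms(1)])
  show ?thesis using N.M.minus_equality[of "\<ominus>\<^sub>M x" x] submod_neg[OF assms] assms submod_carrier[OF assms]
    by (simp add: M.l_neg)
qed

lemma (in module) submodule_update_iff: assumes "submodule H R M"
  shows "submodule K R (M\<lparr>carrier := H\<rparr>) \<longleftrightarrow> submodule K R M \<and> K \<subseteq> H"
proof -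
  interpret N: module R "M\<lparr>carrier := H\<rparr>" by (rule submodule_module[OF assms(1)])
  show ?thesis
  proof
    assume K: "submodule K R (M\<lparr>carrier := H\<rparr>)"
    show "submodule K R M \<and> K \<subseteq> H" using N.submod_carrier[OF K] submod_carrier[OF assms] N.submod_closed[OF K]
      by (auto intro!: submodI)
  next
    assume K: "submodule K R M \<and> K \<subseteq> H"
    thus "submodule K R (M\<lparr>carrier := H\<rparr>)" by (auto intro!: N.submodI intro: submod_closed)
  qed
qed

lemma (in module) finsum_submod:
  assumes "submodule H R M" "\<And>k. k \<in> A \<Longrightarrow> f k \<in> H" shows "finsum M f A \<in> H"
  using assms(2)
proof (induction A rule: infinite_finite_induct)
  case (insert x F)
  thus ?case using submod_carrier[OF assms(1)] by (subst M.finsum_insert) (auto intro: submod_add[OF assms(1)])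
qed (auto simp: submod_zero[OF assms(1)] M.finsum_infinite)

lemma homology_trivial_iff:
  assumes "module R (F n)" "submodule (d (n + 1) ` carrier (F (n + 1))) R (F n)" "d n \<zero>\<^sub>(F n) = \<zero>\<^sub>(F (n - 1))"
  shows "(carrier (homology F d n) = {\<zero>\<^sub>(homology F d n)}) \<longleftrightarrow>
     (\<forall>z\<in>carrier (F n). d n z = \<zero>\<^sub>(F (n - 1)) \<longrightarrow> z \<in> d (n + 1) ` carrier (F (n + 1)))" (is "?L \<longleftrightarrow> ?R")
proof -
  interpret module R "F n" by fact
  let ?I = "d (n + 1) ` carrier (F (n + 1))"
  have c: "carrier (homology F d n) = {?I +>\<^bsub>F n\<^esub> z | z. z \<in> carrier (F n) \<and> d n z = \<zero>\<^sub>(F (n - 1))}"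
    by (auto simp: homology_def quot_module_def A_RCOSETS_def')
  have z: "\<zero>\<^sub>(homology F d n) = ?I" by (simp add: homology_def quot_module_def)
  have "?L \<longleftrightarrow> (\<forall>z\<in>carrier (F n). d n z = \<zero>\<^sub>(F (n - 1)) \<longrightarrow> ?I +>\<^bsub>F n\<^esub> z = ?I)"
    unfolding c z using assms(3) coset_zero[OF assms(2)] M.zero_closed by blast
  thus ?thesis using coset_eq_H[OF assms(2)] by auto
qed

lemma (in cring) self_module_diff [simp]:
  "x \<in> carrier R \<Longrightarrow> y \<in> carrier R \<Longrightarrow> x \<ominus>\<^sub>(self_module R) y = x \<ominus> y"
  by (simp add: a_minus_def)

context noeth_local begin

abbreviation "U \<equiv> fun_mod (self_module R)"

lemma U_module: "module R U"
  using module.fun_mod_module[OF SR_module] .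

definition Fr where "Fr S = {f \<in> carrier U. \<forall>k. k \<notin> S \<longrightarrow> f k = \<zero>}"

definition FM where "FM S = U\<lparr>carrier := Fr S\<rparr>"

lemma FM_simps [simp]: "carrier (FM S) = Fr S" "add (FM S) = (\<lambda>f g k. f k \<oplus> g k)"
  "smult (FM S) = (\<lambda>a f k. a \<otimes> f k)" "zero (FM S) = (\<lambda>k. \<zero>)"
  by (simp_all add: FM_def)

lemma Fr_submodule: "submodule (Fr S) R U"
  by (rule module.submodI[OF U_module]) (auto simp: Fr_def)

lemma FrD: "f \<in> Fr S \<Longrightarrow> f k \<in> carrier R" "f \<in> Fr S \<Longrightarrow> k \<notin> S \<Longrightarrow> f k = \<zero>" "f \<in> Fr S \<Longrightarrow> f \<in> carrier U"
  by (auto simp: Fr_def)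

lemma FM_module: "module R (FM S)"
  unfolding FM_def by (rule module.submodule_module[OF U_module Fr_submodule])

lemma FM_minus [simp]: "f \<in> Fr S \<Longrightarrow> \<ominus>\<^sub>(FM S) f = (\<lambda>k. \<ominus> f k)"
  unfolding FM_def
  by (subst module.neg_carrier_update[OF U_module Fr_submodule], assumption,
     subst module.fun_mod_neg[OF SR_module]) (auto simp: Fr_def)

definition uv where "uv k = (\<lambda>j. if j = k then \<one> else \<zero>)" for k :: nat

lemma uv_Fr: "k \<in> S \<Longrightarrow> uv k \<in> Fr S" by (auto simp: uv_def Fr_def)

lemma Fr_empty: "Fr {} = {\<lambda>k. \<zero>}" by (auto simp: Fr_def)

lemma W_FM: assumes "finite S" shows "W (FM S) n = {f \<in> Fr S. \<forall>k. f k \<in> mp n}"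
proof
  interpret F: module R "FM S" by (rule FM_module)
  show "W (FM S) n \<subseteq> {f \<in> Fr S. \<forall>k. f k \<in> mp n}" unfolding W_def
  proof (rule F.set_smult_least)
    show "submodule {f \<in> Fr S. \<forall>k. f k \<in> mp n} R (FM S)"
      by (rule F.submodI) (use F.submod_closed[OF F.carrier_is_submodule] in \<open>auto intro: mp_closed\<close>)
    fix a z assume "a \<in> mp n" "z \<in> carrier (FM S)"
    thus "a \<odot>\<^sub>(FM S) z \<in> {f \<in> Fr S. \<forall>k. f k \<in> mp n}"
      using F.smult_closed[of a z] mp_carrier by (auto simp: FrD intro: ideal.I_r_closed[OF mp_ideal])
  qed
  have "f \<in> W (FM S) n" if "finite T" "T \<subseteq> S" "f \<in> Fr T" "\<forall>k. f k \<in> mp n" for T f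
    using that
  proof (induction T arbitrary: f rule: finite_induct)
    case empty
    hence "f = \<zero>\<^sub>(FM S)" by (auto simp: Fr_empty)
    thus ?case using F.submod_zero[OF W_submodule[OF FM_module]] by simp
  next
    case (insert k T)
    have 1: "f(k := \<zero>) \<in> W (FM S) n"
      by (rule insert.IH) (use insert in \<open>auto simp: Fr_def mp_closed\<close>)
    have 2: "f k \<odot>\<^sub>(FM S) uv k \<in> W (FM S) n"
      using insert.prems by (intro W_mem[OF FM_module]) (auto intro: uv_Fr)
    have "f = f(k := \<zero>) \<oplus>\<^sub>(FM S) f k \<odot>\<^sub>(FM S) uv k"
      using insert.prems FrD(1)[OF insert.prems(2)] by (auto simp: uv_def fun_eq_iff)
    thus ?case using F.submod_add[OF W_submodule[OF FM_module] 1 2] by simp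
  qed
  thus "{f \<in> Fr S. \<forall>k. f k \<in> mp n} \<subseteq> W (FM S) n" using assms by blast
qed

definition comb where "comb P S g f = finsum P (\<lambda>k. f k \<odot>\<^sub>P g k) S" for S :: "nat set"

lemma comb_lin: assumes "module R P" "finite S" "\<And>k. k \<in> S \<Longrightarrow> g k \<in> carrier P"
  shows "comb P S g \<in> lin_maps R U P"
proof -
  interpret P: module R P by fact
  show ?thesis unfolding lin_maps_def comb_def
    using assms(2,3)
    by (auto simp: P.smult_l_distr P.M.finsum_addf P.smult_assoc1 P.finsum_smult_ldistr Pi_def
        intro!: P.M.finsum_closed P.M.finsum_cong' simp flip: P.M.finsum_addf)
qed

lemma comb_uv: assumes "module R P" "finite S" "\<And>k. k \<in> S \<Longrightarrow> g k \<in> carrier P" "k \<in> S"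
  shows "comb P S g (uv k) = g k"
proof -
  interpret P: module R P by fact
  have "comb P S g (uv k) = finsum P (\<lambda>j. if k = j then g j else \<zero>\<^sub>P) S" unfolding comb_def uv_def
    by (rule P.M.finsum_cong') (use assms in auto)
  also have "\<dots> = g k" using assms by (intro P.M.finsum_singleton) auto
  finally show ?thesis .
qed

lemma comb_submod: assumes "module R P" "submodule H R P" "\<And>k. k \<in> S \<Longrightarrow> g k \<in> H" "f \<in> carrier U"
  shows "comb P S g f \<in> H"
  unfolding comb_def using assms by (intro module.finsum_submod module.submod_smult[of _ P H]) auto

lemma finsum_FM: assumes "finite A" "\<And>a. a \<in> A \<Longrightarrow> F a \<in> Fr S"
  shows "finsum (FM S) F A j = finsum R (\<lambda>a. F a j) A"
  using assms
proof (induction A rule: finite_induct)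
  interpret F: module R "FM S" by (rule FM_module)
  case empty show ?case by simp
next
  interpret F: module R "FM S" by (rule FM_module)
  case (insert x A)
  thus ?case by (subst F.M.finsum_insert, auto, subst finsum_insert) (auto intro: FrD(1)[of _ S])
qed

lemma FM_free: assumes "finite S" shows "fin_gen_free R (FM S)"
proof -
  interpret F: module R "FM S" by (rule FM_module)
  have inj: "inj_on uv S" by (rule inj_onI) (metis uv_def one_notin mm.zero_closed)
  have ev: "(finsum (FM S) (\<lambda>b. c b \<odot>\<^sub>(FM S) b) (uv ` S)) j = (if j \<in> S then c (uv j) else \<zero>)"
    if c: "c \<in> uv ` S \<rightarrow> carrier R" for c j
  proof -
    have 1: "(finsum (FM S) (\<lambda>b. c b \<odot>\<^sub>(FM S) b) (uv ` S)) = finsum (FM S) (\<lambda>k. c (uv k) \<odot>\<^sub>(FM S) uv k) S"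
      using c by (intro F.M.finsum_reindex inj) (auto simp: Pi_def intro!: F.smult_closed[simplified] uv_Fr)
    have "finsum (FM S) (\<lambda>k. c (uv k) \<odot>\<^sub>(FM S) uv k) S j = finsum R (\<lambda>k. (c (uv k) \<odot>\<^sub>(FM S) uv k) j) S"
      by (rule finsum_FM[OF assms]) (use c in \<open>auto simp: Pi_def intro!: F.smult_closed[simplified] uv_Fr\<close>)
    also have "\<dots> = finsum R (\<lambda>k. if j = k then c (uv k) else \<zero>) S"
      by (rule finsum_cong') (use c in \<open>auto simp: uv_def Pi_def\<close>)
    also have "\<dots> = (if j \<in> S then c (uv j) else \<zero>)"
    proof (cases "j \<in> S")
      case True thus ?thesis using assms c by (simp add: finsum_singleton Pi_def)
    next
      case False
      have "finsum R (\<lambda>k. if j = k then c (uv k) else \<zero>) S = finsum R (\<lambda>k. \<zero>) S"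
        by (rule finsum_cong') (use False in auto)
      thus ?thesis using False by simp
    qed
    finally show ?thesis unfolding 1 .
  qed
  show ?thesis unfolding fin_gen_free_def
  proof (intro exI[of _ "uv ` S"] conjI ballI)
    show "finite (uv ` S)" "uv ` S \<subseteq> carrier (FM S)" using assms uv_Fr by auto
    fix f assume f: "f \<in> carrier (FM S)"
    define c where "c = restrict (\<lambda>b. f (the_inv_into S uv b)) (uv ` S)"
    have cu: "c (uv k) = f k" if "k \<in> S" for k using that by (simp add: c_def the_inv_into_f_f[OF inj])
    have cc: "c \<in> uv ` S \<rightarrow>\<^sub>E carrier R" using cu f by (auto simp: FrD c_def)
    show "\<exists>!c. c \<in> uv ` S \<rightarrow>\<^sub>E carrier R \<and> f = (\<Oplus>\<^bsub>FM S\<^esub>b\<in>uv ` S. c b \<odot>\<^sub>(FM S) b)"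
    proof (rule ex1I[of _ c])
      have "c \<in> uv ` S \<rightarrow> carrier R" using cc by auto
      thus "c \<in> uv ` S \<rightarrow>\<^sub>E carrier R \<and> f = (\<Oplus>\<^bsub>FM S\<^esub>b\<in>uv ` S. c b \<odot>\<^sub>(FM S) b)"
        using ev[of c] cc cu f by (auto simp: fun_eq_iff FrD)
      fix c' assume c': "c' \<in> uv ` S \<rightarrow>\<^sub>E carrier R \<and> f = (\<Oplus>\<^bsub>FM S\<^esub>b\<in>uv ` S. c' b \<odot>\<^sub>(FM S) b)"
      hence "c' \<in> uv ` S \<rightarrow> carrier R" by auto
      note * = ev[OF this]
      show "c' = c"
      proof (rule PiE_ext[of c' "uv ` S" "\<lambda>_. carrier R"])
        fix b assume "b \<in> uv ` S"
        then obtain k where "k \<in> S" "b = uv k" by auto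
        thus "c' b = c b" using *[of k] c' cu by auto
      qed (use c' cc in auto)
    qed
  qed
qed

section \<open>Finite generation and Nakayama's lemma\<close>

definition fin_gen_sub where "fin_gen_sub P H \<longleftrightarrow> (\<exists>X. finite X \<and> X \<subseteq> H \<and> module_span R P X = H)"

text \<open>In a generating family of least size, a relation with a coefficient outside \<open>\<mm>\<close>, hence with a unit, would
  make one of the generators redundant.\<close>

lemma fin_gen_sub_minimal_cover:
  assumes P: "module R P" and H: "submodule H R P" and fg: "fin_gen_sub P H"
  obtains S and \<delta> where "finite (S :: nat set)" "\<delta> \<in> lin_maps R U P" "\<delta> ` Fr S = H"
    "\<And>f. f \<in> carrier U \<Longrightarrow> \<delta> f \<in> H" "\<And>f k. f \<in> Fr S \<Longrightarrow> \<delta> f = \<zero>\<^sub>P \<Longrightarrow> f k \<in> \<mm>"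
proof -
  interpret P: module R P by fact
  interpret U: module R U by (rule U_module)
  define Q where "Q = (\<lambda>(S::nat set, g). finite S \<and> g ` S \<subseteq> H \<and> H \<subseteq> comb P S g ` Fr S)"
  have sub: "submodule (comb P S g ` Fr S) R P" if "finite S" "g ` S \<subseteq> H" for S g
  proof -
    have "lin_map R U P (comb P S g)"
      using that P.submod_carrier[OF H] by (intro lin_mapI P U_module comb_lin) auto
    from lin_map.image_submodule[OF this Fr_submodule] show ?thesis .
  qed
  have mem: "g k \<in> comb P S g ` Fr S" if "finite S" "g ` S \<subseteq> H" "k \<in> S" for S g k
    using comb_uv[OF P that(1) _ that(3), of g] that P.submod_carrier[OF H] uv_Fr[OF that(3)]
    by (metis image_eqI image_subset_iff)
  have Qex: "\<exists>Sg. Q Sg"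
  proof -
    obtain X where X: "finite X" "X \<subseteq> H" "module_span R P X = H" using fg by (auto simp: fin_gen_sub_def)
    obtain n g where g: "X = g ` {i::nat. i < n}" using finite_imp_nat_seg_image_inj_on[OF X(1)] by blast
    have "X \<subseteq> comb P {i. i < n} g ` Fr {i. i < n}" using mem[of "{i. i < n}" g] g X(2) by auto
    hence "H \<subseteq> comb P {i. i < n} g ` Fr {i. i < n}"
      using P.span_least[OF sub[of "{i. i < n}" g], of X] X g by blast
    thus ?thesis using X g by (intro exI[of _ "({i. i < n}, g)"]) (auto simp: Q_def)
  qed
  define Sg where "Sg = arg_min (\<lambda>(S,g). card S) Q"
  obtain S g where Sg: "Sg = (S, g)" by force
  obtain Sg0 where "Q Sg0" using Qex by blast
  hence "Q Sg" unfolding Sg_def by (rule arg_min_natI)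
  hence S: "finite S" "g ` S \<subseteq> H" "H \<subseteq> comb P S g ` Fr S" by (auto simp: Sg Q_def)
  have gc: "g k \<in> carrier P" if "k \<in> S" for k using that S P.submod_carrier[OF H] by auto
  have inH: "comb P S g f \<in> H" if "f \<in> carrier U" for f
    by (rule comb_submod[OF P H _ that]) (use S in auto)
  show thesis
  proof
    show "finite S" "comb P S g \<in> lin_maps R U P" using S comb_lin[OF P S(1) gc] by auto
    show "comb P S g f \<in> H" if "f \<in> carrier U" for f using inH[OF that] .
    thus "comb P S g ` Fr S = H" using S FrD(3) by auto
    fix f k assume f: "f \<in> Fr S" "comb P S g f = \<zero>\<^sub>P"
    show "f k \<in> \<mm>"
    proof (rule ccontr)
      assume nk: "f k \<notin> \<mm>"
      hence k: "k \<in> S" using FrD(2)[OF f(1), of k] mm.zero_closed by metis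
      have fk: "f k \<in> Units R" using unit_or nk FrD(1)[OF f(1)] by blast
      let ?T = "S - {k}" let ?K = "comb P ?T g ` Fr ?T"
      have T: "finite ?T" "g ` ?T \<subseteq> H" using S by auto
      note K = sub[OF T]
      have gK: "g j \<in> ?K" if "j \<in> ?T" for j using mem[OF T that] .
      have "comb P ?T g f \<in> ?K" by (rule comb_submod[OF P K gK]) (use f FrD in auto)
      moreover have "comb P S g f = f k \<odot>\<^sub>P g k \<oplus>\<^sub>P comb P ?T g f"
        unfolding comb_def using S(1) k gc FrD(1)[OF f(1)]
        by (subst P.M.finsum_insert[symmetric]) (auto simp: insert_absorb)
      ultimately have "f k \<odot>\<^sub>P g k \<in> ?K"
        using f(2) P.submod_zero[OF K] P.submod_cancel[OF K] gc[OF k] FrD(1)[OF f(1), of k] by auto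
      hence "inv (f k) \<odot>\<^sub>P (f k \<odot>\<^sub>P g k) \<in> ?K" using P.submod_smult[OF K] fk by blast
      hence "g k \<in> ?K" using fk gc[OF k] FrD(1)[OF f(1), of k] by (simp add: P.smult_assoc1[symmetric])
      hence "g j \<in> ?K" if "j \<in> S" for j using gK that by (cases "j = k") auto
      hence cK: "comb P S g f \<in> ?K" if "f \<in> Fr S" for f by (rule comb_submod[OF P K _ FrD(3)[OF that]])
      have "comb P S g ` Fr S \<subseteq> ?K" by (rule image_subsetI) (rule cK)
      with S(3) have "H \<subseteq> ?K" by (rule subset_trans)
      hence "Q (?T, g)" using T by (auto simp: Q_def)
      hence "(\<lambda>(S,g). card S) Sg \<le> (\<lambda>(S,g). card S) (?T, g)" unfolding Sg_def by (rule arg_min_nat_le)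
      hence "card S \<le> card ?T" by (simp add: Sg)
      thus False using S(1) k by (metis card_Diff1_less not_le)
    qed
  qed
qed

lemma fin_gen_sub_lin_image:
  assumes "module R P" "module R Q" "\<delta> \<in> lin_maps R P Q" "submodule H R P" "fin_gen_sub P H"
  shows "fin_gen_sub Q (\<delta> ` H)"
proof -
  interpret lin_map R P Q \<delta> using assms by (intro lin_mapI)
  obtain X where X: "finite X" "X \<subseteq> H" "module_span R P X = H" using assms by (auto simp: fin_gen_sub_def)
  have XP: "X \<subseteq> carrier P" using X M.submod_carrier[OF assms(4)] by auto
  hence *: "submodule (module_span R Q (\<delta> ` X)) R Q" by (intro N.span_submodule) auto
  have "module_span R Q (\<delta> ` X) \<subseteq> \<delta> ` H"
    by (rule N.span_least[OF image_submodule[OF assms(4)]]) (use X in auto)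
  moreover have "H \<subseteq> {x \<in> carrier P. \<delta> x \<in> module_span R Q (\<delta> ` X)}"
    unfolding X(3)[symmetric] by (rule M.span_least[OF vimage_submodule[OF *]])
      (use XP N.span_superset[of "\<delta> ` X"] in auto)
  ultimately have "module_span R Q (\<delta> ` X) = \<delta> ` H" by auto
  thus ?thesis using X by (auto simp: fin_gen_sub_def intro!: exI[of _ "\<delta> ` X"])
qed

text \<open>Induction on the number of coordinates: the values of one coordinate form an ideal, and the elements
  where it is zero lie in a smaller free module.\<close>

lemma Fr_noetherian:
  assumes "finite S" "submodule H R U" "H \<subseteq> Fr S" shows "fin_gen_sub U H"
  using assms
proof (induction S arbitrary: H rule: finite_induct)
  case empty
  interpret U: module R U by (rule U_module)
  have "H = {\<zero>\<^sub>U}" using empty U.submod_zero[OF empty(1)] by (auto simp: Fr_empty)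
  moreover have "module_span R U {} = {\<zero>\<^sub>U}"
    using U.span_least[OF U.zero_submodule, of "{}"] U.submod_zero[OF U.span_submodule, of "{}"] by auto
  ultimately show ?case by (auto simp: fin_gen_sub_def)
next
  case (insert k S)
  interpret U: module R U by (rule U_module)
  note H = insert.prems(1)
  have img: "ideal ((\<lambda>f. f k) ` K) R" if K: "submodule K R U" for K
  proof (rule submodule_idealI)
    show "\<zero> \<in> (\<lambda>f. f k) ` K" using U.submod_zero[OF K] by force
    show "(\<lambda>f. f k) ` K \<subseteq> carrier R" using U.submod_carrier[OF K] by auto
  next
    fix a b assume "a \<in> (\<lambda>f. f k) ` K" "b \<in> (\<lambda>f. f k) ` K"
    then obtain f g where "f \<in> K" "g \<in> K" "a = f k" "b = g k" by auto
    thus "a \<oplus> b \<in> (\<lambda>f. f k) ` K" using U.submod_add[OF K, of f g] by (force simp: image_iff)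
  next
    fix a b assume "a \<in> carrier R" "b \<in> (\<lambda>f. f k) ` K"
    then obtain f where "f \<in> K" "b = f k" by auto
    thus "a \<otimes> b \<in> (\<lambda>f. f k) ` K" using U.submod_smult[OF K \<open>a \<in> carrier R\<close>, of f] by (force simp: image_iff)
  qed
  obtain A where A: "A \<subseteq> carrier R" "finite A" "(\<lambda>f. f k) ` H = Idl A"
    using finetely_gen[OF img[OF H]] by blast
  have "A \<subseteq> (\<lambda>f. f k) ` H" using A genideal_self[OF A(1)] by simp
  then obtain Y where Y: "Y \<subseteq> H" "finite Y" "A = (\<lambda>f. f k) ` Y" using finite_subset_image[OF A(2)] by metis
  have "fin_gen_sub U (H \<inter> Fr S)" using insert.IH[of "H \<inter> Fr S"] U.submodule_Int[OF H Fr_submodule] by auto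
  then obtain X where X: "finite X" "X \<subseteq> H" "module_span R U X = H \<inter> Fr S" by (auto simp: fin_gen_sub_def)
  let ?V = "module_span R U (X \<union> Y)"
  have XY: "X \<union> Y \<subseteq> carrier U" using X Y U.submod_carrier[OF H] by auto
  note V = U.span_submodule[OF XY]
  have "?V \<subseteq> H" by (rule U.span_least[OF H]) (use X Y in auto)
  moreover have "H \<subseteq> ?V"
  proof
    fix h assume h: "h \<in> H"
    have "A \<subseteq> (\<lambda>f. f k) ` ?V" using Y U.span_superset[of "X \<union> Y"] by auto
    hence "Idl A \<subseteq> (\<lambda>f. f k) ` ?V" using genideal_minimal[OF img[OF V]] by auto
    then obtain w where w: "w \<in> ?V" "w k = h k" using A(3) imageI[OF h, of "\<lambda>f. f k"] by auto
    have wH: "w \<in> H" using w \<open>?V \<subseteq> H\<close> by auto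
    have "h \<ominus>\<^sub>U w \<in> H" using U.submod_diff[OF H h wH] .
    moreover have "h \<ominus>\<^sub>U w \<in> Fr S"
    proof -
      have hw: "h \<in> carrier U" "w \<in> carrier U" using h wH U.submod_carrier[OF H] by auto
      have "h j = \<zero>" "w j = \<zero>" if "j \<notin> insert k S" for j
        using FrD(2)[OF subsetD[OF insert.prems(2) h] that] FrD(2)[OF subsetD[OF insert.prems(2) wH] that] by auto
      hence "h j \<ominus> w j = \<zero>" if "j \<notin> S" for j using that w(2) hw by (cases "j = k") (auto simp: a_minus_def r_neg)
      thus ?thesis unfolding module.fun_mod_minus[OF SR_module hw] using hw
        by (auto simp: Fr_def simp del: minus_eq)
    qed
    moreover have "module_span R U X \<subseteq> ?V"
      by (rule U.span_least[OF V]) (use U.span_superset[of "X \<union> Y"] in auto)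
    ultimately have "h \<ominus>\<^sub>U w \<in> ?V" using X by auto
    from U.submod_add[OF V this w(1)] show "h \<in> ?V"
      using U.submod_carrier[OF H] h wH by (simp only: U.M.move_minus U.M.minus_eq_iff U.M.add.m_closed)
         (metis U.M.add_minus2 U.M.minus_eq_iff U.M.add.m_closed)
  qed
  ultimately show ?case using X Y by (auto simp: fin_gen_sub_def intro!: exI[of _ "X \<union> Y"])
qed

lemma fin_gen_iff: "fin_gen R M \<longleftrightarrow> fin_gen_sub M (carrier M)"
  by (simp add: fin_gen_sub_def fin_gen_def)

lemma fin_gen_noetherian:
  assumes M: "module R M" "fin_gen R M" and H: "submodule H R M" shows "fin_gen_sub M H"
proof -
  interpret module R M by fact
  obtain S \<delta> where S: "finite S" "\<delta> \<in> lin_maps R U M" "\<delta> ` Fr S = carrier M"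
    using fin_gen_sub_minimal_cover[OF M(1) carrier_is_submodule M(2)[unfolded fin_gen_iff]] by metis
  interpret d: lin_map R U M \<delta> using S M by (intro lin_mapI U_module)
  let ?H = "{f \<in> carrier U. \<delta> f \<in> H} \<inter> Fr S"
  have 1: "submodule ?H R U" by (intro d.M.submodule_Int d.vimage_submodule H Fr_submodule)
  have "fin_gen_sub U ?H" by (rule Fr_noetherian[OF S(1) 1]) auto
  hence "fin_gen_sub M (\<delta> ` ?H)" by (rule fin_gen_sub_lin_image[OF U_module M(1) S(2) 1])
  moreover have "\<delta> ` ?H = H"
  proof
    show "H \<subseteq> \<delta> ` ?H"
    proof
      fix h assume "h \<in> H"
      then obtain f where "f \<in> Fr S" "h = \<delta> f" using S(3) submod_carrier[OF H] by (metis image_iff)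
      thus "h \<in> \<delta> ` ?H" using \<open>h \<in> H\<close> FrD(3) by blast
    qed
  qed auto
  ultimately show ?thesis by simp
qed

lemma fin_gen_sub_chain:
  assumes M: "module R M" "fin_gen R M" and H: "\<And>i::nat. submodule (H i) R M" "\<And>i. H i \<subseteq> H (Suc i)"
  obtains n where "\<And>j. n \<le> j \<Longrightarrow> H j = H n"
proof -
  interpret module R M by fact
  have mono: "H i \<subseteq> H j" if "i \<le> j" for i j using lift_Suc_mono_le[of H, OF H(2) that] .
  note u = submodule_chain_UN[of H, OF H]
  obtain X where X: "finite X" "X \<subseteq> (\<Union>i. H i)" "module_span R M X = (\<Union>i. H i)"
    using fin_gen_noetherian[OF M u] by (auto simp: fin_gen_sub_def)
  have "\<exists>n. Y \<subseteq> H n" if "finite Y" "Y \<subseteq> (\<Union>i. H i)" for Y using that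
  proof (induction Y rule: finite_induct)
    case (insert y Y)
    then obtain n m where "Y \<subseteq> H n" "y \<in> H m" by auto
    hence "insert y Y \<subseteq> H (max n m)" using mono[of n "max n m"] mono[of m "max n m"] by auto
    thus ?case by blast
  qed auto
  then obtain n where "X \<subseteq> H n" using X by blast
  hence "(\<Union>i. H i) \<subseteq> H n" using span_least[OF H(1)] X(3) by metis
  thus thesis using that[of n] mono by blast
qed

lemma one_minus_add: "a \<in> carrier R \<Longrightarrow> (\<one> \<ominus> a) \<oplus> a = \<one>"
  by (simp add: move_minus)

text \<open>If the minimal cover has a basis element, it is congruent to an element of \<open>\<mm> F\<close> modulo the kernel, which
  lies in \<open>\<mm> F\<close>; then its coordinate \<open>\<one>\<close> is in \<open>\<mm>\<close>.\<close>

lemma nakayama: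
  assumes M: "module R M" "fin_gen R M" and "W M 1 = carrier M" shows "carrier M = {\<zero>\<^sub>M}"
proof -
  interpret module R M by fact
  obtain S \<delta> where S: "finite S" "\<delta> \<in> lin_maps R U M" "\<delta> ` Fr S = carrier M"
     and min: "\<And>f k. f \<in> Fr S \<Longrightarrow> \<delta> f = \<zero>\<^sub>M \<Longrightarrow> f k \<in> \<mm>"
    using fin_gen_sub_minimal_cover[OF M(1) carrier_is_submodule M(2)[unfolded fin_gen_iff]] by metis
  interpret d: lin_map R U M \<delta> using S M by (intro lin_mapI U_module)
  have dF: "\<delta> \<in> lin_maps R (FM S) M" using S FrD(3)[of _ S] lin_mapsD[OF S(2)] unfolding lin_maps_def by auto
  have "S = {}"
  proof (rule ccontr)
    assume "S \<noteq> {}"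
    then obtain k where k: "k \<in> S" by auto
    have "\<delta> (uv k) \<in> W M 1" using assms(3) S(3) uv_Fr[OF k] by auto
    then obtain f where f: "f \<in> W (FM S) 1" "\<delta> (uv k) = \<delta> f"
      using W_surj[OF FM_module M(1) dF, of 1] S(3) by auto
    have f': "f \<in> Fr S" "f k \<in> \<mm>" using f(1) S(1) by (auto simp: W_FM)
    have "uv k \<ominus>\<^sub>U f \<in> Fr S" using d.M.submod_diff[OF Fr_submodule uv_Fr[OF k] f'(1)] .
    moreover have "\<delta> (uv k \<ominus>\<^sub>U f) = \<zero>\<^sub>M"
      using f' f(2) FrD(3) uv_Fr[OF k] d.closed[of f] by (subst d.diff) (auto simp: a_minus_def M.r_neg)
    ultimately have "(uv k \<ominus>\<^sub>U f) k \<in> \<mm>" using min by blast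
    hence "\<one> \<ominus> f k \<in> \<mm>" using FrD(3)[OF f'(1)] FrD(3)[OF uv_Fr[OF k]]
      by (subst (asm) module.fun_mod_minus[OF SR_module]) (auto simp: uv_def a_minus_def)
    hence "(\<one> \<ominus> f k) \<oplus> f k \<in> \<mm>" using f'(2) by simp
    moreover have "(\<one> \<ominus> f k) \<oplus> f k = \<one>" using one_minus_add[OF FrD(1)[OF f'(1), of k]] .
    ultimately show False using one_notin by simp
  qed
  thus ?thesis using S(3) d.zero by (simp add: Fr_empty)
qed

end

section \<open>Minimal resolutions and their comparison\<close>

lemma lin_maps_comp: "f \<in> lin_maps R M N \<Longrightarrow> g \<in> lin_maps R N P \<Longrightarrow> (\<lambda>x. g (f x)) \<in> lin_maps R M P"
  by (auto simp: lin_maps_def Pi_iff)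

lemma (in module) lin_maps_id: "(\<lambda>x. x) \<in> lin_maps R M M"
  by (auto simp: lin_maps_def)

lemma lin_maps_zero: "module R M \<Longrightarrow> module R N \<Longrightarrow> (\<lambda>x. \<zero>\<^sub>N) \<in> lin_maps R M N"
proof -
  assume "module R M" "module R N"
  then interpret N: module R N by simp
  show ?thesis by (auto simp: lin_maps_def)
qed

lemma (in module) smult_r_diff: "a \<in> carrier R \<Longrightarrow> x \<in> carrier M \<Longrightarrow> y \<in> carrier M \<Longrightarrow>
    a \<odot>\<^sub>M (x \<ominus>\<^sub>M y) = a \<odot>\<^sub>M x \<ominus>\<^sub>M a \<odot>\<^sub>M y"
  by (simp add: a_minus_def smult_r_distr smult_r_minus)

lemma lin_maps_diff: assumes "module R M" "module R N" "f \<in> lin_maps R M N" "g \<in> lin_maps R M N"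
  shows "(\<lambda>x. f x \<ominus>\<^sub>N g x) \<in> lin_maps R M N"
proof -
  interpret f: lin_map R M N f using assms by (simp add: lin_mapI)
  interpret g: lin_map R M N g using assms by (simp add: lin_mapI)
  show ?thesis unfolding lin_maps_def
    by (auto simp: f.N.smult_r_diff) (auto simp: f.N.M.move_minus)
qed

lemma (in lin_map) finsum_hom:
  assumes "finite A" "\<And>b. b \<in> A \<Longrightarrow> g b \<in> carrier M"
  shows "f (finsum M g A) = finsum N (\<lambda>b. f (g b)) A"
  using assms
proof (induction A rule: finite_induct)
  case (insert x F)
  have "f (finsum M g (insert x F)) = f (g x \<oplus>\<^sub>M finsum M g F)"
    using insert by (subst M.M.finsum_insert) auto
  thus ?case using insert by (subst N.M.finsum_insert) auto
qed simp

text \<open>Projectivity of free modules: lift the images of a basis.\<close>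

lemma free_lift:
  assumes P: "module R P" and Q: "module R Q" and T: "module R T" and free: "fin_gen_free R P"
    and \<alpha>: "\<alpha> \<in> lin_maps R P T" and \<beta>: "\<beta> \<in> lin_maps R Q T" and sub: "\<alpha> ` carrier P \<subseteq> \<beta> ` carrier Q"
  shows "\<exists>\<gamma> \<in> lin_maps R P Q. \<forall>x\<in>carrier P. \<beta> (\<gamma> x) = \<alpha> x"
proof -
  interpret a: lin_map R P T \<alpha> using assms by (simp add: lin_mapI)
  interpret b: lin_map R Q T \<beta> using assms by (simp add: lin_mapI)
  obtain B where B': "finite B \<and> B \<subseteq> carrier P \<and>
     (\<forall>x\<in>carrier P. \<exists>!c. c \<in> B \<rightarrow>\<^sub>E carrier R \<and> x = (\<Oplus>\<^bsub>P\<^esub>b\<in>B. c b \<odot>\<^sub>P b))"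
    using free unfolding fin_gen_free_def by (elim exE)
  have B: "finite B" "B \<subseteq> carrier P" using B' by blast+
  have u: "\<exists>!c. c \<in> B \<rightarrow>\<^sub>E carrier R \<and> x = (\<Oplus>\<^bsub>P\<^esub>b\<in>B. c b \<odot>\<^sub>P b)" if "x \<in> carrier P" for x
    using B' that by (elim conjE) (rule bspec)
  define c where "c x = (THE c. c \<in> B \<rightarrow>\<^sub>E carrier R \<and> x = (\<Oplus>\<^bsub>P\<^esub>b\<in>B. c b \<odot>\<^sub>P b))" for x
  have c: "c x \<in> B \<rightarrow>\<^sub>E carrier R" "x = (\<Oplus>\<^bsub>P\<^esub>b\<in>B. c x b \<odot>\<^sub>P b)" if "x \<in> carrier P" for x
    unfolding c_def using theI'[OF u[OF that]] by blast+
  have cu: "c x = c'" if "x \<in> carrier P" "c' \<in> B \<rightarrow>\<^sub>E carrier R" "x = (\<Oplus>\<^bsub>P\<^esub>b\<in>B. c' b \<odot>\<^sub>P b)" for x c'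
    unfolding c_def by (rule the1_equality[OF u[OF that(1)]]) (use that in simp)
  have cc: "c x b \<in> carrier R" if "x \<in> carrier P" "b \<in> B" for x b using PiE_mem[OF c(1)[OF that(1)] that(2)] .
  have cadd: "c (x \<oplus>\<^sub>P y) b = c x b \<oplus>\<^sub>R c y b" if x: "x \<in> carrier P" and y: "y \<in> carrier P" and b: "b \<in> B" for x y b
  proof -
    have "c (x \<oplus>\<^sub>P y) = (\<lambda>b\<in>B. c x b \<oplus>\<^sub>R c y b)"
    proof (rule cu)
      have "(\<Oplus>\<^bsub>P\<^esub>b\<in>B. (\<lambda>b\<in>B. c x b \<oplus>\<^sub>R c y b) b \<odot>\<^sub>P b) = (\<Oplus>\<^bsub>P\<^esub>b\<in>B. c x b \<odot>\<^sub>P b \<oplus>\<^sub>P c y b \<odot>\<^sub>P b)"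
        using x y B(2) cc by (intro a.M.M.finsum_cong') (auto simp: a.M.smult_l_distr)
      also have "\<dots> = x \<oplus>\<^sub>P y" using x y B cc
        by (subst a.M.M.finsum_addf) (auto simp: c(2)[symmetric])
      finally show "x \<oplus>\<^sub>P y = (\<Oplus>\<^bsub>P\<^esub>b\<in>B. (\<lambda>b\<in>B. c x b \<oplus>\<^sub>R c y b) b \<odot>\<^sub>P b)" by simp
    qed (use x y cc in auto)
    thus ?thesis using b by simp
  qed
  have csm: "c (r \<odot>\<^sub>P x) b = r \<otimes>\<^bsub>R\<^esub> c x b" if x: "x \<in> carrier P" and r: "r \<in> carrier R" and b: "b \<in> B" for x r b
  proof -
    have "c (r \<odot>\<^sub>P x) = (\<lambda>b\<in>B. r \<otimes>\<^bsub>R\<^esub> c x b)"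
    proof (rule cu)
      have "(\<Oplus>\<^bsub>P\<^esub>b\<in>B. (\<lambda>b\<in>B. r \<otimes>\<^bsub>R\<^esub> c x b) b \<odot>\<^sub>P b) = (\<Oplus>\<^bsub>P\<^esub>b\<in>B. r \<odot>\<^sub>P (c x b \<odot>\<^sub>P b))"
        using x r B(2) cc by (intro a.M.M.finsum_cong') (auto simp: a.M.smult_assoc1)
      also have "\<dots> = r \<odot>\<^sub>P x" using x r B cc
        by (subst a.M.finsum_smult_ldistr[symmetric]) (auto simp: c(2)[symmetric])
      finally show "r \<odot>\<^sub>P x = (\<Oplus>\<^bsub>P\<^esub>b\<in>B. (\<lambda>b\<in>B. r \<otimes>\<^bsub>R\<^esub> c x b) b \<odot>\<^sub>P b)" by simp
    qed (use x r cc in auto)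
    thus ?thesis using b by simp
  qed
  have "\<forall>b\<in>B. \<exists>q\<in>carrier Q. \<beta> q = \<alpha> b"
  proof
    fix b assume "b \<in> B"
    hence "\<alpha> b \<in> \<beta> ` carrier Q" using sub B(2) by blast
    thus "\<exists>q\<in>carrier Q. \<beta> q = \<alpha> b" by auto
  qed
  then obtain q where q: "\<And>b. b \<in> B \<Longrightarrow> q b \<in> carrier Q" "\<And>b. b \<in> B \<Longrightarrow> \<beta> (q b) = \<alpha> b" by metis
  define \<gamma> where "\<gamma> x = (\<Oplus>\<^bsub>Q\<^esub>b\<in>B. c x b \<odot>\<^sub>Q q b)" for x
  have "\<gamma> \<in> lin_maps R P Q"
  proof -
    have "\<gamma> (x \<oplus>\<^sub>P y) = \<gamma> x \<oplus>\<^sub>Q \<gamma> y" if "x \<in> carrier P" "y \<in> carrier P" for x y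
    proof -
      have "\<gamma> (x \<oplus>\<^sub>P y) = (\<Oplus>\<^bsub>Q\<^esub>b\<in>B. c x b \<odot>\<^sub>Q q b \<oplus>\<^sub>Q c y b \<odot>\<^sub>Q q b)" unfolding \<gamma>_def
        using that q cc by (intro b.M.M.finsum_cong') (auto simp: cadd b.M.smult_l_distr)
      thus ?thesis unfolding \<gamma>_def using that q cc by (subst (asm) b.M.M.finsum_addf) auto
    qed
    moreover have "\<gamma> (r \<odot>\<^sub>P x) = r \<odot>\<^sub>Q \<gamma> x" if "x \<in> carrier P" "r \<in> carrier R" for x r
    proof -
      have "\<gamma> (r \<odot>\<^sub>P x) = (\<Oplus>\<^bsub>Q\<^esub>b\<in>B. r \<odot>\<^sub>Q (c x b \<odot>\<^sub>Q q b))" unfolding \<gamma>_def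
        using that q cc by (intro b.M.M.finsum_cong') (auto simp: csm b.M.smult_assoc1)
      thus ?thesis unfolding \<gamma>_def using that q cc B(1) by (subst b.M.finsum_smult_ldistr) auto
    qed
    moreover have "\<gamma> x \<in> carrier Q" if "x \<in> carrier P" for x
      unfolding \<gamma>_def using that q cc by (intro b.M.M.finsum_closed) auto
    ultimately show ?thesis by (auto simp: lin_maps_def)
  qed
  moreover have "\<beta> (\<gamma> x) = \<alpha> x" if x: "x \<in> carrier P" for x
  proof -
    have "\<beta> (\<gamma> x) = (\<Oplus>\<^bsub>T\<^esub>b\<in>B. \<beta> (c x b \<odot>\<^sub>Q q b))" unfolding \<gamma>_def
      by (rule b.finsum_hom[OF B(1)]) (use x q cc in auto)
    also have "\<dots> = (\<Oplus>\<^bsub>T\<^esub>b\<in>B. \<alpha> (c x b \<odot>\<^sub>P b))"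
      using x q cc B(2) by (intro a.N.M.finsum_cong') auto
    also have "\<dots> = \<alpha> (\<Oplus>\<^bsub>P\<^esub>b\<in>B. c x b \<odot>\<^sub>P b)"
      by (rule a.finsum_hom[OF B(1), symmetric]) (use x B cc in auto)
    also have "\<dots> = \<alpha> x" using c(2)[OF x] by simp
    finally show ?thesis .
  qed
  ultimately show ?thesis by blast
qed

context noeth_local begin

text \<open>The homology of the linear part vanishes in degree n, said for elements: p stands for \<open>i - n\<close>. For
  \<open>p = 0\<close> the truncated \<open>p - 1\<close> is right, since \<open>\<mm>\<^sup>j\<close> is the whole ring for negative j.\<close>

definition lin_exact where "lin_exact F d n \<longleftrightarrow> (\<forall>p. \<forall>z\<in>W (F n) p. d n z \<in> W (F (n - 1)) (p + 2) \<longrightarrow>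
   (\<exists>w\<in>W (F (n + 1)) (p - 1). z \<ominus>\<^sub>(F n) d (n + 1) w \<in> W (F n) (p + 1)))" for n :: int and p :: nat

text \<open>A minimal free resolution with a given augmentation \<open>\<epsilon>\<close>.\<close>

definition min_res where "min_res P F d \<epsilon> \<longleftrightarrow> (\<forall>n::int. module R (F n) \<and> d n \<in> lin_maps R (F n) (F (n - 1)) \<and>
    (\<forall>x\<in>carrier (F n). d (n - 1) (d n x) = \<zero>\<^sub>(F (n - 2)) \<and> d n x \<in> W (F (n - 1)) 1) \<and> fin_gen_free R (F n) \<and>
    (n < 0 \<longrightarrow> carrier (F n) = {\<zero>\<^sub>(F n)}) \<and>
    (n > 0 \<longrightarrow> (\<forall>x\<in>carrier (F n). d n x = \<zero>\<^sub>(F (n - 1)) \<longrightarrow> x \<in> d (n + 1) ` carrier (F (n + 1))))) \<and>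
    \<epsilon> \<in> lin_maps R (F 0) P \<and> \<epsilon> ` carrier (F 0) = carrier P \<and>
        {x \<in> carrier (F 0). \<epsilon> x = \<zero>\<^sub>P} = d 1 ` carrier (F 1)"

lemma min_res_iff: "minimal_free_resolution R \<mm> P F d \<longleftrightarrow> (\<exists>\<epsilon>. min_res P F d \<epsilon>)"
proof -
  have W1: "W (F n) 1 = set_smult R (F n) \<mm>" for n by (simp add: W_def)
  have h: "(carrier (homology F d n) = {\<zero>\<^sub>(homology F d n)}) \<longleftrightarrow>
     (\<forall>x\<in>carrier (F n). d n x = \<zero>\<^sub>(F (n - 1)) \<longrightarrow> x \<in> d (n + 1) ` carrier (F (n + 1)))"
    if "\<And>n. module R (F n)" "\<And>n. d n \<in> lin_maps R (F n) (F (n - 1))" for n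
  proof (rule homology_trivial_iff)
    interpret a: lin_map R "F (n+1)" "F n" "d (n+1)" using that[of "n+1"] that(1)[of n] by (intro lin_mapI) auto
    interpret b: lin_map R "F n" "F (n-1)" "d n" using that[of n] that(1)[of "n-1"] by (intro lin_mapI) auto
    show "d n \<zero>\<^sub>(F n) = \<zero>\<^sub>(F (n - 1))" by simp
    show "submodule (d (n + 1) ` carrier (F (n + 1))) R (F n)" by (rule a.image_submodule[OF a.M.carrier_is_submodule])
  qed (rule that)
  show ?thesis
  proof
    assume a: "minimal_free_resolution R \<mm> P F d"
    hence m: "module R (F n)" "d n \<in> lin_maps R (F n) (F (n - 1))" for n
      by (auto simp: minimal_free_resolution_def minimal_complex_def chain_complex_def)
    show "\<exists>\<epsilon>. min_res P F d \<epsilon>" using a h[OF m] unfolding min_res_def minimal_free_resolution_def minimal_complex_def chain_complex_def W1 Bex_def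
      by (elim conjE exE, intro exI conjI) (auto simp: image_subset_iff)
  next
    assume "\<exists>\<epsilon>. min_res P F d \<epsilon>"
    then obtain \<epsilon> where a: "min_res P F d \<epsilon>" by blast
    hence m: "module R (F n)" "d n \<in> lin_maps R (F n) (F (n - 1))" for n
      by (auto simp: min_res_def)
    show "minimal_free_resolution R \<mm> P F d" using a h[OF m] unfolding min_res_def minimal_free_resolution_def minimal_complex_def chain_complex_def W1 Bex_def
      by (elim conjE exE, intro exI[of _ \<epsilon>] conjI) (auto simp: image_subset_iff)
  qed
qed

lemma min_resD: assumes "min_res P F d \<epsilon>"
  shows "module R (F n)" "d n \<in> lin_maps R (F n) (F (n - 1))" "x \<in> carrier (F n) \<Longrightarrow> d n x \<in> W (F (n - 1)) 1"
   "x \<in> carrier (F n) \<Longrightarrow> d (n - 1) (d n x) = \<zero>\<^sub>(F (n - 2))" "fin_gen_free R (F n)" "n < 0 \<Longrightarrow> carrier (F n) = {\<zero>\<^sub>(F n)}"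
   "n > 0 \<Longrightarrow> x \<in> carrier (F n) \<Longrightarrow> d n x = \<zero>\<^sub>(F (n - 1)) \<Longrightarrow> x \<in> d (n + 1) ` carrier (F (n + 1))"
   "\<epsilon> \<in> lin_maps R (F 0) P" "\<epsilon> ` carrier (F 0) = carrier P" "x \<in> carrier (F 0) \<Longrightarrow> \<epsilon> x = \<zero>\<^sub>P \<longleftrightarrow> x \<in> d 1 ` carrier (F 1)"
  using assms by (auto simp: min_res_def)

lemma min_res_d1: assumes "min_res P F d \<epsilon>" "x \<in> carrier (F 1)" shows "d 1 x \<in> carrier (F 0)" "\<epsilon> (d 1 x) = \<zero>\<^sub>P"
proof -
  show *: "d 1 x \<in> carrier (F 0)" using lin_mapsD(1)[OF min_resD(2)[OF assms(1), of 1] assms(2)] by simp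
  show "\<epsilon> (d 1 x) = \<zero>\<^sub>P" using min_resD(10)[OF assms(1) *] assms(2) by blast
qed

text \<open>The comparison theorem; the map is built degree by degree with projectivity.\<close>

lemma comparison:
  assumes P: "module R P" and F: "min_res P F d \<epsilon>" and G: "min_res P G e \<eta>"
  shows "\<exists>f. (\<forall>n. f n \<in> lin_maps R (F n) (G n)) \<and> (\<forall>n. \<forall>x\<in>carrier (F n). e n (f n x) = f (n - 1) (d n x)) \<and>
      (\<forall>x\<in>carrier (F 0). \<eta> (f 0 x) = \<epsilon> x)"
proof -
  note mF = min_resD(1)[OF F] and mG = min_resD(1)[OF G] and lF = min_resD(2)[OF F] and lG = min_resD(2)[OF G]
  have ee: "e (n - 1) (e n x) = \<zero>\<^sub>(G (n - 2))" if "x \<in> carrier (G n)" for n x using min_resD(4)[OF G that] .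
  have dd: "d (n - 1) (d n x) = \<zero>\<^sub>(F (n - 2))" if "x \<in> carrier (F n)" for n x using min_resD(4)[OF F that] .
  define A where "A k f \<longleftrightarrow> f \<in> lin_maps R (F (int k)) (G (int k)) \<and>
     (\<forall>x\<in>carrier (F (int k + 1)). f (d (int k + 1) x) \<in> e (int k + 1) ` carrier (G (int k + 1))) \<and>
     (k = 0 \<longrightarrow> (\<forall>x\<in>carrier (F 0). \<eta> (f x) = \<epsilon> x))" for k f
  define B where "B k f f' \<longleftrightarrow> (\<forall>x\<in>carrier (F (int k + 1)). e (int k + 1) (f' x) = f (d (int k + 1) x))" for k f f'
  have "\<exists>f. \<forall>n. A n (f n) \<and> B n (f n) (f (Suc n))"
  proof (rule dependent_nat_choice)
    obtain f where f: "f \<in> lin_maps R (F 0) (G 0)" "\<And>x. x\<in>carrier (F 0) \<Longrightarrow> \<eta> (f x) = \<epsilon> x"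
      using free_lift[OF mF mG P min_resD(5)[OF F] min_resD(8)[OF F] min_resD(8)[OF G]] min_resD(9)[OF F] min_resD(9)[OF G] by auto
    have "f (d 1 x) \<in> e 1 ` carrier (G 1)" if "x \<in> carrier (F 1)" for x
      using min_res_d1[OF F that] f(2)[of "d 1 x"] min_resD(10)[OF G] lin_mapsD(1)[OF f(1), of "d 1 x"] by auto
    hence "A 0 f" using f by (auto simp: A_def)
    thus "\<exists>f. A 0 f" by blast
  next
    fix f k assume A: "A k f"
    have fd: "(\<lambda>x. f (d (int k + 1) x)) \<in> lin_maps R (F (int k + 1)) (G (int k))"
      by (rule lin_maps_comp[OF _ conjunct1[OF A[unfolded A_def]]]) (use lF[of "int k + 1"] in simp)
    have sub: "(\<lambda>x. f (d (int k + 1) x)) ` carrier (F (int k + 1)) \<subseteq> e (int k + 1) ` carrier (G (int k + 1))"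
      using A unfolding A_def by (auto simp del: image_eqI)
    have lGk: "e (int k + 1) \<in> lin_maps R (G (int k + 1)) (G (int k))" using lG[of "int k + 1"] by simp
    obtain f' where f': "f' \<in> lin_maps R (F (int k + 1)) (G (int k + 1))"
       "\<And>x. x\<in>carrier (F (int k + 1)) \<Longrightarrow> e (int k + 1) (f' x) = f (d (int k + 1) x)"
      using free_lift[OF mF mG mG min_resD(5)[OF F] fd lGk sub] by blast
    have "f' (d (int k + 2) x) \<in> e (int k + 2) ` carrier (G (int k + 2))" if x: "x \<in> carrier (F (int k + 2))" for x
    proof -
      have dx: "d (int k + 2) x \<in> carrier (F (int k + 1))" using lin_mapsD(1)[OF lF x] by (simp add: algebra_simps)
      have ddx: "d (int k + 1) (d (int k + 2) x) = \<zero>\<^sub>(F (int k))" using dd[OF x] by (simp add: algebra_simps)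
      interpret f: lin_map R "F (int k)" "G (int k)" f by (rule lin_mapI[OF mF mG conjunct1[OF A[unfolded A_def]]])
      have "e (int k + 1) (f' (d (int k + 2) x)) = \<zero>\<^sub>(G (int k))" using f'(2)[OF dx] ddx by simp
      thus ?thesis using min_resD(7)[OF G, of "int k + 1" "f' (d (int k + 2) x)"] lin_mapsD(1)[OF f'(1) dx]
        by (simp add: algebra_simps)
    qed
    hence "A (Suc k) f'" using f'(1) by (simp add: A_def algebra_simps)
    moreover have "B k f f'" using f'(2) by (auto simp: B_def)
    ultimately show "\<exists>f'. A (Suc k) f' \<and> B k f f'" by blast
  qed
  then obtain f where A: "\<And>k. A k (f k)" and B: "\<And>k. B k (f k) (f (Suc k))" by auto
  define g where "g n = (if n < 0 then (\<lambda>x. \<zero>\<^sub>(G n)) else f (nat n))" for n :: int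
  have g: "g n \<in> lin_maps R (F n) (G n)" for n
    using A[of "nat n"] lin_maps_zero[OF mF mG] by (auto simp: A_def g_def)
  moreover have "e n (g n x) = g (n - 1) (d n x)" if x: "x \<in> carrier (F n)" for n x
  proof (cases "n \<le> 0")
    case True
    have c: "carrier (G (n - 1)) = {\<zero>\<^sub>(G (n - 1))}" by (rule min_resD(6)[OF G]) (use True in simp)
    have "e n (g n x) \<in> carrier (G (n - 1))" "g (n - 1) (d n x) \<in> carrier (G (n - 1))"
      using lin_mapsD(1)[OF lG lin_mapsD(1)[OF g x]] lin_mapsD(1)[OF g lin_mapsD(1)[OF lF x]] by auto
    thus ?thesis unfolding c by simp
  next
    case False
    then obtain k where "n = int k + 1" by (metis add.commute int_one_le_iff_zero_less linorder_not_le nonneg_int_cases add_diff_cancel_left' zle_iff_zadd)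
    thus ?thesis using B[of k] x by (auto simp: B_def g_def nat_add_distrib)
  qed
  moreover have "\<eta> (g 0 x) = \<epsilon> x" if x: "x \<in> carrier (F 0)" for x
    using A[of 0] x by (auto simp: A_def g_def)
  ultimately show ?thesis by blast
qed

text \<open>Lifting zero, \<open>\<phi>\<close> is homotopic to zero, and the image of \<open>d h + h d\<close> lies in \<open>\<mm> F\<close> by minimality.\<close>

lemma homotopic_to_zero:
  assumes P: "module R P" and F: "min_res P F d \<epsilon>" and \<phi>: "\<And>n. \<phi> n \<in> lin_maps R (F n) (F n)"
   and ch: "\<And>n x. x\<in>carrier (F n) \<Longrightarrow> d n (\<phi> n x) = \<phi> (n - 1) (d n x)" and z: "\<And>x. x \<in> carrier (F 0) \<Longrightarrow> \<epsilon> (\<phi> 0 x) = \<zero>\<^sub>P"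
   and x: "x \<in> carrier (F n)"
  shows "\<phi> n x \<in> W (F n) 1"
proof -
  note mF = min_resD(1)[OF F] and lF = min_resD(2)[OF F]
  have dd: "d (n - 1) (d n x) = \<zero>\<^sub>(F (n - 2))" if "x \<in> carrier (F n)" for n x using min_resD(4)[OF F that] .
  define A where "A k h \<longleftrightarrow> h \<in> lin_maps R (F (int k)) (F (int k + 1)) \<and>
     (\<forall>x\<in>carrier (F (int k + 1)). d (int k + 1) (h (d (int k + 1) x)) = \<phi> (int k) (d (int k + 1) x)) \<and>
     (k = 0 \<longrightarrow> (\<forall>x\<in>carrier (F 0). d 1 (h x) = \<phi> 0 x))" for k h
  define B where "B k h h' \<longleftrightarrow> (\<forall>x\<in>carrier (F (int k + 1)). d (int k + 2) (h' x) = \<phi> (int k + 1) x \<ominus>\<^sub>(F (int k + 1)) h (d (int k + 1) x))" for k h h'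
  have "\<exists>f. \<forall>n. A n (f n) \<and> B n (f n) (f (Suc n))"
  proof (rule dependent_nat_choice)
    have l1: "d 1 \<in> lin_maps R (F 1) (F 0)" using lF[of 1] by simp
    have "\<phi> 0 ` carrier (F 0) \<subseteq> d 1 ` carrier (F 1)"
      using z min_resD(10)[OF F] lin_mapsD(1)[OF \<phi>[of 0]] by auto
    then obtain h where h: "h \<in> lin_maps R (F 0) (F 1)" "\<And>x. x\<in>carrier (F 0) \<Longrightarrow> d 1 (h x) = \<phi> 0 x"
      using free_lift[OF mF mF mF min_resD(5)[OF F] \<phi> l1] by auto
    hence "A 0 h" using min_res_d1[OF F] by (auto simp: A_def)
    thus "\<exists>f. A 0 f" by blast
  next
    fix h k assume A: "A k h"
    interpret d: lin_map R "F (int k + 1)" "F (int k)" "d (int k + 1)"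
      using lF[of "int k + 1"] mF by (intro lin_mapI) auto
    have hl: "h \<in> lin_maps R (F (int k)) (F (int k + 1))" and hd: "\<And>x. x\<in>carrier (F (int k + 1)) \<Longrightarrow>
       d (int k + 1) (h (d (int k + 1) x)) = \<phi> (int k) (d (int k + 1) x)"
      using A by (auto simp: A_def)
    interpret h: lin_map R "F (int k)" "F (int k + 1)" h by (intro lin_mapI mF hl)
    interpret p: lin_map R "F (int k + 1)" "F (int k + 1)" "\<phi> (int k + 1)" by (intro lin_mapI mF \<phi>)
    define \<alpha> where "\<alpha> x = \<phi> (int k + 1) x \<ominus>\<^sub>(F (int k + 1)) h (d (int k + 1) x)" for x
    have al: "\<alpha> \<in> lin_maps R (F (int k + 1)) (F (int k + 1))" unfolding \<alpha>_def
      by (intro lin_maps_diff mF \<phi> lin_maps_comp[OF d.lin hl])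
    have "\<alpha> x \<in> d (int k + 2) ` carrier (F (int k + 2))" if x: "x \<in> carrier (F (int k + 1))" for x
    proof -
      have "\<phi> (int k) (d (int k + 1) x) \<in> carrier (F (int k))" using x lin_mapsD(1)[OF \<phi>] by auto
      hence "d (int k + 1) (\<alpha> x) = \<zero>\<^sub>(F (int k))" unfolding \<alpha>_def using x hd[OF x] ch[OF x]
        by (simp add: a_minus_def d.N.M.r_neg)
      thus ?thesis using min_resD(7)[OF F, of "int k + 1" "\<alpha> x"] lin_mapsD(1)[OF al x] by (simp add: add.assoc)
    qed
    moreover have l2: "d (int k + 2) \<in> lin_maps R (F (int k + 2)) (F (int k + 1))" using lF[of "int k + 2"] by (simp add: algebra_simps)
    ultimately obtain h' where h': "h' \<in> lin_maps R (F (int k + 1)) (F (int k + 2))"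
       "\<And>x. x\<in>carrier (F (int k + 1)) \<Longrightarrow> d (int k + 2) (h' x) = \<alpha> x"
      using free_lift[OF mF mF mF min_resD(5)[OF F] al l2] by blast
    have "d (int k + 2) (h' (d (int k + 2) x)) = \<phi> (int k + 1) (d (int k + 2) x)" if x: "x \<in> carrier (F (int k + 2))" for x
    proof -
      have dx: "d (int k + 2) x \<in> carrier (F (int k + 1))" using lin_mapsD(1)[OF l2 x] .
      have "d (int k + 1) (d (int k + 2) x) = \<zero>\<^sub>(F (int k))" using dd[OF x] by (simp add: algebra_simps)
      thus ?thesis using dx by (simp add: h'(2) \<alpha>_def d.M.M.minus_zero)
    qed
    hence "A (Suc k) h'" using h'(1) by (simp add: A_def algebra_simps)
    moreover have "B k h h'" using h'(2) by (auto simp: B_def \<alpha>_def)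
    ultimately show "\<exists>f'. A (Suc k) f' \<and> B k h f'" by blast
  qed
  then obtain h where A: "\<And>k. A k (h k)" and B: "\<And>k. B k (h k) (h (Suc k))" by auto
  have hl: "h k \<in> lin_maps R (F (int k)) (F (int k + 1))" for k using A[of k] by (auto simp: A_def)
  have Wsub: "submodule (W (F n) 1) R (F n)" for n by (rule W_submodule[OF mF])
  consider "n < 0" | "n = 0" | k where "n = int k + 1"
    by (metis add.commute less_linear zle_iff_zadd add1_zle_eq add_0)
  thus ?thesis
  proof cases
    case 1 thus ?thesis using min_resD(6)[OF F, of n] lin_mapsD(1)[OF \<phi> x] module.submod_zero[OF mF Wsub] by auto
  next
    case 2
    have "h 0 x \<in> carrier (F 1)" using hl[of 0] x 2 lin_mapsD(1)[of "h 0" R "F 0" "F 1" x] by simp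
    thus ?thesis using A[of 0] min_resD(3)[OF F, of "h 0 x" 1] x 2 by (auto simp: A_def)
  next
    case (3 k)
    have x: "x \<in> carrier (F (int k + 1))" using x 3 by simp
    interpret d: lin_map R "F (int k + 1)" "F (int k)" "d (int k + 1)"
      using lF[of "int k + 1"] mF by (intro lin_mapI) auto
    have "d (int k + 1) x \<in> W (F (int k)) 1" using min_resD(3)[OF F x] by simp
    hence 1: "h k (d (int k + 1) x) \<in> W (F (int k + 1)) 1" by (rule W_lin0[OF mF mF hl])
    have "h (Suc k) x \<in> carrier (F (int k + 2))" using lin_mapsD(1)[OF hl[of "Suc k"], of x] x by (simp add: algebra_simps)
    hence 2: "d (int k + 2) (h (Suc k) x) \<in> W (F (int k + 1)) 1" using min_resD(3)[OF F, of "h (Suc k) x" "int k + 2"] by (simp add: algebra_simps)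
    hence "\<phi> (int k + 1) x \<ominus>\<^sub>(F (int k + 1)) h k (d (int k + 1) x) \<in> W (F (int k + 1)) 1" using B[of k] x by (auto simp: B_def)
    from d.M.submod_add[OF Wsub this 1] show ?thesis
      using W_carrier[OF mF 1] lin_mapsD(1)[OF \<phi> x] 3 by (simp add: d.M.M.move_minus) (metis d.M.M.add_minus2 d.M.M.minus_eq_iff d.M.M.add.m_closed)
  qed
qed

text \<open>The composite of comparison maps \<open>F \<rightarrow> G \<rightarrow> F\<close> differs from the identity by a map into \<open>\<mm> F\<close>, hence induces
  the identity on the linear part. So the linear part of F is a retract of that of G.\<close>

lemma lin_exact_transfer:
  assumes P: "module R P" and F: "min_res P F d \<epsilon>" and G: "min_res P G e \<eta>" and lin_exact: "lin_exact G e n"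
  shows "lin_exact F d n"
proof -
  note mF = min_resD(1)[OF F] and lF = min_resD(2)[OF F]
  note mG = min_resD(1)[OF G] and lG = min_resD(2)[OF G]
  obtain f where f: "\<And>n. f n \<in> lin_maps R (F n) (G n)" "\<And>n x. x\<in>carrier (F n) \<Longrightarrow> e n (f n x) = f (n - 1) (d n x)"
      "\<And>x. x\<in>carrier (F 0) \<Longrightarrow> \<eta> (f 0 x) = \<epsilon> x" using comparison[OF P F G] by blast
  obtain g where g: "\<And>n. g n \<in> lin_maps R (G n) (F n)" "\<And>n x. x\<in>carrier (G n) \<Longrightarrow> d n (g n x) = g (n - 1) (e n x)"
      "\<And>x. x\<in>carrier (G 0) \<Longrightarrow> \<epsilon> (g 0 x) = \<eta> x" using comparison[OF P G F] by blast
  define \<phi> where "\<phi> n x = g n (f n x) \<ominus>\<^sub>(F n) x" for n x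
  have gf: "(\<lambda>x. g n (f n x)) \<in> lin_maps R (F n) (F n)" for n by (rule lin_maps_comp[OF f(1) g(1)])
  have \<phi>: "\<phi> n \<in> lin_maps R (F n) (F n)" for n unfolding \<phi>_def
    by (intro lin_maps_diff mF gf module.lin_maps_id)
  have \<phi>W: "\<phi> n x \<in> W (F n) 1" if "x \<in> carrier (F n)" for n x
  proof (rule homotopic_to_zero[OF P F \<phi> _ _ that])
    fix n x assume x: "x \<in> carrier (F n)"
    interpret d: lin_map R "F n" "F (n - 1)" "d n" by (intro lin_mapI mF lF)
    have 1: "f n x \<in> carrier (G n)" "g n (f n x) \<in> carrier (F n)" using lin_mapsD(1)[OF f(1) x] lin_mapsD(1)[OF g(1)] by auto
    show "d n (\<phi> n x) = \<phi> (n - 1) (d n x)" unfolding \<phi>_def using x 1 by (simp add: f(2) g(2))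
  next
    fix x assume x: "x \<in> carrier (F 0)"
    interpret e: lin_map R "F 0" P \<epsilon> by (intro lin_mapI mF P min_resD(8)[OF F])
    have 1: "f 0 x \<in> carrier (G 0)" "g 0 (f 0 x) \<in> carrier (F 0)" using lin_mapsD(1)[OF f(1) x] lin_mapsD(1)[OF g(1)] by auto
    show "\<epsilon> (\<phi> 0 x) = \<zero>\<^sub>P" unfolding \<phi>_def using x 1 e.closed[OF x] by (simp add: f(3) g(3)) (simp add: a_minus_def e.N.M.r_neg)
  qed
  show ?thesis unfolding lin_exact_def
  proof (intro allI ballI impI)
    fix p z assume z: "z \<in> W (F n) p" and dz: "d n z \<in> W (F (n - 1)) (p + 2)"
    interpret g: lin_map R "G n" "F n" "g n" by (intro lin_mapI mF mG g)
    have zc: "z \<in> carrier (F n)" using W_carrier[OF mF z] .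
    have fz: "f n z \<in> W (G n) p" using W_lin0[OF mF mG f(1) z] .
    have "e n (f n z) \<in> W (G (n - 1)) (p + 2)" unfolding f(2)[OF zc] by (rule W_lin0[OF mF mG f(1) dz])
    then obtain w where w: "w \<in> W (G (n + 1)) (p - 1)" "f n z \<ominus>\<^sub>(G n) e (n + 1) w \<in> W (G n) (p + 1)"
      using lin_exact fz unfolding lin_exact_def by blast
    have wc: "w \<in> carrier (G (n + 1))" using W_carrier[OF mG w(1)] .
    have ew: "e (n + 1) w \<in> carrier (G n)" using lin_mapsD(1)[OF lG wc] by simp
    have fzc: "f n z \<in> carrier (G n)" using W_carrier[OF mG fz] .
    let ?w = "g (n + 1) w"
    have 1: "?w \<in> W (F (n + 1)) (p - 1)" by (rule W_lin0[OF mG mF g(1) w(1)])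
    have dw: "d (n + 1) ?w = g n (e (n + 1) w)" using g(2)[OF wc] by simp
    have "g n (f n z \<ominus>\<^sub>(G n) e (n + 1) w) \<in> W (F n) (p + 1)" by (rule W_lin0[OF mG mF g(1) w(2)])
    hence 2: "g n (f n z) \<ominus>\<^sub>(F n) d (n + 1) ?w \<in> W (F n) (p + 1)" using ew fzc by (simp add: dw)
    have 3: "\<phi> n z \<in> W (F n) (p + 1)" by (rule W_lin[OF mF mF \<phi> _ z]) (use \<phi>W in auto)
    have "z \<ominus>\<^sub>(F n) d (n + 1) ?w = (g n (f n z) \<ominus>\<^sub>(F n) d (n + 1) ?w) \<ominus>\<^sub>(F n) \<phi> n z"
      unfolding \<phi>_def dw using zc fzc ew by (simp add: g.N.M.move_minus)
    hence "z \<ominus>\<^sub>(F n) d (n + 1) ?w \<in> W (F n) (p + 1)" using g.N.submod_diff[OF W_submodule[OF mF] 2 3] by simp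
    thus "\<exists>w\<in>W (F (n + 1)) (p - 1). z \<ominus>\<^sub>(F n) d (n + 1) w \<in> W (F n) (p + 1)" using 1 by blast
  qed
qed

end

section \<open>The homology of the linear part\<close>

lemma direct_sum_simps [simp]:
  "f \<in> carrier (direct_sum N) \<longleftrightarrow> (\<forall>i. f i \<in> carrier (N i)) \<and> finite {i. f i \<noteq> \<zero>\<^sub>(N i)}"
  "zero (direct_sum N) = (\<lambda>i. \<zero>\<^sub>(N i))" "add (direct_sum N) = (\<lambda>f g i. f i \<oplus>\<^sub>(N i) g i)"
  "smult (direct_sum N) = (\<lambda>a f i. a \<odot>\<^sub>(N i) f i)"
  by (simp_all add: direct_sum_def)

lemma direct_sum_module:
  assumes "cring R" "\<And>i. module R (N i)" shows "module R (direct_sum N)"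
proof -
  interpret N: module R "N i" for i by (rule assms)
  show ?thesis
  proof (rule moduleI)
    show "abelian_group (direct_sum N)"
    proof (rule abelian_groupI)
      fix f g assume fg: "f \<in> carrier (direct_sum N)" "g \<in> carrier (direct_sum N)"
      have "{i. f i \<oplus>\<^sub>(N i) g i \<noteq> \<zero>\<^sub>(N i)} \<subseteq> {i. f i \<noteq> \<zero>\<^sub>(N i)} \<union> {i. g i \<noteq> \<zero>\<^sub>(N i)}" by auto
      thus "f \<oplus>\<^sub>(direct_sum N) g \<in> carrier (direct_sum N)" using fg finite_subset by fastforce
      show "f \<oplus>\<^sub>(direct_sum N) g = g \<oplus>\<^sub>(direct_sum N) f" using fg by (auto simp: N.M.a_ac)
      have "{i. \<ominus>\<^sub>(N i) f i \<noteq> \<zero>\<^sub>(N i)} \<subseteq> {i. f i \<noteq> \<zero>\<^sub>(N i)}" by auto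
      hence "(\<lambda>i. \<ominus>\<^sub>(N i) f i) \<in> carrier (direct_sum N)" using fg finite_subset by fastforce
      thus "\<exists>y\<in>carrier (direct_sum N). y \<oplus>\<^sub>(direct_sum N) f = \<zero>\<^sub>(direct_sum N)"
        by (rule bexI[rotated]) (use fg in \<open>auto simp: N.M.l_neg\<close>)
    qed (auto simp: N.M.a_ac)
    fix a f assume a: "a \<in> carrier R" "f \<in> carrier (direct_sum N)"
    have "{i. a \<odot>\<^sub>(N i) f i \<noteq> \<zero>\<^sub>(N i)} \<subseteq> {i. f i \<noteq> \<zero>\<^sub>(N i)}" using a by auto
    thus "a \<odot>\<^sub>(direct_sum N) f \<in> carrier (direct_sum N)" using a finite_subset by fastforce
  qed (auto simp: N.smult_l_distr N.smult_r_distr N.smult_assoc1 intro: assms(1))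
qed

context noeth_local begin

definition lin_quot where "lin_quot F n i = quot_module ((F n)\<lparr>carrier := lin_filt R \<mm> F i n\<rparr>) (lin_filt R \<mm> F (i + 1) n)" for n i :: int

lemma lin_module_eq: "lin_module R \<mm> F n = direct_sum (lin_quot F n)"
  unfolding lin_module_def lin_quot_def[abs_def] ..

lemma minimal_complexD: assumes "minimal_complex R \<mm> F d"
  shows "module R (F n)" "d n \<in> lin_maps R (F n) (F (n - 1))" "x \<in> carrier (F n) \<Longrightarrow> d n x \<in> W (F (n - 1)) 1"
  "x \<in> carrier (F n) \<Longrightarrow> d (n - 1) (d n x) = \<zero>\<^sub>(F (n - 2))"
  using assms by (auto simp: minimal_complex_def chain_complex_def W_def image_subset_iff)

context
  fixes F :: "int \<Rightarrow> ('a, 'c) module" and d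
  assumes mc: "minimal_complex R \<mm> F d"
begin

abbreviation lstep where "lstep i n \<equiv> lin_filt R \<mm> F i n"

lemma mF: "module R (F n)" using minimal_complexD(1)[OF mc] .
lemma lF: "d n \<in> lin_maps R (F n) (F (n - 1))" using minimal_complexD(2)[OF mc] .

lemma lstep_sub: "submodule (lstep i n) R (F n)" unfolding lin_filt_def by (rule W_submodule[OF mF])
lemma lstep_carrier: "z \<in> lstep i n \<Longrightarrow> z \<in> carrier (F n)" unfolding lin_filt_def by (rule W_carrier[OF mF])
lemma lstep_Suc: "z \<in> lstep (i + 1) n \<Longrightarrow> z \<in> lstep i n" unfolding lin_filt_def
  using W_antimono[OF mF[of n], of "nat (i - n)" "nat (i + 1 - n)"] nat_mono[of "i - n" "i + 1 - n"] by auto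
lemma lstep_module: "module R ((F n)\<lparr>carrier := lstep i n\<rparr>)" by (rule module.submodule_module[OF mF lstep_sub])
lemma lstep_sub': "submodule (lstep (i + 1) n) R ((F n)\<lparr>carrier := lstep i n\<rparr>)"
  unfolding module.submodule_update_iff[OF mF lstep_sub] using lstep_sub lstep_Suc by blast
lemma lin_quot_module: "module R (lin_quot F n i)" unfolding lin_quot_def by (rule module.quot_module_module[OF lstep_module lstep_sub'])

abbreviation lin_cls where "lin_cls n i z \<equiv> lstep (i + 1) n +>\<^bsub>F n\<^esub> z"

lemma lin_quot_carrier: "X \<in> carrier (lin_quot F n i) \<longleftrightarrow> (\<exists>z\<in>lstep i n. X = lin_cls n i z)"
  unfolding lin_quot_def using module.quot_carrier[OF lstep_module] by simp

lemma lin_quot_simps: "z \<in> lstep i n \<Longrightarrow> w \<in> lstep i n \<Longrightarrow> lin_cls n i z \<oplus>\<^sub>(lin_quot F n i) lin_cls n i w = lin_cls n i (z \<oplus>\<^sub>(F n) w)"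
  "z \<in> lstep i n \<Longrightarrow> a \<in> carrier R \<Longrightarrow> a \<odot>\<^sub>(lin_quot F n i) lin_cls n i z = lin_cls n i (a \<odot>\<^sub>(F n) z)"
  "\<zero>\<^sub>(lin_quot F n i) = lstep (i + 1) n"
  unfolding lin_quot_def using module.quot_simps(1,2)[OF lstep_module lstep_sub'] module.quot_simps(3)[OF lstep_module] by simp_all

lemma lin_cls_eq: "z \<in> carrier (F n) \<Longrightarrow> w \<in> carrier (F n) \<Longrightarrow> lin_cls n i z = lin_cls n i w \<longleftrightarrow> z \<ominus>\<^sub>(F n) w \<in> lstep (i + 1) n"
  by (rule module.coset_eq[OF mF lstep_sub])

lemma lin_cls_zero: "z \<in> carrier (F n) \<Longrightarrow> lin_cls n i z = lstep (i + 1) n \<longleftrightarrow> z \<in> lstep (i + 1) n"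
  by (rule module.coset_eq_H[OF mF lstep_sub])

lemma d_lstep: assumes "z \<in> lstep i n" shows "d n z \<in> lstep i (n - 1)"
proof -
  have "d n z \<in> W (F (n - 1)) (nat (i - n) + 1)"
    by (rule W_lin[OF mF mF lF]) (use minimal_complexD(3)[OF mc] assms in \<open>auto simp: lin_filt_def\<close>)
  moreover have "nat (i - (n - 1)) \<le> nat (i - n) + 1" by auto
  ultimately show ?thesis unfolding lin_filt_def using W_antimono[OF mF] by blast
qed

lemma lin_diff_lin_cls: assumes f: "f i = lin_cls n i z" "z \<in> lstep i n"
  shows "lin_diff R \<mm> F d n f i = lin_cls (n - 1) i (d n z)"
proof -
  interpret d: lin_map R "F n" "F (n - 1)" "d n" by (intro lin_mapI mF lF)
  have zc: "z \<in> carrier (F n)" using lstep_carrier f by auto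
  have "lin_cls (n - 1) i (d n z') = lin_cls (n - 1) i (d n z)" if "z' \<in> f i" for z'
  proof -
    have z': "z' \<in> carrier (F n)" "z' \<ominus>\<^sub>(F n) z \<in> lstep (i + 1) n" using that f d.M.coset_mem[OF lstep_sub zc] by auto
    have "d n z' \<ominus>\<^sub>(F (n - 1)) d n z = d n (z' \<ominus>\<^sub>(F n) z)" using z' zc by simp
    thus ?thesis using d_lstep[OF z'(2)] z' zc by (simp add: lin_cls_eq)
  qed
  moreover have "z \<in> f i" using f d.M.coset_self[OF lstep_sub zc] by simp
  ultimately show ?thesis unfolding lin_diff_def by blast
qed

lemma lin_module_module: "module R (lin_module R \<mm> F n)"
  unfolding lin_module_eq by (rule direct_sum_module[OF is_cring lin_quot_module])

lemma lin_reps: assumes "f \<in> carrier (lin_module R \<mm> F n)"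
  obtains z where "\<And>i. z i \<in> lstep i n" "\<And>i. f i = lin_cls n i (z i)" "finite {i. f i \<noteq> lstep (i + 1) n}"
proof -
  have "\<forall>i. \<exists>z. z \<in> lstep i n \<and> f i = lin_cls n i z" using assms by (auto simp: lin_module_eq lin_quot_carrier)
  then obtain z where "\<And>i. z i \<in> lstep i n" "\<And>i. f i = lin_cls n i (z i)" by metis
  thus thesis using assms by (intro that[of z]) (auto simp: lin_module_eq lin_quot_simps)
qed

lemma lin_memI: assumes "\<And>i. z i \<in> lstep i n" "finite {i. z i \<notin> lstep (i + 1) n}"
  shows "(\<lambda>i. lin_cls n i (z i)) \<in> carrier (lin_module R \<mm> F n)"
proof -
  have "{i. lin_cls n i (z i) \<noteq> lstep (i + 1) n} \<subseteq> {i. z i \<notin> lstep (i + 1) n}" using lin_cls_zero lstep_carrier[OF assms(1)] by blast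
  thus ?thesis using assms by (auto simp: lin_module_eq lin_quot_simps lin_quot_carrier intro: finite_subset)
qed

lemma lin_diff_reps: assumes "\<And>i. z i \<in> lstep i n" "\<And>i. f i = lin_cls n i (z i)"
  shows "lin_diff R \<mm> F d n f = (\<lambda>i. lin_cls (n - 1) i (d n (z i)))"
  by (rule ext, rule lin_diff_lin_cls[OF assms(2,1)])

lemma lin_diff_lin: "lin_diff R \<mm> F d n \<in> lin_maps R (lin_module R \<mm> F n) (lin_module R \<mm> F (n - 1))"
proof -
  interpret d: lin_map R "F n" "F (n - 1)" "d n" by (intro lin_mapI mF lF)
  show ?thesis unfolding lin_maps_def
  proof (intro CollectI conjI ballI)
    show "lin_diff R \<mm> F d n \<in> carrier (lin_module R \<mm> F n) \<rightarrow> carrier (lin_module R \<mm> F (n - 1))"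
    proof
      fix f assume f: "f \<in> carrier (lin_module R \<mm> F n)"
      obtain z where z: "\<And>i. z i \<in> lstep i n" "\<And>i. f i = lin_cls n i (z i)" "finite {i. f i \<noteq> lstep (i + 1) n}" by (rule lin_reps[OF f]) (rule that)
      have "{i. d n (z i) \<notin> lstep (i + 1) (n - 1)} \<subseteq> {i. f i \<noteq> lstep (i + 1) n}"
        by (auto simp: z(2) lin_cls_zero lstep_carrier[OF z(1)] intro: d_lstep)
      thus "lin_diff R \<mm> F d n f \<in> carrier (lin_module R \<mm> F (n - 1))"
        unfolding lin_diff_reps[OF z(1,2)] using z d_lstep by (intro lin_memI) (auto intro: finite_subset)
    qed
    fix f assume f: "f \<in> carrier (lin_module R \<mm> F n)"
    obtain z where z: "\<And>i. z i \<in> lstep i n" "\<And>i. f i = lin_cls n i (z i)" "finite {i. f i \<noteq> lstep (i + 1) n}" by (rule lin_reps[OF f]) (rule that)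
    { fix g assume g: "g \<in> carrier (lin_module R \<mm> F n)"
      obtain w where w: "\<And>i. w i \<in> lstep i n" "\<And>i. g i = lin_cls n i (w i)" "finite {i. g i \<noteq> lstep (i + 1) n}" by (rule lin_reps[OF g]) (rule that)
      have "lin_diff R \<mm> F d n (f \<oplus>\<^bsub>lin_module R \<mm> F n\<^esub> g) = (\<lambda>i. lin_cls (n - 1) i (d n (z i \<oplus>\<^sub>(F n) w i)))"
        by (rule lin_diff_reps) (use z w d.M.submod_add[OF lstep_sub] in \<open>auto simp: lin_module_eq lin_quot_simps\<close>)
      thus "lin_diff R \<mm> F d n (f \<oplus>\<^bsub>lin_module R \<mm> F n\<^esub> g) = lin_diff R \<mm> F d n f \<oplus>\<^bsub>lin_module R \<mm> F (n - 1)\<^esub> lin_diff R \<mm> F d n g"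
        unfolding lin_diff_reps[OF z(1,2)] lin_diff_reps[OF w(1,2)] using z(1) w(1) lstep_carrier[OF z(1)] lstep_carrier[OF w(1)] d_lstep by (auto simp: lin_module_eq lin_quot_simps) }
    fix a assume a: "a \<in> carrier R"
    have "lin_diff R \<mm> F d n (a \<odot>\<^bsub>lin_module R \<mm> F n\<^esub> f) = (\<lambda>i. lin_cls (n - 1) i (d n (a \<odot>\<^sub>(F n) z i)))"
      by (rule lin_diff_reps) (use z a d.M.submod_smult[OF lstep_sub] in \<open>auto simp: lin_module_eq lin_quot_simps\<close>)
    thus "lin_diff R \<mm> F d n (a \<odot>\<^bsub>lin_module R \<mm> F n\<^esub> f) = a \<odot>\<^bsub>lin_module R \<mm> F (n - 1)\<^esub> lin_diff R \<mm> F d n f"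
      unfolding lin_diff_reps[OF z(1,2)] using z(1) a lstep_carrier[OF z(1)] d_lstep by (auto simp: lin_module_eq lin_quot_simps)
  qed
qed

text \<open>An element of the linear part is a finite family of classes, and its differential acts on each index
  separately. So exactness can be tested on a single class.\<close>

lemma lin_homology_iff:
  "(carrier (homology (lin_module R \<mm> F) (lin_diff R \<mm> F d) n) = {\<zero>\<^bsub>homology (lin_module R \<mm> F) (lin_diff R \<mm> F d) n\<^esub>})
    \<longleftrightarrow> lin_exact F d n"
proof -
  interpret d: lin_map R "F n" "F (n - 1)" "d n" by (intro lin_mapI mF lF)
  have lF1: "d (n + 1) \<in> lin_maps R (F (n + 1)) (F n)" using lF[of "n + 1"] by simp
  interpret d1: lin_map R "F (n + 1)" "F n" "d (n + 1)" by (intro lin_mapI mF lF1)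
  have l1: "lin_diff R \<mm> F d (n + 1) \<in> lin_maps R (lin_module R \<mm> F (n + 1)) (lin_module R \<mm> F n)"
    using lin_diff_lin[of "n + 1"] by simp
  interpret D: lin_map R "lin_module R \<mm> F n" "lin_module R \<mm> F (n - 1)" "lin_diff R \<mm> F d n"
    by (intro lin_mapI lin_module_module lin_diff_lin)
  interpret D1: lin_map R "lin_module R \<mm> F (n + 1)" "lin_module R \<mm> F n" "lin_diff R \<mm> F d (n + 1)"
    by (intro lin_mapI lin_module_module l1)
  have d_lf1: "d (n + 1) w \<in> lstep i n" if "w \<in> lstep i (n + 1)" for w i using d_lstep[OF that] by simp
  have reps1: "lin_diff R \<mm> F d (n + 1) f = (\<lambda>i. lin_cls n i (d (n + 1) (z i)))"
    if "\<And>i. z i \<in> lstep i (n + 1)" "\<And>i. f i = lin_cls (n + 1) i (z i)" for f z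
    using lin_diff_reps[of z "n + 1" f, OF that] by simp
  have zero: "\<zero>\<^bsub>lin_module R \<mm> F k\<^esub> = (\<lambda>i. lstep (i + 1) k)" for k by (simp add: lin_module_eq lin_quot_simps)
  have "(carrier (homology (lin_module R \<mm> F) (lin_diff R \<mm> F d) n) = {\<zero>\<^bsub>homology (lin_module R \<mm> F) (lin_diff R \<mm> F d) n\<^esub>})
    \<longleftrightarrow> (\<forall>f\<in>carrier (lin_module R \<mm> F n). lin_diff R \<mm> F d n f = \<zero>\<^bsub>lin_module R \<mm> F (n - 1)\<^esub> \<longrightarrow>
        f \<in> lin_diff R \<mm> F d (n + 1) ` carrier (lin_module R \<mm> F (n + 1)))" (is "_ \<longleftrightarrow> ?A")
    by (rule homology_trivial_iff[OF lin_module_module])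
       (simp_all add: D1.image_submodule[OF D1.M.carrier_is_submodule])
  also have "\<dots> \<longleftrightarrow> lin_exact F d n"
  proof
    assume A: ?A
    show "lin_exact F d n" unfolding lin_exact_def
    proof (intro allI ballI impI)
      fix p z assume z: "z \<in> W (F n) p" and dz: "d n z \<in> W (F (n - 1)) (p + 2)"
      define i where "i = n + int p"
      have zi: "z \<in> lstep i n" using z by (simp add: lin_filt_def i_def)
      have dzi: "d n z \<in> lstep (i + 1) (n - 1)" using dz by (simp add: lin_filt_def i_def nat_add_distrib numeral_2_eq_2)
      define y where "y j = (if j = i then z else \<zero>\<^sub>(F n))" for j
      have y: "y j \<in> lstep j n" for j using zi d.M.submod_zero[OF lstep_sub] by (simp add: y_def)
      have "{j. y j \<notin> lstep (j + 1) n} \<subseteq> {i}" using d.M.submod_zero[OF lstep_sub] by (auto simp: y_def)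
      hence f: "(\<lambda>j. lin_cls n j (y j)) \<in> carrier (lin_module R \<mm> F n)" by (intro lin_memI y) (auto intro: finite_subset)
      have "lin_diff R \<mm> F d n (\<lambda>j. lin_cls n j (y j)) = (\<lambda>j. lin_cls (n - 1) j (d n (y j)))"
        by (rule lin_diff_reps[OF y]) simp
      moreover have "lin_cls (n - 1) j (d n (y j)) = lstep (j + 1) (n - 1)" for j
        using dzi d.N.submod_zero[OF lstep_sub] lstep_carrier[OF y] lstep_carrier[OF zi] by (subst lin_cls_zero) (auto simp: y_def)
      ultimately have "(\<lambda>j. lin_cls n j (y j)) \<in> lin_diff R \<mm> F d (n + 1) ` carrier (lin_module R \<mm> F (n + 1))"
        using A f zero by auto
      then obtain g where g: "g \<in> carrier (lin_module R \<mm> F (n + 1))" "(\<lambda>j. lin_cls n j (y j)) = lin_diff R \<mm> F d (n + 1) g" by blast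
      obtain w where w: "\<And>i. w i \<in> lstep i (n + 1)" "\<And>i. g i = lin_cls (n + 1) i (w i)" "finite {i. g i \<noteq> lstep (i + 1) (n + 1)}" by (rule lin_reps[OF g(1)]) (rule that)
      have "(\<lambda>j. lin_cls n j (y j)) = (\<lambda>j. lin_cls n j (d (n + 1) (w j)))" using g(2) reps1[of w g] w by simp
      hence "lin_cls n i z = lin_cls n i (d (n + 1) (w i))" by (auto simp: y_def dest: fun_cong[of _ _ i])
      hence "z \<ominus>\<^sub>(F n) d (n + 1) (w i) \<in> lstep (i + 1) n" using lstep_carrier[OF zi] lstep_carrier[OF w(1)] by (simp add: lin_cls_eq)
      moreover have "lstep (i + 1) n = W (F n) (p + 1)" "lstep i (n + 1) = W (F (n + 1)) (p - 1)"
        by (simp_all add: lin_filt_def i_def nat_add_distrib nat_diff_distrib nat_minus_as_int)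
      ultimately show "\<exists>w\<in>W (F (n + 1)) (p - 1). z \<ominus>\<^sub>(F n) d (n + 1) w \<in> W (F n) (p + 1)"
        using w(1)[of i] by auto
    qed
  next
    assume L: "lin_exact F d n"
    show ?A
    proof (intro ballI impI)
      fix f assume f: "f \<in> carrier (lin_module R \<mm> F n)" and Df: "lin_diff R \<mm> F d n f = \<zero>\<^bsub>lin_module R \<mm> F (n - 1)\<^esub>"
      obtain z where z: "\<And>i. z i \<in> lstep i n" "\<And>i. f i = lin_cls n i (z i)" "finite {i. f i \<noteq> lstep (i + 1) n}" by (rule lin_reps[OF f]) (rule that)
      have "\<exists>w. w \<in> lstep i (n + 1) \<and> z i \<ominus>\<^sub>(F n) d (n + 1) w \<in> lstep (i + 1) n \<and> (f i = lstep (i + 1) n \<longrightarrow> w = \<zero>\<^sub>(F (n + 1)))" for i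
      proof (cases "f i = lstep (i + 1) n")
        case True
        hence "z i \<in> lstep (i + 1) n" using lin_cls_zero lstep_carrier[OF z(1)] z(2) by metis
        thus ?thesis using d1.M.submod_zero[OF lstep_sub] lstep_carrier[OF z(1)[of i]]
          by (intro exI[of _ "\<zero>\<^sub>(F (n + 1))"]) (auto simp: d.M.M.minus_zero)
      next
        case False
        hence ni: "i \<ge> n" using lin_cls_zero[OF lstep_carrier[OF z(1)]] z W_0[OF mF[of n]] lstep_carrier[OF z(1)[of i]]
          by (force simp: lin_filt_def)
        define p where "p = nat (i - n)"
        have eqs: "lstep i n = W (F n) p" "lstep (i + 1) (n - 1) = W (F (n - 1)) (p + 2)"
           "lstep (i + 1) n = W (F n) (p + 1)" "lstep i (n + 1) = W (F (n + 1)) (p - 1)"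
          unfolding lin_filt_def p_def using ni by (auto intro!: arg_cong[of _ _ "W _"])
        have "lin_cls (n - 1) i (d n (z i)) = lstep (i + 1) (n - 1)" using Df zero lin_diff_reps[OF z(1,2)] by (metis (no_types, lifting))
        hence "d n (z i) \<in> lstep (i + 1) (n - 1)" using lin_cls_zero lstep_carrier[OF d_lstep[OF z(1)]] by blast
        thus ?thesis using L z(1)[of i] False unfolding lin_exact_def eqs by blast
      qed
      then obtain w where w: "\<And>i. w i \<in> lstep i (n + 1)" "\<And>i. z i \<ominus>\<^sub>(F n) d (n + 1) (w i) \<in> lstep (i + 1) n"
         "\<And>i. f i = lstep (i + 1) n \<Longrightarrow> w i = \<zero>\<^sub>(F (n + 1))" by metis
      have "{i. w i \<notin> lstep (i + 1) (n + 1)} \<subseteq> {i. f i \<noteq> lstep (i + 1) n}" using w(3) d1.M.submod_zero[OF lstep_sub] by auto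
      hence g: "(\<lambda>i. lin_cls (n + 1) i (w i)) \<in> carrier (lin_module R \<mm> F (n + 1))"
        using z(3) by (intro lin_memI w(1)) (auto intro: finite_subset)
      have "f = (\<lambda>i. lin_cls n i (d (n + 1) (w i)))"
        by (rule ext) (simp add: z(2) lin_cls_eq[OF lstep_carrier[OF z(1)] lstep_carrier[OF d_lf1[OF w(1)]]] w(2))
      also have "\<dots> = lin_diff R \<mm> F d (n + 1) (\<lambda>i. lin_cls (n + 1) i (w i))" by (rule reps1[symmetric, OF w(1)]) simp
      finally show "f \<in> lin_diff R \<mm> F d (n + 1) ` carrier (lin_module R \<mm> F (n + 1))" using g by blast
    qed
  qed
  finally show ?thesis .
qed

lemma lin_defect_complex_eq: "lin_defect_complex R \<mm> F d = Sup {ereal (real_of_int i) | i. \<not> lin_exact F d i}"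
  unfolding lin_defect_complex_def Let_def lin_homology_iff ..

end

text \<open>The choice of the resolution in the definition is immaterial.\<close>

lemma lin_defect_eq:
  fixes F :: "int \<Rightarrow> ('a, nat \<Rightarrow> 'a) module"
  assumes P: "module R P" and F: "minimal_free_resolution R \<mm> P F d"
  shows "lin_defect R \<mm> P = Sup {ereal (real_of_int i) | i. \<not> lin_exact F d i}"
proof -
  define Gd where "Gd = (SOME (F :: int \<Rightarrow> ('a, nat \<Rightarrow> 'a) module, d). minimal_free_resolution R \<mm> P F d)"
  obtain G e where Ge: "Gd = (G, e)" by force
  have "(\<lambda>(F, d). minimal_free_resolution R \<mm> P F d) Gd" unfolding Gd_def
    by (rule someI[of _ "(F, d)"]) (use F in simp)
  hence G: "minimal_free_resolution R \<mm> P G e" by (simp add: Ge)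
  hence mc: "minimal_complex R \<mm> G e" by (simp add: minimal_free_resolution_def)
  have "lin_defect R \<mm> P = lin_defect_complex R \<mm> G e"
    unfolding lin_defect_def Gd_def[symmetric] Ge by simp
  also have "\<dots> = Sup {ereal (real_of_int i) | i. \<not> lin_exact G e i}" by (rule lin_defect_complex_eq[OF mc])
  also have "lin_exact G e = lin_exact F d"
    using F G lin_exact_transfer[OF P] unfolding min_res_iff by blast
  finally show ?thesis .
qed

end

section \<open>Iterated mapping cones of filtered complexes\<close>

text \<open>A pair of vectors is coded as one vector by interleaving, so that a cone has terms of the same type as
  the complex it is built from.\<close>

definition Node :: "(nat \<Rightarrow> 'b) \<Rightarrow> (nat \<Rightarrow> 'b) \<Rightarrow> nat \<Rightarrow> 'b" where
  "Node u v = (\<lambda>k. if even k then u (k div 2) else v (k div 2))"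
definition lft :: "(nat \<Rightarrow> 'b) \<Rightarrow> nat \<Rightarrow> 'b" where "lft f = (\<lambda>k. f (2 * k))"
definition rgt :: "(nat \<Rightarrow> 'b) \<Rightarrow> nat \<Rightarrow> 'b" where "rgt f = (\<lambda>k. f (2 * k + 1))"

lemma lft_Node [simp]: "lft (Node u v) = u" by (simp add: lft_def Node_def)
lemma rgt_Node [simp]: "rgt (Node u v) = v" by (simp add: rgt_def Node_def)
lemma Node_lft_rgt [simp]: "Node (lft f) (rgt f) = f"
  by (auto simp: lft_def rgt_def Node_def fun_eq_iff)
lemma Node_eq_iff [simp]: "Node u v = Node u' v' \<longleftrightarrow> u = u' \<and> v = v'" by (metis lft_Node rgt_Node)

lemma node_ext: "lft f = lft g \<Longrightarrow> rgt f = rgt g \<Longrightarrow> f = g" by (metis Node_lft_rgt)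

text \<open>The second half of a cone is shifted by one in the degree and also in the index of the filtration. With
  this shift the linear part of the cone is again a cone.\<close>

definition cone_filt :: "(int \<Rightarrow> int \<Rightarrow> (nat \<Rightarrow> 'b) set) \<Rightarrow> int \<Rightarrow> int \<Rightarrow> (nat \<Rightarrow> 'b) set" where
  "cone_filt \<Phi> n i = {f. lft f \<in> \<Phi> n i \<and> rgt f \<in> \<Phi> (n - 1) (i - 1)}"

lemma cone_filt_iff: "f \<in> cone_filt \<Phi> n i \<longleftrightarrow> lft f \<in> \<Phi> n i \<and> rgt f \<in> \<Phi> (n - 1) (i - 1)"
  by (simp add: cone_filt_def)

abbreviation cone_filts where "cone_filts k \<equiv> cone_filt ^^ k"

declare fun_mod_simps [simp del]

locale fmodule = module R M + UM: module R "fun_mod M" for R (structure) and M (structure)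

lemma (in module) fmodule: "fmodule R M"
  by (intro fmodule.intro module_axioms fun_mod_module)

context fmodule begin

abbreviation "UM \<equiv> fun_mod M"

lemma smult_swap: "a \<in> carrier R \<Longrightarrow> b \<in> carrier R \<Longrightarrow> f \<in> carrier UM \<Longrightarrow> a \<odot>\<^sub>UM (b \<odot>\<^sub>UM f) = b \<odot>\<^sub>UM (a \<odot>\<^sub>UM f)"
  by (metis UM.smult_assoc1 R.m_comm)

lemma neg_zero_UM [simp]: "\<ominus>\<^sub>UM \<zero>\<^sub>UM = \<zero>\<^sub>UM"
  by (rule UM.M.minus_equality) auto

lemma lft_closed [simp]: "f \<in> carrier UM \<Longrightarrow> lft f \<in> carrier UM" by (simp add: fun_mod_simps lft_def)
lemma rgt_closed [simp]: "f \<in> carrier UM \<Longrightarrow> rgt f \<in> carrier UM" by (simp add: fun_mod_simps rgt_def)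
lemma Node_closed [simp]: "Node u v \<in> carrier UM \<longleftrightarrow> u \<in> carrier UM \<and> v \<in> carrier UM"
  by (metis (no_types, lifting) lft_closed rgt_closed lft_Node rgt_Node Node_def fun_mod_simps(1))
lemma lft_add [simp]: "lft (f \<oplus>\<^sub>UM g) = lft f \<oplus>\<^sub>UM lft g" by (simp add: fun_mod_simps lft_def)
lemma rgt_add [simp]: "rgt (f \<oplus>\<^sub>UM g) = rgt f \<oplus>\<^sub>UM rgt g" by (simp add: fun_mod_simps rgt_def)
lemma lft_zero [simp]: "lft \<zero>\<^sub>UM = \<zero>\<^sub>UM" by (simp add: fun_mod_simps lft_def)
lemma rgt_zero [simp]: "rgt \<zero>\<^sub>UM = \<zero>\<^sub>UM" by (simp add: fun_mod_simps rgt_def)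
lemma lft_smult [simp]: "lft (a \<odot>\<^sub>UM f) = a \<odot>\<^sub>UM lft f" by (simp add: fun_mod_simps lft_def)
lemma rgt_smult [simp]: "rgt (a \<odot>\<^sub>UM f) = a \<odot>\<^sub>UM rgt f" by (simp add: fun_mod_simps rgt_def)
lemma lft_neg [simp]: "f \<in> carrier UM \<Longrightarrow> lft (\<ominus>\<^sub>UM f) = \<ominus>\<^sub>UM lft f"
  by (simp add: fun_mod_neg) (simp add: lft_def)
lemma rgt_neg [simp]: "f \<in> carrier UM \<Longrightarrow> rgt (\<ominus>\<^sub>UM f) = \<ominus>\<^sub>UM rgt f"
  by (simp add: fun_mod_neg) (simp add: rgt_def)
lemma lft_diff [simp]: "f \<in> carrier UM \<Longrightarrow> g \<in> carrier UM \<Longrightarrow> lft (f \<ominus>\<^sub>UM g) = lft f \<ominus>\<^sub>UM lft g"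
  by (simp add: a_minus_def)
lemma rgt_diff [simp]: "f \<in> carrier UM \<Longrightarrow> g \<in> carrier UM \<Longrightarrow> rgt (f \<ominus>\<^sub>UM g) = rgt f \<ominus>\<^sub>UM rgt g"
  by (simp add: a_minus_def)
lemma Node_zero [simp]: "Node \<zero>\<^sub>UM \<zero>\<^sub>UM = \<zero>\<^sub>UM" by (rule node_ext) simp_all

text \<open>The differential \<open>(u, v) \<mapsto> (d u + x v, - d v)\<close> of the mapping cone of multiplication by x.\<close>

definition cone where
  "cone d x n f = Node (d n (lft f) \<oplus>\<^sub>UM x \<odot>\<^sub>UM rgt f) (\<ominus>\<^sub>UM d (n - 1) (rgt f))" for n :: int

lemma cone_simps [simp]: "lft (cone d x n f) = d n (lft f) \<oplus>\<^sub>UM x \<odot>\<^sub>UM rgt f"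
  "rgt (cone d x n f) = \<ominus>\<^sub>UM d (n - 1) (rgt f)"
  by (simp_all add: cone_def)

abbreviation "cones d xs \<equiv> foldl cone d xs"

definition differential where
  "differential d \<longleftrightarrow> (\<forall>n::int. d n \<in> lin_maps R UM UM \<and> (\<forall>f\<in>carrier UM. d (n - 1) (d n f) = \<zero>\<^sub>UM))"

text \<open>For each index a subcomplex; the elements of X act with degree one in the index.\<close>

definition filt_sys where
  "filt_sys \<Phi> d X \<longleftrightarrow> (\<forall>(n::int) (i::int). submodule (\<Phi> n i) R UM \<and> (\<forall>f\<in>\<Phi> n i. d n f \<in> \<Phi> (n - 1) i) \<and>
      (\<forall>x\<in>X. \<forall>f\<in>\<Phi> n i. x \<odot>\<^sub>UM f \<in> \<Phi> n (i + 1)))"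

text \<open>Exactness of \<open>\<Phi>/\<Psi>\<close> in degree n, at the index i.\<close>

definition exact_mod where
  "exact_mod \<Phi> \<Psi> d n i \<longleftrightarrow> (\<forall>z\<in>\<Phi> n i. d n z \<in> \<Psi> (n - 1) i \<longrightarrow> (\<exists>w\<in>\<Phi> (n + 1) i. z \<ominus>\<^sub>UM d (n + 1) w \<in> \<Psi> n i))"
  for n i :: int

lemma differentialD: assumes "differential d"
  shows "f \<in> carrier UM \<Longrightarrow> d n f \<in> carrier UM" "f \<in> carrier UM \<Longrightarrow> g \<in> carrier UM \<Longrightarrow> d n (f \<oplus>\<^sub>UM g) = d n f \<oplus>\<^sub>UM d n g"
   "a \<in> carrier R \<Longrightarrow> f \<in> carrier UM \<Longrightarrow> d n (a \<odot>\<^sub>UM f) = a \<odot>\<^sub>UM d n f"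
   "f \<in> carrier UM \<Longrightarrow> d (n - 1) (d n f) = \<zero>\<^sub>UM"
   "f \<in> carrier UM \<Longrightarrow> d n (d (n + 1) f) = \<zero>\<^sub>UM"
   "f \<in> carrier UM \<Longrightarrow> d n (\<ominus>\<^sub>UM f) = \<ominus>\<^sub>UM d n f"
   "f \<in> carrier UM \<Longrightarrow> g \<in> carrier UM \<Longrightarrow> d n (f \<ominus>\<^sub>UM g) = d n f \<ominus>\<^sub>UM d n g"
   "d n \<zero>\<^sub>UM = \<zero>\<^sub>UM" "f \<in> carrier UM \<Longrightarrow> d (n - 2) (d (n - 1) f) = \<zero>\<^sub>UM"
proof -
  have l: "d n \<in> lin_maps R UM UM" using assms by (simp add: differential_def)
  interpret l: lin_map R UM UM "d n" by (intro lin_mapI UM.module_axioms l)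
  show "f \<in> carrier UM \<Longrightarrow> d n f \<in> carrier UM" "f \<in> carrier UM \<Longrightarrow> g \<in> carrier UM \<Longrightarrow> d n (f \<oplus>\<^sub>UM g) = d n f \<oplus>\<^sub>UM d n g"
   "a \<in> carrier R \<Longrightarrow> f \<in> carrier UM \<Longrightarrow> d n (a \<odot>\<^sub>UM f) = a \<odot>\<^sub>UM d n f"
   "f \<in> carrier UM \<Longrightarrow> d n (\<ominus>\<^sub>UM f) = \<ominus>\<^sub>UM d n f"
   "f \<in> carrier UM \<Longrightarrow> g \<in> carrier UM \<Longrightarrow> d n (f \<ominus>\<^sub>UM g) = d n f \<ominus>\<^sub>UM d n g"
   "d n \<zero>\<^sub>UM = \<zero>\<^sub>UM" by simp_all
  show "d (n - 2) (d (n - 1) f) = \<zero>\<^sub>UM" if "f \<in> carrier UM"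
  proof -
    have "d (n - 1 - 1) (d (n - 1) f) = \<zero>\<^sub>UM" using assms that unfolding differential_def by blast
    thus ?thesis by simp
  qed
  show "f \<in> carrier UM \<Longrightarrow> d (n - 1) (d n f) = \<zero>\<^sub>UM" using assms by (simp add: differential_def)
  show "d n (d (n + 1) f) = \<zero>\<^sub>UM" if "f \<in> carrier UM"
  proof -
    have "d (n + 1 - 1) (d (n + 1) f) = \<zero>\<^sub>UM" using assms that unfolding differential_def by blast
    thus ?thesis by simp
  qed
qed

lemma filt_sysD: assumes "filt_sys \<Phi> d X"
  shows "submodule (\<Phi> n i) R UM" "f \<in> \<Phi> n i \<Longrightarrow> d n f \<in> \<Phi> (n - 1) i" "f \<in> \<Phi> (n + 1) i \<Longrightarrow> d (n + 1) f \<in> \<Phi> n i"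
   "x \<in> X \<Longrightarrow> f \<in> \<Phi> n i \<Longrightarrow> x \<odot>\<^sub>UM f \<in> \<Phi> n (i + 1)" "x \<in> X \<Longrightarrow> f \<in> \<Phi> n (i - 1) \<Longrightarrow> x \<odot>\<^sub>UM f \<in> \<Phi> n i"
   "f \<in> \<Phi> n i \<Longrightarrow> f \<in> carrier UM"
proof -
  show 1: "submodule (\<Phi> n i) R UM" and "f \<in> \<Phi> n i \<Longrightarrow> d n f \<in> \<Phi> (n - 1) i"
     "x \<in> X \<Longrightarrow> f \<in> \<Phi> n i \<Longrightarrow> x \<odot>\<^sub>UM f \<in> \<Phi> n (i + 1)" using assms by (auto simp: filt_sys_def)
  show "f \<in> \<Phi> (n + 1) i \<Longrightarrow> d (n + 1) f \<in> \<Phi> n i" using assms unfolding filt_sys_def by (metis add_diff_cancel_right')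
  show "x \<in> X \<Longrightarrow> f \<in> \<Phi> n (i - 1) \<Longrightarrow> x \<odot>\<^sub>UM f \<in> \<Phi> n i" using assms unfolding filt_sys_def by (metis diff_add_cancel)
  show "f \<in> \<Phi> n i \<Longrightarrow> f \<in> carrier UM" using UM.submod_carrier[OF 1] .
qed

lemma cone_filt_submodule: assumes "submodule (\<Phi> n i) R UM" "submodule (\<Phi> (n - 1) (i - 1)) R UM"
  shows "submodule (cone_filt \<Phi> n i) R UM"
proof (rule UM.submodI)
  show "cone_filt \<Phi> n i \<subseteq> carrier UM"
  proof
    fix f assume "f \<in> cone_filt \<Phi> n i"
    hence "Node (lft f) (rgt f) \<in> carrier UM" using assms UM.submod_carrier by (auto simp: cone_filt_iff simp del: Node_lft_rgt)
    thus "f \<in> carrier UM" by simp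
  qed
qed (auto simp: cone_filt_iff UM.submod_closed[OF assms(1)] UM.submod_closed[OF assms(2)])

lemma cone_differential: assumes "differential d" "x \<in> carrier R" shows "differential (cone d x)"
proof -
  note [simp] = differentialD[OF assms(1)]
  have cl: "cone d x n f \<in> carrier UM" if "f \<in> carrier UM" for n f
    using that assms(2) by (simp add: cone_def)
  have "cone d x n (f \<oplus>\<^sub>UM g) = cone d x n f \<oplus>\<^sub>UM cone d x n g" if "f \<in> carrier UM" "g \<in> carrier UM" for n f g
    using that assms(2) by - (rule node_ext, simp_all add: UM.smult_r_distr UM.M.a_ac UM.M.minus_add)
  moreover have "cone d x n (a \<odot>\<^sub>UM f) = a \<odot>\<^sub>UM cone d x n f" if "f \<in> carrier UM" "a \<in> carrier R" for n f a
    using that assms(2) smult_swap[of x a "rgt f"] by - (rule node_ext, simp_all add: UM.smult_r_distr UM.smult_r_minus)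
  ultimately have "cone d x n \<in> lin_maps R UM UM" for n unfolding lin_maps_def using cl by simp
  moreover have "cone d x (n - 1) (cone d x n f) = \<zero>\<^sub>UM" if "f \<in> carrier UM" for n f
    using that assms(2) by - (rule node_ext, simp_all add: UM.smult_r_minus UM.M.r_neg)
  ultimately show ?thesis by (simp add: differential_def)
qed

lemma cone_filt_sys: assumes "differential d" "filt_sys \<Phi> d X" "x \<in> X" "X \<subseteq> carrier R" shows "filt_sys (cone_filt \<Phi>) (cone d x) X"
  unfolding filt_sys_def
proof (intro allI conjI ballI)
  note s = filt_sysD[OF assms(2)]
  fix n i show "submodule (cone_filt \<Phi> n i) R UM" by (intro cone_filt_submodule s)
  fix f assume f: "f \<in> cone_filt \<Phi> n i"
  hence f': "lft f \<in> \<Phi> n i" "rgt f \<in> \<Phi> (n - 1) (i - 1)" by (auto simp: cone_filt_iff)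
  show "cone d x n f \<in> cone_filt \<Phi> (n - 1) i" unfolding cone_filt_iff
    using s(2)[OF f'(1)] s(2)[OF f'(2)] s(5)[OF assms(3) f'(2)]
    by (auto intro!: UM.submod_add[OF s(1)] UM.submod_neg[OF s(1)])
  fix y assume y: "y \<in> X"
  show "y \<odot>\<^sub>UM f \<in> cone_filt \<Phi> n (i + 1)" unfolding cone_filt_iff using s(4)[OF y f'(1)] s(4)[OF y f'(2)] by simp
qed

text \<open>The part \<open>H\<^sub>n(C) \<rightarrow> H\<^sub>n(cone) \<rightarrow> H\<^sub>n\<^sub>-\<^sub>1(C)\<close> of the long exact sequence of a cone.\<close>

lemma cone_exact_mod:
  assumes d: "differential d" and \<Phi>: "filt_sys \<Phi> d X" and \<Psi>: "filt_sys \<Psi> d X" and x: "x \<in> X" "X \<subseteq> carrier R"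
    and e1: "exact_mod \<Phi> \<Psi> d n i" and e2: "exact_mod \<Phi> \<Psi> d (n - 1) (i - 1)"
  shows "exact_mod (cone_filt \<Phi>) (cone_filt \<Psi>) (cone d x) n i"
  unfolding exact_mod_def
proof (intro ballI impI)
  note [simp] = differentialD[OF d]
  note s = filt_sysD[OF \<Phi>] and t = filt_sysD[OF \<Psi>]
  have xR: "x \<in> carrier R" using x by auto
  fix z assume z: "z \<in> cone_filt \<Phi> n i" and dz: "cone d x n z \<in> cone_filt \<Psi> (n - 1) i"
  define u v where "u = lft z" and "v = rgt z"
  have u: "u \<in> \<Phi> n i" "d n u \<oplus>\<^sub>UM x \<odot>\<^sub>UM v \<in> \<Psi> (n - 1) i"
   and v: "v \<in> \<Phi> (n - 1) (i - 1)" "\<ominus>\<^sub>UM d (n - 1) v \<in> \<Psi> (n - 1 - 1) (i - 1)"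
    using z dz by (auto simp: cone_filt_iff u_def v_def)
  have uc: "u \<in> carrier UM" and vc: "v \<in> carrier UM" using s(6) u(1) v(1) by auto
  have "d (n - 1) v \<in> \<Psi> (n - 1 - 1) (i - 1)" using UM.submod_neg[OF t(1) v(2)] vc by simp
  then obtain v' where v': "v' \<in> \<Phi> n (i - 1)" "v \<ominus>\<^sub>UM d n v' \<in> \<Psi> (n - 1) (i - 1)"
    using e2 v(1) unfolding exact_mod_def by auto
  have v'c: "v' \<in> carrier UM" using s(6) v'(1) by auto
  define r where "r = v \<ominus>\<^sub>UM d n v'"
  have r: "r \<in> \<Psi> (n - 1) (i - 1)" "r \<in> carrier UM" using v'(2) t(6) r_def by auto
  have vr: "v = d n v' \<oplus>\<^sub>UM r" using vc v'c by (simp add: r_def UM.M.move_minus)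
  define u' where "u' = u \<oplus>\<^sub>UM x \<odot>\<^sub>UM v'"
  have u': "u' \<in> \<Phi> n i" unfolding u'_def by (rule UM.submod_add[OF s(1) u(1) s(5)[OF x(1) v'(1)]])
  have "d n u' = (d n u \<oplus>\<^sub>UM x \<odot>\<^sub>UM v) \<ominus>\<^sub>UM x \<odot>\<^sub>UM r"
    unfolding u'_def vr using uc v'c r(2) xR by (simp add: UM.smult_r_distr UM.M.move_minus)
  hence "d n u' \<in> \<Psi> (n - 1) i" using UM.submod_diff[OF t(1) u(2) t(5)[OF x(1) r(1)]] by simp
  then obtain w where w: "w \<in> \<Phi> (n + 1) i" "u' \<ominus>\<^sub>UM d (n + 1) w \<in> \<Psi> n i"
    using e1 u' unfolding exact_mod_def by blast
  have wc: "w \<in> carrier UM" using s(6) w(1) by auto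
  let ?w = "Node w (\<ominus>\<^sub>UM v')"
  have "?w \<in> cone_filt \<Phi> (n + 1) i" using w(1) UM.submod_neg[OF s(1) v'(1)] by (simp add: cone_filt_iff)
  moreover have "z \<ominus>\<^sub>UM cone d x (n + 1) ?w \<in> cone_filt \<Psi> n i"
  proof -
    have zc: "z \<in> carrier UM" using UM.submod_carrier[OF cone_filt_submodule[of \<Phi> n i, OF s(1) s(1)] z] .
    have cc: "cone d x (n + 1) ?w \<in> carrier UM" using differentialD(1)[OF cone_differential[OF d xR]] wc v'c by simp
    have "u \<ominus>\<^sub>UM (d (n + 1) w \<oplus>\<^sub>UM x \<odot>\<^sub>UM (\<ominus>\<^sub>UM v')) = u' \<ominus>\<^sub>UM d (n + 1) w"
      unfolding u'_def using uc wc v'c xR by (simp add: UM.smult_r_minus UM.M.move_minus)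
    moreover have "v \<ominus>\<^sub>UM (\<ominus>\<^sub>UM d n (\<ominus>\<^sub>UM v')) = r" using vc v'c by (simp add: r_def)
    ultimately show ?thesis using w(2) r(1) zc cc by (simp add: cone_filt_iff u_def[symmetric] v_def[symmetric])
  qed
  ultimately show "\<exists>w\<in>cone_filt \<Phi> (n + 1) i. z \<ominus>\<^sub>UM cone d x (n + 1) w \<in> cone_filt \<Psi> n i" by blast
qed

text \<open>A Nakayama argument, by induction on the index i. A cycle z of the complex bounds in the
  cone: modulo \<open>\<Psi>\<close>, it is \<open>d a + x b\<close> for a cycle b of index \<open>i - 1\<close>. By induction b is a boundary modulo \<open>\<Psi>\<close>, and
  then so is z. The induction starts at \<open>i < n\<close>, where the quotient is zero.\<close>

lemma cone_exact_mod_rev: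
  assumes d: "differential d" and \<Phi>: "filt_sys \<Phi> d X" and \<Psi>: "filt_sys \<Psi> d X" and x: "x \<in> X" "X \<subseteq> carrier R"
    and e: "\<And>i. exact_mod (cone_filt \<Phi>) (cone_filt \<Psi>) (cone d x) n i" and b: "\<And>i. i < n \<Longrightarrow> \<Phi> n i \<subseteq> \<Psi> n i"
  shows "exact_mod \<Phi> \<Psi> d n i"
proof -
  note [simp] = differentialD[OF d]
  note s = filt_sysD[OF \<Phi>] and t = filt_sysD[OF \<Psi>]
  have xR: "x \<in> carrier R" using x by auto
  have base: "exact_mod \<Phi> \<Psi> d n i" if "i < n" for i
    unfolding exact_mod_def using b[OF that] s(6) UM.submod_zero[OF s(1)]
    by (intro ballI impI bexI[of _ "\<zero>\<^sub>UM"]) (auto simp: UM.M.minus_zero)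
  show ?thesis
  proof (cases "i < n")
    case False
    hence "n - 1 \<le> i" by simp
    thus ?thesis
    proof (induction i rule: int_ge_induct)
      case base show ?case using \<open>\<And>i. i < n \<Longrightarrow> exact_mod \<Phi> \<Psi> d n i\<close> by simp
    next
      case (step i)
      show ?case unfolding exact_mod_def
      proof (intro ballI impI)
        fix z assume z: "z \<in> \<Phi> n (i + 1)" and dz: "d n z \<in> \<Psi> (n - 1) (i + 1)"
        have zc: "z \<in> carrier UM" using s(6) z by auto
        have nz: "Node z \<zero>\<^sub>UM \<in> cone_filt \<Phi> n (i + 1)" "cone d x n (Node z \<zero>\<^sub>UM) \<in> cone_filt \<Psi> (n - 1) (i + 1)"
          using z dz zc xR UM.submod_zero[OF s(1)] UM.submod_zero[OF t(1)] by (simp_all add: cone_filt_iff UM.M.add.inv_one)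
        then obtain w where w: "w \<in> cone_filt \<Phi> (n + 1) (i + 1)" "Node z \<zero>\<^sub>UM \<ominus>\<^sub>UM cone d x (n + 1) w \<in> cone_filt \<Psi> n (i + 1)"
          using e[of "i + 1"] unfolding exact_mod_def by blast
        define a b where "a = lft w" and "b = rgt w"
        have ab: "a \<in> \<Phi> (n + 1) (i + 1)" "b \<in> \<Phi> n i" using w(1) by (auto simp: cone_filt_iff a_def b_def)
        hence abc: "a \<in> carrier UM" "b \<in> carrier UM" using s(6) by auto
        have wc: "w \<in> carrier UM" using abc by (metis Node_closed Node_lft_rgt a_def b_def)
        have cc: "cone d x (n + 1) w \<in> carrier UM" using differentialD(1)[OF cone_differential[OF d xR]] wc by simp
        have 1: "z \<ominus>\<^sub>UM (d (n + 1) a \<oplus>\<^sub>UM x \<odot>\<^sub>UM b) \<in> \<Psi> n (i + 1)" and 2: "\<zero>\<^sub>UM \<ominus>\<^sub>UM (\<ominus>\<^sub>UM d n b) \<in> \<Psi> (n - 1) i"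
          using w(2) zc cc by (simp_all add: cone_filt_iff a_def[symmetric] b_def[symmetric])
        have "d n b \<in> \<Psi> (n - 1) i" using 2 abc by (simp add: a_minus_def)
        then obtain y where y: "y \<in> \<Phi> (n + 1) i" "b \<ominus>\<^sub>UM d (n + 1) y \<in> \<Psi> n i"
          using step.IH ab(2) unfolding exact_mod_def by blast
        have yc: "y \<in> carrier UM" using s(6) y by auto
        have 3: "x \<odot>\<^sub>UM (b \<ominus>\<^sub>UM d (n + 1) y) \<in> \<Psi> n (i + 1)" by (rule t(4)[OF x(1) y(2)])
        let ?w = "a \<oplus>\<^sub>UM x \<odot>\<^sub>UM y"
        have "?w \<in> \<Phi> (n + 1) (i + 1)" by (rule UM.submod_add[OF s(1) ab(1) s(4)[OF x(1) y(1)]])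
        moreover have "z \<ominus>\<^sub>UM d (n + 1) ?w = (z \<ominus>\<^sub>UM (d (n + 1) a \<oplus>\<^sub>UM x \<odot>\<^sub>UM b)) \<oplus>\<^sub>UM x \<odot>\<^sub>UM (b \<ominus>\<^sub>UM d (n + 1) y)"
          using zc abc yc xR by (simp add: UM.smult_r_diff UM.M.move_minus)
        ultimately show "\<exists>w\<in>\<Phi> (n + 1) (i + 1). z \<ominus>\<^sub>UM d (n + 1) w \<in> \<Psi> n (i + 1)"
          using UM.submod_add[OF t(1) 1 3] by metis
      qed
    qed
  qed (rule base)
qed

text \<open>Since \<open>\<Psi>'/\<Psi>\<close> is exact, \<open>\<Phi>/\<Psi> \<rightarrow> \<Phi>/\<Psi>'\<close> induces isomorphisms in homology.\<close>

lemma exact_mod_compare: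
  assumes d: "differential d" and \<Phi>: "filt_sys \<Phi> d X" and \<Psi>: "filt_sys \<Psi> d X" and \<Psi>': "filt_sys \<Psi>' d X"
    and sub: "\<And>n i. \<Psi> n i \<subseteq> \<Psi>' n i" "\<And>n i. \<Psi>' n i \<subseteq> \<Phi> n i" and e: "\<And>n i. exact_mod \<Psi>' \<Psi> d n i"
  shows "exact_mod \<Phi> \<Psi> d n i \<longleftrightarrow> exact_mod \<Phi> \<Psi>' d n i"
proof
  note [simp] = differentialD[OF d]
  note s = filt_sysD[OF \<Phi>] and t = filt_sysD[OF \<Psi>] and t' = filt_sysD[OF \<Psi>']
  { assume A: "exact_mod \<Phi> \<Psi> d n i"
    show "exact_mod \<Phi> \<Psi>' d n i" unfolding exact_mod_def
    proof (intro ballI impI)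
      fix z assume z: "z \<in> \<Phi> n i" and dz: "d n z \<in> \<Psi>' (n - 1) i"
      have zc: "z \<in> carrier UM" using s(6) z by auto
      have "d (n - 1) (d n z) \<in> \<Psi> (n - 1 - 1) i" using zc UM.submod_zero[OF t(1)] by simp
      then obtain w where w: "w \<in> \<Psi>' n i" "d n z \<ominus>\<^sub>UM d n w \<in> \<Psi> (n - 1) i"
        using e[of "n - 1" i] dz unfolding exact_mod_def by auto
      have wc: "w \<in> carrier UM" using t'(6) w by auto
      have zw: "z \<ominus>\<^sub>UM w \<in> \<Phi> n i" "d n (z \<ominus>\<^sub>UM w) \<in> \<Psi> (n - 1) i"
        using UM.submod_diff[OF s(1) z subsetD[OF sub(2) w(1)]] w(2) zc wc by auto
      then obtain y where y: "y \<in> \<Phi> (n + 1) i" "(z \<ominus>\<^sub>UM w) \<ominus>\<^sub>UM d (n + 1) y \<in> \<Psi> n i" using A unfolding exact_mod_def by blast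
      have yc: "y \<in> carrier UM" using s(6) y by auto
      have "z \<ominus>\<^sub>UM d (n + 1) y = ((z \<ominus>\<^sub>UM w) \<ominus>\<^sub>UM d (n + 1) y) \<oplus>\<^sub>UM w" using zc wc yc by (simp add: UM.M.move_minus)
      hence "z \<ominus>\<^sub>UM d (n + 1) y \<in> \<Psi>' n i" using UM.submod_add[OF t'(1) subsetD[OF sub(1) y(2)] w(1)] by simp
      thus "\<exists>w\<in>\<Phi> (n + 1) i. z \<ominus>\<^sub>UM d (n + 1) w \<in> \<Psi>' n i" using y by blast
    qed }
  { assume A: "exact_mod \<Phi> \<Psi>' d n i"
    show "exact_mod \<Phi> \<Psi> d n i" unfolding exact_mod_def
    proof (intro ballI impI)
      fix z assume z: "z \<in> \<Phi> n i" and dz: "d n z \<in> \<Psi> (n - 1) i"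
      have zc: "z \<in> carrier UM" using s(6) z by auto
      obtain w where w: "w \<in> \<Phi> (n + 1) i" "z \<ominus>\<^sub>UM d (n + 1) w \<in> \<Psi>' n i"
        using A z subsetD[OF sub(1) dz] unfolding exact_mod_def by blast
      have wc: "w \<in> carrier UM" using s(6) w by auto
      have "d n (z \<ominus>\<^sub>UM d (n + 1) w) \<in> \<Psi> (n - 1) i" using dz zc wc by (simp add: UM.M.minus_zero)
      then obtain y where y: "y \<in> \<Psi>' (n + 1) i" "(z \<ominus>\<^sub>UM d (n + 1) w) \<ominus>\<^sub>UM d (n + 1) y \<in> \<Psi> n i"
        using e w(2) unfolding exact_mod_def by blast
      have yc: "y \<in> carrier UM" using t'(6) y by auto
      have "z \<ominus>\<^sub>UM d (n + 1) (w \<oplus>\<^sub>UM y) = (z \<ominus>\<^sub>UM d (n + 1) w) \<ominus>\<^sub>UM d (n + 1) y" using zc wc yc by (simp add: UM.M.move_minus)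
      moreover have "w \<oplus>\<^sub>UM y \<in> \<Phi> (n + 1) i" using w y sub UM.submod_add[OF s(1)] by blast
      ultimately show "\<exists>w\<in>\<Phi> (n + 1) i. z \<ominus>\<^sub>UM d (n + 1) w \<in> \<Psi> n i" using y(2) by metis
    qed }
qed

lemma cones_differential: "differential d \<Longrightarrow> set xs \<subseteq> carrier R \<Longrightarrow> differential (cones d xs)"
  by (induction xs rule: rev_induct) (auto intro: cone_differential)

lemma cones_filt_sys: "differential d \<Longrightarrow> filt_sys \<Phi> d X \<Longrightarrow> set xs \<subseteq> X \<Longrightarrow> X \<subseteq> carrier R \<Longrightarrow> filt_sys (cone_filts (length xs) \<Phi>) (cones d xs) X"
  by (induction xs rule: rev_induct) (auto intro!: cone_filt_sys cones_differential)

lemma cone_filts_mono: "(\<And>n i. \<Phi> n i \<subseteq> \<Psi> n i) \<Longrightarrow> cone_filts k \<Phi> n i \<subseteq> cone_filts k \<Psi> n i"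
proof (induction k arbitrary: n i)
  case (Suc k) show ?case using Suc.IH[OF Suc.prems, of n i] Suc.IH[OF Suc.prems, of "n - 1" "i - 1"] by (auto simp: cone_filt_iff)
qed simp

lemma cones_exact_mod:
  assumes "differential d" "filt_sys \<Phi> d X" "filt_sys \<Psi> d X" "set xs \<subseteq> X" "X \<subseteq> carrier R" "\<And>n i. exact_mod \<Phi> \<Psi> d n i"
  shows "exact_mod (cone_filts (length xs) \<Phi>) (cone_filts (length xs) \<Psi>) (cones d xs) n i"
  using assms(4)
proof (induction xs arbitrary: n i rule: rev_induct)
  case (snoc x xs)
  thus ?case using assms by (auto intro!: cone_exact_mod[OF cones_differential cones_filt_sys cones_filt_sys])
qed (use assms in simp)

lemma cones_exact_mod_rev:
  assumes "differential d" "filt_sys \<Phi> d X" "filt_sys \<Psi> d X" "set xs \<subseteq> X" "X \<subseteq> carrier R" "\<And>n i. i < n \<Longrightarrow> \<Phi> n i \<subseteq> \<Psi> n i"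
    and "\<And>n i. n > 0 \<Longrightarrow> exact_mod (cone_filts (length xs) \<Phi>) (cone_filts (length xs) \<Psi>) (cones d xs) n i" and "k \<le> length xs" "n > 0"
  shows "exact_mod (cone_filts k \<Phi>) (cone_filts k \<Psi>) (cones d (take k xs)) n i"
  using assms(4,7,8,9)
proof (induction xs arbitrary: n i rule: rev_induct)
  case Nil thus ?case by simp
next
  case (snoc x xs)
  have b: "cone_filts j \<Phi> n i \<subseteq> cone_filts j \<Psi> n i" if "i < n" for j n i
    using that
  proof (induction j arbitrary: n i)
    case (Suc j) thus ?case using Suc.IH[of i n] Suc.IH[of "i - 1" "n - 1"] by (simp add: cone_filt_iff subset_iff)
  qed (use assms(6) in auto)
  have 1: "exact_mod (cone_filts (length xs) \<Phi>) (cone_filts (length xs) \<Psi>) (cones d xs) n i" if "n > 0" for n i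
    by (rule cone_exact_mod_rev[where X = X, OF cones_differential cones_filt_sys cones_filt_sys])
       (use assms(1-5) snoc.prems(1,2) that b in auto)
  show ?case
  proof (cases "k \<le> length xs")
    case True thus ?thesis using snoc.IH[OF _ 1] snoc.prems by simp
  next
    case False
    hence "k = Suc (length xs)" using snoc.prems by simp
    thus ?thesis using snoc.prems(2)[OF snoc.prems(4)] by simp
  qed
qed

lemma cones_exact_mod_compare:
  assumes "differential d" "filt_sys \<Phi> d X" "filt_sys \<Psi> d X" "filt_sys \<Psi>' d X" "set xs \<subseteq> X" "X \<subseteq> carrier R"
    "\<And>n i. \<Psi> n i \<subseteq> \<Psi>' n i" "\<And>n i. \<Psi>' n i \<subseteq> \<Phi> n i" "\<And>n i. exact_mod \<Psi>' \<Psi> d n i"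
  shows "exact_mod (cone_filts (length xs) \<Phi>) (cone_filts (length xs) \<Psi>) (cones d xs) n i \<longleftrightarrow>
     exact_mod (cone_filts (length xs) \<Phi>) (cone_filts (length xs) \<Psi>') (cones d xs) n i"
  by (rule exact_mod_compare[OF cones_differential cones_filt_sys cones_filt_sys cones_filt_sys cone_filts_mono cone_filts_mono cones_exact_mod])
     (use assms in \<open>auto intro: order_trans\<close>)

end

section \<open>The Koszul complex\<close>

context fmodule begin

text \<open>The submodule Y as a complex concentrated in degree zero, at every index. An element sits in the
  coordinate zero.\<close>

definition base :: "'c set \<Rightarrow> int \<Rightarrow> int \<Rightarrow> (nat \<Rightarrow> 'c) set" where
  "base Y n i = (if n = 0 then {f. f 0 \<in> Y \<and> (\<forall>k>0. f k = \<zero>\<^sub>M)} else {\<zero>\<^sub>UM})"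

definition zero_diff :: "int \<Rightarrow> (nat \<Rightarrow> 'c) \<Rightarrow> nat \<Rightarrow> 'c" where "zero_diff n f = \<zero>\<^sub>UM"

text \<open>As iterated cone of a module in degree zero, this is the Koszul complex with coefficients in Y, and
  \<open>KD xs\<close> is its differential.\<close>

abbreviation "KK k Y \<equiv> cone_filts k (base Y)"
abbreviation "KD xs \<equiv> cones zero_diff xs"

lemma zero_diff_differential: "differential zero_diff"
  by (auto simp: differential_def zero_diff_def lin_maps_def)

lemma base_submodule: assumes Y: "submodule Y R M" shows "submodule (base Y n i) R UM"
proof (cases "n = 0")
  case True
  show ?thesis unfolding base_def using True
    by (auto intro!: UM.submodI simp: fun_mod_simps submod_closed[OF Y])
       (metis (no_types, lifting) M.zero_closed gr0I submod_carrier[OF Y])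
next
  case False thus ?thesis by (simp add: base_def UM.zero_submodule)
qed

lemma base_filt_sys: "submodule Y R M \<Longrightarrow> filt_sys (base Y) zero_diff (carrier R)"
  unfolding filt_sys_def using UM.submod_zero[OF base_submodule] UM.submod_smult[OF base_submodule]
  by (auto simp: base_submodule zero_diff_def) (simp add: base_def)

lemma KK_filt_sys: "submodule Y R M \<Longrightarrow> set xs \<subseteq> carrier R \<Longrightarrow> filt_sys (KK (length xs) Y) (KD xs) (carrier R)"
  by (rule cones_filt_sys[OF zero_diff_differential base_filt_sys]) auto

lemma KD_differential: "set xs \<subseteq> carrier R \<Longrightarrow> differential (KD xs)"
  by (rule cones_differential[OF zero_diff_differential])

lemma KK_const: "KK k Y n i = KK k Y n j"
proof (induction k arbitrary: n i j)
  case (Suc k)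
  have "KK k Y n i = KK k Y n j" "KK k Y (n - 1) (i - 1) = KK k Y (n - 1) (j - 1)" by (rule Suc)+
  thus ?case by (simp add: set_eq_iff cone_filt_iff)
qed (simp add: base_def)

lemma KK_vanish: assumes "n < 0 \<or> int k < n" "f \<in> KK k Y n i" shows "f = \<zero>\<^sub>UM"
  using assms
proof (induction k arbitrary: n i f)
  case (Suc k)
  have "lft f = \<zero>\<^sub>UM" "rgt f = \<zero>\<^sub>UM"
    using Suc.IH[of n "lft f" i] Suc.IH[of "n - 1" "rgt f" "i - 1"] Suc.prems by (auto simp: cone_filt_iff)
  thus ?case by - (rule node_ext, simp_all)
qed (auto simp: base_def)

text \<open>The Koszul homology of xs on M/Y vanishes in degree n. The complexes do not depend on the index;
  zero stands for any.\<close>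

definition koszul_exact where "koszul_exact xs Y n \<longleftrightarrow> exact_mod (KK (length xs) (carrier M)) (KK (length xs) Y) (KD xs) n 0"

text \<open>Multiplication by y is homotopic to zero on the Koszul complex, by a homotopy that respects all
  submodules of coefficients and therefore passes to quotients.\<close>

definition null_homotopic where "null_homotopic xs y \<longleftrightarrow> (\<exists>h\<in>lin_maps R UM UM.
   (\<forall>n. \<forall>f\<in>carrier UM. KD xs (n + 1) (h f) \<oplus>\<^sub>UM h (KD xs n f) = y \<odot>\<^sub>UM f) \<and>
   (\<forall>Y n i f. submodule Y R M \<longrightarrow> f \<in> KK (length xs) Y n i \<longrightarrow> h f \<in> KK (length xs) Y (n + 1) i))"

lemma KK_submodule: "submodule Y R M \<Longrightarrow> submodule (KK k Y n i) R UM"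
  by (induction k arbitrary: n i) (auto intro: base_submodule cone_filt_submodule)

text \<open>The homotopy \<open>(u, v) \<mapsto> (0, u)\<close>.\<close>

lemma null_homotopic_last: assumes xs: "set xs \<subseteq> carrier R" "x \<in> carrier R" shows "null_homotopic (xs @ [x]) x"
  unfolding null_homotopic_def
proof (intro bexI[of _ "\<lambda>f. Node \<zero>\<^sub>UM (lft f)"] conjI allI ballI impI)
  note [simp] = differentialD[OF KD_differential[OF xs(1)]]
  fix n f assume f: "f \<in> carrier UM"
  show "KD (xs @ [x]) (n + 1) (Node \<zero>\<^sub>UM (lft f)) \<oplus>\<^sub>UM Node \<zero>\<^sub>UM (lft (KD (xs @ [x]) n f)) = x \<odot>\<^sub>UM f"
    using f xs(2) by - (rule node_ext, simp_all, simp add: UM.M.move_minus)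
next
  fix Y n i f assume "submodule Y R M" "f \<in> KK (length (xs @ [x])) Y n i"
  thus "Node \<zero>\<^sub>UM (lft f) \<in> KK (length (xs @ [x])) Y (n + 1) i"
    using KK_const[of "length xs" Y n i "i - 1"] UM.submod_zero[OF KK_submodule] by (auto simp: cone_filt_iff)
next
  show "(\<lambda>f. Node \<zero>\<^sub>UM (lft f)) \<in> lin_maps R UM UM"
    by (auto simp: lin_maps_def) (rule node_ext, simp_all)+
qed

text \<open>A homotopy on the complex extends to the cone, with a sign on the second half.\<close>

lemma null_homotopic_snoc: assumes xs: "set xs \<subseteq> carrier R" "x \<in> carrier R" "y \<in> carrier R" and h: "null_homotopic xs y" shows "null_homotopic (xs @ [x]) y"
proof -
  obtain h where hl: "h \<in> lin_maps R UM UM" and hh: "\<And>n f. f \<in> carrier UM \<Longrightarrow> KD xs (n + 1) (h f) \<oplus>\<^sub>UM h (KD xs n f) = y \<odot>\<^sub>UM f"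
    and hm: "\<And>Y n i f. submodule Y R M \<Longrightarrow> f \<in> KK (length xs) Y n i \<Longrightarrow> h f \<in> KK (length xs) Y (n + 1) i"
    using h unfolding null_homotopic_def by blast
  interpret h: lin_map R UM UM h by (intro lin_mapI UM.module_axioms hl)
  note [simp] = differentialD[OF KD_differential[OF xs(1)]]
  show ?thesis unfolding null_homotopic_def
  proof (intro bexI[of _ "\<lambda>f. Node (h (lft f)) (\<ominus>\<^sub>UM h (rgt f))"] conjI allI ballI impI)
    fix n f assume f: "f \<in> carrier UM"
    have 1: "KD xs (n + 1) (h (lft f)) \<oplus>\<^sub>UM h (KD xs n (lft f)) = y \<odot>\<^sub>UM lft f"
      "KD xs n (h (rgt f)) \<oplus>\<^sub>UM h (KD xs (n - 1) (rgt f)) = y \<odot>\<^sub>UM rgt f"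
      using hh[of "lft f" n] hh[of "rgt f" "n - 1"] f by simp_all
    have 2: "(A \<oplus>\<^sub>UM \<ominus>\<^sub>UM C) \<oplus>\<^sub>UM (B \<oplus>\<^sub>UM C) = A \<oplus>\<^sub>UM B" if "A \<in> carrier UM" "B \<in> carrier UM" "C \<in> carrier UM" for A B C
      using that by (simp add: UM.M.move_minus)
    show "KD (xs @ [x]) (n + 1) (Node (h (lft f)) (\<ominus>\<^sub>UM h (rgt f))) \<oplus>\<^sub>UM
        Node (h (lft (KD (xs @ [x]) n f))) (\<ominus>\<^sub>UM h (rgt (KD (xs @ [x]) n f))) = y \<odot>\<^sub>UM f"
      using f xs 1 by - (rule node_ext, simp_all add: UM.smult_r_minus 2)
  next
    fix Y n i f assume Y: "submodule Y R M" and "f \<in> KK (length (xs @ [x])) Y n i"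
    thus "Node (h (lft f)) (\<ominus>\<^sub>UM h (rgt f)) \<in> KK (length (xs @ [x])) Y (n + 1) i"
      using hm[OF Y, of "lft f" n i] hm[OF Y, of "rgt f" "n - 1" "i - 1"] UM.submod_neg[OF KK_submodule[OF Y]] by (simp add: cone_filt_iff)
  next
    show "(\<lambda>f. Node (h (lft f)) (\<ominus>\<^sub>UM h (rgt f))) \<in> lin_maps R UM UM"
      by (auto simp: lin_maps_def) (rule node_ext, simp_all add: UM.smult_r_minus UM.M.minus_add)+
  qed
qed

lemma null_homotopic_mem: "x \<in> set xs \<Longrightarrow> set xs \<subseteq> carrier R \<Longrightarrow> null_homotopic xs x"
  by (induction xs rule: rev_induct) (auto intro: null_homotopic_last null_homotopic_snoc)

lemma null_homotopic_zero: "set xs \<subseteq> carrier R \<Longrightarrow> null_homotopic xs \<zero>"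
  unfolding null_homotopic_def using differentialD(8)[OF KD_differential] differentialD(1)[OF KD_differential] UM.submod_zero[OF KK_submodule]
  by (intro bexI[of _ "\<lambda>f. \<zero>\<^sub>UM"]) (auto simp: lin_maps_def)

lemma null_homotopic_add: assumes xs: "set xs \<subseteq> carrier R" "y \<in> carrier R" "y' \<in> carrier R" "null_homotopic xs y" "null_homotopic xs y'" shows "null_homotopic xs (y \<oplus> y')"
proof -
  obtain h where hl: "h \<in> lin_maps R UM UM" and hh: "\<And>n f. f \<in> carrier UM \<Longrightarrow> KD xs (n + 1) (h f) \<oplus>\<^sub>UM h (KD xs n f) = y \<odot>\<^sub>UM f"
    and hm: "\<And>Y n i f. submodule Y R M \<Longrightarrow> f \<in> KK (length xs) Y n i \<Longrightarrow> h f \<in> KK (length xs) Y (n + 1) i"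
    using assms(4) unfolding null_homotopic_def by blast
  interpret h: lin_map R UM UM h by (intro lin_mapI UM.module_axioms hl)
  obtain g where gl: "g \<in> lin_maps R UM UM" and gh: "\<And>n f. f \<in> carrier UM \<Longrightarrow> KD xs (n + 1) (g f) \<oplus>\<^sub>UM g (KD xs n f) = y' \<odot>\<^sub>UM f"
    and gm: "\<And>Y n i f. submodule Y R M \<Longrightarrow> f \<in> KK (length xs) Y n i \<Longrightarrow> g f \<in> KK (length xs) Y (n + 1) i"
    using assms(5) unfolding null_homotopic_def by blast
  interpret g: lin_map R UM UM g by (intro lin_mapI UM.module_axioms gl)
  note [simp] = differentialD[OF KD_differential[OF xs(1)]]
  show ?thesis unfolding null_homotopic_def
  proof (intro bexI[of _ "\<lambda>f. h f \<oplus>\<^sub>UM g f"] conjI allI ballI impI)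
    fix n f assume f: "f \<in> carrier UM"
    have "(y \<oplus> y') \<odot>\<^sub>UM f = y \<odot>\<^sub>UM f \<oplus>\<^sub>UM y' \<odot>\<^sub>UM f" using f xs by (simp add: UM.smult_l_distr)
    thus "KD xs (n + 1) (h f \<oplus>\<^sub>UM g f) \<oplus>\<^sub>UM (h (KD xs n f) \<oplus>\<^sub>UM g (KD xs n f)) = (y \<oplus> y') \<odot>\<^sub>UM f"
      using f by (simp add: hh[OF f, of n, symmetric] gh[OF f, of n, symmetric] UM.M.a_ac)
  next
    show "(\<lambda>f. h f \<oplus>\<^sub>UM g f) \<in> lin_maps R UM UM"
      by (auto simp: lin_maps_def UM.smult_r_distr UM.M.a_ac)
  qed (use hm gm in \<open>auto intro!: UM.submod_add[OF KK_submodule]\<close>)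
qed

lemma null_homotopic_mult: assumes xs: "set xs \<subseteq> carrier R" "y \<in> carrier R" "a \<in> carrier R" "null_homotopic xs y" shows "null_homotopic xs (a \<otimes> y)"
proof -
  obtain h where hl: "h \<in> lin_maps R UM UM" and hh: "\<And>n f. f \<in> carrier UM \<Longrightarrow> KD xs (n + 1) (h f) \<oplus>\<^sub>UM h (KD xs n f) = y \<odot>\<^sub>UM f"
    and hm: "\<And>Y n i f. submodule Y R M \<Longrightarrow> f \<in> KK (length xs) Y n i \<Longrightarrow> h f \<in> KK (length xs) Y (n + 1) i"
    using assms(4) unfolding null_homotopic_def by blast
  interpret h: lin_map R UM UM h by (intro lin_mapI UM.module_axioms hl)
  note [simp] = differentialD[OF KD_differential[OF xs(1)]]
  show ?thesis unfolding null_homotopic_def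
  proof (intro bexI[of _ "\<lambda>f. a \<odot>\<^sub>UM h f"] conjI allI ballI impI)
    fix n f assume f: "f \<in> carrier UM"
    have "KD xs (n + 1) (a \<odot>\<^sub>UM h f) \<oplus>\<^sub>UM a \<odot>\<^sub>UM h (KD xs n f) = a \<odot>\<^sub>UM (KD xs (n + 1) (h f) \<oplus>\<^sub>UM h (KD xs n f))"
      using f xs by (simp add: UM.smult_r_distr)
    thus "KD xs (n + 1) (a \<odot>\<^sub>UM h f) \<oplus>\<^sub>UM a \<odot>\<^sub>UM h (KD xs n f) = (a \<otimes> y) \<odot>\<^sub>UM f"
      using f xs hh[OF f] by (simp add: UM.smult_assoc1)
  next
    show "(\<lambda>f. a \<odot>\<^sub>UM h f) \<in> lin_maps R UM UM" using smult_swap assms(3)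
      by (auto simp: lin_maps_def UM.smult_r_distr)
  qed (use hm assms(3) in \<open>auto intro!: UM.submod_smult[OF KK_submodule]\<close>)
qed

text \<open>The y with this property form an ideal.\<close>

lemma null_homotopic_ideal: assumes xs: "set xs \<subseteq> carrier R" and y: "y \<in> Idl (set xs)" shows "null_homotopic xs y"
proof -
  have "ideal {y \<in> carrier R. null_homotopic xs y} R"
    by (rule R.submodule_idealI) (use xs in \<open>auto intro: null_homotopic_zero null_homotopic_add null_homotopic_mult\<close>)
  hence "Idl (set xs) \<subseteq> {y \<in> carrier R. null_homotopic xs y}"
    by (rule R.genideal_minimal) (use xs null_homotopic_mem in auto)
  thus ?thesis using y by auto
qed

text \<open>This and the next property of multiplication by y pass to cones, hence from M to Koszul complexes.
  Together they are the short exact sequence \<open>0 \<rightarrow> \<Phi>/\<Psi> \<rightarrow> \<Phi>/\<Psi> \<rightarrow> \<Phi>/\<Psi>'' \<rightarrow> 0\<close>.\<close>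

definition sum_decomp where "sum_decomp \<Phi> \<Psi> \<Psi>'' y \<longleftrightarrow> (\<forall>(n::int) (i::int) f. f \<in> \<Psi>'' n i \<longleftrightarrow> (\<exists>s\<in>\<Psi> n i. \<exists>t\<in>\<Phi> n i. f = s \<oplus>\<^sub>UM y \<odot>\<^sub>UM t))"
definition injective_mod where "injective_mod \<Phi> \<Psi> y \<longleftrightarrow> (\<forall>(n::int) (i::int). \<forall>t\<in>\<Phi> n i. y \<odot>\<^sub>UM t \<in> \<Psi> n i \<longrightarrow> t \<in> \<Psi> n i)"

lemma sum_decompD: assumes "sum_decomp \<Phi> \<Psi> \<Psi>'' y"
  shows "f \<in> \<Psi>'' n i \<Longrightarrow> \<exists>s\<in>\<Psi> n i. \<exists>t\<in>\<Phi> n i. f = s \<oplus>\<^sub>UM y \<odot>\<^sub>UM t"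
    "s \<in> \<Psi> n i \<Longrightarrow> t \<in> \<Phi> n i \<Longrightarrow> s \<oplus>\<^sub>UM y \<odot>\<^sub>UM t \<in> \<Psi>'' n i"
  using assms unfolding sum_decomp_def by blast+

lemma cone_filt_sum_decomp: assumes s: "sum_decomp \<Phi> \<Psi> \<Psi>'' y" shows "sum_decomp (cone_filt \<Phi>) (cone_filt \<Psi>) (cone_filt \<Psi>'') y"
  unfolding sum_decomp_def
proof (intro allI iffI)
  fix n i f assume "f \<in> cone_filt \<Psi>'' n i"
  hence l: "lft f \<in> \<Psi>'' n i" and r: "rgt f \<in> \<Psi>'' (n - 1) (i - 1)" by (auto simp: cone_filt_iff)
  obtain s1 t1 where 1: "s1\<in>\<Psi> n i" "t1\<in>\<Phi> n i" "lft f = s1 \<oplus>\<^sub>UM y \<odot>\<^sub>UM t1" using sum_decompD(1)[OF s l] by blast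
  obtain s2 t2 where 2: "s2\<in>\<Psi> (n-1) (i-1)" "t2\<in>\<Phi> (n-1) (i-1)" "rgt f = s2 \<oplus>\<^sub>UM y \<odot>\<^sub>UM t2" using sum_decompD(1)[OF s r] by blast
  have "f = Node s1 s2 \<oplus>\<^sub>UM y \<odot>\<^sub>UM Node t1 t2" using 1 2 by - (rule node_ext, simp_all)
  thus "\<exists>s\<in>cone_filt \<Psi> n i. \<exists>t\<in>cone_filt \<Phi> n i. f = s \<oplus>\<^sub>UM y \<odot>\<^sub>UM t" using 1 2
    by (intro bexI[of _ "Node s1 s2"] bexI[of _ "Node t1 t2"]) (auto simp: cone_filt_iff)
qed (auto simp: cone_filt_iff intro: sum_decompD(2)[OF s])

lemma cone_filt_injective: "injective_mod \<Phi> \<Psi> y \<Longrightarrow> injective_mod (cone_filt \<Phi>) (cone_filt \<Psi>) y"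
  by (auto simp: injective_mod_def cone_filt_iff)

lemma base_sum_decomp: assumes Y: "submodule Y R M" and y: "y \<in> carrier R"
  shows "sum_decomp (base (carrier M)) (base Y) (base (msum Y {y \<odot>\<^sub>M z | z. z \<in> carrier M})) y"
  unfolding sum_decomp_def
proof (intro allI iffI)
  fix n i f assume f: "f \<in> base (msum Y {y \<odot>\<^sub>M z | z. z \<in> carrier M}) n i"
  show "\<exists>s\<in>base Y n i. \<exists>t\<in>base (carrier M) n i. f = s \<oplus>\<^sub>UM y \<odot>\<^sub>UM t"
  proof (cases "n = 0")
    case True
    then obtain s z where sz: "s \<in> Y" "z \<in> carrier M" "f 0 = s \<oplus>\<^sub>M y \<odot>\<^sub>M z" "\<And>k. k > 0 \<Longrightarrow> f k = \<zero>\<^sub>M"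
      using f by (auto simp: base_def msum_def)
    show ?thesis using True sz y
      by (intro bexI[of _ "\<lambda>k. if k = 0 then s else \<zero>\<^sub>M"] bexI[of _ "\<lambda>k. if k = 0 then z else \<zero>\<^sub>M"])
         (auto simp: base_def fun_mod_simps fun_eq_iff)
  next
    case False thus ?thesis using f y by (auto simp: base_def)
  qed
next
  fix n i f assume "\<exists>s\<in>base Y n i. \<exists>t\<in>base (carrier M) n i. f = s \<oplus>\<^sub>UM y \<odot>\<^sub>UM t"
  then obtain s t where "s \<in> base Y n i" "t \<in> base (carrier M) n i" "f = s \<oplus>\<^sub>UM y \<odot>\<^sub>UM t" by blast
  thus "f \<in> base (msum Y {y \<odot>\<^sub>M z | z. z \<in> carrier M}) n i"
    using y submod_carrier[OF Y] by (cases "n = 0") (auto simp: base_def msum_def fun_mod_simps)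
qed

lemma KK_sum_decomp: "submodule Y R M \<Longrightarrow> y \<in> carrier R \<Longrightarrow>
    sum_decomp (KK k (carrier M)) (KK k Y) (KK k (msum Y {y \<odot>\<^sub>M z | z. z \<in> carrier M})) y"
  by (induction k) (auto intro: base_sum_decomp cone_filt_sum_decomp)

lemma KK_injective: assumes "\<And>z. z \<in> carrier M \<Longrightarrow> y \<odot>\<^sub>M z \<in> Y \<Longrightarrow> z \<in> Y"
  shows "injective_mod (KK k (carrier M)) (KK k Y) y"
proof (induction k)
  case 0 show ?case using assms by (auto simp: injective_mod_def base_def fun_mod_simps)
qed (auto intro: cone_filt_injective)

text \<open>Multiplication by y is zero on Koszul homology. So in its long exact sequence the connecting map
  \<open>H\<^sub>n\<^sub>+\<^sub>1(K/yK) \<rightarrow> H\<^sub>n(K)\<close> is surjective.\<close>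

lemma koszul_exact_up:
  assumes xs: "set xs \<subseteq> carrier R" and Y: "submodule Y R M" and y: "y \<in> Idl (set xs)"
    and reg: "\<And>z. z \<in> carrier M \<Longrightarrow> y \<odot>\<^sub>M z \<in> Y \<Longrightarrow> z \<in> Y"
    and e: "koszul_exact xs (msum Y {y \<odot>\<^sub>M z | z. z \<in> carrier M}) (n + 1)"
  shows "koszul_exact xs Y n"
  unfolding koszul_exact_def exact_mod_def
proof (intro ballI impI)
  let ?k = "length xs" and ?d = "KD xs" and ?Y = "msum Y {y \<odot>\<^sub>M z | z. z \<in> carrier M}"
  note [simp] = differentialD[OF KD_differential[OF xs(1)]]
  have yR: "y \<in> carrier R" using R.genideal_ideal[OF xs] y ideal.Icarr by metis
  have Y'': "submodule ?Y R M" by (rule msum_submodule[OF Y smult_image_submodule[OF yR carrier_is_submodule]])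
  note s = filt_sysD[OF KK_filt_sys[OF carrier_is_submodule xs]] and t = filt_sysD[OF KK_filt_sys[OF Y xs]] and t'' = filt_sysD[OF KK_filt_sys[OF Y'' xs]]
  note sp = sum_decompD[OF KK_sum_decomp[OF Y yR]]
  obtain h where hl: "h \<in> lin_maps R UM UM" and hh: "\<And>n f. f \<in> carrier UM \<Longrightarrow> KD xs (n + 1) (h f) \<oplus>\<^sub>UM h (KD xs n f) = y \<odot>\<^sub>UM f"
    and hm: "\<And>Y n i f. submodule Y R M \<Longrightarrow> f \<in> KK (length xs) Y n i \<Longrightarrow> h f \<in> KK (length xs) Y (n + 1) i"
    using null_homotopic_ideal[OF xs y] unfolding null_homotopic_def by blast
  interpret h: lin_map R UM UM h by (intro lin_mapI UM.module_axioms hl)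
  fix w assume w: "w \<in> KK ?k (carrier M) n 0" and dw: "?d n w \<in> KK ?k Y (n - 1) 0"
  have wc: "w \<in> carrier UM" using s(6) w by auto
  have hw: "h w \<in> KK ?k (carrier M) (n + 1) 0" by (rule hm[OF carrier_is_submodule w])
  have hdw: "h (?d n w) \<in> KK ?k Y n 0" using hm[OF Y dw] by simp
  have hc: "h w \<in> carrier UM" "h (?d n w) \<in> carrier UM" using wc by auto
  have H: "?d (n + 1) (h w) = \<ominus>\<^sub>UM h (?d n w) \<oplus>\<^sub>UM y \<odot>\<^sub>UM w"
    using hh[OF wc, of n, symmetric] hc by (simp add: UM.M.move_minus)
  have "?d (n + 1) (h w) \<in> KK ?k ?Y n 0" unfolding H
    by (rule sp(2)[OF UM.submod_neg[OF t(1) hdw] w])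
  then obtain u where u: "u \<in> KK ?k (carrier M) (n + 1 + 1) 0" "h w \<ominus>\<^sub>UM ?d (n + 1 + 1) u \<in> KK ?k ?Y (n + 1) 0"
    using e hw unfolding koszul_exact_def exact_mod_def by auto
  have uc: "u \<in> carrier UM" using s(6) u by auto
  obtain p t where pt: "p \<in> KK ?k Y (n + 1) 0" "t \<in> KK ?k (carrier M) (n + 1) 0" "h w \<ominus>\<^sub>UM ?d (n + 1 + 1) u = p \<oplus>\<^sub>UM y \<odot>\<^sub>UM t"
    using sp(1)[OF u(2)] by blast
  have ptc: "p \<in> carrier UM" "t \<in> carrier UM" using s(6) t(6) pt by auto
  have "?d (n + 1) (?d (n + 1 + 1) u) = \<zero>\<^sub>UM" using differentialD(5)[OF KD_differential[OF xs(1)] uc] .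
  hence "?d (n + 1) (h w \<ominus>\<^sub>UM ?d (n + 1 + 1) u) = ?d (n + 1) (h w)" using hc uc by (simp add: UM.M.minus_zero)
  hence "?d (n + 1) (h w) = ?d (n + 1) p \<oplus>\<^sub>UM y \<odot>\<^sub>UM ?d (n + 1) t" unfolding pt(3) using ptc yR by simp
  hence "y \<odot>\<^sub>UM (w \<ominus>\<^sub>UM ?d (n + 1) t) = ?d (n + 1) p \<oplus>\<^sub>UM h (?d n w)" unfolding H
    using wc hc ptc yR by (simp add: UM.smult_r_diff UM.M.move_minus)
  also have "\<dots> \<in> KK ?k Y n 0" by (rule UM.submod_add[OF t(1) t(3)[OF pt(1)] hdw])
  finally have "w \<ominus>\<^sub>UM ?d (n + 1) t \<in> KK ?k Y n 0"
    using KK_injective[OF reg, where k = ?k] UM.submod_diff[OF s(1) w s(3)[OF pt(2)]] unfolding injective_mod_def by blast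
  thus "\<exists>w'\<in>KK ?k (carrier M) (n + 1) 0. w \<ominus>\<^sub>UM ?d (n + 1) w' \<in> KK ?k Y n 0" using pt(2) by blast
qed

text \<open>The part \<open>H\<^sub>n(K) \<rightarrow> H\<^sub>n(K/yK) \<rightarrow> H\<^sub>n\<^sub>-\<^sub>1(K)\<close> of the long exact sequence of multiplication by y.\<close>

lemma koszul_exact_down:
  assumes xs: "set xs \<subseteq> carrier R" and Y: "submodule Y R M" and yR: "y \<in> carrier R"
    and reg: "\<And>z. z \<in> carrier M \<Longrightarrow> y \<odot>\<^sub>M z \<in> Y \<Longrightarrow> z \<in> Y"
    and e: "koszul_exact xs Y n" "koszul_exact xs Y (n - 1)"
  shows "koszul_exact xs (msum Y {y \<odot>\<^sub>M z | z. z \<in> carrier M}) n"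
  unfolding koszul_exact_def exact_mod_def
proof (intro ballI impI)
  let ?k = "length xs" and ?d = "KD xs" and ?Y = "msum Y {y \<odot>\<^sub>M z | z. z \<in> carrier M}"
  note [simp] = differentialD[OF KD_differential[OF xs(1)]]
  note s = filt_sysD[OF KK_filt_sys[OF carrier_is_submodule xs]] and t = filt_sysD[OF KK_filt_sys[OF Y xs]]
  note sp = sum_decompD[OF KK_sum_decomp[OF Y yR]]
  fix w assume w: "w \<in> KK ?k (carrier M) n 0" and dw: "?d n w \<in> KK ?k ?Y (n - 1) 0"
  have wc: "w \<in> carrier UM" using s(6) w by auto
  obtain p t where pt: "p \<in> KK ?k Y (n - 1) 0" "t \<in> KK ?k (carrier M) (n - 1) 0" "?d n w = p \<oplus>\<^sub>UM y \<odot>\<^sub>UM t"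
    using sp(1)[OF dw] by blast
  have ptc: "p \<in> carrier UM" "t \<in> carrier UM" using s(6) t(6) pt by auto
  have "?d (n - 1) (?d n w) = \<zero>\<^sub>UM" using wc by simp
  hence "y \<odot>\<^sub>UM ?d (n - 1) t = \<ominus>\<^sub>UM ?d (n - 1) p" unfolding pt(3) using ptc yR by (simp add: UM.M.move_minus)
  also have "\<dots> \<in> KK ?k Y (n - 1 - 1) 0" by (rule UM.submod_neg[OF t(1) t(2)[OF pt(1)]])
  finally have "?d (n - 1) t \<in> KK ?k Y (n - 1 - 1) 0" using KK_injective[OF reg, where k = ?k] s(2)[OF pt(2)] unfolding injective_mod_def by blast
  then obtain u where u: "u \<in> KK ?k (carrier M) n 0" "t \<ominus>\<^sub>UM ?d n u \<in> KK ?k Y (n - 1) 0"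
    using e(2) pt(2) unfolding koszul_exact_def exact_mod_def by auto
  have uc: "u \<in> carrier UM" using s(6) u by auto
  have wyu: "w \<ominus>\<^sub>UM y \<odot>\<^sub>UM u \<in> KK ?k (carrier M) n 0" by (rule UM.submod_diff[OF s(1) w UM.submod_smult[OF s(1) yR u(1)]])
  have "?d n (w \<ominus>\<^sub>UM y \<odot>\<^sub>UM u) = ?d n w \<ominus>\<^sub>UM y \<odot>\<^sub>UM ?d n u" using wc uc yR by simp
  also have "\<dots> = p \<oplus>\<^sub>UM y \<odot>\<^sub>UM (t \<ominus>\<^sub>UM ?d n u)" unfolding pt(3) using ptc uc yR by (simp add: UM.smult_r_diff UM.M.move_minus)
  also have "\<dots> \<in> KK ?k Y (n - 1) 0" by (rule UM.submod_add[OF t(1) pt(1) UM.submod_smult[OF t(1) yR u(2)]])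
  finally obtain v where v: "v \<in> KK ?k (carrier M) (n + 1) 0" "(w \<ominus>\<^sub>UM y \<odot>\<^sub>UM u) \<ominus>\<^sub>UM ?d (n + 1) v \<in> KK ?k Y n 0"
    using e(1) wyu unfolding koszul_exact_def exact_mod_def by blast
  have vc: "v \<in> carrier UM" using s(6) v by auto
  have "w \<ominus>\<^sub>UM ?d (n + 1) v = ((w \<ominus>\<^sub>UM y \<odot>\<^sub>UM u) \<ominus>\<^sub>UM ?d (n + 1) v) \<oplus>\<^sub>UM y \<odot>\<^sub>UM u"
    using wc uc vc yR by (simp add: UM.M.move_minus)
  hence "w \<ominus>\<^sub>UM ?d (n + 1) v \<in> KK ?k ?Y n 0" using sp(2)[OF v(2) u(1)] by simp
  thus "\<exists>w'\<in>KK ?k (carrier M) (n + 1) 0. w \<ominus>\<^sub>UM ?d (n + 1) w' \<in> KK ?k ?Y n 0" using v(1) by blast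
qed

lemma koszul_exact_vanish: assumes "n < 0 \<or> int (length xs) < n" "set xs \<subseteq> carrier R" "submodule Y R M" shows "koszul_exact xs Y n"
  unfolding koszul_exact_def exact_mod_def
proof (intro ballI impI)
  note s = filt_sysD[OF KK_filt_sys[OF carrier_is_submodule assms(2)]] and t = filt_sysD[OF KK_filt_sys[OF assms(3,2)]]
  fix z assume "z \<in> KK (length xs) (carrier M) n 0"
  hence "z = \<zero>\<^sub>UM" using KK_vanish[OF assms(1)] by blast
  thus "\<exists>w\<in>KK (length xs) (carrier M) (n + 1) 0. z \<ominus>\<^sub>UM KD xs (n + 1) w \<in> KK (length xs) Y n 0"
    using UM.submod_zero[OF s(1)] UM.submod_zero[OF t(1)]
    by (intro bexI[of _ "\<zero>\<^sub>UM"]) (auto simp: differentialD(8)[OF KD_differential[OF assms(2)]] UM.M.minus_zero)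
qed

definition in0 where "in0 z = (\<lambda>k::nat. if k = 0 then z else \<zero>\<^sub>M)"

lemma in0_closed [simp]: "z \<in> carrier M \<Longrightarrow> in0 z \<in> carrier UM" by (simp add: in0_def fun_mod_simps)
lemma in0_base: "in0 z \<in> base Y 0 i \<longleftrightarrow> z \<in> Y" by (auto simp: in0_def base_def)
lemma base_in0: "f \<in> base Y 0 i \<Longrightarrow> \<exists>z\<in>Y. f = in0 z" by (auto simp: base_def in0_def fun_eq_iff)
lemma in0_smult: "z \<in> carrier M \<Longrightarrow> a \<in> carrier R \<Longrightarrow> a \<odot>\<^sub>UM in0 z = in0 (a \<odot>\<^sub>M z)"
  by (auto simp: in0_def fun_mod_simps fun_eq_iff)
lemma in0_add: "in0 z \<oplus>\<^sub>UM in0 w = in0 (z \<oplus>\<^sub>M w)"  if "z \<in> carrier M" "w \<in> carrier M"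
  using that by (auto simp: in0_def fun_mod_simps fun_eq_iff)

text \<open>The copies of the coefficients in the highest and the lowest degree of the Koszul complex.\<close>

definition ktop where "ktop k z = ((Node \<zero>\<^sub>UM) ^^ k) (in0 z)"
definition kbot where "kbot k z = ((\<lambda>u. Node u \<zero>\<^sub>UM) ^^ k) (in0 z)"

lemma ktop_KK: "submodule Y R M \<Longrightarrow> ktop k z \<in> KK k Y (int k) i \<longleftrightarrow> z \<in> Y"
  by (induction k arbitrary: i) (auto simp: ktop_def in0_base cone_filt_iff UM.submod_zero[OF KK_submodule])

lemma ktop_closed: "z \<in> carrier M \<Longrightarrow> ktop k z \<in> carrier UM"
  using ktop_KK[OF carrier_is_submodule] UM.submod_carrier[OF KK_submodule[OF carrier_is_submodule]] by blast

lemma ktop_smult: "z \<in> carrier M \<Longrightarrow> a \<in> carrier R \<Longrightarrow> a \<odot>\<^sub>UM ktop k z = ktop k (a \<odot>\<^sub>M z)"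
proof (induction k)
  case (Suc k) thus ?case by - (rule node_ext, simp_all add: ktop_def)
qed (simp add: ktop_def in0_smult)

lemma KD_top: assumes "set xs \<subseteq> carrier R" "submodule Y R M" "z \<in> carrier M" "\<And>x. x \<in> set xs \<Longrightarrow> x \<odot>\<^sub>M z \<in> Y"
  shows "KD xs (int (length xs)) (ktop (length xs) z) \<in> KK (length xs) Y (int (length xs) - 1) i"
  using assms(1,4)
proof (induction xs arbitrary: i rule: rev_induct)
  case Nil thus ?case using UM.submod_zero[OF KK_submodule[OF assms(2)], of 0] by (simp add: zero_diff_def)
next
  case (snoc x xs)
  have xs: "set xs \<subseteq> carrier R" using snoc by auto
  note [simp] = differentialD[OF KD_differential[OF xs]]
  have t: "ktop (Suc (length xs)) z = Node \<zero>\<^sub>UM (ktop (length xs) z)" by (simp add: ktop_def)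
  have "\<ominus>\<^sub>UM KD xs (int (length xs)) (ktop (length xs) z) \<in> KK (length xs) Y (int (length xs) - 1) j" for j
    by (rule UM.submod_neg[OF KK_submodule[OF assms(2)] snoc.IH]) (use snoc in auto)
  thus ?case using snoc.prems assms(3) ktop_closed by (simp add: t cone_filt_iff ktop_smult ktop_KK[OF assms(2)])
qed

text \<open>The element z gives a cycle in the highest degree, where zero is the only boundary.\<close>

lemma koszul_exact_top: assumes "set xs \<subseteq> carrier R" "submodule Y R M" "koszul_exact xs Y (int (length xs))" "z \<in> carrier M"
  "\<And>x. x \<in> set xs \<Longrightarrow> x \<odot>\<^sub>M z \<in> Y" shows "z \<in> Y"
proof -
  let ?k = "length xs"
  have "ktop ?k z \<in> KK ?k (carrier M) (int ?k) 0" using ktop_KK[OF carrier_is_submodule] assms(4) by blast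
  then obtain w where w: "w \<in> KK ?k (carrier M) (int ?k + 1) 0" "ktop ?k z \<ominus>\<^sub>UM KD xs (int ?k + 1) w \<in> KK ?k Y (int ?k) 0"
    using assms(3) KD_top[OF assms(1,2,4,5)] unfolding koszul_exact_def exact_mod_def by blast
  have "w = \<zero>\<^sub>UM" by (rule KK_vanish[OF _ w(1)]) simp
  hence "ktop ?k z \<in> KK ?k Y (int ?k) 0" using w(2) ktop_closed[OF assms(4)]
    by (simp add: differentialD(8)[OF KD_differential[OF assms(1)]] UM.M.minus_zero)
  thus ?thesis using ktop_KK[OF assms(2)] by blast
qed

lemma kbot_KK: "submodule Y R M \<Longrightarrow> f \<in> KK k Y 0 i \<longleftrightarrow> (\<exists>z\<in>Y. f = kbot k z)"
proof (induction k arbitrary: f i)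
  case 0 thus ?case by (auto simp: kbot_def in0_base dest: base_in0)
next
  case (Suc k)
  have "f \<in> KK (Suc k) Y 0 i \<longleftrightarrow> lft f \<in> KK k Y 0 i \<and> rgt f = \<zero>\<^sub>UM"
    using KK_vanish[of "-1" k "rgt f" Y] UM.submod_zero[OF KK_submodule[OF Suc.prems]] by (auto simp: cone_filt_iff)
  also have "\<dots> \<longleftrightarrow> (\<exists>z\<in>Y. f = kbot (Suc k) z)"
    using Suc.IH[OF Suc.prems] by (auto simp: kbot_def) (metis Node_lft_rgt)
  finally show ?case .
qed

lemma kbot_closed: "z \<in> carrier M \<Longrightarrow> kbot k z \<in> carrier UM"
  using kbot_KK[OF carrier_is_submodule] UM.submod_carrier[OF KK_submodule[OF carrier_is_submodule]] by blast

lemma kbot_smult: "z \<in> carrier M \<Longrightarrow> a \<in> carrier R \<Longrightarrow> a \<odot>\<^sub>UM kbot k z = kbot k (a \<odot>\<^sub>M z)"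
proof (induction k)
  case (Suc k) thus ?case by - (rule node_ext, simp_all add: kbot_def)
qed (simp add: kbot_def in0_smult)

lemma kbot_add: "z \<in> carrier M \<Longrightarrow> w \<in> carrier M \<Longrightarrow> kbot k z \<oplus>\<^sub>UM kbot k w = kbot k (z \<oplus>\<^sub>M w)"
proof (induction k)
  case (Suc k) thus ?case by - (rule node_ext, simp_all add: kbot_def)
qed (simp add: kbot_def in0_add)

lemma kbot_inj: "kbot k z = kbot k w \<longleftrightarrow> z = w"
proof (induction k)
  case 0 show ?case by (auto simp: kbot_def in0_def fun_eq_iff)
qed (simp add: kbot_def)

text \<open>The boundaries in degree zero.\<close>

lemma KD_image: assumes "set xs \<subseteq> carrier R"
  shows "KD xs 1 ` KK (length xs) (carrier M) 1 i = kbot (length xs) ` set_smult R M (set xs)"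
  using assms
proof (induction xs arbitrary: i rule: rev_induct)
  case Nil
  thus ?case using UM.submod_zero[OF KK_submodule[OF carrier_is_submodule, of 0]]
    by (auto simp: zero_diff_def[abs_def] set_smult_empty kbot_def base_def in0_def fun_mod_simps fun_eq_iff image_iff)
next
  case (snoc x xs)
  have xs: "set xs \<subseteq> carrier R" "x \<in> carrier R" using snoc by auto
  note [simp] = differentialD[OF KD_differential[OF xs(1)]]
  note IH = snoc.IH[OF xs(1)]
  let ?L = "set_smult R M (set xs)"
  have L: "submodule ?L R M" by (rule set_smult_submodule[OF xs(1)])
  have eq: "set_smult R M (set (xs @ [x])) = msum ?L {x \<odot>\<^sub>M z | z. z \<in> carrier M}"
    using set_smult_insert[OF xs] by simp
  have b: "kbot (Suc (length xs)) z = Node (kbot (length xs) z) \<zero>\<^sub>UM" for z by (simp add: kbot_def)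
  have d0: "KD xs 0 (kbot (length xs) z) = \<zero>\<^sub>UM" if "z \<in> carrier M" for z
  proof -
    have "kbot (length xs) z \<in> KK (length xs) (carrier M) 0 0" using kbot_KK[OF carrier_is_submodule] that by blast
    from filt_sysD(2)[OF KK_filt_sys[OF carrier_is_submodule xs(1)] this] show ?thesis by (intro KK_vanish[of "-1" "length xs" _ "carrier M" 0]) auto
  qed
  show ?case unfolding eq
  proof (intro equalityI subsetI)
    fix g assume "g \<in> KD (xs @ [x]) 1 ` KK (length (xs @ [x])) (carrier M) 1 i"
    then obtain f where f: "lft f \<in> KK (length xs) (carrier M) 1 i" "rgt f \<in> KK (length xs) (carrier M) 0 (i - 1)"
      "g = cone (KD xs) x 1 f" by (auto simp: cone_filt_iff)
    obtain z where z: "z \<in> carrier M" "rgt f = kbot (length xs) z" using f(2) kbot_KK[OF carrier_is_submodule] by blast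
    have "KD xs 1 (lft f) \<in> kbot (length xs) ` ?L" unfolding IH[of i, symmetric] by (rule imageI[OF f(1)])
    then obtain l where l': "KD xs 1 (lft f) = kbot (length xs) l" "l \<in> ?L" by (rule imageE)
    note l = l'(2,1)
    have "g = kbot (Suc (length xs)) (l \<oplus>\<^sub>M x \<odot>\<^sub>M z)" unfolding f(3) b
      by (rule node_ext) (use z l xs submod_carrier[OF L] in \<open>simp_all add: kbot_smult kbot_add d0\<close>)
    thus "g \<in> kbot (length (xs @ [x])) ` msum ?L {x \<odot>\<^sub>M z | z. z \<in> carrier M}" using l z by (auto simp: msum_def)
  next
    fix g assume "g \<in> kbot (length (xs @ [x])) ` msum ?L {x \<odot>\<^sub>M z | z. z \<in> carrier M}"
    then obtain l z where lz: "l \<in> ?L" "z \<in> carrier M" "g = kbot (Suc (length xs)) (l \<oplus>\<^sub>M x \<odot>\<^sub>M z)" by (auto simp: msum_def)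
    have "kbot (length xs) l \<in> KD xs 1 ` KK (length xs) (carrier M) 1 i" unfolding IH by (rule imageI[OF lz(1)])
    then obtain u where u': "kbot (length xs) l = KD xs 1 u" "u \<in> KK (length xs) (carrier M) 1 i" by (rule imageE)
    note u = u'(2) u'(1)[symmetric]
    have uc: "u \<in> carrier UM" using UM.submod_carrier[OF KK_submodule[OF carrier_is_submodule] u(1)] .
    have "g = KD (xs @ [x]) 1 (Node u (kbot (length xs) z))" unfolding lz(3) b
      by (rule node_ext) (use lz u uc xs submod_carrier[OF L] in \<open>simp_all add: kbot_smult kbot_add d0\<close>)
    moreover have "Node u (kbot (length xs) z) \<in> KK (length (xs @ [x])) (carrier M) 1 i"
      using u(1) lz(2) kbot_KK[OF carrier_is_submodule] by (auto simp: cone_filt_iff)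
    ultimately show "g \<in> KD (xs @ [x]) 1 ` KK (length (xs @ [x])) (carrier M) 1 i" by blast
  qed
qed

text \<open>If \<open>x z\<close> is in \<open>(xs) M\<close>, it is a boundary of the Koszul complex of xs, so z is the second half of a cycle
  of degree one of the cone. As a boundary it has its second half in \<open>(xs) M\<close>.\<close>

lemma koszul_exact_regular_last:
  assumes xs: "set xs \<subseteq> carrier R" "x \<in> carrier R" and e: "koszul_exact (xs @ [x]) {\<zero>\<^sub>M} 1"
    and z: "z \<in> carrier M" "x \<odot>\<^sub>M z \<in> set_smult R M (set xs)"
  shows "z \<in> set_smult R M (set xs)"
proof -
  let ?k = "length xs"
  note [simp] = differentialD[OF KD_differential[OF xs(1)]]
  have L: "submodule (set_smult R M (set xs)) R M" by (rule set_smult_submodule[OF xs(1)])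
  note KC = KK_submodule[OF carrier_is_submodule] and K0 = KK_submodule[OF zero_submodule]
  have "kbot ?k (x \<odot>\<^sub>M z) \<in> KD xs 1 ` KK ?k (carrier M) 1 0" unfolding KD_image[OF xs(1)] by (rule imageI[OF z(2)])
  then obtain u where u': "kbot ?k (x \<odot>\<^sub>M z) = KD xs 1 u" "u \<in> KK ?k (carrier M) 1 0" by (rule imageE)
  note u = u'(2) u'(1)[symmetric]
  have uc: "u \<in> carrier UM" and bc: "kbot ?k z \<in> carrier UM" using UM.submod_carrier[OF KC u(1)] kbot_closed z by auto
  have bz: "kbot ?k z \<in> KK ?k (carrier M) 0 i" for i using kbot_KK[OF carrier_is_submodule] z by blast
  have d0: "KD xs 0 (kbot ?k z) = \<zero>\<^sub>UM"
    using filt_sysD(2)[OF KK_filt_sys[OF carrier_is_submodule xs(1)] bz[of 0]] by (intro KK_vanish[of "-1" "length xs" _ "carrier M" 0]) auto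
  let ?f = "Node (\<ominus>\<^sub>UM u) (kbot ?k z)"
  have f: "?f \<in> KK (length (xs @ [x])) (carrier M) 1 0" using u(1) bz UM.submod_neg[OF KC] by (simp add: cone_filt_iff)
  have "KD (xs @ [x]) 1 ?f = \<zero>\<^sub>UM"
    by (rule node_ext) (use uc bc xs z u(2) kbot_closed in \<open>simp_all add: d0 kbot_smult UM.M.l_neg\<close>)
  hence "KD (xs @ [x]) 1 ?f \<in> KK (length (xs @ [x])) {\<zero>\<^sub>M} (1 - 1) 0" using UM.submod_zero[OF K0] by metis
  then obtain w where w: "w \<in> KK (length (xs @ [x])) (carrier M) (1 + 1) 0" "?f \<ominus>\<^sub>UM KD (xs @ [x]) (1 + 1) w \<in> KK (length (xs @ [x])) {\<zero>\<^sub>M} 1 0"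
    using e f unfolding koszul_exact_def exact_mod_def by blast
  have wr: "rgt w \<in> KK ?k (carrier M) 1 (-1)" using w(1) by (simp add: cone_filt_iff)
  have wc: "w \<in> carrier UM" using UM.submod_carrier[OF KC w(1)] .
  have "rgt (?f \<ominus>\<^sub>UM KD (xs @ [x]) (1 + 1) w) \<in> KK ?k {\<zero>\<^sub>M} 0 (-1)" using w(2) by (simp add: cone_filt_iff)
  moreover have "rgt (?f \<ominus>\<^sub>UM KD (xs @ [x]) (1 + 1) w) = kbot ?k z \<oplus>\<^sub>UM KD xs 1 (rgt w)"
    using uc bc wc xs differentialD(1)[OF cone_differential[OF KD_differential[OF xs(1)] xs(2)] wc] by (simp add: UM.M.minus_neg1)
  moreover have "KD xs 1 (rgt w) \<in> kbot ?k ` set_smult R M (set xs)"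
    unfolding KD_image[OF xs(1), of "-1", symmetric] by (rule imageI[OF wr])
  then obtain l where l': "KD xs 1 (rgt w) = kbot ?k l" "l \<in> set_smult R M (set xs)" by (rule imageE)
  note l = l'(2,1)
  ultimately have "kbot ?k (z \<oplus>\<^sub>M l) \<in> KK ?k {\<zero>\<^sub>M} 0 (-1)" using z(1) submod_carrier[OF L] by (simp add: kbot_add)
  hence "z \<oplus>\<^sub>M l = \<zero>\<^sub>M" using kbot_KK[OF zero_submodule] by (auto simp: kbot_inj)
  thus ?thesis using submod_cancel[OF L _ l(1) z(1)] submod_zero[OF L] by simp
qed

end

section \<open>Minimal resolutions by coordinate vectors\<close>

sublocale noeth_local \<subseteq> SF: fmodule R "self_module R"
  by (rule module.fmodule[OF SR_module])

context noeth_local begin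

text \<open>A minimal free resolution of M/L, with the free module on the finite set \<open>S n\<close> in degree n. The
  module is given as a pair because a cone keeps M and enlarges L.\<close>

definition coord_res where
  "coord_res S d \<epsilon> M L \<longleftrightarrow> (\<forall>n. finite (S n)) \<and> (\<forall>n<0. S n = {}) \<and> SF.differential d \<and>
    (\<forall>n. \<forall>f\<in>Fr (S n). d n f \<in> Fr (S (n - 1)) \<and> (\<forall>k. d n f k \<in> \<mm>)) \<and>
    (\<forall>n>0. \<forall>f\<in>Fr (S n). d n f = \<zero>\<^sub>U \<longrightarrow> f \<in> d (n + 1) ` Fr (S (n + 1))) \<and>
    \<epsilon> \<in> lin_maps R U M \<and> \<epsilon> ` Fr (S 0) = carrier M \<and>
    (\<forall>f\<in>Fr (S 0). \<epsilon> f \<in> L \<longleftrightarrow> f \<in> d 1 ` Fr (S 1))"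

lemma coord_resD: assumes "coord_res S d \<epsilon> M L"
  shows "finite (S n)" "n < 0 \<Longrightarrow> S n = {}" "SF.differential d" "f \<in> Fr (S n) \<Longrightarrow> d n f \<in> Fr (S (n - 1))"
    "f \<in> Fr (S n) \<Longrightarrow> d n f k \<in> \<mm>" "n > 0 \<Longrightarrow> f \<in> Fr (S n) \<Longrightarrow> d n f = \<zero>\<^sub>U \<Longrightarrow> f \<in> d (n + 1) ` Fr (S (n + 1))"
    "\<epsilon> \<in> lin_maps R U M" "\<epsilon> ` Fr (S 0) = carrier M" "f \<in> Fr (S 0) \<Longrightarrow> \<epsilon> f \<in> L \<longleftrightarrow> f \<in> d 1 ` Fr (S 1)"
  using assms by (auto simp: coord_res_def)

text \<open>Minimal covers of the successive kernels.\<close>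

lemma coord_res_exists:
  assumes M: "module R M" "fin_gen R M" shows "\<exists>S d \<epsilon>. coord_res S d \<epsilon> M {\<zero>\<^sub>M}"
proof -
  interpret M: module R M by fact
  obtain S0 \<epsilon> where S0: "finite S0" "\<epsilon> \<in> lin_maps R U M" "\<epsilon> ` Fr S0 = carrier M"
     and min0: "\<And>f k. f \<in> Fr S0 \<Longrightarrow> \<epsilon> f = \<zero>\<^sub>M \<Longrightarrow> f k \<in> \<mm>"
    using fin_gen_sub_minimal_cover[OF M(1) M.carrier_is_submodule M(2)[unfolded fin_gen_iff]] by metis
  interpret e: lin_map R U M \<epsilon> by (intro lin_mapI U_module M S0)
  have ker: "submodule {f \<in> Fr S. \<delta> f = \<zero>\<^sub>P} R U" if "lin_map R U P \<delta>" for S P \<delta>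
  proof -
    interpret lin_map R U P \<delta> by fact
    show ?thesis by (rule SF.UM.submodI) (auto simp: SF.UM.submod_closed[OF Fr_submodule] SF.UM.submod_carrier[OF Fr_submodule])
  qed
  define A where "A n q \<longleftrightarrow> (case q of (Z, S, \<delta>) \<Rightarrow> submodule Z R U \<and> (\<exists>T. finite T \<and> Z \<subseteq> Fr T) \<and> (\<forall>f\<in>Z. \<forall>k. f k \<in> \<mm>) \<and>
     finite S \<and> \<delta> \<in> lin_maps R U U \<and> \<delta> ` Fr S = Z \<and> (\<forall>f\<in>carrier U. \<delta> f \<in> Z) \<and> (\<forall>f\<in>Fr S. \<delta> f = \<zero>\<^sub>U \<longrightarrow> (\<forall>k. f k \<in> \<mm>)) \<and>
     (n = 0 \<longrightarrow> Z = {f \<in> Fr S0. \<epsilon> f = \<zero>\<^sub>M}))" for n :: nat and q :: "(nat \<Rightarrow> 'a) set \<times> nat set \<times> ((nat \<Rightarrow> 'a) \<Rightarrow> (nat \<Rightarrow> 'a))"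
  define B where "B (n::nat) q q' \<longleftrightarrow> (case q of (Z, S, \<delta>) \<Rightarrow> fst q' = {f \<in> Fr S. \<delta> f = \<zero>\<^sub>U})"
    for n and q q' :: "(nat \<Rightarrow> 'a) set \<times> nat set \<times> ((nat \<Rightarrow> 'a) \<Rightarrow> (nat \<Rightarrow> 'a))"
  have cover: "\<exists>S \<delta>. A n (Z, S, \<delta>)" if Z: "submodule Z R U" "finite T" "Z \<subseteq> Fr T" "\<forall>f\<in>Z. \<forall>k. f k \<in> \<mm>"
    "n = 0 \<longrightarrow> Z = {f \<in> Fr S0. \<epsilon> f = \<zero>\<^sub>M}" for Z T n
  proof -
    obtain S \<delta> where "finite (S :: nat set)" "\<delta> \<in> lin_maps R U U" "\<delta> ` Fr S = Z"
      "\<And>f. f \<in> carrier U \<Longrightarrow> \<delta> f \<in> Z" "\<And>f k. f \<in> Fr S \<Longrightarrow> \<delta> f = \<zero>\<^sub>U \<Longrightarrow> f k \<in> \<mm>"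
      using fin_gen_sub_minimal_cover[OF U_module Z(1) Fr_noetherian[OF Z(2,1,3)]] by metis
    thus ?thesis using Z by (intro exI[of _ S] exI[of _ \<delta>]) (auto simp: A_def)
  qed
  have "\<exists>q. \<forall>n. A n (q n) \<and> B n (q n) (q (Suc n))"
  proof (rule dependent_nat_choice)
    show "\<exists>q. A 0 q" using cover[OF ker[OF e.lin_map_axioms, of S0] S0(1)] min0 by blast
  next
    fix q :: "(nat \<Rightarrow> 'a) set \<times> nat set \<times> ((nat \<Rightarrow> 'a) \<Rightarrow> (nat \<Rightarrow> 'a))" and n assume A: "A n q"
    obtain Z S \<delta> where q: "q = (Z, S, \<delta>)" by (cases q)
    let ?Z = "{f \<in> Fr S. \<delta> f = \<zero>\<^sub>U}"
    have "lin_map R U U \<delta>" using A by (intro lin_mapI U_module) (simp add: A_def q)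
    hence "submodule ?Z R U" by (rule ker)
    then obtain S' \<delta>' where "A (Suc n) (?Z, S', \<delta>')" using cover[of ?Z S "Suc n"] A by (auto simp: A_def q)
    thus "\<exists>q'. A (Suc n) q' \<and> B n q q'" by (intro exI[of _ "(?Z, S', \<delta>')"]) (simp add: B_def q)
  qed
  then obtain q where A: "\<And>n. A n (q n)" and B: "\<And>n. B n (q n) (q (Suc n))" by blast
  define Z where "Z n = fst (q n)" for n
  define SS where "SS n = fst (snd (q n))" for n
  define \<delta> where "\<delta> n = snd (snd (q n))" for n
  have q: "q n = (Z n, SS n, \<delta> n)" for n by (simp add: Z_def SS_def \<delta>_def)
  have Z: "\<And>n f k. f \<in> Z n \<Longrightarrow> f k \<in> \<mm>" "\<And>n. finite (SS n)" "\<And>n. \<delta> n \<in> lin_maps R U U" "\<And>n. \<delta> n ` Fr (SS n) = Z n"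
    "\<And>n f. f \<in> carrier U \<Longrightarrow> \<delta> n f \<in> Z n" "Z 0 = {f \<in> Fr S0. \<epsilon> f = \<zero>\<^sub>M}" "\<And>n. Z (Suc n) = {f \<in> Fr (SS n). \<delta> n f = \<zero>\<^sub>U}"
    using A B unfolding A_def B_def q by auto
  define S where "S n = (if n < 0 then {} else if n = 0 then S0 else SS (nat (n - 1)))" for n :: int
  define d where "d n = (if n \<le> 0 then (\<lambda>f. \<zero>\<^sub>U) else \<delta> (nat (n - 1)))" for n :: int
  have cases: "n < 0 \<or> n = 0 \<or> n = 1 \<or> (\<exists>k. n = int k + 2)" for n
  proof (cases "n < 2")
    case False
    hence "n = int (nat (n - 2)) + 2" by simp
    thus ?thesis by blast
  qed auto
  have Spos: "S (int k + 1) = SS k" "d (int k + 1) = \<delta> k" for k by (auto simp: S_def d_def)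
  have Spos2: "S (int k + 2) = SS (Suc k)" "d (int k + 2) = \<delta> (Suc k)" for k using Spos[of "Suc k"] by (simp_all add: add.commute)
  have S1: "S 1 = SS 0" "d 1 = \<delta> 0" "S 0 = S0" using Spos[of 0] by (simp_all add: S_def)
  have dl: "d n \<in> lin_maps R U U" for n using Z(3) lin_maps_zero[OF U_module U_module] by (simp add: d_def)
  have "coord_res S d \<epsilon> M {\<zero>\<^sub>M}" unfolding coord_res_def
  proof (intro conjI allI impI ballI)
    show "finite (S n)" for n using Z(2) S0 by (simp add: S_def)
    show "S n = {}" if "n < 0" for n using that by (simp add: S_def)
    show "\<epsilon> \<in> lin_maps R U M" "\<epsilon> ` Fr (S 0) = carrier M" using S0 by (simp_all add: S1)
    show "SF.differential d" unfolding SF.differential_def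
    proof (intro allI conjI ballI dl)
      fix n f assume f: "f \<in> carrier U"
      consider "n \<le> 0" | "n = 1" | k where "n = int k + 2" using cases[of n] by fastforce
      thus "d (n - 1) (d n f) = \<zero>\<^sub>U"
      proof cases
        case (3 k)
        hence "n - 1 = int k + 1" by simp
        thus ?thesis using 3 Z(5)[OF f, of "Suc k"] Z(7)[of k] by (simp only: Spos Spos2) simp
      qed (simp_all add: d_def)
    qed
    fix n f assume f: "f \<in> Fr (S n)"
    note fc = FrD(3)[OF f]
    consider "n \<le> 0" | "n = 1" | k where "n = int k + 2" using cases[of n] by fastforce
    thus "d n f \<in> Fr (S (n - 1))"
    proof cases
      case 1 thus ?thesis by (simp add: d_def SF.UM.submod_zero[OF Fr_submodule])
    next
      case 2 thus ?thesis using Z(5)[OF fc, of 0] Z(6) by (simp add: S1)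
    next
      case (3 k)
      hence "n - 1 = int k + 1" by simp
      thus ?thesis using 3 Z(5)[OF fc, of "Suc k"] Z(7)[of k] by (simp only: Spos Spos2) simp
    qed
    show "d n f k \<in> \<mm>" for k using Z(1)[OF Z(5)[OF fc]] by (simp add: d_def fun_mod_simps)
  next
    fix n f assume n: "n > 0" and f: "f \<in> Fr (S n)" "d n f = \<zero>\<^sub>U"
    define k where "k = nat (n - 1)"
    have k: "n = int k + 1" "n + 1 = int k + 2" using n by (auto simp: k_def)
    have "f \<in> Z (Suc k)" using f Z(7) Spos[of k] by (simp add: k)
    thus "f \<in> d (n + 1) ` Fr (S (n + 1))" using Z(4)[of "Suc k"] by (simp only: k(2) Spos2)
  next
    fix f assume f: "f \<in> Fr (S 0)"
    have "\<epsilon> f \<in> {\<zero>\<^sub>M} \<longleftrightarrow> f \<in> Z 0" using Z(6) f by (simp add: S1)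
    thus "\<epsilon> f \<in> {\<zero>\<^sub>M} \<longleftrightarrow> f \<in> d 1 ` Fr (S 1)" using Z(4)[of 0] by (simp only: S1)
  qed
  thus ?thesis by blast
qed

lemma FM_zero: "\<zero>\<^sub>(FM S) = \<zero>\<^sub>U" by (simp add: FM_def)

lemma coord_res_min_res:
  assumes c: "coord_res S d \<epsilon> M L" and M: "module R M" and P: "module R P" and \<pi>: "\<pi> \<in> lin_maps R M P" "\<pi> ` carrier M = carrier P"
    "\<And>z. z \<in> carrier M \<Longrightarrow> \<pi> z = \<zero>\<^sub>P \<longleftrightarrow> z \<in> L"
  shows "minimal_free_resolution R \<mm> P (\<lambda>n. FM (S n)) d"
proof -
  note D = coord_resD[OF c] and dD = SF.differentialD[OF coord_resD(3)[OF c]]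
  have "min_res P (\<lambda>n. FM (S n)) d (\<lambda>f. \<pi> (\<epsilon> f))" unfolding min_res_def
  proof (intro conjI allI ballI impI)
    fix n
    show "module R (FM (S n))" by (rule FM_module)
    show "fin_gen_free R (FM (S n))" by (rule FM_free[OF D(1)])
    show "carrier (FM (S n)) = {\<zero>\<^sub>(FM (S n))}" if "n < 0" using D(2)[OF that] by (simp add: Fr_empty)
    show "d n \<in> lin_maps R (FM (S n)) (FM (S (n - 1)))"
      unfolding lin_maps_def using D(4) dD(2,3) by (auto simp: FM_def FrD(3))
    fix f assume "f \<in> carrier (FM (S n))"
    hence f: "f \<in> Fr (S n)" by simp
    show "d (n - 1) (d n f) = \<zero>\<^sub>(FM (S (n - 2)))" unfolding FM_zero by (rule dD(4)[OF FrD(3)[OF f]])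
    show "d n f \<in> W (FM (S (n - 1))) 1" using D(4,5)[OF f] by (simp add: W_FM[OF D(1)])
    { assume "0 < n" "d n f = \<zero>\<^sub>(FM (S (n - 1)))"
      thus "f \<in> d (n + 1) ` carrier (FM (S (n + 1)))" using D(6)[OF _ f] unfolding FM_zero by simp }
  next
    have "\<epsilon> \<in> lin_maps R (FM (S 0)) M" using lin_mapsD[OF D(7)] unfolding lin_maps_def by (auto simp: FM_def FrD(3))
    thus "(\<lambda>f. \<pi> (\<epsilon> f)) \<in> lin_maps R (FM (S 0)) P" by (rule lin_maps_comp[OF _ \<pi>(1)])
    show "(\<lambda>f. \<pi> (\<epsilon> f)) ` carrier (FM (S 0)) = carrier P" using D(8) \<pi>(2) by (simp add: image_image[symmetric])
    have "\<pi> (\<epsilon> f) = \<zero>\<^sub>P \<longleftrightarrow> f \<in> d 1 ` Fr (S 1)" if "f \<in> Fr (S 0)" for f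
      using \<pi>(3)[of "\<epsilon> f"] D(9)[OF that] D(8) that by auto
    moreover have "d 1 ` Fr (S 1) \<subseteq> Fr (S 0)" using D(4)[of _ 1] by auto
    ultimately show "{x \<in> carrier (FM (S 0)). \<pi> (\<epsilon> x) = \<zero>\<^sub>P} = d 1 ` carrier (FM (S 1))" by auto
  qed
  thus ?thesis unfolding min_res_iff by blast
qed

text \<open>The filtration whose associated graded complex is the linear part; FS' is its next step.\<close>

definition FS where "FS S n i = {f \<in> Fr (S n). \<forall>k. f k \<in> mp (nat (i - n))}" for n i :: int
definition FS' where "FS' S n i = FS S n (i + 1)" for n i :: int

lemma FS_W: "finite (S n) \<Longrightarrow> FS S n i = W (FM (S n)) (nat (i - n))"
  by (simp add: FS_def W_FM)

lemma FS_submodule: "submodule (FS S n i) R U"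
proof (rule SF.UM.submodI)
  show "FS S n i \<subseteq> carrier U" using FrD(3) by (auto simp: FS_def)
  show "\<zero>\<^sub>U \<in> FS S n i" using SF.UM.submod_zero[OF Fr_submodule] by (simp add: FS_def fun_mod_simps mp_closed(1))
  fix a b assume "a \<in> FS S n i" "b \<in> FS S n i"
  thus "a \<oplus>\<^sub>U b \<in> FS S n i" using SF.UM.submod_add[OF Fr_submodule, of a "S n" b] by (simp add: FS_def fun_mod_simps mp_closed(2))
next
  fix a b assume "a \<in> carrier R" "b \<in> FS S n i"
  thus "a \<odot>\<^sub>U b \<in> FS S n i" using SF.UM.submod_smult[OF Fr_submodule, of a b "S n"] by (simp add: FS_def fun_mod_simps mp_closed(3))
qed

lemma FS_Fr: "f \<in> FS S n i \<Longrightarrow> f \<in> Fr (S n)" by (simp add: FS_def)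

lemma FS_mono: "i \<le> j \<Longrightarrow> FS S n j \<subseteq> FS S n i"
  unfolding FS_def using mp_antimono[of "nat (i - n)" "nat (j - n)"] nat_mono[of "i - n" "j - n"] by (auto simp: subset_iff)

lemma FS_filt_sys: assumes c: "coord_res S d \<epsilon> M L" shows "SF.filt_sys (FS S) d \<mm>"
  unfolding SF.filt_sys_def
proof (intro allI conjI ballI FS_submodule)
  note D = coord_resD[OF c] and dD = SF.differentialD[OF coord_resD(3)[OF c]]
  fix n i f assume f: "f \<in> FS S n i"
  have dl: "d n \<in> lin_maps R (FM (S n)) (FM (S (n - 1)))"
    unfolding lin_maps_def using D(4) dD(2,3) by (auto simp: FM_def FrD(3))
  have "d n f \<in> W (FM (S (n - 1))) (nat (i - n) + 1)"
    by (rule W_lin[OF FM_module FM_module dl]) (use D(4,5) f in \<open>auto simp: W_FM D(1) FS_W\<close>)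
  moreover have "nat (i - (n - 1)) \<le> nat (i - n) + 1" by auto
  ultimately show "d n f \<in> FS S (n - 1) i" unfolding FS_W[OF D(1)] using W_antimono[OF FM_module] by blast
  fix x assume x: "x \<in> \<mm>"
  have "x \<odot>\<^sub>(FM (S n)) f \<in> W (FM (S n)) (Suc (nat (i - n)))"
    by (rule W_mult1[OF FM_module x]) (use f in \<open>simp add: FS_W D(1)\<close>)
  moreover have "nat (i + 1 - n) \<le> Suc (nat (i - n))" by auto
  ultimately have "x \<odot>\<^sub>(FM (S n)) f \<in> FS S n (i + 1)" unfolding FS_W[OF D(1)] using W_antimono[OF FM_module] by blast
  thus "x \<odot>\<^sub>U f \<in> FS S n (i + 1)" by (simp add: FM_def)
qed

lemma FS'_filt_sys: "coord_res S d \<epsilon> M L \<Longrightarrow> SF.filt_sys (FS' S) d \<mm>"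
  using FS_filt_sys[of S d \<epsilon> M L] unfolding SF.filt_sys_def FS'_def by blast

lemma FM_diff: assumes "f \<in> Fr S" "g \<in> Fr S" shows "f \<ominus>\<^sub>(FM S) g = f \<ominus>\<^sub>U g"
  using assms FrD(3)[OF assms(2)] by (simp add: a_minus_def SF.fun_mod_neg) (simp add: fun_mod_simps FrD)

text \<open>The index here is \<open>i = n + p\<close>; for \<open>i < n\<close> the two steps of the filtration agree.\<close>

lemma lin_exact_iff: assumes c: "coord_res S d \<epsilon> M L"
  shows "lin_exact (\<lambda>n. FM (S n)) d n \<longleftrightarrow> (\<forall>i. SF.exact_mod (FS S) (FS' S) d n i)"
proof
  note D = coord_resD[OF c] and dD = SF.differentialD[OF coord_resD(3)[OF c]]
  note W = FS_W[OF D(1)]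
  have d1: "d (n + 1) w \<in> Fr (S n)" if "w \<in> Fr (S (n + 1))" for w using D(4)[OF that] by simp
  { assume l: "lin_exact (\<lambda>n. FM (S n)) d n"
    show "\<forall>i. SF.exact_mod (FS S) (FS' S) d n i" unfolding SF.exact_mod_def FS'_def
    proof (intro allI ballI impI)
      fix i z assume z: "z \<in> FS S n i" and dz: "d n z \<in> FS S (n - 1) (i + 1)"
      show "\<exists>w\<in>FS S (n + 1) i. z \<ominus>\<^sub>U d (n + 1) w \<in> FS S n (i + 1)"
      proof (cases "i < n")
        case True
        hence "FS S n i = FS S n (i + 1)" by (simp add: FS_def)
        thus ?thesis using z SF.UM.submod_zero[OF FS_submodule] FrD(3)[OF FS_Fr[OF z]]
          by (intro bexI[of _ "\<zero>\<^sub>U"]) (auto simp: dD(8) SF.UM.M.minus_zero)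
      next
        case False
        define p where "p = nat (i - n)"
        have p: "nat (i - n) = p" "nat (i + 1 - (n - 1)) = p + 2" "nat (i - (n + 1)) = p - 1" "nat (i + 1 - n) = p + 1"
          using False by (auto simp: p_def)
        obtain w where w: "w \<in> FS S (n + 1) i" "z \<ominus>\<^sub>(FM (S n)) d (n + 1) w \<in> FS S n (i + 1)"
          using l z dz unfolding lin_exact_def W p by blast
        thus ?thesis using FM_diff[OF FS_Fr[OF z] d1[OF FS_Fr[OF w(1)]]] by auto
      qed
    qed }
  { assume e: "\<forall>i. SF.exact_mod (FS S) (FS' S) d n i"
    show "lin_exact (\<lambda>n. FM (S n)) d n" unfolding lin_exact_def
    proof (intro allI ballI impI)
      fix p z assume z: "z \<in> W (FM (S n)) p" and dz: "d n z \<in> W (FM (S (n - 1))) (p + 2)"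
      have p: "nat (n + int p - n) = p" "nat (n + int p + 1 - (n - 1)) = p + 2" "nat (n + int p - (n + 1)) = p - 1" "nat (n + int p + 1 - n) = p + 1"
        by (auto simp: nat_diff_distrib)
      have z': "z \<in> FS S n (n + int p)" using z unfolding W p .
      obtain w where w: "w \<in> FS S (n + 1) (n + int p)" "z \<ominus>\<^sub>U d (n + 1) w \<in> FS S n (n + int p + 1)"
        using e[rule_format, of "n + int p"] z dz unfolding SF.exact_mod_def FS'_def W p by blast
      have "z \<ominus>\<^sub>(FM (S n)) d (n + 1) w \<in> FS S n (n + int p + 1)"
        using w(2) FM_diff[OF FS_Fr[OF z'] d1[OF FS_Fr[OF w(1)]]] by simp
      thus "\<exists>w\<in>W (FM (S (n + 1))) (p - 1). z \<ominus>\<^sub>(FM (S n)) d (n + 1) w \<in> W (FM (S n)) (p + 1)" using w(1) unfolding W p by blast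
    qed }
qed

definition cone_idx :: "(int \<Rightarrow> nat set) \<Rightarrow> int \<Rightarrow> nat set" where
  "cone_idx S n = (\<lambda>k. 2 * k) ` S n \<union> (\<lambda>k. 2 * k + 1) ` S (n - 1)"

lemma Fr_cone_idx: "f \<in> Fr (cone_idx S n) \<longleftrightarrow> lft f \<in> Fr (S n) \<and> rgt f \<in> Fr (S (n - 1))"
proof -
  have e: "(\<forall>k. P k) \<longleftrightarrow> (\<forall>k. P (2 * k)) \<and> (\<forall>k. P (2 * k + 1))" for P :: "nat \<Rightarrow> bool"
    by (metis oddE evenE)
  have m: "2 * k \<in> cone_idx S n \<longleftrightarrow> k \<in> S n" "2 * k + 1 \<in> cone_idx S n \<longleftrightarrow> k \<in> S (n - 1)" for k
    unfolding cone_idx_def by (auto dest: arg_cong[of _ _ even])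
  show ?thesis unfolding Fr_def mem_Collect_eq fun_mod_simps e[of "\<lambda>k. f k \<in> _"] e[of "\<lambda>k. k \<notin> _ \<longrightarrow> _ k"] m lft_def rgt_def by auto
qed

lemma FS_cone_idx: "FS (cone_idx S) = cone_filt (FS S)"
proof (rule ext, rule ext, rule Set.set_eqI)
  fix n i f
  have e: "(\<forall>k. P k) \<longleftrightarrow> (\<forall>k. P (2 * k)) \<and> (\<forall>k. P (2 * k + 1))" for P :: "nat \<Rightarrow> bool"
    by (metis oddE evenE)
  show "f \<in> FS (cone_idx S) n i \<longleftrightarrow> f \<in> cone_filt (FS S) n i"
    unfolding FS_def cone_filt_iff mem_Collect_eq Fr_cone_idx e[of "\<lambda>k. f k \<in> _"] by (auto simp: lft_def rgt_def)
qed

lemma FS'_cone_idx: "FS' (cone_idx S) = cone_filt (FS' S)"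
proof (rule ext, rule ext, rule Set.set_eqI)
  fix n i f
  show "f \<in> FS' (cone_idx S) n i \<longleftrightarrow> f \<in> cone_filt (FS' S) n i" unfolding FS'_def FS_cone_idx cone_filt_iff by simp
qed

lemma FS_cone_idxs: "FS ((cone_idx ^^ k) S) = cone_filts k (FS S)" "FS' ((cone_idx ^^ k) S) = cone_filts k (FS' S)"
  by (induction k) (simp_all add: FS_cone_idx FS'_cone_idx)

text \<open>As x is regular on M/L, the long exact sequence of the cone leaves no homology in positive degrees. The
  cone is minimal because x is in \<open>\<mm>\<close>.\<close>

lemma coord_res_cone:
  assumes M: "module R M" and c: "coord_res S d \<epsilon> M L" and L: "submodule L R M" and x: "x \<in> \<mm>"
    and reg: "\<And>z. z \<in> carrier M \<Longrightarrow> x \<odot>\<^sub>M z \<in> L \<Longrightarrow> z \<in> L"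
  shows "coord_res (cone_idx S) (SF.cone d x) (\<lambda>f. \<epsilon> (lft f)) M (module.msum M L {x \<odot>\<^sub>M z | z. z \<in> carrier M})"
proof -
  interpret M: module R M by fact
  note D = coord_resD[OF c] and dD [simp] = SF.differentialD[OF coord_resD(3)[OF c]]
  interpret e: lin_map R U M \<epsilon> by (intro lin_mapI U_module M D(7))
  have xR: "x \<in> carrier R" using x mm.Icarr by simp
  note Frm = SF.UM.submod_add[OF Fr_submodule] SF.UM.submod_neg[OF Fr_submodule] SF.UM.submod_diff[OF Fr_submodule]
  have Frx: "x \<odot>\<^sub>U f \<in> Fr T" if "f \<in> Fr T" for f T using SF.UM.submod_smult[OF Fr_submodule xR that] .
  have Fr0: "\<zero>\<^sub>U \<in> Fr T" for T using SF.UM.submod_zero[OF Fr_submodule] .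
  have Fm: "f \<in> Fr (S (-1)) \<Longrightarrow> f = \<zero>\<^sub>U" for f using D(2)[of "-1"] by (simp add: Fr_empty fun_mod_simps)
  show ?thesis unfolding coord_res_def
  proof (intro conjI allI impI ballI)
    show "finite (cone_idx S n)" for n using D(1) by (simp add: cone_idx_def)
    show "cone_idx S n = {}" if "n < 0" for n using that D(2) by (simp add: cone_idx_def)
    show "SF.differential (SF.cone d x)" by (rule SF.cone_differential[OF D(3) xR])
    have "lft \<in> lin_maps R U U" by (auto simp: lin_maps_def)
    thus "(\<lambda>f. \<epsilon> (lft f)) \<in> lin_maps R U M" by (rule lin_maps_comp[OF _ D(7)])
    show "(\<lambda>f. \<epsilon> (lft f)) ` Fr (cone_idx S 0) = carrier M"
    proof
      show "carrier M \<subseteq> (\<lambda>f. \<epsilon> (lft f)) ` Fr (cone_idx S 0)"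
      proof
        fix z assume "z \<in> carrier M"
        then obtain u where "u \<in> Fr (S 0)" "z = \<epsilon> u" using D(8) by blast
        thus "z \<in> (\<lambda>f. \<epsilon> (lft f)) ` Fr (cone_idx S 0)" using Fr0 by (intro image_eqI[of _ _ "Node u \<zero>\<^sub>U"]) (simp_all add: Fr_cone_idx)
      qed
    qed (auto simp: Fr_cone_idx D(8)[symmetric])
  next
    fix n f assume "f \<in> Fr (cone_idx S n)"
    hence f: "lft f \<in> Fr (S n)" "rgt f \<in> Fr (S (n - 1))" by (auto simp: Fr_cone_idx)
    show "SF.cone d x n f \<in> Fr (cone_idx S (n - 1))" unfolding Fr_cone_idx
      using D(4)[OF f(1)] D(4)[OF f(2)] Frx[OF f(2)] by (auto intro: Frm)
    fix k
    have "\<ominus> (d (n - 1) (rgt f) j) \<in> \<mm>" "d n (lft f) j \<oplus> x \<otimes> rgt f j \<in> \<mm>" for j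
      using D(5)[OF f(1), of j] D(5)[OF f(2), of j] x FrD(1)[OF f(2), of j] by (auto intro: mm.I_r_closed)
    moreover have "\<ominus>\<^sub>U d (n - 1) (rgt f) = (\<lambda>j. \<ominus> (d (n - 1) (rgt f) j))"
      using FrD(3)[OF D(4)[OF f(2)]] by (subst SF.fun_mod_neg) (auto simp: fun_mod_simps)
    ultimately show "SF.cone d x n f k \<in> \<mm>" by (simp add: SF.cone_def Node_def fun_mod_simps)
  next
    fix n f assume n: "n > 0" and "f \<in> Fr (cone_idx S n)" and z: "SF.cone d x n f = \<zero>\<^sub>U"
    hence f: "lft f \<in> Fr (S n)" "rgt f \<in> Fr (S (n - 1))" by (auto simp: Fr_cone_idx)
    have fc: "lft f \<in> carrier U" "rgt f \<in> carrier U" using f FrD(3) by auto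
    have z1: "d n (lft f) \<oplus>\<^sub>U x \<odot>\<^sub>U rgt f = \<zero>\<^sub>U" using arg_cong[OF z, of lft] by simp
    have z2: "d (n - 1) (rgt f) = \<zero>\<^sub>U" using arg_cong[OF z, of rgt] fc by (simp add: SF.UM.M.neg_eq)
    have "rgt f \<in> d n ` Fr (S n)"
    proof (cases "n = 1")
      case True
      have r: "rgt f \<in> Fr (S 0)" using f(2) True by simp
      have "d 1 (lft f) \<in> Fr (S 0)" using D(4)[OF f(1)] True by simp
      hence "\<epsilon> (d 1 (lft f)) \<in> L" using D(9) f(1) True by blast
      moreover have "x \<odot>\<^sub>U rgt f = \<ominus>\<^sub>U d 1 (lft f)" using z1 fc xR True by (simp add: SF.UM.M.move_minus)
      hence "\<epsilon> (x \<odot>\<^sub>U rgt f) = \<epsilon> (\<ominus>\<^sub>U d 1 (lft f))" by (rule arg_cong)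
      hence "x \<odot>\<^sub>M \<epsilon> (rgt f) = \<ominus>\<^sub>M \<epsilon> (d 1 (lft f))" using fc xR by simp
      ultimately have "x \<odot>\<^sub>M \<epsilon> (rgt f) \<in> L" using M.submod_neg[OF L] by simp
      hence "\<epsilon> (rgt f) \<in> L" using reg fc(2) by simp
      thus ?thesis using D(9)[OF r] True by simp
    next
      case False thus ?thesis using D(6)[OF _ f(2) z2] n by simp
    qed
    then obtain v' where v': "v' \<in> Fr (S n)" "rgt f = d n v'" by blast
    have v'c: "v' \<in> carrier U" using FrD(3) v' by blast
    have "d n (lft f \<oplus>\<^sub>U x \<odot>\<^sub>U v') = \<zero>\<^sub>U" using z1 fc v'c xR by (simp add: v'(2))
    moreover have u': "lft f \<oplus>\<^sub>U x \<odot>\<^sub>U v' \<in> Fr (S n)" by (rule Frm(1)[OF f(1) Frx[OF v'(1)]])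
    ultimately obtain w where w: "w \<in> Fr (S (n + 1))" "lft f \<oplus>\<^sub>U x \<odot>\<^sub>U v' = d (n + 1) w" using D(6)[OF n] by blast
    have wc: "w \<in> carrier U" using FrD(3) w by blast
    have "lft f = d (n + 1) w \<ominus>\<^sub>U x \<odot>\<^sub>U v'" using w(2) fc v'c wc xR by (simp add: SF.UM.M.move_minus)
    hence "f = SF.cone d x (n + 1) (Node w (\<ominus>\<^sub>U v'))"
      using v'c v'(2) xR wc by - (rule node_ext, simp_all add: SF.UM.smult_r_minus SF.UM.M.move_minus)
    moreover have "Node w (\<ominus>\<^sub>U v') \<in> Fr (cone_idx S (n + 1))" using w(1) Frm(2)[OF v'(1)] by (simp add: Fr_cone_idx)
    ultimately show "f \<in> SF.cone d x (n + 1) ` Fr (cone_idx S (n + 1))" by blast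
  next
    fix f assume "f \<in> Fr (cone_idx S 0)"
    hence f: "lft f \<in> Fr (S 0)" "rgt f = \<zero>\<^sub>U" using Fm by (auto simp: Fr_cone_idx)
    let ?L = "M.msum L {x \<odot>\<^sub>M z | z. z \<in> carrier M}"
    have fc: "lft f \<in> carrier U" using FrD(3)[OF f(1)] .
    show "\<epsilon> (lft f) \<in> ?L \<longleftrightarrow> f \<in> SF.cone d x 1 ` Fr (cone_idx S 1)"
    proof
      assume "\<epsilon> (lft f) \<in> ?L"
      then obtain l z where lz: "l \<in> L" "z \<in> carrier M" "\<epsilon> (lft f) = l \<oplus>\<^sub>M x \<odot>\<^sub>M z" by (auto simp: M.msum_def)
      obtain b where b: "b \<in> Fr (S 0)" "z = \<epsilon> b" using lz(2) D(8) by blast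
      have bc: "b \<in> carrier U" using FrD(3)[OF b(1)] .
      have "\<epsilon> (lft f \<ominus>\<^sub>U x \<odot>\<^sub>U b) = l" using lz b bc fc xR M.submod_carrier[OF L lz(1)] by (simp add: M.M.move_minus)
      moreover have "lft f \<ominus>\<^sub>U x \<odot>\<^sub>U b \<in> Fr (S 0)" by (rule Frm(3)[OF f(1) Frx[OF b(1)]])
      ultimately obtain a where a: "a \<in> Fr (S 1)" "lft f \<ominus>\<^sub>U x \<odot>\<^sub>U b = d 1 a" using D(9) lz(1) by blast
      have ac: "a \<in> carrier U" using FrD(3)[OF a(1)] .
      have "d 0 b = \<zero>\<^sub>U" using D(4)[OF b(1)] Fm by simp
      moreover have "lft f = d 1 a \<oplus>\<^sub>U x \<odot>\<^sub>U b" using a(2) fc ac bc xR by (simp add: SF.UM.M.move_minus)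
      ultimately have "f = SF.cone d x 1 (Node a b)" using f(2) by - (rule node_ext, simp_all)
      moreover have "Node a b \<in> Fr (cone_idx S 1)" using a b by (simp add: Fr_cone_idx)
      ultimately show "f \<in> SF.cone d x 1 ` Fr (cone_idx S 1)" by blast
    next
      assume "f \<in> SF.cone d x 1 ` Fr (cone_idx S 1)"
      then obtain g where g: "lft g \<in> Fr (S 1)" "rgt g \<in> Fr (S 0)" "f = SF.cone d x 1 g" by (auto simp: Fr_cone_idx)
      have gc: "lft g \<in> carrier U" "rgt g \<in> carrier U" using g FrD(3) by auto
      have "d 1 (lft g) \<in> Fr (S 0)" using D(4)[OF g(1)] by simp
      hence "\<epsilon> (d 1 (lft g)) \<in> L" using D(9) g(1) by blast
      moreover have "\<epsilon> (lft f) = \<epsilon> (d 1 (lft g)) \<oplus>\<^sub>M x \<odot>\<^sub>M \<epsilon> (rgt g)" using gc xR by (simp add: g(3))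
      moreover have "\<epsilon> (rgt g) \<in> carrier M" using gc by simp
      ultimately show "\<epsilon> (lft f) \<in> ?L" unfolding M.msum_def by blast
    qed
  qed
qed

lemma coord_res_cones:
  assumes M: "module R M" and c: "coord_res S d \<epsilon> M {\<zero>\<^sub>M}" and xs: "set xs \<subseteq> \<mm>"
    and reg: "\<And>i z. i < length xs \<Longrightarrow> z \<in> carrier M \<Longrightarrow>
     xs ! i \<odot>\<^sub>M z \<in> set_smult R M (set (take i xs)) \<Longrightarrow> z \<in> set_smult R M (set (take i xs))"
  shows "\<exists>\<eta>. coord_res ((cone_idx ^^ length xs) S) (SF.cones d xs) \<eta> M (set_smult R M (set xs))"
  using xs reg
proof (induction xs rule: rev_induct)
  case Nil
  interpret M: module R M by fact
  show ?case using c by (auto simp: M.set_smult_empty)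
next
  case (snoc x xs)
  interpret M: module R M by fact
  have xR: "set xs \<subseteq> carrier R" "x \<in> carrier R" "x \<in> \<mm>" using snoc.prems(1) mm.a_subset by auto
  have "\<exists>\<eta>. coord_res ((cone_idx ^^ length xs) S) (SF.cones d xs) \<eta> M (set_smult R M (set xs))"
  proof (rule snoc.IH)
    fix i z assume "i < length xs" "z \<in> carrier M" "xs ! i \<odot>\<^sub>M z \<in> set_smult R M (set (take i xs))"
    thus "z \<in> set_smult R M (set (take i xs))" using snoc.prems(2)[of i z] by (simp add: nth_append)
  qed (use snoc.prems in auto)
  then obtain \<eta> where "coord_res ((cone_idx ^^ length xs) S) (SF.cones d xs) \<eta> M (set_smult R M (set xs))" by blast
  from coord_res_cone[OF M this M.set_smult_submodule[OF xR(1)] xR(3)] snoc.prems(2)[of "length xs"]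
  have "coord_res (cone_idx ((cone_idx ^^ length xs) S)) (SF.cone (SF.cones d xs) x) (\<lambda>f. \<eta> (lft f)) M (set_smult R M (insert x (set xs)))"
    by (simp add: M.set_smult_insert[OF xR(1,2)])
  thus ?case by auto
qed

end

section \<open>The associated graded ring and its modules\<close>

context noeth_local begin

abbreviation gq where "gq M i \<equiv> gr_comp R \<mm> M i"
text \<open>The class of z in \<open>\<mm>\<^sup>i M/\<mm>\<^sup>i\<^sup>+\<^sup>1 M\<close>.\<close>

definition gc where "gc M i z = W M (Suc i) +>\<^bsub>M\<^esub> z"
abbreviation "SR \<equiv> self_module R"
abbreviation "cls M j z \<equiv> gr_class R \<mm> M j z"

context
  fixes M :: "('a, 'm, 'q) module_scheme"
  assumes M: "module R M"
begin

interpretation M: module R M by (rule M)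

lemma Wi_module: "module R (M\<lparr>carrier := W M i\<rparr>)" by (rule M.submodule_module[OF W_submodule[OF M]])
lemma Wi_sub: "submodule (W M (Suc i)) R (M\<lparr>carrier := W M i\<rparr>)"
  unfolding M.submodule_update_iff[OF W_submodule[OF M]] using W_submodule[OF M] W_Suc_sub[OF M] by blast

lemma gq_module: "module R (gq M i)" unfolding gr_comp_def by (rule module.quot_module_module[OF Wi_module Wi_sub])

lemma gq_carrier: "X \<in> carrier (gq M i) \<longleftrightarrow> (\<exists>z\<in>W M i. X = gc M i z)"
  unfolding gr_comp_def gc_def using module.quot_carrier[OF Wi_module] by simp

lemma gq_zero: "\<zero>\<^sub>(gq M i) = W M (Suc i)" by (simp add: gr_comp_def module.quot_simps(3)[OF Wi_module])
lemma gq_add: "z \<in> W M i \<Longrightarrow> w \<in> W M i \<Longrightarrow> gc M i z \<oplus>\<^sub>(gq M i) gc M i w = gc M i (z \<oplus>\<^sub>M w)"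
  unfolding gr_comp_def gc_def using module.quot_simps(1)[OF Wi_module Wi_sub] by simp
lemma gc_in: "z \<in> W M i \<Longrightarrow> gc M i z \<in> carrier (gq M i)" unfolding gq_carrier by blast

lemma gc_eq: "z \<in> carrier M \<Longrightarrow> w \<in> carrier M \<Longrightarrow> gc M i z = gc M i w \<longleftrightarrow> z \<ominus>\<^sub>M w \<in> W M (Suc i)"
  unfolding gc_def by (rule M.coset_eq[OF W_submodule[OF M]])
lemma gc_zero_iff: "z \<in> carrier M \<Longrightarrow> gc M i z = W M (Suc i) \<longleftrightarrow> z \<in> W M (Suc i)"
  unfolding gc_def by (rule M.coset_eq_H[OF W_submodule[OF M]])
lemma gc_mem: "z \<in> carrier M \<Longrightarrow> w \<in> gc M i z \<longleftrightarrow> w \<in> carrier M \<and> w \<ominus>\<^sub>M z \<in> W M (Suc i)"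
  unfolding gc_def by (rule M.coset_mem[OF W_submodule[OF M]])
lemma gc_self: "z \<in> carrier M \<Longrightarrow> z \<in> gc M i z"
  unfolding gc_def by (rule M.coset_self[OF W_submodule[OF M]])

abbreviation "DD \<equiv> direct_sum (gr_comp R \<mm> M)"

lemma DD_module: "module R DD" by (rule direct_sum_module[OF is_cring gq_module])

lemma DD_reps: assumes "f \<in> carrier DD"
  obtains z where "\<And>i. z i \<in> W M i" "\<And>i. f i = gc M i (z i)" "finite {i. f i \<noteq> W M (Suc i)}"
proof -
  have "\<forall>i. \<exists>z. z \<in> W M i \<and> f i = gc M i z" using assms by (auto simp: gq_carrier)
  then obtain z where "\<And>i. z i \<in> W M i" "\<And>i. f i = gc M i (z i)" by metis
  thus thesis using assms by (intro that[of z]) (auto simp: gq_zero)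
qed

lemma DD_I: assumes "\<And>i. z i \<in> W M i" "finite {i. z i \<notin> W M (Suc i)}"
  shows "(\<lambda>i. gc M i (z i)) \<in> carrier DD"
proof -
  have "{i. gc M i (z i) \<noteq> W M (Suc i)} \<subseteq> {i. z i \<notin> W M (Suc i)}" using gc_zero_iff W_carrier[OF M assms(1)] by blast
  thus ?thesis using assms by (auto simp: gq_zero gq_carrier intro: finite_subset)
qed

lemma cls_eq: "cls M j z = (\<lambda>i. if i = j then gc M j z else W M (Suc i))"
  by (simp add: gr_class_def gc_def gq_zero fun_eq_iff)

lemma cls_closed: assumes "z \<in> W M j" shows "cls M j z \<in> carrier DD"
proof -
  have "{i. cls M j z i \<noteq> W M (Suc i)} \<subseteq> {j}" by (auto simp: cls_eq)
  hence "finite {i. cls M j z i \<noteq> W M (Suc i)}" by (rule finite_subset) simp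
  moreover have "W M (Suc i) \<in> carrier (gq M i)" for i
    using gc_in[of "\<zero>\<^sub>M" i] M.submod_zero[OF W_submodule[OF M]] by (metis gc_zero_iff M.zero_closed)
  ultimately show ?thesis using assms gc_in by (auto simp: gq_zero cls_eq)
qed

lemma cls_zero: assumes "z \<in> W M (Suc j)" shows "cls M j z = \<zero>\<^sub>DD"
  using gc_zero_iff[OF W_carrier[OF M assms], of j] assms by (auto simp: cls_eq gq_zero fun_eq_iff)

lemma cls_add: "z \<in> W M j \<Longrightarrow> w \<in> W M j \<Longrightarrow> cls M j (z \<oplus>\<^sub>M w) = cls M j z \<oplus>\<^sub>DD cls M j w"
proof -
  have "W M (Suc i) \<oplus>\<^sub>(gq M i) W M (Suc i) = W M (Suc i)" for i
  proof -
    interpret Q: module R "gq M i" by (rule gq_module)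
    show ?thesis using Q.M.l_zero[OF Q.M.zero_closed] by (simp add: gq_zero)
  qed
  moreover assume "z \<in> W M j" "w \<in> W M j"
  ultimately show ?thesis by (auto simp: cls_eq gq_add fun_eq_iff)
qed

text \<open>The highest component is removed first.\<close>

lemma homogeneous_induct:
  assumes f: "f \<in> carrier DD" and h: "\<And>j z. z \<in> W M j \<Longrightarrow> P (cls M j z)"
    and a: "\<And>f g. f \<in> carrier DD \<Longrightarrow> g \<in> carrier DD \<Longrightarrow> P f \<Longrightarrow> P g \<Longrightarrow> P (f \<oplus>\<^sub>DD g)"
  shows "P f"
proof -
  interpret Q: module R "gq M q" for q by (rule gq_module)
  have "P f" if "f \<in> carrier DD" "\<forall>i\<ge>N. f i = W M (Suc i)" for N f using that
  proof (induction N arbitrary: f)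
    case 0
    hence "f = cls M 0 \<zero>\<^sub>M" by (auto simp: cls_zero M.submod_zero[OF W_submodule[OF M]] gq_zero)
    thus ?case using h[of "\<zero>\<^sub>M" 0] by (simp add: M.submod_zero[OF W_submodule[OF M]])
  next
    case (Suc N)
    obtain z where z: "z \<in> W M N" "f N = gc M N z" using Suc.prems(1) by (auto simp: gq_carrier)
    let ?g = "f(N := W M (Suc N))"
    have "{i. ?g i \<noteq> W M (Suc i)} \<subseteq> {i. f i \<noteq> W M (Suc i)}" by auto
    hence fin: "finite {i. ?g i \<noteq> W M (Suc i)}" by (rule finite_subset) (use Suc.prems(1) in \<open>simp add: gq_zero\<close>)
    have g: "?g \<in> carrier DD" using Suc.prems(1) fin Q.M.zero_closed by (auto simp: gq_zero)
    have "P ?g" by (rule Suc.IH[OF g]) (use Suc.prems(2) in auto)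
    moreover have "f = ?g \<oplus>\<^sub>DD cls M N z"
    proof (rule ext)
      fix i show "f i = (?g \<oplus>\<^sub>DD cls M N z) i"
        using Q.M.l_zero[of "f i" i] Q.M.r_zero[of "f i" i] Suc.prems(1) z by (auto simp: cls_eq gq_zero)
    qed
    ultimately show ?case using a[OF g cls_closed[OF z(1)] _ h[OF z(1)]] by simp
  qed
  moreover obtain N where "\<forall>i\<ge>N. f i = W M (Suc i)"
  proof -
    have "finite {i. f i \<noteq> W M (Suc i)}" using f by (simp add: gq_zero)
    then obtain N where "\<forall>i\<in>{i. f i \<noteq> W M (Suc i)}. i < N" using finite_nat_set_iff_bounded by blast
    thus ?thesis using that[of N] by force
  qed
  ultimately show ?thesis using f by blast
qed

end

lemma WS_sub: "W SR n = mp n" by (rule W_self)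

abbreviation "gS \<equiv> gc SR"

lemmas gS_mem = gc_mem[OF SR_module, unfolded WS_sub]
lemmas gS_zero_iff = gc_zero_iff[OF SR_module, unfolded WS_sub]
lemmas gS_self = gc_self[OF SR_module]

abbreviation "DS \<equiv> direct_sum (gr_comp R \<mm> SR)"

context
  fixes M :: "('a, 'm, 'q) module_scheme"
  assumes M: "module R M"
begin

interpretation M: module R M by (rule M)

text \<open>The union in the definition of the graded multiplication is a single coset.\<close>

lemma prod_term: assumes a: "a \<in> mp j" and z: "z \<in> W M k"
  shows "(\<Union>a'\<in>gS j a. \<Union>z'\<in>gc M k z. W M (Suc (j + k)) +>\<^bsub>M\<^esub> (a' \<odot>\<^sub>M z')) = gc M (j + k) (a \<odot>\<^sub>M z)"
proof -
  have ac: "a \<in> carrier R" and zc: "z \<in> carrier M" using mp_carrier a W_carrier[OF M z] by auto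
  have "gc M (j + k) (a' \<odot>\<^sub>M z') = gc M (j + k) (a \<odot>\<^sub>M z)" if "a' \<in> gS j a" "z' \<in> gc M k z" for a' z'
  proof -
    have a': "a' \<in> carrier R" "a' \<ominus> a \<in> mp (Suc j)" using that(1) gS_mem[of a a' j] ac by auto
    have z': "z' \<in> carrier M" "z' \<ominus>\<^sub>M z \<in> W M (Suc k)" using that(2) gc_mem[OF M zc] by auto
    have zW: "z' \<in> W M k"
    proof -
      have "z' = (z' \<ominus>\<^sub>M z) \<oplus>\<^sub>M z" using z' zc by (simp add: M.M.move_minus)
      thus ?thesis using M.submod_add[OF W_submodule[OF M] W_Suc_sub[OF M z'(2)] z] by simp
    qed
    have "(a' \<ominus> a) \<odot>\<^sub>M z' = a' \<odot>\<^sub>M z' \<ominus>\<^sub>M a \<odot>\<^sub>M z'" using a' ac z'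
      by (simp add: a_minus_def M.smult_l_distr M.smult_l_minus)
    hence "a' \<odot>\<^sub>M z' \<ominus>\<^sub>M a \<odot>\<^sub>M z = (a' \<ominus> a) \<odot>\<^sub>M z' \<oplus>\<^sub>M a \<odot>\<^sub>M (z' \<ominus>\<^sub>M z)"
      using a' ac z' zc by (simp add: M.smult_r_diff M.M.move_minus)
    moreover have "(a' \<ominus> a) \<odot>\<^sub>M z' \<in> W M (Suc (j + k))" using W_mult[OF M a'(2) zW] by simp
    moreover have "a \<odot>\<^sub>M (z' \<ominus>\<^sub>M z) \<in> W M (Suc (j + k))" using W_mult[OF M a z'(2)] by simp
    ultimately have "a' \<odot>\<^sub>M z' \<ominus>\<^sub>M a \<odot>\<^sub>M z \<in> W M (Suc (j + k))" using M.submod_add[OF W_submodule[OF M]] by simp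
    thus ?thesis using a' ac z' zc by (simp add: gc_eq[OF M])
  qed
  moreover have "a \<in> gS j a" "z \<in> gc M k z" using gS_self[of a] gc_self[OF M] ac zc by auto
  ultimately show ?thesis unfolding gc_def[symmetric] by blast
qed

lemma gr_smult_eq:
  assumes "\<And>j. a j \<in> mp j" "\<And>j. f j = gS j (a j)" "\<And>j. z j \<in> W M j" "\<And>j. g j = gc M j (z j)"
  shows "gr_smult R \<mm> M f g i = (\<Oplus>\<^bsub>gq M i\<^esub>j\<in>{..i}. gc M i (a j \<odot>\<^sub>M z (i - j)))"
proof -
  interpret Q: module R "gq M q" for q by (rule gq_module[OF M])
  have W: "a j \<odot>\<^sub>M z (i - j) \<in> W M i" if "j \<le> i" for j using W_mult[OF M assms(1)[of j] assms(3)[of "i - j"]] that by simp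
  have eqj: "(\<Union>a\<in>f j. \<Union>z\<in>g (i - j). W M (Suc i) +>\<^bsub>M\<^esub> a \<odot>\<^sub>M z) = gc M i (a j \<odot>\<^sub>M z (i - j))" if "j \<le> i" for j
    using prod_term[OF assms(1)[of j] assms(3)[of "i - j"]] that by (simp add: assms(2,4))
  show ?thesis unfolding gr_smult_def
    by (rule Q.M.finsum_cong') (use eqj W gc_in[OF M] in auto)
qed

lemma S_reps: assumes "f \<in> carrier DS"
  obtains z where "\<And>i. z i \<in> mp i" "\<And>i. f i = gS i (z i)" "finite {i. f i \<noteq> mp (Suc i)}"
  using DD_reps[OF SR_module assms] unfolding WS_sub by metis

lemma gr_smult_closed: assumes f: "f \<in> carrier DS" and g: "g \<in> carrier (direct_sum (gr_comp R \<mm> M))"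
  shows "gr_smult R \<mm> M f g \<in> carrier (direct_sum (gr_comp R \<mm> M))"
proof -
  interpret Q: module R "gq M q" for q by (rule gq_module[OF M])
  obtain a where a: "\<And>i. a i \<in> mp i" "\<And>i. f i = gS i (a i)" "finite {i. f i \<noteq> mp (Suc i)}" by (rule S_reps[OF f]) (rule that)
  obtain z where z: "\<And>i. z i \<in> W M i" "\<And>i. g i = gc M i (z i)" "finite {i. g i \<noteq> W M (Suc i)}" by (rule DD_reps[OF M g]) (rule that)
  note eq = gr_smult_eq[OF a(1,2) z(1,2)]
  have W: "a j \<odot>\<^sub>M z (i - j) \<in> W M i" if "j \<le> i" for i j using W_mult[OF M a(1)[of j] z(1)[of "i - j"]] that by simp
  obtain J where J: "\<And>j. j \<ge> J \<Longrightarrow> f j = mp (Suc j)" using a(3) finite_nat_set_iff_bounded by (metis (mono_tags, lifting) leD mem_Collect_eq)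
  obtain K where K: "\<And>j. j \<ge> K \<Longrightarrow> g j = W M (Suc j)" using z(3) finite_nat_set_iff_bounded by (metis (mono_tags, lifting) leD mem_Collect_eq)
  have az: "a j \<in> mp (Suc j)" if "j \<ge> J" for j using J[OF that] a(2) gS_zero_iff[of "a j" j] mp_carrier[OF a(1)[of j]] by simp
  have zz: "z j \<in> W M (Suc j)" if "j \<ge> K" for j using K[OF that] z(2) gc_zero_iff[OF M] W_carrier[OF M z(1)[of j]] by simp
  have "gr_smult R \<mm> M f g i = W M (Suc i)" if "i \<ge> J + K" for i
  proof -
    have z0: "gc M i (a j \<odot>\<^sub>M z (i - j)) = \<zero>\<^sub>(gq M i)" if j: "j \<in> {..i}" for j
    proof -
      have "a j \<odot>\<^sub>M z (i - j) \<in> W M (Suc i)"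
      proof (cases "j \<ge> J")
        case True thus ?thesis using W_mult[OF M az[OF True] z(1)[of "i - j"]] j by simp
      next
        case False
        hence "i - j \<ge> K" using \<open>i \<ge> J + K\<close> by simp
        thus ?thesis using W_mult[OF M a(1)[of j] zz] j by (metis add_Suc_right le_add_diff_inverse atMost_iff)
      qed
      thus ?thesis using gc_zero_iff[OF M W_carrier[OF M]] gq_zero[OF M] by simp
    qed
    have "(\<Oplus>\<^bsub>gq M i\<^esub>j\<in>{..i}. gc M i (a j \<odot>\<^sub>M z (i - j))) = (\<Oplus>\<^bsub>gq M i\<^esub>j\<in>{..i}. \<zero>\<^sub>(gq M i))"
      by (rule Q.M.finsum_cong') (auto simp: z0)
    thus ?thesis unfolding eq gq_zero[OF M, symmetric] by simp
  qed
  hence "{i. gr_smult R \<mm> M f g i \<noteq> W M (Suc i)} \<subseteq> {..<J + K}" by force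
  hence "finite {i. gr_smult R \<mm> M f g i \<noteq> W M (Suc i)}" by (rule finite_subset) simp
  moreover have "gr_smult R \<mm> M f g i \<in> carrier (gq M i)" for i unfolding eq
    by (rule Q.M.finsum_closed) (use W gc_in[OF M] in auto)
  ultimately show ?thesis by (simp add: gq_zero[OF M])
qed

lemma gr_smult_l_distr: assumes f: "f \<in> carrier DS" "f' \<in> carrier DS" and g: "g \<in> carrier (direct_sum (gr_comp R \<mm> M))"
  shows "gr_smult R \<mm> M (f \<oplus>\<^sub>DS f') g = gr_smult R \<mm> M f g \<oplus>\<^bsub>direct_sum (gr_comp R \<mm> M)\<^esub> gr_smult R \<mm> M f' g"
proof
  fix i
  interpret Q: module R "gq M q" for q by (rule gq_module[OF M])
  obtain a where a: "\<And>i. a i \<in> mp i" "\<And>i. f i = gS i (a i)" "finite {i. f i \<noteq> mp (Suc i)}" by (rule S_reps[OF f(1)]) (rule that)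
  obtain b where b: "\<And>i. b i \<in> mp i" "\<And>i. f' i = gS i (b i)" "finite {i. f' i \<noteq> mp (Suc i)}" by (rule S_reps[OF f(2)]) (rule that)
  obtain z where z: "\<And>i. z i \<in> W M i" "\<And>i. g i = gc M i (z i)" "finite {i. g i \<noteq> W M (Suc i)}" by (rule DD_reps[OF M g]) (rule that)
  have ab: "(f \<oplus>\<^sub>DS f') j = gS j (a j \<oplus> b j)" for j
    using gq_add[OF SR_module, of "a j" j "b j"] a b WS_sub by simp
  have W: "a j \<odot>\<^sub>M z (i - j) \<in> W M i" "b j \<odot>\<^sub>M z (i - j) \<in> W M i" if "j \<le> i" for j
    using W_mult[OF M a(1)[of j] z(1)[of "i - j"]] W_mult[OF M b(1)[of j] z(1)[of "i - j"]] that by simp_all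
  have "gr_smult R \<mm> M (f \<oplus>\<^sub>DS f') g i = (\<Oplus>\<^bsub>gq M i\<^esub>j\<in>{..i}. gc M i ((a j \<oplus> b j) \<odot>\<^sub>M z (i - j)))"
    by (rule gr_smult_eq[OF mp_closed(2)[OF a(1) b(1)] ab z(1,2)])
  also have "\<dots> = (\<Oplus>\<^bsub>gq M i\<^esub>j\<in>{..i}. gc M i (a j \<odot>\<^sub>M z (i - j)) \<oplus>\<^sub>(gq M i) gc M i (b j \<odot>\<^sub>M z (i - j)))"
    by (rule Q.M.finsum_cong') (use W gc_in[OF M] mp_carrier[OF a(1)] mp_carrier[OF b(1)] W_carrier[OF M z(1)] in
      \<open>auto simp: gq_add[OF M] M.smult_l_distr\<close>)
  also have "\<dots> = gr_smult R \<mm> M f g i \<oplus>\<^sub>(gq M i) gr_smult R \<mm> M f' g i"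
    unfolding gr_smult_eq[OF a(1,2) z(1,2)] gr_smult_eq[OF b(1,2) z(1,2)]
    by (rule Q.M.finsum_addf) (use W gc_in[OF M] in auto)
  finally show "gr_smult R \<mm> M (f \<oplus>\<^sub>DS f') g i = (gr_smult R \<mm> M f g \<oplus>\<^bsub>direct_sum (gr_comp R \<mm> M)\<^esub> gr_smult R \<mm> M f' g) i" by simp
qed

lemma gr_smult_r_distr: assumes f: "f \<in> carrier DS" and g: "g \<in> carrier (direct_sum (gr_comp R \<mm> M))" "g' \<in> carrier (direct_sum (gr_comp R \<mm> M))"
  shows "gr_smult R \<mm> M f (g \<oplus>\<^bsub>direct_sum (gr_comp R \<mm> M)\<^esub> g') = gr_smult R \<mm> M f g \<oplus>\<^bsub>direct_sum (gr_comp R \<mm> M)\<^esub> gr_smult R \<mm> M f g'"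
proof
  fix i
  interpret Q: module R "gq M q" for q by (rule gq_module[OF M])
  obtain a where a: "\<And>i. a i \<in> mp i" "\<And>i. f i = gS i (a i)" "finite {i. f i \<noteq> mp (Suc i)}" by (rule S_reps[OF f(1)]) (rule that)
  obtain z where z: "\<And>i. z i \<in> W M i" "\<And>i. g i = gc M i (z i)" "finite {i. g i \<noteq> W M (Suc i)}" by (rule DD_reps[OF M g(1)]) (rule that)
  obtain w where w: "\<And>i. w i \<in> W M i" "\<And>i. g' i = gc M i (w i)" "finite {i. g' i \<noteq> W M (Suc i)}" by (rule DD_reps[OF M g(2)]) (rule that)
  have zw: "(g \<oplus>\<^bsub>direct_sum (gr_comp R \<mm> M)\<^esub> g') j = gc M j (z j \<oplus>\<^sub>M w j)" for j
    using gq_add[OF M, of "z j" j "w j"] z w by simp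
  have W: "a j \<odot>\<^sub>M z (i - j) \<in> W M i" "a j \<odot>\<^sub>M w (i - j) \<in> W M i" if "j \<le> i" for j
    using W_mult[OF M a(1)[of j] z(1)[of "i - j"]] W_mult[OF M a(1)[of j] w(1)[of "i - j"]] that by simp_all
  have "gr_smult R \<mm> M f (g \<oplus>\<^bsub>direct_sum (gr_comp R \<mm> M)\<^esub> g') i = (\<Oplus>\<^bsub>gq M i\<^esub>j\<in>{..i}. gc M i (a j \<odot>\<^sub>M (z (i - j) \<oplus>\<^sub>M w (i - j))))"
    by (rule gr_smult_eq[OF a(1,2) M.submod_add[OF W_submodule[OF M] z(1) w(1)] zw])
  also have "\<dots> = (\<Oplus>\<^bsub>gq M i\<^esub>j\<in>{..i}. gc M i (a j \<odot>\<^sub>M z (i - j)) \<oplus>\<^sub>(gq M i) gc M i (a j \<odot>\<^sub>M w (i - j)))"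
    by (rule Q.M.finsum_cong') (use W gc_in[OF M] mp_carrier[OF a(1)] W_carrier[OF M z(1)] W_carrier[OF M w(1)] in
      \<open>auto simp: gq_add[OF M] M.smult_r_distr\<close>)
  also have "\<dots> = gr_smult R \<mm> M f g i \<oplus>\<^sub>(gq M i) gr_smult R \<mm> M f g' i"
    unfolding gr_smult_eq[OF a(1,2) z(1,2)] gr_smult_eq[OF a(1,2) w(1,2)]
    by (rule Q.M.finsum_addf) (use W gc_in[OF M] in auto)
  finally show "gr_smult R \<mm> M f (g \<oplus>\<^bsub>direct_sum (gr_comp R \<mm> M)\<^esub> g') i = (gr_smult R \<mm> M f g \<oplus>\<^bsub>direct_sum (gr_comp R \<mm> M)\<^esub> gr_smult R \<mm> M f g') i" by simp
qed

lemma gr_smult_cls_comp: assumes a: "a \<in> mp j" and z: "\<And>i. z i \<in> W M i" "\<And>i. g i = gc M i (z i)"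
  shows "gr_smult R \<mm> M (cls SR j a) g i = (if j \<le> i then gc M i (a \<odot>\<^sub>M z (i - j)) else W M (Suc i))"
proof -
  interpret Q: module R "gq M q" for q by (rule gq_module[OF M])
  define b where "b l = (if l = j then a else \<zero>)" for l
  have b: "b l \<in> mp l" "cls SR j a l = gS l (b l)" for l
    using a gS_zero_iff[of \<zero> l] by (auto simp: b_def mp_closed cls_eq[OF SR_module] WS_sub)
  have "gr_smult R \<mm> M (cls SR j a) g i = (\<Oplus>\<^bsub>gq M i\<^esub>l\<in>{..i}. gc M i (b l \<odot>\<^sub>M z (i - l)))"
    by (rule gr_smult_eq[OF b z])
  also have "\<dots> = (\<Oplus>\<^bsub>gq M i\<^esub>l\<in>{..i}. if j = l then gc M i (a \<odot>\<^sub>M z (i - j)) else \<zero>\<^sub>(gq M i))"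
  proof (rule Q.M.finsum_cong')
    have W: "a \<odot>\<^sub>M z (i - j) \<in> W M i" if "j \<le> i" using W_mult[OF M a z(1)[of "i - j"]] that by simp
    show "(\<lambda>l. if j = l then gc M i (a \<odot>\<^sub>M z (i - j)) else \<zero>\<^sub>(gq M i)) \<in> {..i} \<rightarrow> carrier (gq M i)"
      using W gc_in[OF M] by auto
    fix l assume "l \<in> {..i}"
    have "gc M i \<zero>\<^sub>M = \<zero>\<^sub>(gq M i)" using gc_zero_iff[OF M] M.submod_zero[OF W_submodule[OF M]] gq_zero[OF M] by simp
    thus "gc M i (b l \<odot>\<^sub>M z (i - l)) = (if j = l then gc M i (a \<odot>\<^sub>M z (i - j)) else \<zero>\<^sub>(gq M i))"
      using W_carrier[OF M z(1)] by (simp add: b_def)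
  qed simp
  also have "\<dots> = (if j \<le> i then gc M i (a \<odot>\<^sub>M z (i - j)) else W M (Suc i))"
  proof (cases "j \<le> i")
    case True
    hence "a \<odot>\<^sub>M z (i - j) \<in> W M i" using W_mult[OF M a z(1)[of "i - j"]] by simp
    hence "gc M i (a \<odot>\<^sub>M z (i - j)) \<in> carrier (gq M i)" by (rule gc_in[OF M])
    thus ?thesis using True Q.M.finsum_singleton[of j "{..i}" "\<lambda>l. gc M i (a \<odot>\<^sub>M z (i - j))" i] by simp
  next
    case False
    hence "(\<Oplus>\<^bsub>gq M i\<^esub>l\<in>{..i}. if j = l then gc M i (a \<odot>\<^sub>M z (i - j)) else \<zero>\<^sub>(gq M i)) = (\<Oplus>\<^bsub>gq M i\<^esub>l\<in>{..i}. \<zero>\<^sub>(gq M i))"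
      by (intro Q.M.finsum_cong') auto
    thus ?thesis using False by (simp add: gq_zero[OF M, symmetric])
  qed
  finally show ?thesis .
qed

lemma gr_smult_cls: assumes a: "a \<in> mp j" and w: "w \<in> W M k"
  shows "gr_smult R \<mm> M (cls SR j a) (cls M k w) = cls M (j + k) (a \<odot>\<^sub>M w)"
proof
  fix i
  define z where "z l = (if l = k then w else \<zero>\<^sub>M)" for l
  have ac: "a \<in> carrier R" using mp_carrier a by auto
  have g0: "gc M l \<zero>\<^sub>M = W M (Suc l)" for l using gc_zero_iff[OF M] M.submod_zero[OF W_submodule[OF M]] by simp
  have z: "z l \<in> W M l" "cls M k w l = gc M l (z l)" for l
    using w g0 by (auto simp: z_def M.submod_zero[OF W_submodule[OF M]] cls_eq[OF M])
  show "gr_smult R \<mm> M (cls SR j a) (cls M k w) i = cls M (j + k) (a \<odot>\<^sub>M w) i"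
    using gr_smult_cls_comp[OF a z, of i] ac by (auto simp: z_def g0 cls_eq[OF M, of "j + k"])
qed

end

abbreviation "GR \<equiv> gr_ring R \<mm>"
abbreviation "GM M \<equiv> gr_module R \<mm> M"

lemma GR_simps: "carrier GR = carrier DS" "add GR = add DS" "zero GR = zero DS" "monoid.mult GR = gr_smult R \<mm> SR"
  "one GR = cls SR 0 \<one>"
  by (simp_all add: gr_ring_def Let_def)

lemma GM_simps: "carrier (GM M) = carrier (direct_sum (gr_comp R \<mm> M))" "add (GM M) = add (direct_sum (gr_comp R \<mm> M))"
  "zero (GM M) = zero (direct_sum (gr_comp R \<mm> M))" "smult (GM M) = gr_smult R \<mm> M"
  by (simp_all add: gr_module_def Let_def)

lemma abelian_group_transfer:
  assumes "abelian_group G" "carrier H = carrier G" "add H = add G" "zero H = zero G" shows "abelian_group H"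
proof -
  interpret G: abelian_group G by fact
  show ?thesis by (rule abelian_groupI) (auto simp: assms(2-4) G.a_ac intro!: bexI[of _ "\<ominus>\<^sub>G x" for x] G.l_neg)
qed

text \<open>Both sides are additive in each argument, so homogeneous elements suffice.\<close>

lemma gr_assoc: assumes M: "module R M" and f: "f \<in> carrier DS" "f' \<in> carrier DS" and g: "g \<in> carrier (direct_sum (gr_comp R \<mm> M))"
  shows "gr_smult R \<mm> M (gr_smult R \<mm> SR f f') g = gr_smult R \<mm> M f (gr_smult R \<mm> M f' g)"
proof -
  interpret M: module R M by fact
  note cl = gr_smult_closed[OF SR_module] gr_smult_closed[OF M]
  note lin = gr_smult_l_distr[OF SR_module] gr_smult_r_distr[OF SR_module] gr_smult_l_distr[OF M] gr_smult_r_distr[OF M]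
  note cS = cls_closed[OF SR_module, unfolded WS_sub] and cM = cls_closed[OF M]
  note DSI = homogeneous_induct[OF SR_module, unfolded WS_sub]
  show ?thesis using f(1)
  proof (rule DSI)
    fix j a assume a: "a \<in> mp j"
    show "gr_smult R \<mm> M (gr_smult R \<mm> SR (cls SR j a) f') g = gr_smult R \<mm> M (cls SR j a) (gr_smult R \<mm> M f' g)" using f(2)
    proof (rule DSI)
      fix k b assume b: "b \<in> mp k"
      show "gr_smult R \<mm> M (gr_smult R \<mm> SR (cls SR j a) (cls SR k b)) g = gr_smult R \<mm> M (cls SR j a) (gr_smult R \<mm> M (cls SR k b) g)"
        using g
      proof (rule homogeneous_induct[OF M])
        fix l z assume z: "z \<in> W M l"
        show "gr_smult R \<mm> M (gr_smult R \<mm> SR (cls SR j a) (cls SR k b)) (cls M l z) = gr_smult R \<mm> M (cls SR j a) (gr_smult R \<mm> M (cls SR k b) (cls M l z))"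
          using a b z mp_carrier[OF a] mp_carrier[OF b] W_carrier[OF M z] gr_smult_cls[OF SR_module a, of b k] mp_mult[OF a b] W_mult[OF M b z]
          by (simp add: gr_smult_cls[OF M] WS_sub M.smult_assoc1 add.assoc)
      qed (use a b in \<open>simp add: lin cl cS del: direct_sum_simps\<close>)
    qed (use a g in \<open>simp add: lin cl cS del: direct_sum_simps\<close>)
  qed (use f g in \<open>simp add: lin cl del: direct_sum_simps\<close>)
qed

lemma gr_comm: assumes f: "f \<in> carrier DS" "f' \<in> carrier DS"
  shows "gr_smult R \<mm> SR f f' = gr_smult R \<mm> SR f' f"
proof -
  interpret D: module R DS by (rule DD_module[OF SR_module])
  note cl = gr_smult_closed[OF SR_module]
  note lin = gr_smult_l_distr[OF SR_module] gr_smult_r_distr[OF SR_module]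
  note cS = cls_closed[OF SR_module, unfolded WS_sub]
  note DSI = homogeneous_induct[OF SR_module, unfolded WS_sub]
  show ?thesis using f(1)
  proof (rule DSI)
    fix j a assume a: "a \<in> mp j"
    show "gr_smult R \<mm> SR (cls SR j a) f' = gr_smult R \<mm> SR f' (cls SR j a)" using f(2)
    proof (rule DSI)
      fix k b assume b: "b \<in> mp k"
      show "gr_smult R \<mm> SR (cls SR j a) (cls SR k b) = gr_smult R \<mm> SR (cls SR k b) (cls SR j a)"
        using a b mp_carrier[OF a] mp_carrier[OF b] gr_smult_cls[OF SR_module a, of b k] gr_smult_cls[OF SR_module b, of a j]
        by (simp add: WS_sub m_comm[of a b] add.commute)
    qed (use a in \<open>simp add: lin cS del: direct_sum_simps\<close>)
  qed (use f in \<open>simp add: lin del: direct_sum_simps\<close>)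
qed

lemma gr_one: assumes M: "module R M" and g: "g \<in> carrier (direct_sum (gr_comp R \<mm> M))"
  shows "gr_smult R \<mm> M (cls SR 0 \<one>) g = g"
proof -
  interpret M: module R M by fact
  obtain z where z: "\<And>i. z i \<in> W M i" "\<And>i. g i = gc M i (z i)" "finite {i. g i \<noteq> W M (Suc i)}" by (rule DD_reps[OF M g]) (rule that)
  have "\<one> \<in> mp 0" by simp
  show ?thesis by (rule ext) (simp add: gr_smult_cls_comp[OF M \<open>\<one> \<in> mp 0\<close> z(1,2)] z(2) W_carrier[OF M z(1)])
qed

lemma GR_cring: "cring GR"
proof (rule cringI)
  note cl = gr_smult_closed[OF SR_module]
  have one: "cls SR 0 \<one> \<in> carrier DS" by (rule cls_closed[OF SR_module]) (simp add: WS_sub)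
  show "abelian_group GR"
    by (rule abelian_group_transfer[OF module.axioms(2)[OF DD_module[OF SR_module]]]) (simp_all add: GR_simps)
  show "Group.comm_monoid GR"
  proof (rule comm_monoidI)
    show "x \<otimes>\<^bsub>GR\<^esub> y = y \<otimes>\<^bsub>GR\<^esub> x" if "x \<in> carrier GR" "y \<in> carrier GR" for x y
      using gr_comm[of x y] that by (simp add: GR_simps del: direct_sum_simps)
  qed (simp_all add: GR_simps cl one gr_assoc[OF SR_module] gr_one[OF SR_module] del: direct_sum_simps)
qed (simp add: GR_simps gr_smult_l_distr[OF SR_module] del: direct_sum_simps)

lemma GM_module: assumes M: "module R M" shows "module GR (GM M)"
proof (rule moduleI[OF GR_cring])
  show "abelian_group (GM M)"
    by (rule abelian_group_transfer[OF module.axioms(2)[OF DD_module[OF M]]]) (simp_all add: GM_simps)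
qed (simp_all add: GM_simps GR_simps gr_smult_closed[OF M] gr_smult_l_distr[OF M] gr_smult_r_distr[OF M] gr_assoc[OF M] gr_one[OF M] del: direct_sum_simps)

end

section \<open>Chains of stable families\<close>

context noeth_local begin

text \<open>Such a family spans a graded submodule of the Rees module. Families of this kind replace homogeneous
  submodules of the associated graded module, and no representatives have to be chosen.\<close>

definition stable where "stable M Y \<longleftrightarrow> (\<forall>p::nat. submodule (Y p) R M \<and> Y p \<subseteq> W M p \<and> (\<forall>t\<in>\<mm>. \<forall>z\<in>Y p. t \<odot>\<^sub>M z \<in> Y (Suc p)))"

definition acc_above where "acc_above M \<Psi> \<longleftrightarrow> (\<forall>Ys. (\<forall>j::nat. stable M (Ys j) \<and> (\<forall>p. \<Psi> p \<subseteq> Ys j p \<and> Ys j p \<subseteq> Ys (Suc j) p)) \<longrightarrow>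
   (\<exists>j0. \<forall>j\<ge>j0. Ys j = Ys j0))"

lemma stableD: assumes "stable M Y" shows "submodule (Y p) R M" "Y p \<subseteq> W M p" "t \<in> \<mm> \<Longrightarrow> z \<in> Y p \<Longrightarrow> t \<odot>\<^sub>M z \<in> Y (Suc p)"
  using assms by (auto simp: stable_def)

lemma stable_mp: assumes M: "module R M" and Y: "stable M Y" and a: "a \<in> mp k" and z: "z \<in> Y p"
  shows "a \<odot>\<^sub>M z \<in> Y (p + k)"
proof -
  interpret M: module R M by fact
  note YD = stableD[OF Y]
  show ?thesis using a z
  proof (induction k arbitrary: a z p)
    case 0 thus ?case using M.submod_smult[OF YD(1)] by simp
  next
    case (Suc k)
    have zc: "z \<in> carrier M" using M.submod_carrier[OF YD(1) Suc.prems(2)] .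
    from Suc.prems(1) show ?case unfolding mp_Suc
    proof (induct a rule: ideal_prod.induct)
      case (prod i j)
      have ij: "i \<in> carrier R" "j \<in> carrier R" using prod mp_carrier mm.Icarr by auto
      have "i \<odot>\<^sub>M (j \<odot>\<^sub>M z) \<in> Y (Suc p + k)" by (rule Suc.IH[OF prod(1) YD(3)[OF prod(2) Suc.prems(2)]])
      thus ?case using ij zc by (simp add: M.smult_assoc1)
    next
      case (sum x y)
      have xy: "x \<in> carrier R" "y \<in> carrier R" using sum mp_carrier[of _ "Suc k"] by (auto simp: mp_Suc)
      thus ?case using sum M.submod_add[OF YD(1)] zc by (simp add: M.smult_l_distr)
    qed
  qed
qed

lemma acc_aboveD: "acc_above M \<Psi> \<Longrightarrow> (\<And>j::nat. stable M (Ys j)) \<Longrightarrow> (\<And>j p. \<Psi> p \<subseteq> Ys j p) \<Longrightarrow> (\<And>j p. Ys j p \<subseteq> Ys (Suc j) p) \<Longrightarrow>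
   \<exists>j0. \<forall>j\<ge>j0. Ys j = Ys j0"
  unfolding acc_above_def by blast

text \<open>The power \<open>\<mm>\<^sup>p\<^sup>-\<^sup>1 M\<close>, and zero for \<open>p = 0\<close>: the coefficients with which t contributes to degree p.\<close>

definition W_pred where "W_pred M p = (case p of 0 \<Rightarrow> {\<zero>\<^sub>M} | Suc q \<Rightarrow> W M q)"

lemma W_pred_submodule: "module R M \<Longrightarrow> submodule (W_pred M p) R M"
  unfolding W_pred_def by (cases p) (auto intro: module.zero_submodule W_submodule)

lemma W_pred_mult: assumes M: "module R M" "t \<in> \<mm>" "w \<in> W_pred M p" shows "t \<odot>\<^sub>M w \<in> W_pred M (Suc p)"
proof -
  interpret M: module R M by fact
  show ?thesis using W_mult1[OF M(1,2), of w "p - 1"] M(2,3) mm.Icarr M.submod_zero[OF W_submodule[OF M(1)]]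
    by (cases p) (auto simp: W_pred_def)
qed

text \<open>As in Hilbert's basis theorem: the coefficients that \<open>t\<^sup>k\<close> can have in elements of Y, up to higher
  powers of t.\<close>

definition lead where "lead M t k Y p = {z \<in> W M p. \<exists>y\<in>Y (p + k). \<exists>w\<in>W_pred M p. t [^] k \<odot>\<^sub>M z = y \<oplus>\<^sub>M t [^] Suc k \<odot>\<^sub>M w}"
  for t k Y p

lemma pow_mp: "t \<in> mp e \<Longrightarrow> t [^] (k::nat) \<in> mp (e * k)"
proof (induction k)
  case (Suc k) thus ?case using mp_mult[of "t [^] k" "e * k" t e] by (simp add: add.commute)
qed simp

lemma pow_mp1: "t \<in> \<mm> \<Longrightarrow> t [^] (k::nat) \<in> mp k" using pow_mp[of t 1 k] by simp

lemma smult_swapR: assumes "module R M" "a \<in> carrier R" "b \<in> carrier R" "z \<in> carrier M"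
  shows "a \<odot>\<^sub>M (b \<odot>\<^sub>M z) = b \<odot>\<^sub>M (a \<odot>\<^sub>M z)"
  using module.smult_assoc1[OF assms(1-4)] module.smult_assoc1[OF assms(1,3,2,4)] m_comm[OF assms(2,3)] by simp

lemma lead_stable: assumes M: "module R M" and t: "t \<in> \<mm>" and Y: "stable M Y" shows "stable M (lead M t k Y)"
  unfolding stable_def
proof (intro allI conjI ballI)
  interpret M: module R M by fact
  note YD = stableD[OF Y]
  have tk: "t [^] k \<in> carrier R" "t [^] Suc k \<in> carrier R" using t mm.Icarr by auto
  have wc: "w \<in> carrier M" if "w \<in> W_pred M p" for w p using M.submod_carrier[OF W_pred_submodule[OF M] that] .
  have yc: "y \<in> carrier M" if "y \<in> Y p" for y p using M.submod_carrier[OF YD(1) that] .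
  fix p
  show "submodule (lead M t k Y p) R M"
  proof (rule M.submodI)
    show "lead M t k Y p \<subseteq> carrier M" using W_carrier[OF M] by (auto simp: lead_def)
    show "\<zero>\<^sub>M \<in> lead M t k Y p" unfolding lead_def using M.submod_zero[OF W_submodule[OF M]] tk
      by (auto intro!: bexI[of _ "\<zero>\<^sub>M"] M.submod_zero[OF YD(1)] M.submod_zero[OF W_pred_submodule[OF M]])
  next
    fix a b assume "a \<in> lead M t k Y p" "b \<in> lead M t k Y p"
    then obtain y w y' w' where *: "a \<in> W M p" "b \<in> W M p" "y \<in> Y (p + k)" "w \<in> W_pred M p" "y' \<in> Y (p + k)" "w' \<in> W_pred M p"
      "t [^] k \<odot>\<^sub>M a = y \<oplus>\<^sub>M t [^] Suc k \<odot>\<^sub>M w" "t [^] k \<odot>\<^sub>M b = y' \<oplus>\<^sub>M t [^] Suc k \<odot>\<^sub>M w'"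
      unfolding lead_def by blast
    have "t [^] k \<odot>\<^sub>M (a \<oplus>\<^sub>M b) = (y \<oplus>\<^sub>M y') \<oplus>\<^sub>M t [^] Suc k \<odot>\<^sub>M (w \<oplus>\<^sub>M w')"
      using *(7,8) tk wc[OF *(4)] wc[OF *(6)] yc[OF *(3)] yc[OF *(5)] W_carrier[OF M *(1)] W_carrier[OF M *(2)]
      by (simp add: M.smult_r_distr M.M.a_ac del: nat_pow_Suc)
    thus "a \<oplus>\<^sub>M b \<in> lead M t k Y p" unfolding lead_def
      using M.submod_add[OF W_submodule[OF M] *(1,2)] M.submod_add[OF YD(1) *(3,5)] M.submod_add[OF W_pred_submodule[OF M] *(4,6)] by blast
  next
    fix r a assume r: "r \<in> carrier R" and "a \<in> lead M t k Y p"
    then obtain y w where *: "a \<in> W M p" "y \<in> Y (p + k)" "w \<in> W_pred M p" "t [^] k \<odot>\<^sub>M a = y \<oplus>\<^sub>M t [^] Suc k \<odot>\<^sub>M w"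
      unfolding lead_def by blast
    have "t [^] k \<odot>\<^sub>M (r \<odot>\<^sub>M a) = r \<odot>\<^sub>M (t [^] k \<odot>\<^sub>M a)" by (rule smult_swapR[OF M tk(1) r W_carrier[OF M *(1)]])
    also have "\<dots> = r \<odot>\<^sub>M y \<oplus>\<^sub>M r \<odot>\<^sub>M (t [^] Suc k \<odot>\<^sub>M w)"
      unfolding *(4) by (rule M.smult_r_distr[OF r yc[OF *(2)] M.smult_closed[OF tk(2) wc[OF *(3)]]])
    also have "r \<odot>\<^sub>M (t [^] Suc k \<odot>\<^sub>M w) = t [^] Suc k \<odot>\<^sub>M (r \<odot>\<^sub>M w)" by (rule smult_swapR[OF M r tk(2) wc[OF *(3)]])
    finally show "r \<odot>\<^sub>M a \<in> lead M t k Y p" unfolding lead_def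
      using M.submod_smult[OF W_submodule[OF M] r *(1)] M.submod_smult[OF YD(1) r *(2)] M.submod_smult[OF W_pred_submodule[OF M] r *(3)] by blast
  qed
  show "lead M t k Y p \<subseteq> W M p" by (auto simp: lead_def)
  fix s z assume s: "s \<in> \<mm>" and "z \<in> lead M t k Y p"
  then obtain y w where *: "z \<in> W M p" "y \<in> Y (p + k)" "w \<in> W_pred M p" "t [^] k \<odot>\<^sub>M z = y \<oplus>\<^sub>M t [^] Suc k \<odot>\<^sub>M w"
    unfolding lead_def by blast
  have r: "s \<in> carrier R" using s mm.Icarr by simp
  have "t [^] k \<odot>\<^sub>M (s \<odot>\<^sub>M z) = s \<odot>\<^sub>M (t [^] k \<odot>\<^sub>M z)" by (rule smult_swapR[OF M tk(1) r W_carrier[OF M *(1)]])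
  also have "\<dots> = s \<odot>\<^sub>M y \<oplus>\<^sub>M s \<odot>\<^sub>M (t [^] Suc k \<odot>\<^sub>M w)"
    unfolding *(4) by (rule M.smult_r_distr[OF r yc[OF *(2)] M.smult_closed[OF tk(2) wc[OF *(3)]]])
  also have "s \<odot>\<^sub>M (t [^] Suc k \<odot>\<^sub>M w) = t [^] Suc k \<odot>\<^sub>M (s \<odot>\<^sub>M w)" by (rule smult_swapR[OF M r tk(2) wc[OF *(3)]])
  finally show "s \<odot>\<^sub>M z \<in> lead M t k Y (Suc p)" unfolding lead_def
    using W_mult1[OF M s *(1)] YD(3)[OF s *(2)] W_pred_mult[OF M s *(3)] by auto
qed

lemma lead_mono: "(\<And>p. Y p \<subseteq> Y' p) \<Longrightarrow> lead M t k Y p \<subseteq> lead M t k Y' p"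
  unfolding lead_def by blast

lemma lead_Suc: assumes M: "module R M" and t: "t \<in> \<mm>" and Y: "stable M Y" shows "lead M t k Y p \<subseteq> lead M t (Suc k) Y p"
proof
  interpret M: module R M by fact
  note YD = stableD[OF Y]
  have tk: "t [^] k \<in> carrier R" "t [^] Suc k \<in> carrier R" "t \<in> carrier R" using t mm.Icarr by auto
  fix z assume "z \<in> lead M t k Y p"
  then obtain y w where *: "z \<in> W M p" "y \<in> Y (p + k)" "w \<in> W_pred M p" "t [^] k \<odot>\<^sub>M z = y \<oplus>\<^sub>M t [^] Suc k \<odot>\<^sub>M w"
    unfolding lead_def by blast
  have wc: "w \<in> carrier M" using M.submod_carrier[OF W_pred_submodule[OF M] *(3)] .
  have yc: "y \<in> carrier M" using M.submod_carrier[OF YD(1) *(2)] .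
  have pw: "t [^] Suc j \<odot>\<^sub>M v = t \<odot>\<^sub>M (t [^] j \<odot>\<^sub>M v)" if "v \<in> carrier M" for v j
    using M.smult_assoc1[of t "t [^] j" v] m_comm[of t "t [^] j"] tk that by simp
  have "t [^] Suc k \<odot>\<^sub>M z = t \<odot>\<^sub>M y \<oplus>\<^sub>M t [^] Suc (Suc k) \<odot>\<^sub>M w"
    unfolding pw[OF W_carrier[OF M *(1)], of k] pw[OF wc, of "Suc k"] *(4) by (rule M.smult_r_distr[OF tk(3) yc M.smult_closed[OF tk(2) wc]])
  thus "z \<in> lead M t (Suc k) Y p" unfolding lead_def using * YD(3)[OF t *(2)] by auto
qed

text \<open>An element of \<open>Y' p\<close> is approximated by elements of \<open>Y p\<close>, up to multiples of higher and higher powers of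
  t. The coefficient of \<open>t\<^sup>k\<close> has degree \<open>p - k\<close>, so after finitely many steps the error is zero.\<close>

lemma lead_inj: assumes M: "module R M" and t: "t \<in> \<mm>" and Y: "stable M Y" "stable M Y'" "\<And>p. Y p \<subseteq> Y' p"
  and eq: "\<And>k. lead M t k Y = lead M t k Y'" shows "Y = Y'"
proof (rule ext, rule equalityI[OF Y(3)], rule subsetI)
  interpret M: module R M by fact
  note YD = stableD[OF Y(1)] and YD' = stableD[OF Y(2)]
  have tR: "t \<in> carrier R" using t mm.Icarr by auto
  fix p z assume z: "z \<in> Y' p"
  have zc: "z \<in> carrier M" using M.submod_carrier[OF YD'(1) z] .
  have "\<exists>y\<in>Y p. \<exists>w\<in>W M (p - k). z = y \<oplus>\<^sub>M t [^] k \<odot>\<^sub>M w" if "k \<le> p" for k using that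
  proof (induction k)
    case 0 show ?case using z YD'(2)[of p] zc M.submod_zero[OF YD(1)] by (intro bexI[of _ "\<zero>\<^sub>M"] bexI[of _ z]) auto
  next
    case (Suc k)
    then obtain y w where *: "y \<in> Y p" "w \<in> W M (p - k)" "z = y \<oplus>\<^sub>M t [^] k \<odot>\<^sub>M w" by auto
    have wc: "w \<in> carrier M" and yc: "y \<in> carrier M" using W_carrier[OF M *(2)] M.submod_carrier[OF YD(1) *(1)] by auto
    have "t [^] k \<odot>\<^sub>M w = z \<ominus>\<^sub>M y" using *(3) wc yc tR zc by (simp add: M.M.move_minus)
    hence "t [^] k \<odot>\<^sub>M w \<in> Y' p" using M.submod_diff[OF YD'(1) z subsetD[OF Y(3) *(1)]] by simp
    moreover have "t [^] k \<odot>\<^sub>M w = t [^] k \<odot>\<^sub>M w \<oplus>\<^sub>M t [^] Suc k \<odot>\<^sub>M \<zero>\<^sub>M" using wc tR by simp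
    ultimately have "w \<in> lead M t k Y' (p - k)" unfolding lead_def
      using *(2) Suc.prems M.submod_zero[OF W_pred_submodule[OF M]] by force
    hence "w \<in> lead M t k Y (p - k)" using eq by simp
    then obtain y' w' where **: "y' \<in> Y p" "w' \<in> W_pred M (p - k)" "t [^] k \<odot>\<^sub>M w = y' \<oplus>\<^sub>M t [^] Suc k \<odot>\<^sub>M w'"
      unfolding lead_def using Suc.prems by auto
    have w'c: "w' \<in> carrier M" "y' \<in> carrier M" using M.submod_carrier[OF W_pred_submodule[OF M] **(2)] M.submod_carrier[OF YD(1) **(1)] by auto
    have "W_pred M (p - k) = W M (p - Suc k)" using Suc.prems by (simp add: W_pred_def split: nat.split) (metis Suc_diff_Suc Suc_le_lessD old.nat.inject nat.distinct(1))
    moreover have "z = (y \<oplus>\<^sub>M y') \<oplus>\<^sub>M t [^] Suc k \<odot>\<^sub>M w'" using *(3) **(3) yc w'c tR by (simp add: M.M.a_assoc)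
    ultimately show ?case using **(2) M.submod_add[OF YD(1) *(1) **(1)] by blast
  qed
  from this[of p] obtain y w where *: "y \<in> Y p" "w \<in> W M 0" "z = y \<oplus>\<^sub>M t [^] p \<odot>\<^sub>M w" by auto
  have wc: "w \<in> carrier M" and yc: "y \<in> carrier M" using W_carrier[OF M *(2)] M.submod_carrier[OF YD(1) *(1)] by auto
  have "t [^] p \<odot>\<^sub>M w = z \<ominus>\<^sub>M y" using *(3) wc yc tR zc by (simp add: M.M.move_minus)
  hence "t [^] p \<odot>\<^sub>M w \<in> Y' p" using M.submod_diff[OF YD'(1) z subsetD[OF Y(3) *(1)]] by simp
  moreover have "t [^] p \<odot>\<^sub>M w = t [^] p \<odot>\<^sub>M w \<oplus>\<^sub>M t [^] Suc p \<odot>\<^sub>M \<zero>\<^sub>M" using wc tR by simp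
  ultimately have "w \<in> lead M t p Y' 0" unfolding lead_def
    using *(2) M.submod_zero[OF W_pred_submodule[OF M]] by force
  hence "w \<in> lead M t p Y 0" using eq by simp
  then obtain y' where **: "y' \<in> Y p" "t [^] p \<odot>\<^sub>M w = y' \<oplus>\<^sub>M t [^] Suc p \<odot>\<^sub>M \<zero>\<^sub>M"
    unfolding lead_def W_pred_def by auto
  hence "t [^] p \<odot>\<^sub>M w \<in> Y p" using tR M.submod_carrier[OF YD(1) **(1)] by simp
  thus "z \<in> Y p" unfolding *(3) by (rule M.submod_add[OF YD(1) *(1)])
qed

definition add_mult where "add_mult M \<Psi> t p = module.msum M (\<Psi> p) {t \<odot>\<^sub>M z | z. z \<in> W_pred M p}"

text \<open>The argument of Hilbert's basis theorem. The leading coefficients increase with the power of t and with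
  the position in the chain; if they are stationary on the diagonal, only finitely many powers are left.\<close>

lemma acc_above_step:
  assumes M: "module R M" and t: "t \<in> \<mm>" and \<Psi>: "stable M \<Psi>" and acc: "acc_above M (add_mult M \<Psi> t)"
  shows "acc_above M \<Psi>"
  unfolding acc_above_def
proof (intro allI impI)
  interpret M: module R M by fact
  fix Ys assume "\<forall>j::nat. stable M (Ys j) \<and> (\<forall>p. \<Psi> p \<subseteq> Ys j p \<and> Ys j p \<subseteq> Ys (Suc j) p)"
  hence F: "\<And>j. stable M (Ys j)" and P: "\<And>j p. \<Psi> p \<subseteq> Ys j p" and A: "\<And>j p. Ys j p \<subseteq> Ys (Suc j) p" by auto
  have tR: "t \<in> carrier R" using t mm.Icarr by auto
  have mono: "Ys i p \<subseteq> Ys j p" if "i \<le> j" for i j p using lift_Suc_mono_le[of "\<lambda>j. Ys j p", OF A that] .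
  let ?L = "\<lambda>k j. lead M t k (Ys j)"
  have Lj: "?L k i p \<subseteq> ?L k j p" if "i \<le> j" for k i j p by (rule lead_mono[OF mono[OF that]])
  have Lk: "?L k i p \<subseteq> ?L l i p" if "k \<le> l" for k l i p using lift_Suc_mono_le[of "\<lambda>k. ?L k i p", OF lead_Suc[OF M t F] that] .
  have contains: "add_mult M \<Psi> t p \<subseteq> ?L k j p" for k j p unfolding add_mult_def
  proof (rule M.msum_least[OF stableD(1)[OF lead_stable[OF M t F]]])
    have pw: "t [^] Suc k \<odot>\<^sub>M v = t [^] k \<odot>\<^sub>M (t \<odot>\<^sub>M v)" if "v \<in> carrier M" for v
      using M.smult_assoc1[of "t [^] k" t v] tR that by simp
    show "\<Psi> p \<subseteq> ?L k j p"
    proof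
      fix z assume z: "z \<in> \<Psi> p"
      hence "t [^] k \<odot>\<^sub>M z \<in> Ys j (p + k)" using stable_mp[OF M F pow_mp1[OF t]] P by blast
      moreover have "t [^] k \<odot>\<^sub>M z = t [^] k \<odot>\<^sub>M z \<oplus>\<^sub>M t [^] Suc k \<odot>\<^sub>M \<zero>\<^sub>M"
        using M.submod_carrier[OF stableD(1)[OF \<Psi>] z] tR by simp
      ultimately show "z \<in> ?L k j p" unfolding lead_def using stableD(2)[OF \<Psi>] z M.submod_zero[OF W_pred_submodule[OF M]] by blast
    qed
    show "{t \<odot>\<^sub>M z | z. z \<in> W_pred M p} \<subseteq> ?L k j p"
    proof
      fix x assume "x \<in> {t \<odot>\<^sub>M z | z. z \<in> W_pred M p}"
      then obtain z where z: "x = t \<odot>\<^sub>M z" "z \<in> W_pred M p" by auto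
      have zc: "z \<in> carrier M" using M.submod_carrier[OF W_pred_submodule[OF M] z(2)] .
      have xW: "x \<in> W M p" using W_pred_mult[OF M t z(2)] z(1) by (simp add: W_pred_def)
      have "t [^] k \<odot>\<^sub>M x = \<zero>\<^sub>M \<oplus>\<^sub>M t [^] Suc k \<odot>\<^sub>M z" unfolding pw[OF zc] z(1) using zc tR by simp
      thus "x \<in> ?L k j p" unfolding lead_def using xW z(2) M.submod_zero[OF stableD(1)[OF F]] by blast
    qed
  qed
  have "\<exists>j0. \<forall>j\<ge>j0. ?L j j = ?L j0 j0"
    by (rule acc_aboveD[OF acc lead_stable[OF M t F] contains]) (rule order_trans[OF Lj[of j "Suc j" for j] Lk], simp_all)
  then obtain j0 where j0: "\<And>j. j \<ge> j0 \<Longrightarrow> ?L j j = ?L j0 j0" by blast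
  have "\<exists>jk. \<forall>j\<ge>jk. ?L k j = ?L k jk" for k
    by (rule acc_aboveD[OF acc lead_stable[OF M t F] contains]) (rule Lj, simp)
  then obtain jk where jk: "\<And>k j. j \<ge> jk k \<Longrightarrow> ?L k j = ?L k (jk k)" by metis
  define J where "J = Max (insert j0 (jk ` {..<j0}))"
  have J: "j0 \<le> J" "\<And>k. k < j0 \<Longrightarrow> jk k \<le> J" by (auto simp: J_def intro!: Max_ge)
  have big: "?L k j = ?L j0 j0" if "k \<ge> j0" "j \<ge> j0" for k j
  proof (rule ext, rule equalityI)
    fix p
    have "?L k j p \<subseteq> ?L (max k j) (max k j) p" by (rule order_trans[OF Lj Lk]) auto
    thus "?L k j p \<subseteq> ?L j0 j0 p" using j0[of "max k j"] that by simp
    show "?L j0 j0 p \<subseteq> ?L k j p" by (rule order_trans[OF Lj Lk]) (use that in auto)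
  qed
  have "Ys j = Ys J" if "j \<ge> J" for j
  proof (rule lead_inj[OF M t F F, symmetric])
    show "Ys J p \<subseteq> Ys j p" for p by (rule mono[OF that])
    show "?L k J = ?L k j" for k
    proof (cases "k < j0")
      case True thus ?thesis using jk[of k J] jk[of k j] J(2)[OF True] that by simp
    next
      case False thus ?thesis using big[of k J] big[of k j] J(1) that by simp
    qed
  qed
  thus "\<exists>j0. \<forall>j\<ge>j0. Ys j = Ys j0" by blast
qed

lemma add_mult_stable: assumes M: "module R M" and t: "t \<in> \<mm>" and \<Psi>: "stable M \<Psi>" shows "stable M (add_mult M \<Psi> t)"
  unfolding stable_def
proof (intro allI conjI ballI)
  interpret M: module R M by fact
  have tR: "t \<in> carrier R" using t mm.Icarr by auto
  note S = stableD[OF \<Psi>]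
  fix p
  have K: "submodule {t \<odot>\<^sub>M z | z. z \<in> W_pred M p} R M" by (rule M.smult_image_submodule[OF tR W_pred_submodule[OF M]])
  show "submodule (add_mult M \<Psi> t p) R M" unfolding add_mult_def by (rule M.msum_submodule[OF S(1) K])
  have "t \<odot>\<^sub>M z \<in> W M p" if "z \<in> W_pred M p" for z using W_pred_mult[OF M t that] by (simp add: W_pred_def)
  thus "add_mult M \<Psi> t p \<subseteq> W M p" unfolding add_mult_def by (intro M.msum_least W_submodule[OF M] S(2)) auto
  fix s z assume s: "s \<in> \<mm>" and "z \<in> add_mult M \<Psi> t p"
  then obtain y w where yw: "y \<in> \<Psi> p" "w \<in> W_pred M p" "z = y \<oplus>\<^sub>M t \<odot>\<^sub>M w" unfolding add_mult_def M.msum_def by blast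
  have wc: "w \<in> carrier M" and yc: "y \<in> carrier M" using M.submod_carrier[OF W_pred_submodule[OF M] yw(2)] M.submod_carrier[OF S(1) yw(1)] by auto
  have sR: "s \<in> carrier R" using s mm.Icarr by auto
  have "s \<odot>\<^sub>M z = s \<odot>\<^sub>M y \<oplus>\<^sub>M t \<odot>\<^sub>M (s \<odot>\<^sub>M w)" unfolding yw(3) using sR tR wc yc smult_swapR[OF M sR tR wc] by (simp add: M.smult_r_distr)
  thus "s \<odot>\<^sub>M z \<in> add_mult M \<Psi> t (Suc p)" unfolding add_mult_def M.msum_def using S(3)[OF s yw(1)] W_pred_mult[OF M s yw(2)] by blast
qed

lemma zero_stable: assumes M: "module R M" shows "stable M (\<lambda>p. {\<zero>\<^sub>M})"
proof -
  interpret M: module R M by fact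
  show ?thesis using M.submod_zero[OF W_submodule[OF M]] mm.Icarr by (auto simp: stable_def M.zero_submodule)
qed

text \<open>The Rees module is noetherian. Above the multiples of all generators of \<open>\<mm>\<close>, only the
  component of degree zero can vary, and M is noetherian; the generators are then removed one at a time.\<close>

theorem acc_above_zero: assumes M: "module R M" "fin_gen R M" shows "acc_above M (\<lambda>p. {\<zero>\<^sub>M})"
proof -
  interpret M: module R M by fact
  obtain T where T: "T \<subseteq> carrier R" "finite T" "\<mm> = Idl T" using finetely_gen[OF mm.is_ideal] by blast
  have Tm: "T \<subseteq> \<mm>" using genideal_self[OF T(1)] T(3) by simp
  obtain ts where ts: "set ts = T" using finite_list[OF T(2)] by blast
  let ?\<Psi> = "foldr (\<lambda>t \<Psi>. add_mult M \<Psi> t) ts (\<lambda>p. {\<zero>\<^sub>M})"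
  have F: "stable M (foldr (\<lambda>t \<Psi>. add_mult M \<Psi> t) us (\<lambda>p. {\<zero>\<^sub>M}))" if "set us \<subseteq> \<mm>" for us
    using that by (induction us) (auto intro: zero_stable[OF M(1)] add_mult_stable[OF M(1)])
  have contains: "t \<odot>\<^sub>M z \<in> foldr (\<lambda>t \<Psi>. add_mult M \<Psi> t) us (\<lambda>p. {\<zero>\<^sub>M}) (Suc p)"
    if "set us \<subseteq> \<mm>" "t \<in> set us" "z \<in> W M p" for us t z p
    using that
  proof (induction us)
    case (Cons u us)
    let ?\<Phi> = "foldr (\<lambda>t \<Psi>. add_mult M \<Psi> t) us (\<lambda>p. {\<zero>\<^sub>M})"
    have stable: "stable M ?\<Phi>" by (rule F) (use Cons.prems in auto)
    have uR: "u \<in> carrier R" using Cons.prems mm.Icarr by auto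
    have up: "?\<Phi> (Suc p) \<subseteq> add_mult M ?\<Phi> u (Suc p)" "{u \<odot>\<^sub>M z | z. z \<in> W_pred M (Suc p)} \<subseteq> add_mult M ?\<Phi> u (Suc p)"
      unfolding add_mult_def[of M ?\<Phi> u "Suc p"] using M.msum_upper[OF stableD(1)[OF stable] M.smult_image_submodule[OF uR W_pred_submodule[OF M(1)]]] by blast+
    show ?case
    proof (cases "t = u")
      case True thus ?thesis using up(2) Cons.prems(3) by (auto simp: W_pred_def)
    next
      case False thus ?thesis using up(1) Cons by auto
    qed
  qed simp
  have top: "acc_above M ?\<Psi>" unfolding acc_above_def
  proof (intro allI impI)
    fix Ys assume "\<forall>j::nat. stable M (Ys j) \<and> (\<forall>p. ?\<Psi> p \<subseteq> Ys j p \<and> Ys j p \<subseteq> Ys (Suc j) p)"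
    hence Y: "\<And>j. stable M (Ys j)" and P: "\<And>j p. ?\<Psi> p \<subseteq> Ys j p" and A: "\<And>j p. Ys j p \<subseteq> Ys (Suc j) p" by auto
    have "W M (Suc p) \<subseteq> Ys j (Suc p)" for j p
      by (rule W_Suc_gens[OF M(1) stableD(1)[OF Y] T(1,3)]) (use contains[of ts] P ts Tm in blast)
    hence full: "Ys j (Suc p) = W M (Suc p)" for j p using stableD(2)[OF Y] by blast
    obtain n where n: "\<And>j. n \<le> j \<Longrightarrow> Ys j 0 = Ys n 0" using fin_gen_sub_chain[OF M, of "\<lambda>j. Ys j 0"] stableD(1)[OF Y] A by metis
    have "Ys j = Ys n" if "j \<ge> n" for j
    proof
      fix p show "Ys j p = Ys n p" using n[OF that] full by (cases p) auto
    qed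
    thus "\<exists>j0. \<forall>j\<ge>j0. Ys j = Ys j0" by blast
  qed
  have "acc_above M (foldr (\<lambda>t \<Psi>. add_mult M \<Psi> t) us (\<lambda>p. {\<zero>\<^sub>M})) \<Longrightarrow> acc_above M (\<lambda>p. {\<zero>\<^sub>M})" if "set us \<subseteq> \<mm>" for us
    using that by (induction us) (auto intro: acc_above_step[OF M(1) _ F])
  thus ?thesis using top ts Tm by blast
qed

text \<open>Let D be the intersection. The families \<open>p \<mapsto> \<mm>\<^sup>p\<^sup>-\<^sup>j D\<close> form an ascending chain in j. When it is
  stationary, comparison in degree \<open>j + 1\<close> gives \<open>\<mm> D = D\<close>, so D is zero.\<close>

lemma krull_intersection: assumes M: "module R M" "fin_gen R M" and z: "\<And>p. z \<in> W M p" shows "z = \<zero>\<^sub>M"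
proof -
  interpret M: module R M by fact
  define D where "D = (\<Inter>p. W M p)"
  have D: "submodule D R M" unfolding D_def by (rule M.submodule_INT) (auto intro: W_submodule M)
  let ?N = "M\<lparr>carrier := D\<rparr>"
  have N: "module R ?N" by (rule M.submodule_module[OF D])
  have WN: "submodule (W ?N q) R M" "W ?N q \<subseteq> D" for q
    using W_submodule[OF N, of q] unfolding M.submodule_update_iff[OF D] by auto
  define Ys where "Ys j p = W ?N (p - j)" for j p :: nat
  have "stable M (Ys j)" for j unfolding stable_def
  proof (intro allI conjI ballI)
    fix p show "submodule (Ys j p) R M" unfolding Ys_def by (rule WN)
    show "Ys j p \<subseteq> W M p" unfolding Ys_def using WN(2)[of "p - j"] by (auto simp: D_def)
    fix t z assume t: "t \<in> \<mm>" "z \<in> Ys j p"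
    show "t \<odot>\<^sub>M z \<in> Ys j (Suc p)"
    proof (cases "j \<le> p")
      case True thus ?thesis using W_mult1[OF N t(1), of z "p - j"] t(2) by (simp add: Ys_def Suc_diff_le)
    next
      case False
      hence "Ys j (Suc p) = D" by (simp add: Ys_def W_0[OF N])
      moreover have "z \<in> D" using t(2) WN(2) by (auto simp: Ys_def)
      ultimately show ?thesis using M.submod_smult[OF D _ \<open>z \<in> D\<close>] mm.Icarr[OF t(1)] by simp
    qed
  qed
  moreover have "Ys j p \<subseteq> Ys (Suc j) p" for j p unfolding Ys_def by (rule W_antimono[OF N]) simp
  moreover have "{\<zero>\<^sub>M} \<subseteq> Ys j p" for j p using M.submod_zero[OF WN(1)] by (simp add: Ys_def)
  ultimately have "\<exists>j0. \<forall>j\<ge>j0. Ys j = Ys j0" by (intro acc_aboveD[OF acc_above_zero[OF M]])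
  then obtain j0 where "\<And>j. j \<ge> j0 \<Longrightarrow> Ys j = Ys j0" by blast
  hence "Ys (Suc j0) = Ys j0" using le_SucI by blast
  hence "Ys (Suc j0) (Suc j0) = Ys j0 (Suc j0)" by simp
  hence W1: "W ?N 1 = carrier ?N" by (simp add: Ys_def W_0[OF N])
  obtain X where X: "finite X" "X \<subseteq> D" "module_span R M X = D" using fin_gen_noetherian[OF M D] by (auto simp: fin_gen_sub_def)
  interpret N: module R ?N by (rule N)
  have XN: "X \<subseteq> carrier ?N" using X by simp
  have "submodule (module_span R ?N X) R M" using N.span_submodule[OF XN] unfolding M.submodule_update_iff[OF D] by blast
  hence "D \<subseteq> module_span R ?N X" using M.span_least[OF _ N.span_superset[of X]] X(3) by simp
  hence "module_span R ?N X = carrier ?N" using N.submod_carrier[OF N.span_submodule[OF XN]] by auto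
  hence "fin_gen R ?N" using X XN unfolding fin_gen_def by blast
  hence "D = {\<zero>\<^sub>M}" using nakayama[OF N _ W1] by simp
  thus ?thesis using z by (auto simp: D_def)
qed

lemma quot_fin_gen: assumes M: "module R M" "fin_gen R M" and L: "submodule L R M" shows "fin_gen R (quot_module M L)"
  and "W (quot_module M L) p = (\<lambda>z. L +>\<^bsub>M\<^esub> z) ` W M p"
proof -
  interpret M: module R M by fact
  have Q: "module R (quot_module M L)" by (rule M.quot_module_module[OF L])
  have lin: "(\<lambda>z. L +>\<^bsub>M\<^esub> z) \<in> lin_maps R M (quot_module M L)" by (auto simp: lin_maps_def M.quot_simps(1,2)[OF L])
  have surj: "(\<lambda>z. L +>\<^bsub>M\<^esub> z) ` carrier M = carrier (quot_module M L)" by (auto simp: M.quot_carrier)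
  show "fin_gen R (quot_module M L)" using fin_gen_sub_lin_image[OF M(1) Q lin M.carrier_is_submodule] M(2) by (simp add: fin_gen_iff surj)
  show "W (quot_module M L) p = (\<lambda>z. L +>\<^bsub>M\<^esub> z) ` W M p" by (rule W_surj[OF M(1) Q lin surj])
qed

lemma krull_intersection_quot: assumes M: "module R M" "fin_gen R M" and L: "submodule L R M" and z: "\<And>p. z \<in> module.msum M L (W M p)"
  shows "z \<in> L"
proof -
  interpret M: module R M by fact
  have zc: "z \<in> carrier M" using M.submod_carrier[OF M.msum_submodule[OF L W_submodule[OF M(1)]] z] .
  have "L +>\<^bsub>M\<^esub> z \<in> W (quot_module M L) p" for p
  proof -
    obtain l w where lw: "l \<in> L" "w \<in> W M p" "z = l \<oplus>\<^sub>M w" using z[of p] unfolding M.msum_def by blast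
    have "z \<ominus>\<^sub>M w = l" using lw M.submod_carrier[OF L lw(1)] W_carrier[OF M(1) lw(2)] by (simp add: M.M.move_minus)
    hence "L +>\<^bsub>M\<^esub> z = L +>\<^bsub>M\<^esub> w" using M.coset_eq[OF L zc W_carrier[OF M(1) lw(2)]] lw(1) by simp
    thus ?thesis unfolding quot_fin_gen(2)[OF M L] using lw(2) by blast
  qed
  hence "L +>\<^bsub>M\<^esub> z = \<zero>\<^sub>(quot_module M L)" by (intro krull_intersection[OF M.quot_module_module[OF L] quot_fin_gen(1)[OF M L]])
  thus ?thesis using M.coset_eq_H[OF L zc] by (simp add: M.quot_simps(3))
qed

end

section \<open>Homogeneous prime avoidance\<close>

context noeth_local begin

text \<open>The homogeneous annihilator of the class of z modulo Y, with its component of degree e.\<close>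

definition Ann where "Ann M Y p z e = {a \<in> mp e. a \<odot>\<^sub>M z \<in> Y (p + e)}"

definition max_ann where "max_ann M Y P \<longleftrightarrow> (\<exists>p z. z \<in> W M p \<and> z \<notin> Y p \<and> P = Ann M Y p z) \<and>
   (\<forall>q w. w \<in> W M q \<longrightarrow> w \<notin> Y q \<longrightarrow> P \<le> Ann M Y q w \<longrightarrow> Ann M Y q w = P)"

lemma SR_fin_gen: "fin_gen R SR"
proof -
  have s: "submodule (module_span R SR {\<one>}) R SR" by (rule SF.span_submodule) simp
  have "a \<in> module_span R SR {\<one>}" if "a \<in> carrier R" for a
    using SF.submod_smult[OF s that, of \<one>] SF.span_superset[of "{\<one>}"] that by simp
  hence "module_span R SR {\<one>} = carrier SR" using SF.submod_carrier[OF s] by auto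
  thus ?thesis unfolding fin_gen_def by (intro exI[of _ "{\<one>}"]) simp
qed

lemma Ann_stable: assumes M: "module R M" and Y: "stable M Y" and z: "z \<in> W M p" shows "stable SR (Ann M Y p z)"
  unfolding stable_def WS_sub
proof (intro allI conjI ballI)
  interpret M: module R M by fact
  note YD = stableD[OF Y]
  have zc: "z \<in> carrier M" using W_carrier[OF M z] .
  fix e
  show "submodule (Ann M Y p z e) R SR"
    by (rule SF.submodI) (use zc mp_carrier[of _ e] in
      \<open>auto simp: Ann_def mp_closed M.smult_l_distr M.smult_assoc1 intro: M.submod_closed[OF YD(1)]\<close>)
  show "Ann M Y p z e \<subseteq> mp e" by (auto simp: Ann_def)
  fix t a assume t: "t \<in> \<mm>" and a: "a \<in> Ann M Y p z e"
  have "t \<odot>\<^sub>M (a \<odot>\<^sub>M z) \<in> Y (Suc (p + e))" using YD(3)[OF t] a by (simp add: Ann_def)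
  moreover have "t \<otimes> a \<in> mp (Suc e)" using mp_mult[of t 1 a e] t a by (simp add: Ann_def)
  ultimately show "t \<odot>\<^sub>SR a \<in> Ann M Y p z (Suc e)" using a mm.Icarr[OF t] mp_carrier[of a e] zc by (simp add: Ann_def M.smult_assoc1)
qed

lemma max_ann_exists:
  assumes M: "module R M" and Y: "stable M Y" and z: "z \<in> W M p" "z \<notin> Y p"
  shows "\<exists>P. max_ann M Y P \<and> Ann M Y p z \<le> P"
proof (rule ccontr)
  assume no: "\<nexists>P. max_ann M Y P \<and> Ann M Y p z \<le> P"
  let ?A = "\<lambda>P. (\<exists>q w. w \<in> W M q \<and> w \<notin> Y q \<and> P = Ann M Y q w) \<and> Ann M Y p z \<le> P"
  have "\<exists>f. \<forall>n. ?A (f n) \<and> (f n \<le> f (Suc n) \<and> f n \<noteq> f (Suc n))"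
  proof (rule dependent_nat_choice)
    show "\<exists>P. ?A P" using z by (intro exI[of _ "Ann M Y p z"]) auto
    fix P and n :: nat assume A: "?A P"
    hence "\<not> max_ann M Y P" using no by blast
    then obtain q w where "w \<in> W M q" "w \<notin> Y q" "P \<le> Ann M Y q w" "Ann M Y q w \<noteq> P" using A unfolding max_ann_def by blast
    thus "\<exists>P'. ?A P' \<and> (P \<le> P' \<and> P \<noteq> P')" using A by (intro exI[of _ "Ann M Y q w"]) (auto intro: order_trans)
  qed
  then obtain f where f: "\<And>n. ?A (f n)" "\<And>n. f n \<le> f (Suc n)" "\<And>n. f n \<noteq> f (Suc n)" by blast
  have stable: "stable SR (f n)" for n
  proof -
    obtain q w where "w \<in> W M q" "f n = Ann M Y q w" using f(1)[of n] by blast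
    thus ?thesis using Ann_stable[OF M Y, of w q] by simp
  qed
  have "\<exists>j0. \<forall>j\<ge>j0. f j = f j0"
    by (rule acc_aboveD[OF acc_above_zero[OF SR_module SR_fin_gen] stable])
       (use SF.submod_zero[OF stableD(1)[OF stable]] f(2) in \<open>auto simp: le_fun_def\<close>)
  then obtain j0 where "\<And>j. j \<ge> j0 \<Longrightarrow> f j = f j0" by blast
  hence "f (Suc j0) = f j0" using le_SucI by blast
  thus False using f(3)[of j0] by simp
qed

text \<open>If \<open>b z\<close> is not in Y, its annihilator contains P and so equals P by maximality.\<close>

lemma max_ann_prime:
  assumes M: "module R M" and Y: "stable M Y" and P: "max_ann M Y P" and a: "a \<in> mp e" and b: "b \<in> mp f" and ab: "a \<otimes> b \<in> P (e + f)"
  shows "a \<in> P e \<or> b \<in> P f"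
proof (rule disjCI)
  interpret M: module R M by fact
  assume nb: "b \<notin> P f"
  obtain p z where z: "z \<in> W M p" "z \<notin> Y p" "P = Ann M Y p z" using P unfolding max_ann_def by blast
  have c: "a \<in> carrier R" "b \<in> carrier R" "z \<in> carrier M" using mp_carrier a b W_carrier[OF M z(1)] by auto
  have bz: "b \<odot>\<^sub>M z \<in> W M (p + f)" "b \<odot>\<^sub>M z \<notin> Y (p + f)" using W_mult[OF M b z(1)] nb b z(3) by (auto simp: add.commute Ann_def)
  have "P \<le> Ann M Y (p + f) (b \<odot>\<^sub>M z)"
  proof (rule le_funI, rule subsetI)
    fix g x assume "x \<in> P g"
    hence x: "x \<in> mp g" "x \<odot>\<^sub>M z \<in> Y (p + g)" by (auto simp: z(3) Ann_def)
    have "x \<odot>\<^sub>M (b \<odot>\<^sub>M z) = b \<odot>\<^sub>M (x \<odot>\<^sub>M z)" by (rule smult_swapR[OF M mp_carrier[OF x(1)] c(2,3)])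
    also have "\<dots> \<in> Y (p + g + f)" by (rule stable_mp[OF M Y b x(2)])
    finally show "x \<in> Ann M Y (p + f) (b \<odot>\<^sub>M z) g" using x(1) by (simp add: Ann_def add_ac)
  qed
  hence eq: "Ann M Y (p + f) (b \<odot>\<^sub>M z) = P" using P bz unfolding max_ann_def by blast
  have "(a \<otimes> b) \<odot>\<^sub>M z \<in> Y (p + (e + f))" using ab by (simp add: z(3) Ann_def)
  hence "a \<in> Ann M Y (p + f) (b \<odot>\<^sub>M z) e" using a c by (simp add: Ann_def M.smult_assoc1 add_ac)
  thus "a \<in> P e" using eq by simp
qed

lemma max_ann_one: assumes M: "module R M" and P: "max_ann M Y P" shows "\<one> \<notin> P 0"
proof -
  interpret M: module R M by fact
  show ?thesis using P W_carrier[OF M] by (auto simp: max_ann_def Ann_def)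
qed

lemma max_ann_sub: "max_ann M Y P \<Longrightarrow> P e \<subseteq> mp e"
  by (auto simp: max_ann_def Ann_def)

lemma max_ann_stable: "module R M \<Longrightarrow> stable M Y \<Longrightarrow> max_ann M Y P \<Longrightarrow> stable SR P"
  by (auto simp: max_ann_def intro: Ann_stable)

lemma max_ann_diff: assumes "max_ann M Y P" "max_ann M Y Q" "P \<noteq> Q"
  shows "\<exists>e c. c \<in> Q e \<and> c \<notin> P e"
proof (rule ccontr)
  assume "\<not> ?thesis"
  hence "Q \<le> P" by (auto simp: le_fun_def)
  thus False using assms unfolding max_ann_def by metis
qed

definition addgen where "addgen M Y p z q = (if p \<le> q then module.msum M (Y q) {a \<odot>\<^sub>M z | a. a \<in> mp (q - p)} else Y q)"

lemma cyc_submodule: assumes M: "module R M" and z: "z \<in> carrier M" shows "submodule {a \<odot>\<^sub>M z | a. a \<in> mp n} R M"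
proof -
  interpret M: module R M by fact
  have "(\<lambda>a. a \<odot>\<^sub>M z) \<in> lin_maps R SR M" using z by (auto simp: lin_maps_def M.smult_l_distr M.smult_assoc1)
  then interpret l: lin_map R SR M "\<lambda>a. a \<odot>\<^sub>M z" by (intro lin_mapI SR_module M)
  have "submodule ((\<lambda>a. a \<odot>\<^sub>M z) ` mp n) R M" by (rule l.image_submodule) (simp add: submodule_self_iff mp_ideal)
  moreover have "(\<lambda>a. a \<odot>\<^sub>M z) ` mp n = {a \<odot>\<^sub>M z | a. a \<in> mp n}" by auto
  ultimately show ?thesis by simp
qed

lemma addgen_stable: assumes M: "module R M" and Y: "stable M Y" and z: "z \<in> W M p"
  shows "stable M (addgen M Y p z)" and "Y q \<subseteq> addgen M Y p z q" and "z \<in> addgen M Y p z p"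
proof -
  interpret M: module R M by fact
  note YD = stableD[OF Y]
  have zc: "z \<in> carrier M" using W_carrier[OF M z] .
  note C = cyc_submodule[OF M zc]
  show "stable M (addgen M Y p z)" unfolding stable_def
  proof (intro allI conjI ballI)
    fix q
    show "submodule (addgen M Y p z q) R M" unfolding addgen_def using M.msum_submodule[OF YD(1) C] YD(1) by simp
    show "addgen M Y p z q \<subseteq> W M q"
    proof (cases "p \<le> q")
      case True
      have "{a \<odot>\<^sub>M z | a. a \<in> mp (q - p)} \<subseteq> W M q" using W_mult[OF M _ z, of _ "q - p"] True by auto
      thus ?thesis unfolding addgen_def using True M.msum_least[OF W_submodule[OF M] YD(2)] by simp
    next
      case False thus ?thesis using YD(2) by (simp add: addgen_def)
    qed
    fix t y assume t: "t \<in> \<mm>" and y: "y \<in> addgen M Y p z q"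
    show "t \<odot>\<^sub>M y \<in> addgen M Y p z (Suc q)"
    proof (cases "p \<le> q")
      case True
      then obtain u a where ua: "u \<in> Y q" "a \<in> mp (q - p)" "y = u \<oplus>\<^sub>M a \<odot>\<^sub>M z" using y by (auto simp: addgen_def M.msum_def)
      have c: "t \<in> carrier R" "a \<in> carrier R" "u \<in> carrier M" using t ua mm.Icarr mp_carrier M.submod_carrier[OF YD(1)] by auto
      have "t \<odot>\<^sub>M y = t \<odot>\<^sub>M u \<oplus>\<^sub>M (t \<otimes> a) \<odot>\<^sub>M z" unfolding ua(3) using c zc by (simp add: M.smult_r_distr M.smult_assoc1)
      moreover have "t \<otimes> a \<in> mp (Suc q - p)" using mp_mult[of t 1 a "q - p"] t ua(2) True by (simp add: Suc_diff_le)
      ultimately show ?thesis using True YD(3)[OF t ua(1)] by (auto simp: addgen_def M.msum_def)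
    next
      case False
      hence "t \<odot>\<^sub>M y \<in> Y (Suc q)" using y YD(3)[OF t] by (simp add: addgen_def)
      thus ?thesis using M.msum_upper(1)[OF YD(1) C] by (auto simp: addgen_def)
    qed
  qed
  show "Y q \<subseteq> addgen M Y p z q" using M.msum_upper(1)[OF YD(1) C] by (auto simp: addgen_def)
  have "z \<in> {a \<odot>\<^sub>M z | a. a \<in> mp 0}" using zc by (auto intro!: exI[of _ \<one>])
  thus "z \<in> addgen M Y p z p" using M.msum_upper(2)[OF YD(1)[of p] C[of 0]] by (auto simp: addgen_def)
qed

text \<open>Let \<open>P\<^sub>k\<close> be infinitely many of them, the annihilators of elements \<open>z\<^sub>k\<close>. By noetherianity some \<open>z\<^sub>k\<close> lies in the
  submodule generated by Y and the earlier \<open>z\<^sub>i\<close>. A product of elements of \<open>P\<^sub>i - P\<^sub>k\<close>, one for each \<open>i < k\<close>, then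
  annihilates \<open>z\<^sub>k\<close> modulo Y, but is not in the prime \<open>P\<^sub>k\<close>.\<close>

lemma max_ann_finite:
  assumes M: "module R M" "fin_gen R M" and Y: "stable M Y" shows "finite {P. max_ann M Y P}"
proof (rule ccontr)
  interpret M: module R M by fact
  assume "infinite {P. max_ann M Y P}"
  then obtain P :: "nat \<Rightarrow> nat \<Rightarrow> 'a set" where P: "inj P" "range P \<subseteq> {P. max_ann M Y P}" using infinite_countable_subset by blast
  have mx: "max_ann M Y (P k)" for k using P(2) by auto
  have "\<forall>k. \<exists>p z. z \<in> W M p \<and> z \<notin> Y p \<and> P k = Ann M Y p z" using mx unfolding max_ann_def by blast
  then obtain p z where pz: "\<And>k. z k \<in> W M (p k)" "\<And>k. z k \<notin> Y (p k)" "\<And>k. P k = Ann M Y (p k) (z k)" by metis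
  define Ys where "Ys = rec_nat Y (\<lambda>k Z. addgen M Z (p k) (z k))"
  have Ys: "Ys 0 = Y" "Ys (Suc k) = addgen M (Ys k) (p k) (z k)" for k by (simp_all add: Ys_def)
  have F: "stable M (Ys k)" for k by (induction k) (auto simp: Ys Y intro: addgen_stable[OF M(1) _ pz(1)])
  have "\<exists>j0. \<forall>j\<ge>j0. Ys j = Ys j0"
    by (rule acc_aboveD[OF acc_above_zero[OF M] F]) (use M.submod_zero[OF stableD(1)[OF F]] addgen_stable(2)[OF M(1) F pz(1)] in \<open>auto simp: Ys\<close>)
  then obtain k where "\<And>j. j \<ge> k \<Longrightarrow> Ys j = Ys k" by blast
  hence "Ys (Suc k) = Ys k" using le_SucI by blast
  hence zk: "z k \<in> Ys k (p k)" using addgen_stable(3)[OF M(1) F pz(1), of k k] by (simp add: Ys)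
  have "\<exists>f b. b \<in> mp f \<and> b \<notin> P k f \<and> (\<forall>q. \<forall>y\<in>Ys i q. b \<odot>\<^sub>M y \<in> Y (q + f))" if "i \<le> k" for i using that
  proof (induction i)
    case 0
    have "\<one> \<odot>\<^sub>M y \<in> Y (q + 0)" if "y \<in> Y q" for y q using that M.submod_carrier[OF stableD(1)[OF Y]] by simp
    moreover have "\<one> \<in> mp 0" by simp
    ultimately show ?case using max_ann_one[OF M(1) mx[of k]] Ys(1) by metis
  next
    case (Suc i)
    then obtain f b where b: "b \<in> mp f" "b \<notin> P k f" "\<And>q y. y \<in> Ys i q \<Longrightarrow> b \<odot>\<^sub>M y \<in> Y (q + f)" by auto
    have "P k \<noteq> P i" using Suc.prems injD[OF P(1), of k i] by auto
    then obtain g c where c: "c \<in> P i g" "c \<notin> P k g" using max_ann_diff[OF mx mx] by blast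
    have cm: "c \<in> mp g" "c \<odot>\<^sub>M z i \<in> Y (p i + g)" using c(1) by (auto simp: pz(3) Ann_def)
    have R: "b \<in> carrier R" "c \<in> carrier R" using b(1) cm(1) mp_carrier by auto
    have "b \<otimes> c \<in> mp (f + g)" by (rule mp_mult[OF b(1) cm(1)])
    moreover have "b \<otimes> c \<notin> P k (f + g)" using max_ann_prime[OF M(1) Y mx b(1) cm(1)] b(2) c(2) by blast
    moreover have "(b \<otimes> c) \<odot>\<^sub>M y \<in> Y (q + (f + g))" if y: "y \<in> Ys (Suc i) q" for q y
    proof -
      have 1: "(b \<otimes> c) \<odot>\<^sub>M u \<in> Y (q + (f + g))" if u: "u \<in> Ys i q" for u
      proof -
        have uc: "u \<in> carrier M" using M.submod_carrier[OF stableD(1)[OF F] u] .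
        have "c \<odot>\<^sub>M (b \<odot>\<^sub>M u) \<in> Y (q + f + g)" by (rule stable_mp[OF M(1) Y cm(1) b(3)[OF u]])
        thus ?thesis using R uc smult_swapR[OF M(1) R(2,1) uc] by (simp add: M.smult_assoc1 add_ac)
      qed
      show ?thesis
      proof (cases "p i \<le> q")
        case True
        then obtain u a where ua: "u \<in> Ys i q" "a \<in> mp (q - p i)" "y = u \<oplus>\<^sub>M a \<odot>\<^sub>M z i" using y by (auto simp: Ys addgen_def M.msum_def)
        have cc: "u \<in> carrier M" "a \<in> carrier R" "z i \<in> carrier M"
          using M.submod_carrier[OF stableD(1)[OF F] ua(1)] mp_carrier[OF ua(2)] W_carrier[OF M(1) pz(1)] by auto
        have "(b \<otimes> a) \<odot>\<^sub>M (c \<odot>\<^sub>M z i) \<in> Y (p i + g + (f + (q - p i)))" by (rule stable_mp[OF M(1) Y mp_mult[OF b(1) ua(2)] cm(2)])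
        moreover have "(b \<otimes> c) \<odot>\<^sub>M (a \<odot>\<^sub>M z i) = (b \<otimes> a) \<odot>\<^sub>M (c \<odot>\<^sub>M z i)"
          using R cc by (simp add: M.smult_assoc1[symmetric] m_assoc m_comm[of c a])
        moreover have "p i + g + (f + (q - p i)) = q + (f + g)" using True by simp
        ultimately show ?thesis using 1[OF ua(1)] M.submod_add[OF stableD(1)[OF Y]] R cc unfolding ua(3) by (simp add: M.smult_r_distr add_ac)
      next
        case False thus ?thesis using 1 y by (simp add: Ys addgen_def)
      qed
    qed
    ultimately show ?case by blast
  qed
  then obtain f b where b: "b \<in> mp f" "b \<notin> P k f" "\<And>q y. y \<in> Ys k q \<Longrightarrow> b \<odot>\<^sub>M y \<in> Y (q + f)" by blast
  thus False using b(3)[OF zk] by (simp add: pz(3) Ann_def)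
qed

lemma prime_pow:
  assumes M: "module R M" and Y: "stable M Y" and P: "max_ann M Y P" and a: "a \<in> mp e"
  shows "a [^] (n::nat) \<in> P (e * n) \<Longrightarrow> a \<in> P e"
proof (induction n)
  case 0 thus ?case using max_ann_one[OF M P] by simp
next
  case (Suc n)
  have "a [^] n \<otimes> a \<in> P (e * n + e)" using Suc.prems by (simp add: add.commute)
  thus ?case using max_ann_prime[OF M Y P pow_mp[OF a] a] Suc.IH by blast
qed

lemma stable_pow: assumes P: "stable SR P" and a: "a \<in> P e" "n > 0" shows "a [^] (n::nat) \<in> P (e * n)"
proof -
  have am: "a \<in> mp e" using stableD(2)[OF P] a(1) by (auto simp: WS_sub)
  obtain m where n: "n = Suc m" using a(2) gr0_implies_Suc by blast
  have "a [^] m \<odot>\<^sub>SR a \<in> P (e + e * m)" by (rule stable_mp[OF SR_module P pow_mp[OF am] a(1)])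
  thus ?thesis by (simp add: n)
qed

text \<open>By the last hypothesis no maximal annihilator contains X. There are finitely many of them, they are prime,
  and each annihilator is contained in one of them, so prime avoidance gives y. Powers bring the summands
  that occur to the same degree.\<close>

theorem homogeneous_avoidance:
  assumes M: "module R M" "fin_gen R M" and Y: "stable M Y" and xs: "X \<subseteq> \<mm>"
    and J: "stable SR J" "\<And>x. x \<in> X \<Longrightarrow> x \<in> J 1"
    and soc: "\<And>p z. z \<in> W M p \<Longrightarrow> (\<And>x. x \<in> X \<Longrightarrow> x \<odot>\<^sub>M z \<in> Y (Suc p)) \<Longrightarrow> z \<in> Y p"
  shows "\<exists>e y. y \<in> J e \<and> (\<forall>p. \<forall>z\<in>W M p. y \<odot>\<^sub>M z \<in> Y (p + e) \<longrightarrow> z \<in> Y p)"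
proof -
  interpret M: module R M by fact
  note JD = stableD[OF J(1), unfolded WS_sub]
  have Jmult: "a \<otimes> b \<in> J (e + f)" if "a \<in> mp f" "b \<in> J e" for a b e f using stable_mp[OF SR_module J(1) that] by simp
  have notX: "\<exists>x\<in>X. x \<notin> P 1" if P: "max_ann M Y P" for P
  proof (rule ccontr)
    assume "\<not> ?thesis"
    moreover obtain p z where z: "z \<in> W M p" "z \<notin> Y p" "P = Ann M Y p z" using P unfolding max_ann_def by blast
    ultimately have "x \<odot>\<^sub>M z \<in> Y (Suc p)" if "x \<in> X" for x using that by (auto simp: Ann_def)
    thus False using soc z(1,2) by blast
  qed
  have "\<exists>e y. e > 0 \<and> y \<in> J e \<and> (\<forall>P\<in>Q. y \<notin> P e)" if "finite Q" "Q \<subseteq> {P. max_ann M Y P}" for Q using that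
  proof (induction Q rule: finite_induct)
    case empty
    show ?case using SF.submod_zero[OF JD(1)] by (intro exI[of _ 1] exI[of _ \<zero>]) simp
  next
    case (insert P Q)
    have P: "max_ann M Y P" and Qm: "\<And>T. T \<in> Q \<Longrightarrow> max_ann M Y T" using insert.prems by auto
    obtain e y where y: "e > 0" "y \<in> J e" "\<And>T. T \<in> Q \<Longrightarrow> y \<notin> T e" using insert by auto
    have ym: "y \<in> mp e" using JD(2) y(2) by auto
    show ?case
    proof (cases "y \<in> P e")
      case False thus ?thesis using y by auto
    next
      case yP: True
      have "\<exists>g b. b \<in> mp g \<and> b \<notin> P g \<and> (\<forall>T\<in>Q'. b \<in> T g)" if "Q' \<subseteq> Q" for Q'
        using finite_subset[OF that insert.hyps(1)] that
      proof (induction Q' rule: finite_induct)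
        case empty show ?case using max_ann_one[OF M(1) P] by (intro exI[of _ 0] exI[of _ \<one>]) simp
      next
        case (insert T Q')
        then obtain g b where b: "b \<in> mp g" "b \<notin> P g" "\<And>T. T \<in> Q' \<Longrightarrow> b \<in> T g" by auto
        have T: "max_ann M Y T" "P \<noteq> T" using insert.prems Qm \<open>P \<notin> Q\<close> by auto
        obtain h c where c: "c \<in> T h" "c \<notin> P h" using max_ann_diff[OF P T(1)] T(2) by blast
        have cm: "c \<in> mp h" using c(1) max_ann_sub[OF T(1)] by auto
        have bc: "b \<in> carrier R" "c \<in> carrier R" using b cm mp_carrier by auto
        have "b \<otimes> c \<notin> P (g + h)" using max_ann_prime[OF M(1) Y P b(1) cm] b(2) c(2) by blast
        moreover have "b \<otimes> c \<in> T' (g + h)" if "T' \<in> insert T Q'" for T'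
        proof -
          have T'm: "max_ann M Y T'" using that insert.prems Qm T(1) by auto
          note TF = max_ann_stable[OF M(1) Y T'm]
          show ?thesis
          proof (cases "T' = T")
            case True thus ?thesis using stable_mp[OF SR_module TF b(1), of c h] c(1) by (simp add: add.commute)
          next
            case False
            hence "c \<odot>\<^sub>SR b \<in> T' (g + h)" using stable_mp[OF SR_module TF cm b(3)] that by simp
            thus ?thesis using bc by (simp add: m_comm)
          qed
        qed
        ultimately show ?case using mp_mult[OF b(1) cm] by blast
      qed
      then obtain g b where b: "b \<in> mp g" "b \<notin> P g" "\<And>T. T \<in> Q \<Longrightarrow> b \<in> T g" by blast
      obtain x where x: "x \<in> X" "x \<notin> P 1" using notX[OF P] by blast
      have xm: "x \<in> mp 1" using x(1) xs by auto
      \<comment> \<open>In \<open>J\<close> and in each member of \<open>Q\<close>, but not in \<open>P\<close>: the factor \<open>x\<close> provides the first property.\<close>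
      define w where "w = b \<otimes> x"
      have wm: "w \<in> mp (g + 1)" unfolding w_def by (rule mp_mult[OF b(1) xm])
      have wJ: "w \<in> J (g + 1)" using Jmult[OF b(1) J(2)[OF x(1)]] by (simp add: w_def)
      have wP: "w \<notin> P (g + 1)" unfolding w_def using max_ann_prime[OF M(1) Y P b(1) xm] b(2) x(2) by blast
      have wT: "w \<in> T (g + 1)" if "T \<in> Q" for T
      proof -
        have "x \<odot>\<^sub>SR b \<in> T (g + 1)" by (rule stable_mp[OF SR_module max_ann_stable[OF M(1) Y Qm[OF that]] xm b(3)[OF that]])
        thus ?thesis using mp_carrier[OF b(1)] mp_carrier[OF xm] by (simp add: w_def m_comm)
      qed
      \<comment> \<open>The exponents make the sum homogeneous.\<close>
      let ?n = "e * (g + 1)"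
      let ?y = "y [^] (g + 1) \<oplus> w [^] e"
      have eq: "(g + 1) * e = ?n" by simp
      have pJ: "y [^] (g + 1) \<in> J ?n" "w [^] e \<in> J ?n"
        using stable_pow[OF J(1) y(2), of "g + 1"] stable_pow[OF J(1) wJ y(1)] by (simp_all only: eq)
      have pc: "y [^] (g + 1) \<in> carrier R" "w [^] e \<in> carrier R" using mp_carrier[OF ym] mp_carrier[OF wm] by (simp_all del: nat_pow_Suc)
      have cancel: "v \<in> T ?n" if T: "max_ann M Y T" and s: "u \<oplus> v \<in> T ?n" and u: "u \<in> T ?n" and v: "v \<in> carrier R" for T u v
      proof -
        have "submodule (T ?n) R SR" by (rule stableD(1)[OF max_ann_stable[OF M(1) Y T]])
        from SF.submod_cancel[OF this, of v u] show ?thesis using s u v SF.submod_carrier[OF \<open>submodule (T ?n) R SR\<close> u] by (simp add: a_comm)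
      qed
      have "?y \<in> J ?n" using SF.submod_add[OF JD(1) pJ] by simp
      moreover have "?y \<notin> P ?n"
      proof
        assume "?y \<in> P ?n"
        hence "w [^] e \<in> P ?n" using cancel[OF P _ _ pc(2)] stable_pow[OF max_ann_stable[OF M(1) Y P] yP, of "g + 1"] by simp
        hence "w [^] e \<in> P ((g + 1) * e)" by (simp only: eq)
        thus False using prime_pow[OF M(1) Y P wm] wP by blast
      qed
      moreover have "?y \<notin> T ?n" if T: "T \<in> Q" for T
      proof
        assume a: "?y \<in> T ?n"
        have "w [^] e \<in> T ?n" using stable_pow[OF max_ann_stable[OF M(1) Y Qm[OF T]] wT[OF T] y(1)] by (simp only: eq)
        hence "y [^] (g + 1) \<in> T ?n" using cancel[OF Qm[OF T] _ _ pc(1), of "w [^] e"] a pc by (simp add: a_comm del: nat_pow_Suc)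
        thus False using prime_pow[OF M(1) Y Qm[OF T] ym] y(3)[OF T] by blast
      qed
      moreover have "?n > 0" using y(1) by simp
      ultimately show ?thesis by blast
    qed
  qed
  from this[OF max_ann_finite[OF M Y]] obtain e y where y: "y \<in> J e" "\<And>P. max_ann M Y P \<Longrightarrow> y \<notin> P e" by blast
  have "z \<in> Y p" if z: "z \<in> W M p" and yz: "y \<odot>\<^sub>M z \<in> Y (p + e)" for p z
  proof (rule ccontr)
    assume "z \<notin> Y p"
    then obtain P where P: "max_ann M Y P" "Ann M Y p z \<le> P" using max_ann_exists[OF M(1) Y z] by blast
    have "y \<in> Ann M Y p z e" using y(1) JD(2) yz by (auto simp: Ann_def)
    thus False using P y(2)[OF P(1)] by (auto simp: le_fun_def)
  qed
  thus ?thesis using y(1) by blast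
qed

section \<open>Lifting regular sequences from the associated graded module\<close>

text \<open>The submodule \<open>Y + y M\<close>, for y homogeneous of degree e.\<close>

definition adjoin where "adjoin M e y Y p = (if e \<le> p then module.msum M (Y p) {y \<odot>\<^sub>M z | z. z \<in> W M (p - e)} else Y p)"

lemma adjoin_stable: assumes M: "module R M" and Y: "stable M Y" and y: "y \<in> mp e"
  shows "stable M (adjoin M e y Y)" and "Y p \<subseteq> adjoin M e y Y p"
proof -
  interpret M: module R M by fact
  note YD = stableD[OF Y]
  have yR: "y \<in> carrier R" using mp_carrier y by auto
  have C: "submodule {y \<odot>\<^sub>M z | z. z \<in> W M q} R M" for q by (rule M.smult_image_submodule[OF yR W_submodule[OF M]])
  show "Y p \<subseteq> adjoin M e y Y p" for p using M.msum_upper(1)[OF YD(1) C] by (auto simp: adjoin_def)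
  thus "stable M (adjoin M e y Y)" unfolding stable_def
  proof (intro allI conjI ballI)
    fix p
    show "submodule (adjoin M e y Y p) R M" unfolding adjoin_def using M.msum_submodule[OF YD(1) C] YD(1) by simp
    have "{y \<odot>\<^sub>M z | z. z \<in> W M (p - e)} \<subseteq> W M p" if "e \<le> p" using W_mult[OF M y, of _ "p - e"] that by auto
    thus "adjoin M e y Y p \<subseteq> W M p" unfolding adjoin_def using M.msum_least[OF W_submodule[OF M] YD(2)] YD(2) by simp
    fix t v assume t: "t \<in> \<mm>" and v: "v \<in> adjoin M e y Y p"
    have tR: "t \<in> carrier R" using t mm.Icarr by simp
    show "t \<odot>\<^sub>M v \<in> adjoin M e y Y (Suc p)"
    proof (cases "e \<le> p")
      case True
      then obtain u z where uz: "u \<in> Y p" "z \<in> W M (p - e)" "v = u \<oplus>\<^sub>M y \<odot>\<^sub>M z" using v by (auto simp: adjoin_def M.msum_def)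
      have c: "u \<in> carrier M" "z \<in> carrier M" using M.submod_carrier[OF YD(1) uz(1)] W_carrier[OF M uz(2)] by auto
      have "t \<odot>\<^sub>M v = t \<odot>\<^sub>M u \<oplus>\<^sub>M y \<odot>\<^sub>M (t \<odot>\<^sub>M z)" unfolding uz(3) using c tR yR smult_swapR[OF M tR yR c(2)] by (simp add: M.smult_r_distr)
      thus ?thesis using True YD(3)[OF t uz(1)] W_mult1[OF M t uz(2)] by (auto simp: adjoin_def M.msum_def Suc_diff_le)
    next
      case False
      hence "t \<odot>\<^sub>M v \<in> Y (Suc p)" using v YD(3)[OF t] by (simp add: adjoin_def)
      thus ?thesis using M.msum_upper(1)[OF YD(1) C] by (auto simp: adjoin_def)
    qed
  qed
qed

text \<open>The zero submodule of the associated graded module; \<open>filt_seq M xs\<close> below corresponds to the submodule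
  generated by the multiples of the initial forms.\<close>

definition filt_zero where "filt_zero M p = W M (Suc p)"

lemma filt_zero_stable: "module R M \<Longrightarrow> stable M (filt_zero M)"
  unfolding stable_def filt_zero_def using W_submodule W_antimono[of M _ "Suc _"] W_mult1 by (auto intro: W_Suc_sub)

definition filt_seq where "filt_seq M xs = foldl (\<lambda>Y x. adjoin M 1 x Y) (filt_zero M) xs"

lemma filt_seq_snoc: "filt_seq M (xs @ [x]) = adjoin M 1 x (filt_seq M xs)" by (simp add: filt_seq_def)

lemma filt_seq_stable: "module R M \<Longrightarrow> set xs \<subseteq> \<mm> \<Longrightarrow> stable M (filt_seq M xs)"
proof (induction xs rule: rev_induct)
  case Nil thus ?case by (simp add: filt_seq_def filt_zero_stable)
next
  case (snoc x xs) thus ?case by (auto simp: filt_seq_snoc intro!: adjoin_stable)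
qed

text \<open>Sequences grow at the end, so the recursion runs over the reversed list.\<close>

primrec img_list where
  "img_list M q [] = {\<zero>\<^sub>M}"
| "img_list M q (x # xs) = module.msum M (img_list M q xs) {x \<odot>\<^sub>M z | z. z \<in> W M q}"

definition img_seq where "img_seq M xs q = img_list M q (rev xs)"

lemma img_seq_simps: "img_seq M [] q = {\<zero>\<^sub>M}" "img_seq M (xs @ [x]) q = module.msum M (img_seq M xs q) {x \<odot>\<^sub>M z | z. z \<in> W M q}"
  by (simp_all add: img_seq_def)

lemma img_seq_submodule: assumes M: "module R M" shows "set xs \<subseteq> carrier R \<Longrightarrow> submodule (img_seq M xs q) R M"
proof (induction xs rule: rev_induct)
  interpret M: module R M by fact
  case Nil show ?case by (simp add: img_seq_simps M.zero_submodule)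
next
  interpret M: module R M by fact
  case (snoc x xs) thus ?case by (simp add: img_seq_simps M.msum_submodule M.smult_image_submodule W_submodule[OF M])
qed

lemma img_seq_0: assumes M: "module R M" shows "set xs \<subseteq> carrier R \<Longrightarrow> img_seq M xs 0 = set_smult R M (set xs)"
proof (induction xs rule: rev_induct)
  interpret M: module R M by fact
  case Nil show ?case by (simp add: img_seq_simps M.set_smult_empty)
next
  interpret M: module R M by fact
  case (snoc x xs) thus ?case by (simp add: img_seq_simps W_0[OF M] M.set_smult_insert)
qed

lemma img_seq_mono: "module R M \<Longrightarrow> i \<le> j \<Longrightarrow> img_seq M xs j \<subseteq> img_seq M xs i"
proof (induction xs rule: rev_induct)
  case (snoc x xs)
  interpret M: module R M by fact
  show ?case unfolding img_seq_simps by (rule M.msum_mono) (use snoc W_antimono[OF snoc.prems] in auto)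
qed (simp add: img_seq_simps)

lemma img_seq_mult: assumes M: "module R M" and xs: "set xs \<subseteq> carrier R" and t: "t \<in> \<mm>"
  shows "z \<in> img_seq M xs q \<Longrightarrow> t \<odot>\<^sub>M z \<in> img_seq M xs (Suc q)"
  using xs
proof (induction xs arbitrary: z rule: rev_induct)
  interpret M: module R M by fact
  case Nil thus ?case using t mm.Icarr by (simp add: img_seq_simps)
next
  interpret M: module R M by fact
  case (snoc x xs)
  obtain l w where lw: "l \<in> img_seq M xs q" "w \<in> W M q" "z = l \<oplus>\<^sub>M x \<odot>\<^sub>M w" using snoc.prems(1) by (auto simp: img_seq_simps M.msum_def)
  have R: "t \<in> carrier R" "x \<in> carrier R" "l \<in> carrier M" "w \<in> carrier M"
    using t mm.Icarr snoc.prems M.submod_carrier[OF img_seq_submodule[OF M] lw(1)] W_carrier[OF M lw(2)] by auto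
  have "t \<odot>\<^sub>M z = t \<odot>\<^sub>M l \<oplus>\<^sub>M x \<odot>\<^sub>M (t \<odot>\<^sub>M w)" unfolding lw(3) using R smult_swapR[OF M R(1,2,4)] by (simp add: M.smult_r_distr)
  moreover have "t \<odot>\<^sub>M l \<in> img_seq M xs (Suc q)" using snoc lw(1) by simp
  ultimately show ?case unfolding img_seq_simps M.msum_def using W_mult1[OF M t lw(2)] by blast
qed

definition img_pred where "img_pred M xs p = (case p of 0 \<Rightarrow> {\<zero>\<^sub>M} | Suc q \<Rightarrow> img_seq M xs q)"

text \<open>In terms of M, the submodule generated by the initial forms is \<open>x\<^sub>1 \<mm>\<^sup>p\<^sup>-\<^sup>1 M + \<dots> + x\<^sub>c \<mm>\<^sup>p\<^sup>-\<^sup>1 M\<close> modulo \<open>\<mm>\<^sup>p\<^sup>+\<^sup>1 M\<close>.\<close>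

lemma filt_seq_eq: assumes M: "module R M" shows "set xs \<subseteq> carrier R \<Longrightarrow> filt_seq M xs p = module.msum M (img_pred M xs p) (W M (Suc p))"
proof (induction xs rule: rev_induct)
  interpret M: module R M by fact
  case Nil
  have "M.msum {\<zero>\<^sub>M} (W M (Suc p)) = W M (Suc p)" using W_carrier[OF M, of _ "Suc p"] by (auto simp: M.msum_def intro!: exI[of _ "_ :: 'c"])
  moreover have "img_pred M [] p = {\<zero>\<^sub>M}" by (simp add: img_pred_def img_seq_simps split: nat.split)
  ultimately show ?case by (simp add: filt_seq_def filt_zero_def)
next
  interpret M: module R M by fact
  case (snoc x xs)
  note IH = snoc.IH
  have xs: "set xs \<subseteq> carrier R" "x \<in> carrier R" using snoc by auto
  show ?case
  proof (cases p)
    case 0 thus ?thesis using IH[OF xs(1)] by (simp add: filt_seq_snoc adjoin_def img_pred_def)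
  next
    case (Suc q)
    have swap: "M.msum (M.msum A B) C = M.msum (M.msum A C) B" if "A \<subseteq> carrier M" "B \<subseteq> carrier M" "C \<subseteq> carrier M" for A B C
    proof -
      have *: "M.msum (M.msum A B) C \<subseteq> M.msum (M.msum A C) B" if "A \<subseteq> carrier M" "B \<subseteq> carrier M" "C \<subseteq> carrier M" for A B C
      proof
        fix u assume "u \<in> M.msum (M.msum A B) C"
        then obtain a b c where abc: "a \<in> A" "b \<in> B" "c \<in> C" "u = (a \<oplus>\<^sub>M b) \<oplus>\<^sub>M c" by (auto simp: M.msum_def)
        hence "u = (a \<oplus>\<^sub>M c) \<oplus>\<^sub>M b" using that by (simp add: M.M.a_ac subset_iff)
        thus "u \<in> M.msum (M.msum A C) B" using abc unfolding M.msum_def by blast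
      qed
      show ?thesis using *[OF that] *[OF that(1,3,2)] by blast
    qed
    have LLc: "img_seq M xs q \<subseteq> carrier M" using M.submod_carrier[OF img_seq_submodule[OF M xs(1)]] by blast
    have Wc: "W M r \<subseteq> carrier M" for r using W_carrier[OF M] by blast
    have xc: "{x \<odot>\<^sub>M z | z. z \<in> W M q} \<subseteq> carrier M" using W_carrier[OF M] xs(2) by auto
    have "filt_seq M (xs @ [x]) p = M.msum (filt_seq M xs p) {x \<odot>\<^sub>M z | z. z \<in> W M q}" by (simp add: filt_seq_snoc adjoin_def Suc)
    also have "\<dots> = M.msum (img_pred M (xs @ [x]) p) (W M (Suc p))"
      unfolding IH[OF xs(1)] by (simp add: img_pred_def Suc img_seq_simps swap[OF LLc Wc xc])
    finally show ?thesis .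
  qed
qed

text \<open>A criterion of Valabrega and Valla. The second conclusion says that the associated graded module of
  \<open>M/(xs)M\<close> is that of M modulo the initial forms; the induction needs both.\<close>

theorem regular_of_gr_regular:
  assumes M: "module R M" "fin_gen R M" and xs: "set xs \<subseteq> \<mm>"
    and reg: "\<And>i p z. i < length xs \<Longrightarrow> z \<in> W M p \<Longrightarrow> xs ! i \<odot>\<^sub>M z \<in> filt_seq M (take i xs) (Suc p) \<Longrightarrow> z \<in> filt_seq M (take i xs) p"
  shows "(\<forall>i<length xs. \<forall>z\<in>carrier M. xs ! i \<odot>\<^sub>M z \<in> set_smult R M (set (take i xs)) \<longrightarrow> z \<in> set_smult R M (set (take i xs)))
    \<and> (\<forall>q. img_seq M xs 0 \<inter> W M (Suc q) \<subseteq> img_seq M xs q)"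
  using xs reg
proof (induction xs rule: rev_induct)
  interpret M: module R M by fact
  case Nil show ?case by (auto simp: img_seq_simps)
next
  interpret M: module R M by fact
  case (snoc x xs)
  have xs: "set xs \<subseteq> \<mm>" "x \<in> \<mm>" using snoc.prems by auto
  hence R: "set xs \<subseteq> carrier R" "x \<in> carrier R" using mm.Icarr by auto
  have IH: "\<And>i z. i<length xs \<Longrightarrow> z\<in>carrier M \<Longrightarrow> xs ! i \<odot>\<^sub>M z \<in> set_smult R M (set (take i xs)) \<Longrightarrow> z \<in> set_smult R M (set (take i xs))"
    and S: "\<And>q. img_seq M xs 0 \<inter> W M (Suc q) \<subseteq> img_seq M xs q"
  proof -
    have "i < length xs \<Longrightarrow> z \<in> W M p \<Longrightarrow> xs ! i \<odot>\<^sub>M z \<in> filt_seq M (take i xs) (Suc p) \<Longrightarrow> z \<in> filt_seq M (take i xs) p" for i p z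
      using snoc.prems(2)[of i z p] by (simp add: nth_append)
    from snoc.IH[OF xs(1) this]
    show "\<And>i z. i<length xs \<Longrightarrow> z\<in>carrier M \<Longrightarrow> xs ! i \<odot>\<^sub>M z \<in> set_smult R M (set (take i xs)) \<Longrightarrow> z \<in> set_smult R M (set (take i xs))"
      "\<And>q. img_seq M xs 0 \<inter> W M (Suc q) \<subseteq> img_seq M xs q" by blast+
  qed
  have rx: "z \<in> filt_seq M xs p" if "z \<in> W M p" "x \<odot>\<^sub>M z \<in> filt_seq M xs (Suc p)" for z p
    using snoc.prems(2)[of "length xs" z p] that by simp
  let ?L = "img_seq M xs 0"
  note Ls = img_seq_submodule[OF M(1) R(1)]
  note Yfe = filt_seq_eq[OF M(1) R(1)]
  have LLY: "img_seq M xs q \<subseteq> filt_seq M xs (Suc q)" for q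
    unfolding Yfe img_pred_def using M.msum_upper(1)[OF Ls W_submodule[OF M(1)]] by simp
  have LmL: "img_pred M xs p \<subseteq> ?L" for p
    using img_seq_mono[OF M(1), of 0 "p - 1" xs] M.submod_zero[OF Ls] by (cases p) (auto simp: img_pred_def)
  \<comment> \<open>By successive approximation, \<open>z\<close> is in \<open>L + \<mm>\<^sup>p M\<close> for every \<open>p\<close>; Krull's theorem concludes.\<close>
  have reglast: "z \<in> ?L" if z: "z \<in> carrier M" and xz: "x \<odot>\<^sub>M z \<in> ?L" for z
  proof -
    have "z \<in> M.msum ?L (W M p)" for p
    proof (induction p)
      case 0 show ?case using z M.msum_upper(2)[OF Ls W_submodule[OF M(1)], of 0 0] by (auto simp: W_0[OF M(1)])
    next
      case (Suc p)
      then obtain l z' where lz: "l \<in> ?L" "z' \<in> W M p" "z = l \<oplus>\<^sub>M z'" unfolding M.msum_def by blast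
      have c: "l \<in> carrier M" "z' \<in> carrier M" using M.submod_carrier[OF Ls lz(1)] W_carrier[OF M(1) lz(2)] by auto
      have "x \<odot>\<^sub>M z' = x \<odot>\<^sub>M z \<ominus>\<^sub>M x \<odot>\<^sub>M l" unfolding lz(3) using c R by (simp add: M.smult_r_distr M.M.move_minus)
      hence "x \<odot>\<^sub>M z' \<in> ?L" using M.submod_diff[OF Ls xz M.submod_smult[OF Ls R(2) lz(1)]] by simp
      hence "x \<odot>\<^sub>M z' \<in> img_seq M xs p" using S W_mult1[OF M(1) xs(2) lz(2)] by blast
      hence "z' \<in> filt_seq M xs p" using rx[OF lz(2)] LLY by blast
      then obtain l' r where lr: "l' \<in> img_pred M xs p" "r \<in> W M (Suc p)" "z' = l' \<oplus>\<^sub>M r" unfolding Yfe M.msum_def by blast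
      have l'L: "l' \<in> ?L" using LmL lr(1) by blast
      have "z = (l \<oplus>\<^sub>M l') \<oplus>\<^sub>M r" unfolding lz(3) lr(3) using c M.submod_carrier[OF Ls l'L] W_carrier[OF M(1) lr(2)] by (simp add: M.M.a_assoc)
      thus ?case unfolding M.msum_def using M.submod_add[OF Ls lz(1) l'L] lr(2) by blast
    qed
    thus ?thesis by (rule krull_intersection_quot[OF M Ls])
  qed
  show ?case
  proof (intro conjI allI impI ballI subsetI)
    fix i z assume i: "i < length (xs @ [x])" and z: "z \<in> carrier M" and xz: "(xs @ [x]) ! i \<odot>\<^sub>M z \<in> set_smult R M (set (take i (xs @ [x])))"
    show "z \<in> set_smult R M (set (take i (xs @ [x])))"
    proof (cases "i < length xs")
      case True thus ?thesis using IH[OF True z] xz by (simp add: nth_append)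
    next
      case False
      hence "i = length xs" using i by simp
      thus ?thesis using reglast[OF z] xz img_seq_0[OF M(1) R(1)] by simp
    qed
  next
    fix q u assume "u \<in> img_seq M (xs @ [x]) 0 \<inter> W M (Suc q)"
    hence u: "u \<in> img_seq M (xs @ [x]) 0" "u \<in> W M (Suc q)" by auto
    have "\<exists>l\<in>img_seq M xs k. \<exists>z\<in>W M k. u = l \<oplus>\<^sub>M x \<odot>\<^sub>M z" if "k \<le> q" for k using that
    proof (induction k)
      case 0 thus ?case using u(1) by (auto simp: img_seq_simps M.msum_def)
    next
      case (Suc k)
      then obtain l z where lz: "l \<in> img_seq M xs k" "z \<in> W M k" "u = l \<oplus>\<^sub>M x \<odot>\<^sub>M z" by auto
      have c: "l \<in> carrier M" "z \<in> carrier M" "u \<in> carrier M" using M.submod_carrier[OF Ls lz(1)] W_carrier[OF M(1) lz(2)] W_carrier[OF M(1) u(2)] by auto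
      have uW: "u \<in> W M (Suc (Suc k))" using u(2) W_antimono[OF M(1), of "Suc (Suc k)" "Suc q"] Suc.prems by auto
      have YS: "submodule (filt_seq M xs (Suc k)) R M" by (rule stableD(1)[OF filt_seq_stable[OF M(1) xs(1)]])
      have uY: "u \<in> filt_seq M xs (Suc k)" unfolding Yfe using M.msum_upper(2)[OF _ W_submodule[OF M(1)]] uW Ls M.zero_submodule
        by (auto simp: img_pred_def split: nat.split)
      have "x \<odot>\<^sub>M z = u \<ominus>\<^sub>M l" using lz(3) c R by (simp add: M.M.move_minus)
      hence "x \<odot>\<^sub>M z \<in> filt_seq M xs (Suc k)" using M.submod_diff[OF YS uY subsetD[OF LLY lz(1)]] by simp
      hence "z \<in> filt_seq M xs k" by (rule rx[OF lz(2)])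
      then obtain y z' where yz: "y \<in> img_pred M xs k" "z' \<in> W M (Suc k)" "z = y \<oplus>\<^sub>M z'" unfolding Yfe M.msum_def by blast
      have yc: "y \<in> carrier M" "z' \<in> carrier M" using subsetD[OF LmL yz(1)] M.submod_carrier[OF Ls] W_carrier[OF M(1) yz(2)] by auto
      have xy: "x \<odot>\<^sub>M y \<in> img_seq M xs k"
        using yz(1) img_seq_mult[OF M(1) R(1) xs(2), of y "k - 1"] R M.submod_zero[OF Ls] by (cases k) (auto simp: img_pred_def)
      let ?l = "l \<oplus>\<^sub>M x \<odot>\<^sub>M y"
      have l1: "?l \<in> img_seq M xs k" by (rule M.submod_add[OF Ls lz(1) xy])
      have "?l = u \<ominus>\<^sub>M x \<odot>\<^sub>M z'" unfolding lz(3) yz(3) using c yc R by (simp add: M.smult_r_distr M.M.move_minus)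
      hence "?l \<in> W M (Suc (Suc k))" using M.submod_diff[OF W_submodule[OF M(1)] uW W_mult1[OF M(1) xs(2) yz(2)]] by simp
      hence "?l \<in> img_seq M xs (Suc k)" using S[of "Suc k"] l1 img_seq_mono[OF M(1), of 0 k xs] by blast
      moreover have "u = ?l \<oplus>\<^sub>M x \<odot>\<^sub>M z'" unfolding lz(3) yz(3) using c yc R by (simp add: M.smult_r_distr M.M.a_assoc)
      ultimately show ?case using yz(2) by blast
    qed
    thus "u \<in> img_seq M (xs @ [x]) q" unfolding img_seq_simps M.msum_def by blast
  qed
qed

end

section \<open>Koszul complexes of initial forms\<close>

context noeth_local begin

lemma GM_zero: "module R M \<Longrightarrow> \<zero>\<^sub>(GM M) = (\<lambda>p. W M (Suc p))"
  by (simp add: GM_simps direct_sum_simps gq_zero)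

lemma GM_I: "module R M \<Longrightarrow> (\<And>i. z i \<in> W M i) \<Longrightarrow> finite {i. z i \<notin> W M (Suc i)} \<Longrightarrow> (\<lambda>i. gc M i (z i)) \<in> carrier (GM M)"
  using DD_I[of M z] by (simp add: GM_simps del: direct_sum_simps)

lemma GM_reps: assumes M: "module R M" and f: "f \<in> carrier (GM M)"
  obtains z where "\<And>i. z i \<in> W M i" "f = (\<lambda>i. gc M i (z i))" "finite {i. z i \<notin> W M (Suc i)}"
proof -
  obtain z where z: "\<And>i. z i \<in> W M i" "\<And>i. f i = gc M i (z i)" "finite {i. f i \<noteq> W M (Suc i)}"
    using DD_reps[OF M f[unfolded GM_simps]] by metis
  have "{i. z i \<notin> W M (Suc i)} \<subseteq> {i. f i \<noteq> W M (Suc i)}" using z gc_zero_iff[OF M W_carrier[OF M z(1)]] by auto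
  hence "finite {i. z i \<notin> W M (Suc i)}" using z(3) finite_subset by blast
  thus thesis using z by (intro that[of z]) auto
qed

lemma GM_minus: assumes M: "module R M" and f: "f \<in> carrier (GM M)" "g \<in> carrier (GM M)"
  and z: "\<And>i. z i \<in> W M i" "\<And>i. f i = gc M i (z i)" and w: "\<And>i. w i \<in> W M i" "\<And>i. g i = gc M i (w i)"
  shows "f \<ominus>\<^sub>(GM M) g = (\<lambda>i. gc M i (z i \<ominus>\<^sub>M w i))"
proof -
  interpret M: module R M by fact
  interpret N: module GR "GM M" by (rule GM_module[OF M])
  let ?h = "\<lambda>i. gc M i (z i \<ominus>\<^sub>M w i)"
  have fin: "finite {i. z i \<notin> W M (Suc i)}" "finite {i. w i \<notin> W M (Suc i)}"
    using f z w gc_zero_iff[OF M W_carrier[OF M z(1)]] gc_zero_iff[OF M W_carrier[OF M w(1)]]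
    by (simp_all add: GM_simps direct_sum_simps gq_zero[OF M])
  have d: "z i \<ominus>\<^sub>M w i \<in> W M i" for i by (rule M.submod_diff[OF W_submodule[OF M] z(1) w(1)])
  have "{i. z i \<ominus>\<^sub>M w i \<notin> W M (Suc i)} \<subseteq> {i. z i \<notin> W M (Suc i)} \<union> {i. w i \<notin> W M (Suc i)}"
    using M.submod_diff[OF W_submodule[OF M]] by blast
  hence "finite {i. z i \<ominus>\<^sub>M w i \<notin> W M (Suc i)}" using fin finite_subset by blast
  hence h: "?h \<in> carrier (GM M)" by (intro GM_I[OF M] d)
  have "?h \<oplus>\<^sub>(GM M) g = f"
  proof
    fix i
    have "(?h \<oplus>\<^sub>(GM M) g) i = gc M i (z i \<ominus>\<^sub>M w i \<oplus>\<^sub>M w i)" using gq_add[OF M d w(1)] by (simp add: GM_simps direct_sum_simps w(2))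
    also have "z i \<ominus>\<^sub>M w i \<oplus>\<^sub>M w i = z i" using W_carrier[OF M z(1)] W_carrier[OF M w(1)] by (simp add: M.M.move_minus)
    finally show "(?h \<oplus>\<^sub>(GM M) g) i = f i" by (simp add: z(2))
  qed
  hence "f \<ominus>\<^sub>(GM M) g = (?h \<oplus>\<^sub>(GM M) g) \<ominus>\<^sub>(GM M) g" by simp
  also have "\<dots> = ?h" using h f(2) by (simp add: N.M.move_minus)
  finally show ?thesis .
qed

lemma cls_GR: "a \<in> mp j \<Longrightarrow> cls SR j a \<in> carrier GR"
  using cls_closed[OF SR_module, of a j] by (simp add: GR_simps WS_sub)

text \<open>The kernel of the map from the filtration of F to the associated graded module of M. It differs from
  the next step of the filtration in degree zero only.\<close>

definition aug_filt :: "(int \<Rightarrow> nat set) \<Rightarrow> ((nat \<Rightarrow> 'a) \<Rightarrow> 'm) \<Rightarrow> ('a, 'm, 'n) module_scheme \<Rightarrow> int \<Rightarrow> int \<Rightarrow> (nat \<Rightarrow> 'a) set" where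
  "aug_filt S \<epsilon> M n i = (if n = 0 then {f \<in> FS S 0 i. \<epsilon> f \<in> W M (nat (i + 1))} else FS S n i)"

text \<open>The family z represents the element f' of the Koszul complex on the associated graded module: \<open>z i\<close> lifts
  its component of internal degree i. The \<open>i + 1\<close> undoes the shift of the index in \<open>cone_filt\<close>.\<close>

primrec lifts where
  "lifts S \<epsilon> M 0 n f' z \<longleftrightarrow> (\<forall>i. z i \<in> FS S n i) \<and>
     (if n = 0 then f' 0 = (\<lambda>p. gc M p (\<epsilon> (z (int p)))) \<and> f' 0 \<in> carrier (GM M) \<and> (\<forall>j>0. f' j = \<zero>\<^sub>(GM M))
      else f' = (\<lambda>j. \<zero>\<^sub>(GM M)))"
| "lifts S \<epsilon> M (Suc k) n f' z \<longleftrightarrow> lifts S \<epsilon> M k n (lft f') (\<lambda>i. lft (z i)) \<and> lifts S \<epsilon> M k (n - 1) (rgt f') (\<lambda>i. rgt (z (i + 1)))"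
  for n :: int

context
  fixes M :: "('a, 'm, 'n) module_scheme" and S d \<epsilon>
  assumes M: "module R M" and c: "coord_res S d \<epsilon> M {\<zero>\<^sub>M}"
begin

interpretation M: module R M by (rule M)
interpretation N: module GR "GM M" by (rule GM_module[OF M])
interpretation NF: fmodule GR "GM M" by (rule N.fmodule)

abbreviation "\<Phi> \<equiv> FS S"
abbreviation "\<Psi> \<equiv> aug_filt S \<epsilon> M"
abbreviation "lk \<equiv> lifts S \<epsilon> M"
abbreviation "NU \<equiv> fun_mod (GM M)"

lemmas cD = coord_resD[OF c]

lemma eps_simps: "f \<in> carrier U \<Longrightarrow> g \<in> carrier U \<Longrightarrow> \<epsilon> (f \<oplus>\<^sub>U g) = \<epsilon> f \<oplus>\<^sub>M \<epsilon> g"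
  "f \<in> carrier U \<Longrightarrow> g \<in> carrier U \<Longrightarrow> \<epsilon> (f \<ominus>\<^sub>U g) = \<epsilon> f \<ominus>\<^sub>M \<epsilon> g"
  "a \<in> carrier R \<Longrightarrow> f \<in> carrier U \<Longrightarrow> \<epsilon> (a \<odot>\<^sub>U f) = a \<odot>\<^sub>M \<epsilon> f"
  "f \<in> carrier U \<Longrightarrow> \<epsilon> f \<in> carrier M"
  "\<epsilon> \<zero>\<^sub>U = \<zero>\<^sub>M"
proof -
  interpret e: lin_map R U M \<epsilon> by (intro lin_mapI U_module M cD)
  show "f \<in> carrier U \<Longrightarrow> g \<in> carrier U \<Longrightarrow> \<epsilon> (f \<oplus>\<^sub>U g) = \<epsilon> f \<oplus>\<^sub>M \<epsilon> g"
  "f \<in> carrier U \<Longrightarrow> g \<in> carrier U \<Longrightarrow> \<epsilon> (f \<ominus>\<^sub>U g) = \<epsilon> f \<ominus>\<^sub>M \<epsilon> g"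
  "a \<in> carrier R \<Longrightarrow> f \<in> carrier U \<Longrightarrow> \<epsilon> (a \<odot>\<^sub>U f) = a \<odot>\<^sub>M \<epsilon> f"
  "f \<in> carrier U \<Longrightarrow> \<epsilon> f \<in> carrier M"  "\<epsilon> \<zero>\<^sub>U = \<zero>\<^sub>M" by simp_all
qed

lemma FS_U: "f \<in> \<Phi> n i \<Longrightarrow> f \<in> carrier U"
  using SF.UM.submod_carrier[OF FS_submodule] .

lemma eps_FS: "\<epsilon> ` \<Phi> 0 i = W M (nat i)"
proof -
  have "\<epsilon> \<in> lin_maps R (FM (S 0)) M" using cD(7) FrD(3) by (auto simp: lin_maps_def FM_def)
  moreover have "\<epsilon> ` carrier (FM (S 0)) = carrier M" using cD(8) by (simp add: FM_def)
  ultimately show ?thesis using W_surj[OF FM_module M] FS_W[where S=S and n=0 and i=i, OF cD(1)] by simp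
qed

lemma eps_W: "f \<in> \<Phi> 0 i \<Longrightarrow> \<epsilon> f \<in> W M (nat i)"
  using eps_FS by blast

lemma eps_lift: assumes "u \<in> W M (nat i)" shows "\<exists>f\<in>\<Phi> 0 i. \<epsilon> f = u"
  using eps_FS[of i] assms by (metis imageE)

lemma eps_d: "f \<in> Fr (S 1) \<Longrightarrow> \<epsilon> (d 1 f) = \<zero>\<^sub>M"
  using cD(9)[of "d 1 f"] cD(4)[of f 1] by auto

lemma aug_filt_sys: "SF.filt_sys \<Psi> d \<mm>"
  unfolding SF.filt_sys_def
proof (intro allI conjI ballI)
  note s = SF.filt_sysD[OF FS_filt_sys[OF c]]
  fix n i
  show "submodule (\<Psi> n i) R U"
  proof (cases "n = 0")
    case True
    have "submodule {f \<in> \<Phi> 0 i. \<epsilon> f \<in> W M (nat (i + 1))} R U"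
      by (rule SF.UM.submodI) (auto simp: FS_U eps_simps SF.UM.submod_closed[OF FS_submodule] M.submod_closed[OF W_submodule[OF M]])
    thus ?thesis by (simp add: aug_filt_def True)
  qed (simp add: aug_filt_def FS_submodule)
  fix f assume f: "f \<in> \<Psi> n i"
  hence fF: "f \<in> \<Phi> n i" by (auto simp: aug_filt_def split: if_splits)
  have df: "d n f \<in> \<Phi> (n - 1) i" using FS_filt_sys[OF c] fF by (simp add: SF.filt_sys_def)
  show "d n f \<in> \<Psi> (n - 1) i"
  proof (cases "n = 1")
    case True
    have "\<epsilon> (d 1 f) = \<zero>\<^sub>M" using eps_d FS_Fr fF True by blast
    thus ?thesis using df True M.submod_zero[OF W_submodule[OF M]] by (simp add: aug_filt_def)
  qed (use df in \<open>simp add: aug_filt_def\<close>)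
  fix x assume x: "x \<in> \<mm>"
  have xf: "x \<odot>\<^sub>U f \<in> \<Phi> n (i + 1)" using FS_filt_sys[OF c] fF x by (simp add: SF.filt_sys_def)
  show "x \<odot>\<^sub>U f \<in> \<Psi> n (i + 1)"
  proof (cases "n = 0")
    case True
    hence "x \<odot>\<^sub>M \<epsilon> f \<in> W M (Suc (nat (i + 1)))" using f W_mult1[OF M x] by (simp add: aug_filt_def)
    moreover have "nat (i + 1 + 1) \<le> Suc (nat (i + 1))" by simp
    ultimately have "x \<odot>\<^sub>M \<epsilon> f \<in> W M (nat (i + 1 + 1))" using W_antimono[OF M] by blast
    thus ?thesis using xf True mm.Icarr[OF x] FS_U[OF fF] by (simp add: aug_filt_def eps_simps)
  qed (use xf in \<open>simp add: aug_filt_def\<close>)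
qed

lemma aug_filt_sub: "\<Psi> n i \<subseteq> \<Phi> n i" "FS' S n i \<subseteq> \<Psi> n i"
proof -
  show "\<Psi> n i \<subseteq> \<Phi> n i" by (auto simp: aug_filt_def)
  show "FS' S n i \<subseteq> \<Psi> n i"
    using FS_mono[of i "i + 1" S n] eps_W[of _ "i + 1"] by (auto simp: aug_filt_def FS'_def)
qed

lemma FS_neg: "n < 0 \<Longrightarrow> f \<in> \<Phi> n i \<Longrightarrow> f = \<zero>\<^sub>U"
  using FrD(1)[OF FS_Fr, of f S n i] FrD(2)[OF FS_Fr, of f S n i] cD(2)[of n] by (auto simp: fun_mod_simps)

lemma aug_filt_small: "i < n \<Longrightarrow> \<Phi> n i \<subseteq> \<Psi> n i"
  using eps_simps(4) FS_U by (auto simp: aug_filt_def W_0[OF M])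

text \<open>For a Koszul module the linear part resolves the associated graded module. In degree zero, z agrees with
  a boundary \<open>d w\<close> modulo the next step of the filtration, but w may have a small index; exactness in degree
  one raises it step by step.\<close>

lemma aug_filt_exact:
  assumes lin_exact: "\<And>n i. n > 0 \<Longrightarrow> SF.exact_mod \<Phi> (FS' S) d n i"
  shows "SF.exact_mod \<Psi> (FS' S) d n i"
proof -
  note [simp] = SF.differentialD[OF cD(3)]
  note dS = SF.filt_sysD[OF FS_filt_sys[OF c]]
  consider "n < 0" | "n = 0" | "n > 0" by linarith
  thus ?thesis
  proof cases
    case 1
    show ?thesis unfolding SF.exact_mod_def
    proof (intro ballI impI)
      fix z assume "z \<in> \<Psi> n i"
      hence "z = \<zero>\<^sub>U" using aug_filt_sub(1) FS_neg[OF 1] by blast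
      thus "\<exists>w\<in>\<Psi> (n + 1) i. z \<ominus>\<^sub>U d (n + 1) w \<in> FS' S n i"
        using SF.UM.submod_zero[OF SF.filt_sysD(1)[OF aug_filt_sys]] SF.UM.submod_zero[OF FS_submodule]
        by (intro bexI[of _ "\<zero>\<^sub>U"]) (simp_all add: FS'_def SF.UM.M.minus_zero)
    qed
  next
    case 3 thus ?thesis using lin_exact[OF 3, of i] by (simp add: SF.exact_mod_def aug_filt_def FS'_def split: if_splits)
  next
    case 2
    have "\<exists>w\<in>\<Psi> 1 i. z \<ominus>\<^sub>U d 1 w \<in> FS' S 0 i" if z: "z \<in> \<Psi> 0 i" for z
    proof -
      have z: "z \<in> \<Phi> 0 i" "\<epsilon> z \<in> W M (nat (i + 1))" using z by (auto simp: aug_filt_def)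
      obtain f where f: "f \<in> \<Phi> 0 (i + 1)" "\<epsilon> f = \<epsilon> z" using eps_lift[OF z(2)] by blast
      have fi: "f \<in> \<Phi> 0 i" using f(1) FS_mono[of i "i + 1"] by auto
      have cU: "z \<in> carrier U" "f \<in> carrier U" using z f FS_U by blast+
      have "z \<ominus>\<^sub>U f \<in> Fr (S 0)" using SF.UM.submod_diff[OF Fr_submodule FS_Fr[OF z(1)] FS_Fr[OF f(1)]] .
      moreover have "\<epsilon> (z \<ominus>\<^sub>U f) = \<zero>\<^sub>M" unfolding eps_simps(2)[OF cU] f(2) using eps_simps(4)[OF cU(1)] by (simp add: M.M.r_neg a_minus_def)
      ultimately obtain w0 where w0: "w0 \<in> Fr (S 1)" "z \<ominus>\<^sub>U f = d 1 w0" using cD(9) by blast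
      have "\<exists>w\<in>\<Phi> 1 (1 + int j). d 1 w = d 1 w0" if "1 + int j \<le> max 1 i" for j using that
      proof (induction j)
        case 0 thus ?case using w0(1) FrD(1)[OF w0(1)] by (intro bexI[of _ w0]) (auto simp: FS_def)
      next
        case (Suc j)
        have "1 + int j \<le> max 1 i" using Suc.prems by simp
        from Suc.IH[OF this] obtain w where w: "w \<in> \<Phi> 1 (1 + int j)" "d 1 w = d 1 w0" by blast
        have "d 1 w \<in> \<Phi> 0 i" unfolding w(2) w0(2)[symmetric] by (rule SF.UM.submod_diff[OF FS_submodule z(1) fi])
        hence "d 1 w \<in> FS' S 0 (1 + int j)" using subsetD[OF FS_mono[of "1 + int j + 1" i S 0]] Suc.prems by (simp add: FS'_def max_def split: if_splits)
        then obtain v where v: "v \<in> \<Phi> 2 (1 + int j)" "w \<ominus>\<^sub>U d 2 v \<in> FS' S 1 (1 + int j)"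
          using lin_exact[of 1 "1 + int j"] w(1) by (auto simp: SF.exact_mod_def)
        have "d 1 (w \<ominus>\<^sub>U d 2 v) = d 1 w0" using FS_U[OF w(1)] FS_U[OF v(1)] SF.differentialD(5)[OF cD(3), of v 1] SF.differentialD(1)[OF cD(3), of w 1] w(2)
          by (simp add: SF.UM.M.minus_zero)
        thus ?case using v(2) by (intro bexI[of _ "w \<ominus>\<^sub>U d 2 v"]) (simp_all add: FS'_def add_ac)
      qed
      moreover have "1 + int (nat (max 1 i - 1)) = max 1 i" by simp
      ultimately obtain w where w: "w \<in> \<Phi> 1 (max 1 i)" "d 1 w = d 1 w0" by (metis order_refl)
      have "w \<in> \<Psi> 1 i" using w(1) FS_mono[of i "max 1 i"] by (auto simp: aug_filt_def)
      moreover have "z \<ominus>\<^sub>U d 1 w = f" unfolding w(2) w0(2)[symmetric] using cU by (simp add: SF.UM.M.move_minus)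
      ultimately show ?thesis using f(1) by (intro bexI[of _ w]) (simp_all add: FS'_def)
    qed
    thus ?thesis by (simp add: SF.exact_mod_def 2)
  qed
qed

lemma FS_0: "\<zero>\<^sub>U \<in> \<Phi> n i" "\<zero>\<^sub>U \<in> \<Psi> n i"
  using SF.UM.submod_zero[OF FS_submodule] SF.UM.submod_zero[OF SF.filt_sysD(1)[OF aug_filt_sys]] by auto

lemma lifts_FS: "lk k n f' z \<Longrightarrow> z i \<in> cone_filts k \<Phi> n i"
proof (induction k arbitrary: n f' z i)
  case (Suc k)
  from Suc.IH[of n "lft f'" "\<lambda>i. lft (z i)" i] Suc.IH[of "n - 1" "rgt f'" "\<lambda>i. rgt (z (i + 1))" "i - 1"] Suc.prems
  show ?case by (simp add: cone_filt_iff)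
qed simp

lemma lifts_KK: "lk k n f' z \<Longrightarrow> f' \<in> NF.KK k (carrier (GM M)) n i"
proof (induction k arbitrary: n f' z i)
  case 0 thus ?case by (auto simp: NF.base_def fun_mod_simps split: if_splits)
next
  case (Suc k)
  from Suc.IH[of n "lft f'" "\<lambda>i. lft (z i)" i] Suc.IH[of "n - 1" "rgt f'" "\<lambda>i. rgt (z (i + 1))" "i - 1"] Suc.prems
  show ?case by (simp add: cone_filt_iff)
qed

lemma lifts_closed: "lk k n f' z \<Longrightarrow> f' \<in> carrier NU"
  using NF.UM.submod_carrier[OF NF.KK_submodule[OF N.carrier_is_submodule]] lifts_KK by blast

lemma lifts_U: assumes "lk k n f' z" shows "z i \<in> carrier U"
  using assms
proof (induction k arbitrary: n f' z i)
  case 0 thus ?case using FS_U by auto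
next
  case (Suc k)
  have "lft (z i) \<in> carrier U" "rgt (z i) \<in> carrier U"
    using Suc.IH[of n "lft f'" "\<lambda>i. lft (z i)" i] Suc.IH[of "n - 1" "rgt f'" "\<lambda>i. rgt (z (i + 1))" "i - 1"] Suc.prems by simp_all
  thus ?case using SF.Node_closed[of "lft (z i)" "rgt (z i)"] by (simp only: Node_lft_rgt simp_thms)
qed

lemma shift_fin: "finite {i::int. P (i + 1) \<or> Q i} \<longleftrightarrow> finite {i. P i \<or> Q (i - 1)}"
proof -
  have "{i. P i \<or> Q (i - 1)} = (\<lambda>i. i + 1) ` {i. P (i + 1) \<or> Q i}"
    by (auto simp: image_iff) (metis add.commute diff_add_cancel)+
  moreover have "inj_on (\<lambda>i. i + 1) {i::int. P (i + 1) \<or> Q i}" by (rule inj_onI) simp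
  ultimately show ?thesis by (simp add: finite_image_iff)
qed

text \<open>Almost all components have to vanish, since elements of a direct sum have finite support.\<close>

lemma lifts_exists:
  assumes "\<And>i. z i \<in> cone_filts k \<Phi> n i" "finite {i. z i \<notin> cone_filts k \<Psi> n i}"
  shows "\<exists>f'. lk k n f' z"
  using assms
proof (induction k arbitrary: n z)
  case 0
  show ?case
  proof (cases "n = 0")
    case True
    have W: "\<epsilon> (z (int p)) \<in> W M p" for p using eps_W[of "z (int p)" "int p"] 0(1)[of "int p"] True by simp
    have "int ` {p. \<epsilon> (z (int p)) \<notin> W M (Suc p)} \<subseteq> {i. z i \<notin> \<Psi> 0 i}" by (auto simp: aug_filt_def nat_add_distrib)
    hence "finite (int ` {p. \<epsilon> (z (int p)) \<notin> W M (Suc p)})" using 0(2) True finite_subset by auto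
    hence "finite {p. \<epsilon> (z (int p)) \<notin> W M (Suc p)}" by (rule finite_imageD) simp
    hence "(\<lambda>p. gc M p (\<epsilon> (z (int p)))) \<in> carrier (GM M)" by (intro GM_I[OF M] W)
    thus ?thesis using 0(1) True
      by (intro exI[of _ "\<lambda>j. if j = 0 then \<lambda>p. gc M p (\<epsilon> (z (int p))) else \<zero>\<^sub>(GM M)"]) simp
  qed (use 0 in simp)
next
  case (Suc k)
  have "finite {i. (\<lambda>i. lft (z i)) i \<notin> cone_filts k \<Psi> n i}"
    by (rule finite_subset[OF _ Suc.prems(2)]) (auto simp: cone_filt_iff)
  then obtain f where f: "lk k n f (\<lambda>i. lft (z i))" using Suc.IH[of "\<lambda>i. lft (z i)" n] Suc.prems(1) by (auto simp: cone_filt_iff)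
  have "finite {i. rgt (z i) \<notin> cone_filts k \<Psi> (n - 1) (i - 1)}"
    by (rule finite_subset[OF _ Suc.prems(2)]) (auto simp: cone_filt_iff)
  hence "finite {i. rgt (z (i + 1)) \<notin> cone_filts k \<Psi> (n - 1) i}"
    using shift_fin[of "\<lambda>i. rgt (z i) \<notin> cone_filts k \<Psi> (n - 1) (i - 1)" "\<lambda>_. False"] by simp
  moreover have "rgt (z (i + 1)) \<in> cone_filts k \<Phi> (n - 1) i" for i using Suc.prems(1)[of "i + 1"] by (simp add: cone_filt_iff)
  ultimately obtain g where g: "lk k (n - 1) g (\<lambda>i. rgt (z (i + 1)))" using Suc.IH[of "\<lambda>i. rgt (z (i + 1))" "n - 1"] by auto
  show ?case using f g by (intro exI[of _ "Node f g"]) simp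
qed

lemma lifts_reps: assumes "f' \<in> NF.KK k (carrier (GM M)) n i" shows "\<exists>z. lk k n f' z"
  using assms
proof (induction k arbitrary: n f' i)
  case 0
  show ?case
  proof (cases "n = 0")
    case True
    have f: "f' 0 \<in> carrier (GM M)" "\<And>j. j > 0 \<Longrightarrow> f' j = \<zero>\<^sub>(GM M)" using 0 True by (auto simp: NF.base_def)
    obtain u where u: "\<And>i. u i \<in> W M i" "f' 0 = (\<lambda>i. gc M i (u i))" by (rule GM_reps[OF M f(1)]) (rule that)
    have "\<forall>i. \<exists>z. z \<in> \<Phi> 0 i \<and> \<epsilon> z = u (nat i)" using eps_lift u(1) by blast
    then obtain z where z: "\<And>i. z i \<in> \<Phi> 0 i" "\<And>i. \<epsilon> (z i) = u (nat i)" by metis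
    show ?thesis using True f z u(2) by (intro exI[of _ z]) simp
  next
    case False
    thus ?thesis using 0 FS_0 by (intro exI[of _ "\<lambda>_. \<zero>\<^sub>U"]) (auto simp: NF.base_def fun_mod_simps)
  qed
next
  case (Suc k)
  obtain z w where "lk k n (lft f') z" "lk k (n - 1) (rgt f') w"
    using Suc.IH[of "lft f'" n i] Suc.IH[of "rgt f'" "n - 1" "i - 1"] Suc.prems by (auto simp: cone_filt_iff)
  thus ?case by (intro exI[of _ "\<lambda>i. Node (z i) (w (i - 1))"]) simp
qed

lemma lifts_finite: assumes "lk k n f' z" shows "finite {i. z i \<notin> cone_filts k \<Psi> n i}"
  using assms
proof (induction k arbitrary: n f' z)
  case 0
  show ?case
  proof (cases "n = 0")
    case True
    have z: "\<And>i. z i \<in> \<Phi> 0 i" and f: "f' 0 = (\<lambda>p. gc M p (\<epsilon> (z (int p))))" "f' 0 \<in> carrier (GM M)" using 0 True by auto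
    have W: "\<epsilon> (z (int p)) \<in> W M p" for p using eps_W[OF z[of "int p"]] by simp
    have "finite {p. f' 0 p \<noteq> W M (Suc p)}" using f(2) by (simp add: GM_simps direct_sum_simps gq_zero[OF M])
    hence "finite {p. \<epsilon> (z (int p)) \<notin> W M (Suc p)}" using gc_zero_iff[OF M W_carrier[OF M W]] by (simp add: f(1))
    hence fin: "finite (int ` {p. \<epsilon> (z (int p)) \<notin> W M (Suc p)})" by simp
    have "{i. z i \<notin> \<Psi> 0 i} \<subseteq> int ` {p. \<epsilon> (z (int p)) \<notin> W M (Suc p)}"
    proof
      fix i assume i: "i \<in> {i. z i \<notin> \<Psi> 0 i}"
      have "\<not> i < 0" using i aug_filt_small[of i 0] z[of i] by auto
      then obtain p where "i = int p" by (metis nonneg_int_cases not_less)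
      thus "i \<in> int ` {p. \<epsilon> (z (int p)) \<notin> W M (Suc p)}" using i z[of i] by (auto simp: aug_filt_def nat_add_distrib)
    qed
    thus ?thesis using fin finite_subset True by auto
  next
    case False thus ?thesis using 0 by (simp add: aug_filt_def)
  qed
next
  case (Suc k)
  have 1: "finite {i. lft (z i) \<notin> cone_filts k \<Psi> n i}" using Suc.IH[of n "lft f'" "\<lambda>i. lft (z i)"] Suc.prems by simp
  have "finite {i. rgt (z (i + 1)) \<notin> cone_filts k \<Psi> (n - 1) i}" using Suc.IH[of "n - 1" "rgt f'" "\<lambda>i. rgt (z (i + 1))"] Suc.prems by simp
  hence 2: "finite {i. rgt (z i) \<notin> cone_filts k \<Psi> (n - 1) (i - 1)}"
    using shift_fin[of "\<lambda>i. rgt (z i) \<notin> cone_filts k \<Psi> (n - 1) (i - 1)" "\<lambda>_. False"] by simp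
  show ?case by (rule finite_subset[OF _ finite_UnI[OF 1 2]]) (auto simp: cone_filt_iff)
qed

lemma lifts_zero: assumes "lk k n f' z" shows "f' = \<zero>\<^sub>NU \<longleftrightarrow> (\<forall>i. z i \<in> cone_filts k \<Psi> n i)"
  using assms
proof (induction k arbitrary: n f' z)
  case 0
  show ?case
  proof (cases "n = 0")
    case True
    have z: "\<And>i. z i \<in> \<Phi> 0 i" and f: "f' 0 = (\<lambda>p. gc M p (\<epsilon> (z (int p))))" "\<And>j. j > 0 \<Longrightarrow> f' j = \<zero>\<^sub>(GM M)" using 0 True by auto
    have W: "\<epsilon> (z (int p)) \<in> W M p" for p using eps_W[OF z[of "int p"]] by simp
    have "f' = \<zero>\<^sub>NU \<longleftrightarrow> f' 0 = \<zero>\<^sub>(GM M)" using f(2) by (simp add: fun_mod_simps fun_eq_iff[of f']) (metis gr0I)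
    also have "\<dots> \<longleftrightarrow> (\<forall>p. \<epsilon> (z (int p)) \<in> W M (Suc p))"
      using gc_zero_iff[OF M W_carrier[OF M W]] by (auto simp: f(1) GM_zero[OF M] fun_eq_iff)
    also have "\<dots> \<longleftrightarrow> (\<forall>i. z i \<in> \<Psi> 0 i)"
    proof
      assume a: "\<forall>p. \<epsilon> (z (int p)) \<in> W M (Suc p)"
      show "\<forall>i. z i \<in> \<Psi> 0 i"
      proof
        fix i
        show "z i \<in> \<Psi> 0 i"
        proof (cases "i < 0")
          case True thus ?thesis using aug_filt_small[of i 0] z[of i] by auto
        next
          case False
          then obtain p where "i = int p" by (metis nonneg_int_cases not_less)
          thus ?thesis using a z[of i] by (simp add: aug_filt_def nat_add_distrib)
        qed
      qed
    next
      assume a: "\<forall>i. z i \<in> \<Psi> 0 i"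
      show "\<forall>p. \<epsilon> (z (int p)) \<in> W M (Suc p)"
      proof
        fix p show "\<epsilon> (z (int p)) \<in> W M (Suc p)" using a[rule_format, of "int p"] by (simp add: aug_filt_def nat_add_distrib)
      qed
    qed
    finally show ?thesis using True by simp
  next
    case False thus ?thesis using 0 by (simp add: aug_filt_def fun_mod_simps)
  qed
next
  case (Suc k)
  have "f' = \<zero>\<^sub>NU \<longleftrightarrow> lft f' = \<zero>\<^sub>NU \<and> rgt f' = \<zero>\<^sub>NU"
    using NF.lft_zero NF.rgt_zero node_ext[of f' "\<zero>\<^sub>NU"] by metis
  also have "\<dots> \<longleftrightarrow> (\<forall>i. lft (z i) \<in> cone_filts k \<Psi> n i) \<and> (\<forall>i. rgt (z (i + 1)) \<in> cone_filts k \<Psi> (n - 1) i)"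
    using Suc.IH[of n "lft f'" "\<lambda>i. lft (z i)"] Suc.IH[of "n - 1" "rgt f'" "\<lambda>i. rgt (z (i + 1))"] Suc.prems by simp
  also have "(\<forall>i. rgt (z (i + 1)) \<in> cone_filts k \<Psi> (n - 1) i) \<longleftrightarrow> (\<forall>i. rgt (z i) \<in> cone_filts k \<Psi> (n - 1) (i - 1))"
    by (metis add_diff_cancel_right' diff_add_cancel)
  finally show ?case by (auto simp: cone_filt_iff)
qed

lemma lifts_diff: assumes "lk k n f' z" "lk k n g' w" shows "lk k n (f' \<ominus>\<^sub>NU g') (\<lambda>i. z i \<ominus>\<^sub>U w i)"
  using assms
proof (induction k arbitrary: n f' g' z w)
  case 0
  have F: "z i \<in> \<Phi> n i" "w i \<in> \<Phi> n i" "z i \<ominus>\<^sub>U w i \<in> \<Phi> n i" for i using 0 SF.UM.submod_diff[OF FS_submodule] by auto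
  have sub: "f' \<ominus>\<^sub>NU g' = (\<lambda>j. f' j \<ominus>\<^sub>(GM M) g' j)" using N.fun_mod_minus[OF lifts_closed[OF 0(1)] lifts_closed[OF 0(2)]] .
  have z0: "\<zero>\<^sub>(GM M) \<ominus>\<^sub>(GM M) \<zero>\<^sub>(GM M) = \<zero>\<^sub>(GM M)" by (simp add: N.M.minus_zero)
  show ?case
  proof (cases "n = 0")
    case True
    have W: "\<epsilon> (z (int p)) \<in> W M p" "\<epsilon> (w (int p)) \<in> W M p" for p using eps_W[of _ "int p"] F True by auto
    have "f' 0 \<ominus>\<^sub>(GM M) g' 0 = (\<lambda>p. gc M p (\<epsilon> (z (int p)) \<ominus>\<^sub>M \<epsilon> (w (int p))))"
      by (rule GM_minus[OF M]) (use 0 True W in auto)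
    moreover have "\<epsilon> (z (int p)) \<ominus>\<^sub>M \<epsilon> (w (int p)) = \<epsilon> (z (int p) \<ominus>\<^sub>U w (int p))" for p
      using FS_U[OF F(1)] FS_U[OF F(2)] by (simp add: eps_simps)
    moreover have "f' 0 \<ominus>\<^sub>(GM M) g' 0 \<in> carrier (GM M)"
    proof (rule N.M.minus_closed)
      show "f' 0 \<in> carrier (GM M)" using 0(1) unfolding lifts.simps True by (metis (full_types))
      show "g' 0 \<in> carrier (GM M)" using 0(2) unfolding lifts.simps True by (metis (full_types))
    qed
    moreover have "f' j \<ominus>\<^sub>(GM M) g' j = \<zero>\<^sub>(GM M)" if "j > 0" for j using 0 True that z0 by simp
    ultimately show ?thesis using True F(3) by (simp add: sub)
  next
    case False thus ?thesis using 0 F z0 unfolding sub by simp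
  qed
next
  case (Suc k)
  have "lft (f' \<ominus>\<^sub>NU g') = lft f' \<ominus>\<^sub>NU lft g'" "rgt (f' \<ominus>\<^sub>NU g') = rgt f' \<ominus>\<^sub>NU rgt g'"
    using lifts_closed[OF Suc.prems(1)] lifts_closed[OF Suc.prems(2)] by simp_all
  moreover have "lft (z i \<ominus>\<^sub>U w i) = lft (z i) \<ominus>\<^sub>U lft (w i)" "rgt (z i \<ominus>\<^sub>U w i) = rgt (z i) \<ominus>\<^sub>U rgt (w i)" for i
    using lifts_U[OF Suc.prems(1)] lifts_U[OF Suc.prems(2)] by simp_all
  ultimately show ?case using Suc.IH[of n "lft f'" "\<lambda>i. lft (z i)" "lft g'" "\<lambda>i. lft (w i)"]
     Suc.IH[of "n - 1" "rgt f'" "\<lambda>i. rgt (z (i + 1))" "rgt g'" "\<lambda>i. rgt (w (i + 1))"] Suc.prems by simp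
qed

lemma lifts_zeros: "lk k n \<zero>\<^sub>NU (\<lambda>i. \<zero>\<^sub>U)"
proof (induction k arbitrary: n)
  case 0
  have "gc M p \<zero>\<^sub>M = W M (Suc p)" for p using gc_zero_iff[OF M] M.submod_zero[OF W_submodule[OF M]] by simp
  hence "\<zero>\<^sub>(GM M) = (\<lambda>p. gc M p (\<epsilon> \<zero>\<^sub>U))" by (simp add: eps_simps GM_zero[OF M])
  moreover have "\<zero>\<^sub>NU = (\<lambda>j. \<zero>\<^sub>(GM M))" by (simp add: fun_mod_simps)
  ultimately show ?case using FS_0(1) N.M.zero_closed by simp
qed simp

lemma lifts_neg: assumes "lk k n f' z" shows "lk k n (\<ominus>\<^sub>NU f') (\<lambda>i. \<ominus>\<^sub>U z i)"
  using lifts_diff[OF lifts_zeros assms] lifts_closed[OF assms] lifts_U[OF assms] by (simp add: a_minus_def)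

lemma lifts_add: assumes "lk k n f' z" "lk k n g' w" shows "lk k n (f' \<oplus>\<^sub>NU g') (\<lambda>i. z i \<oplus>\<^sub>U w i)"
  using lifts_diff[OF assms(1) lifts_neg[OF assms(2)]] lifts_closed[OF assms(1)] lifts_U[OF assms(1)] lifts_closed[OF assms(2)] lifts_U[OF assms(2)]
  by (simp add: a_minus_def)

lemma lifts_smult: assumes "lk k n f' z" and x: "x \<in> \<mm>" shows "lk k n (cls SR 1 x \<odot>\<^sub>NU f') (\<lambda>i. x \<odot>\<^sub>U z (i - 1))"
  using assms(1)
proof (induction k arbitrary: n f' z)
  case 0
  have x1: "x \<in> mp 1" using x by simp
  note xbar = cls_GR[OF x1]
  have F: "z i \<in> \<Phi> n i" "x \<odot>\<^sub>U z (i - 1) \<in> \<Phi> n i" for i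
    using 0 SF.filt_sysD(5)[OF FS_filt_sys[OF c] x, of "z (i - 1)" n i] by auto
  have z0: "cls SR 1 x \<odot>\<^sub>(GM M) \<zero>\<^sub>(GM M) = \<zero>\<^sub>(GM M)" using xbar by simp
  show ?case
  proof (cases "n = 0")
    case True
    have W: "\<epsilon> (z (int p)) \<in> W M p" for p using eps_W[of _ "int p"] F True by auto
    have "gr_smult R \<mm> M (cls SR 1 x) (f' 0) p = gc M p (\<epsilon> (x \<odot>\<^sub>U z (int p - 1)))" for p
    proof -
      have eq: "gr_smult R \<mm> M (cls SR 1 x) (f' 0) p = (if 1 \<le> p then gc M p (x \<odot>\<^sub>M \<epsilon> (z (int (p - 1)))) else W M (Suc p))"
        by (rule gr_smult_cls_comp[OF M x1, of "\<lambda>p. \<epsilon> (z (int p))"]) (use W 0 True in auto)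
      have e: "\<epsilon> (x \<odot>\<^sub>U z (int p - 1)) = x \<odot>\<^sub>M \<epsilon> (z (int p - 1))" using mm.Icarr[OF x] FS_U[OF F(1)] by (simp add: eps_simps)
      show ?thesis
      proof (cases "1 \<le> p")
        case True thus ?thesis using eq e by (simp add: of_nat_diff)
      next
        case False
        hence p: "p = 0" by simp
        have "x \<odot>\<^sub>M \<epsilon> (z (- 1)) \<in> W M (Suc 0)" using W_mult1[OF M x, of "\<epsilon> (z (- 1))" 0] eps_simps(4)[OF FS_U[OF F(1)]] by (simp add: W_0[OF M])
        hence "gc M 0 (x \<odot>\<^sub>M \<epsilon> (z (- 1))) = W M (Suc 0)" using gc_zero_iff[OF M W_carrier[OF M]] by blast
        thus ?thesis using eq e p by simp
      qed
    qed
    moreover have "f' 0 \<in> carrier (GM M)" using 0(1) unfolding lifts.simps True by (metis (full_types))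
    hence "cls SR 1 x \<odot>\<^sub>(GM M) f' 0 \<in> carrier (GM M)" by (rule N.smult_closed[OF xbar])
    moreover have "cls SR 1 x \<odot>\<^sub>(GM M) f' j = \<zero>\<^sub>(GM M)" if "j > 0" for j using 0 True that z0 by simp
    moreover have "(cls SR 1 x \<odot>\<^sub>NU f') j = cls SR 1 x \<odot>\<^sub>(GM M) f' j" for j by (simp add: fun_mod_simps)
    moreover have "smult (GM M) = gr_smult R \<mm> M" by (rule GM_simps)
    ultimately show ?thesis using True F(2) by (simp add: fun_eq_iff[of "gr_smult R \<mm> M (cls SR (Suc 0) x) (f' 0)"])
  next
    case False thus ?thesis using 0 F z0 by (simp add: fun_mod_simps)
  qed
next
  case (Suc k)
  show ?case using Suc.IH[of n "lft f'" "\<lambda>i. lft (z i)"] Suc.IH[of "n - 1" "rgt f'" "\<lambda>i. rgt (z (i + 1))"] Suc.prems by (simp add: algebra_simps)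
qed

lemma lifts_D: assumes "set xs \<subseteq> \<mm>" "lk (length xs) n f' z"
  shows "lk (length xs) (n - 1) (NF.KD (map (cls SR 1) xs) n f') (\<lambda>i. SF.cones d xs n (z i))"
  using assms
proof (induction xs arbitrary: n f' z rule: rev_induct)
  case Nil
  have f': "NF.zero_diff n f' = (\<lambda>j. \<zero>\<^sub>(GM M))" by (simp add: NF.zero_diff_def fun_mod_simps)
  have z: "\<And>i. z i \<in> \<Phi> n i" using Nil by simp
  have dz: "d n (z i) \<in> \<Phi> (n - 1) i" for i using FS_filt_sys[OF c] z by (simp add: SF.filt_sys_def)
  show ?case
  proof (cases "n = 1")
    case True
    have "\<epsilon> (d 1 (z i)) = \<zero>\<^sub>M" for i using eps_d[OF FS_Fr[of "z i" S 1 i]] z True by blast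
    moreover have "gc M p \<zero>\<^sub>M = W M (Suc p)" for p using gc_zero_iff[OF M] M.submod_zero[OF W_submodule[OF M]] by simp
    ultimately have "\<zero>\<^sub>(GM M) = (\<lambda>p. gc M p (\<epsilon> (d 1 (z (int p)))))" by (simp add: GM_zero[OF M])
    thus ?thesis using dz True f' N.M.zero_closed by simp
  next
    case False thus ?thesis using dz f' by simp
  qed
next
  case (snoc x xs)
  have xs: "set xs \<subseteq> \<mm>" "x \<in> \<mm>" using snoc.prems(1) by auto
  let ?k = "length xs"
  have l: "lk ?k n (lft f') (\<lambda>i. lft (z i))" "lk ?k (n - 1) (rgt f') (\<lambda>i. rgt (z (i + 1)))" using snoc.prems(2) by simp_all
  have "(\<lambda>i. x \<odot>\<^sub>U rgt (z (i - 1 + 1))) = (\<lambda>i. x \<odot>\<^sub>U rgt (z i))" by simp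
  hence 1: "lk ?k (n - 1) (cls SR 1 x \<odot>\<^sub>NU rgt f') (\<lambda>i. x \<odot>\<^sub>U rgt (z i))" using lifts_smult[OF l(2) xs(2)] by metis
  note L = lifts_add[OF snoc.IH[OF xs(1) l(1)] 1] and Rr = lifts_neg[OF snoc.IH[OF xs(1) l(2)]]
  show ?case using L Rr by simp
qed

lemma KK_zero: "NF.KK k {\<zero>\<^sub>(GM M)} n i = {\<zero>\<^sub>NU}"
proof (induction k arbitrary: n i)
  case 0
  have "\<zero>\<^sub>NU = (\<lambda>j. \<zero>\<^sub>(GM M))" by (simp add: fun_mod_simps)
  thus ?case by (auto simp: NF.base_def fun_eq_iff[of _ "\<lambda>j. \<zero>\<^sub>(GM M)"]) (metis gr0I)
next
  case (Suc k)
  have "f \<in> NF.KK (Suc k) {\<zero>\<^sub>(GM M)} n i \<longleftrightarrow> f = \<zero>\<^sub>NU" for f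
    using NF.lft_zero NF.rgt_zero node_ext[of f "\<zero>\<^sub>NU"] by (auto simp: cone_filt_iff Suc.IH)
  thus ?case by blast
qed

text \<open>Cycles and boundaries of the Koszul complex lift to families of cycles and boundaries modulo
  \<open>aug_filt\<close>, and the indices can be treated one at a time. Where a cycle is already zero the boundary is
  chosen to be zero, so that the supports stay finite.\<close>

theorem lifts_exact:
  assumes xs: "set xs \<subseteq> \<mm>"
  shows "NF.koszul_exact (map (cls SR 1) xs) {\<zero>\<^sub>(GM M)} n \<longleftrightarrow>
    (\<forall>i. SF.exact_mod (cone_filts (length xs) \<Phi>) (cone_filts (length xs) \<Psi>) (SF.cones d xs) n i)"
proof -
  let ?k = "length xs" and ?xb = "map (cls SR 1) xs"
  have xR: "set xs \<subseteq> carrier R" "\<mm> \<subseteq> carrier R" using xs mm.Icarr by auto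
  note sF = SF.cones_filt_sys[OF cD(3) FS_filt_sys[OF c] xs xR(2)] and sA = SF.cones_filt_sys[OF cD(3) aug_filt_sys xs xR(2)]
  note F = SF.filt_sysD[OF sF] and A = SF.filt_sysD[OF sA]
  have A0: "\<zero>\<^sub>U \<in> cone_filts ?k \<Psi> n i" for n i by (rule SF.UM.submod_zero[OF A(1)])
  have F0: "\<zero>\<^sub>U \<in> cone_filts ?k \<Phi> n i" for n i by (rule SF.UM.submod_zero[OF F(1)])
  have dA: "f \<in> cone_filts ?k \<Psi> n i \<Longrightarrow> SF.cones d xs n f \<in> cone_filts ?k \<Psi> (n - 1) i" for f n i using sA by (simp add: SF.filt_sys_def)
  note Dl = SF.cones_differential[OF cD(3) xR(1)]
  note [simp] = SF.differentialD[OF Dl]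
  show ?thesis
  proof (intro iffI allI)
    fix i assume e: "NF.koszul_exact ?xb {\<zero>\<^sub>(GM M)} n"
    show "SF.exact_mod (cone_filts ?k \<Phi>) (cone_filts ?k \<Psi>) (SF.cones d xs) n i" unfolding SF.exact_mod_def
    proof (intro ballI impI)
      fix z0 assume z0: "z0 \<in> cone_filts ?k \<Phi> n i" "SF.cones d xs n z0 \<in> cone_filts ?k \<Psi> (n - 1) i"
      define z where "z j = (if j = i then z0 else \<zero>\<^sub>U)" for j
      have "finite {j. z j \<notin> cone_filts ?k \<Psi> n j}" by (rule finite_subset[of _ "{i}"]) (use A0 in \<open>auto simp: z_def\<close>)
      moreover have "z j \<in> cone_filts ?k \<Phi> n j" for j using z0(1) F0 by (simp add: z_def)
      ultimately obtain f' where f': "lk ?k n f' z" using lifts_exists[of z ?k n] by blast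
      have "NF.KD ?xb n f' = \<zero>\<^sub>NU" using lifts_zero[OF lifts_D[OF xs f']] z0(2) A0 by (auto simp: z_def)
      then obtain w' where w': "w' \<in> NF.KK ?k (carrier (GM M)) (n + 1) 0" "f' \<ominus>\<^sub>NU NF.KD ?xb (n + 1) w' = \<zero>\<^sub>NU"
        using e lifts_KK[OF f'] unfolding NF.koszul_exact_def NF.exact_mod_def by (auto simp: KK_zero)
      obtain w where w: "lk ?k (n + 1) w' w" using lifts_reps[OF w'(1)] by blast
      have "lk ?k n (NF.KD ?xb (n + 1) w') (\<lambda>i. SF.cones d xs (n + 1) (w i))" using lifts_D[OF xs w] by simp
      from lifts_zero[OF lifts_diff[OF f' this]] w'(2) have "z i \<ominus>\<^sub>U SF.cones d xs (n + 1) (w i) \<in> cone_filts ?k \<Psi> n i" by blast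
      thus "\<exists>w\<in>cone_filts ?k \<Phi> (n + 1) i. z0 \<ominus>\<^sub>U SF.cones d xs (n + 1) w \<in> cone_filts ?k \<Psi> n i"
        using lifts_FS[OF w, of i] by (auto simp: z_def)
    qed
  next
    assume e: "\<forall>i. SF.exact_mod (cone_filts ?k \<Phi>) (cone_filts ?k \<Psi>) (SF.cones d xs) n i"
    show "NF.koszul_exact ?xb {\<zero>\<^sub>(GM M)} n" unfolding NF.koszul_exact_def NF.exact_mod_def
    proof (intro ballI impI)
      fix f' assume f': "f' \<in> NF.KK (length ?xb) (carrier (GM M)) n 0" "NF.KD ?xb n f' \<in> NF.KK (length ?xb) {\<zero>\<^sub>(GM M)} (n - 1) 0"
      obtain z where z: "lk ?k n f' z" using lifts_reps f'(1) by fastforce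
      have "NF.KD ?xb n f' = \<zero>\<^sub>NU" using f'(2) by (simp add: KK_zero)
      hence dz: "SF.cones d xs n (z i) \<in> cone_filts ?k \<Psi> (n - 1) i" for i using lifts_zero[OF lifts_D[OF xs z]] by blast
      have "\<exists>w. w \<in> cone_filts ?k \<Phi> (n + 1) i \<and> z i \<ominus>\<^sub>U SF.cones d xs (n + 1) w \<in> cone_filts ?k \<Psi> n i \<and> (z i \<in> cone_filts ?k \<Psi> n i \<longrightarrow> w = \<zero>\<^sub>U)" for i
      proof (cases "z i \<in> cone_filts ?k \<Psi> n i")
        case True thus ?thesis using F0 lifts_U[OF z] by (intro exI[of _ "\<zero>\<^sub>U"]) (simp add: SF.UM.M.minus_zero)
      next
        case False thus ?thesis using e lifts_FS[OF z] dz unfolding SF.exact_mod_def by blast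
      qed
      then obtain w where w: "\<And>i. w i \<in> cone_filts ?k \<Phi> (n + 1) i" "\<And>i. z i \<ominus>\<^sub>U SF.cones d xs (n + 1) (w i) \<in> cone_filts ?k \<Psi> n i"
        "\<And>i. z i \<in> cone_filts ?k \<Psi> n i \<Longrightarrow> w i = \<zero>\<^sub>U" by metis
      have "finite {i. w i \<notin> cone_filts ?k \<Psi> (n + 1) i}"
        by (rule finite_subset[OF _ lifts_finite[OF z]]) (use w(3) A0 in auto)
      then obtain w' where w': "lk ?k (n + 1) w' w" using lifts_exists w(1) by blast
      have "lk ?k n (NF.KD ?xb (n + 1) w') (\<lambda>i. SF.cones d xs (n + 1) (w i))" using lifts_D[OF xs w'] by simp
      from lifts_zero[OF lifts_diff[OF z this]] w(2) have "f' \<ominus>\<^sub>NU NF.KD ?xb (n + 1) w' = \<zero>\<^sub>NU" by blast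
      thus "\<exists>w\<in>NF.KK (length ?xb) (carrier (GM M)) (n + 1) 0. f' \<ominus>\<^sub>NU NF.KD ?xb (n + 1) w \<in> NF.KK (length ?xb) {\<zero>\<^sub>(GM M)} n 0"
        using lifts_KK[OF w'] by (auto simp: KK_zero)
    qed
  qed
qed

end

end

section \<open>Depth sensitivity of the Koszul complex\<close>

context fmodule begin

text \<open>Dividing out the whole of ys raises the degree by its length, beyond the length of the Koszul complex.
  From there \<open>koszul_exact_up\<close> leads back down.\<close>

lemma koszul_exact_regular:
  assumes xs: "set xs \<subseteq> carrier R" and ys: "set ys \<subseteq> Idl (set xs)"
    and reg: "\<And>i z. i < length ys \<Longrightarrow> z \<in> carrier M \<Longrightarrow> ys ! i \<odot>\<^sub>M z \<in> set_smult R M (set (take i ys)) \<Longrightarrow> z \<in> set_smult R M (set (take i ys))"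
    and n: "int (length xs) < n + int (length ys)"
  shows "koszul_exact xs {\<zero>\<^sub>M} n"
proof -
  have yR: "set ys \<subseteq> carrier R" using ys ideal.Icarr[OF R.genideal_ideal[OF xs]] by blast
  have "koszul_exact xs (set_smult R M (set (take i ys))) n" if "i \<le> length ys" "int (length xs) < n + int (length ys - i)" for i n
    using that
  proof (induction "length ys - i" arbitrary: i n)
    case 0
    have "submodule (set_smult R M (set (take i ys))) R M" using yR set_take_subset[of i ys] by (intro set_smult_submodule) blast
    thus ?case using 0 xs by (intro koszul_exact_vanish) simp_all
  next
    case (Suc j)
    hence i: "i < length ys" by simp
    have S: "set (take i ys) \<subseteq> carrier R" using yR set_take_subset[of i ys] by blast
    have y: "ys ! i \<in> Idl (set xs)" "ys ! i \<in> carrier R" using ys yR i nth_mem by blast+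
    have t: "set (take (Suc i) ys) = insert (ys ! i) (set (take i ys))" using i by (simp add: take_Suc_conv_app_nth)
    have "koszul_exact xs (set_smult R M (set (take (Suc i) ys))) (n + 1)"
      using Suc.hyps(1)[of "Suc i" "n + 1"] Suc.hyps(2) Suc.prems i by (auto simp: Suc_diff_Suc of_nat_diff)
    thus ?case unfolding t set_smult_insert[OF S y(2)] by (intro koszul_exact_up[OF xs set_smult_submodule[OF S] y(1) reg[OF i]])
  qed
  from this[of 0 n] show ?thesis using n by (simp add: set_smult_empty)
qed

end

context noeth_local begin

text \<open>The homogeneous submodule with components \<open>Y p/\<mm>\<^sup>p\<^sup>+\<^sup>1 M\<close>.\<close>

definition homog where "homog M Y = {f \<in> carrier (GM M). \<forall>p. f p \<subseteq> Y p}"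

definition stable_gr where "stable_gr M Y \<longleftrightarrow> stable M Y \<and> (\<forall>p. W M (Suc p) \<subseteq> Y p)"

lemma stable_grD: "stable_gr M Y \<Longrightarrow> stable M Y" "stable_gr M Y \<Longrightarrow> z \<in> W M (Suc p) \<Longrightarrow> z \<in> Y p"
  by (auto simp: stable_gr_def)

context
  fixes M :: "('a, 'm, 'n) module_scheme"
  assumes M: "module R M"
begin

interpretation M: module R M by (rule M)
interpretation N: module GR "GM M" by (rule GM_module[OF M])

lemma gc_subset: assumes Y: "stable_gr M Y" and z: "z \<in> carrier M" shows "gc M p z \<subseteq> Y p \<longleftrightarrow> z \<in> Y p"
proof
  show "gc M p z \<subseteq> Y p \<Longrightarrow> z \<in> Y p" using gc_self[OF M z] by blast
  assume zY: "z \<in> Y p"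
  show "gc M p z \<subseteq> Y p"
  proof
    fix w assume "w \<in> gc M p z"
    hence w: "w \<in> carrier M" "w \<ominus>\<^sub>M z \<in> W M (Suc p)" using gc_mem[OF M z] by auto
    have "(w \<ominus>\<^sub>M z) \<oplus>\<^sub>M z \<in> Y p" by (rule M.submod_add[OF stableD(1)[OF stable_grD(1)[OF Y]] stable_grD(2)[OF Y w(2)] zY])
    moreover have "(w \<ominus>\<^sub>M z) \<oplus>\<^sub>M z = w" using w(1) z by (simp add: M.M.move_minus)
    ultimately show "w \<in> Y p" by simp
  qed
qed

lemma homog_iff:
  assumes "stable_gr M Y" "\<And>i. z i \<in> W M i" "f \<in> carrier (GM M)" "\<And>i. f i = gc M i (z i)"
  shows "f \<in> homog M Y \<longleftrightarrow> (\<forall>i. z i \<in> Y i)"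
  using gc_subset[OF assms(1) W_carrier[OF M assms(2)]] assms(3,4) by (simp add: homog_def)

lemma homog_cls: assumes Y: "stable_gr M Y" and z: "z \<in> W M p" shows "cls M p z \<in> homog M Y \<longleftrightarrow> z \<in> Y p"
proof -
  have "cls M p z \<in> carrier (GM M)" using cls_closed[OF M z] by (simp add: GM_simps del: direct_sum_simps)
  moreover have "(\<forall>q. cls M p z q \<subseteq> Y q) \<longleftrightarrow> z \<in> Y p"
    using gc_subset[OF Y W_carrier[OF M z]] stable_grD(2)[OF Y] by (auto simp: cls_eq[OF M])
  ultimately show ?thesis by (simp add: homog_def)
qed

lemma smult_cls_reps:
  assumes y: "y \<in> mp e" and z: "\<And>i. z i \<in> W M i" "f = (\<lambda>i. gc M i (z i))" and f: "f \<in> carrier (GM M)"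
  shows "(cls SR e y \<odot>\<^sub>(GM M) f) i = gc M i (if e \<le> i then y \<odot>\<^sub>M z (i - e) else \<zero>\<^sub>M)"
    and "(if e \<le> i then y \<odot>\<^sub>M z (i - e) else \<zero>\<^sub>M) \<in> W M i"
    and "cls SR e y \<odot>\<^sub>(GM M) f \<in> carrier (GM M)"
proof -
  have "gc M i \<zero>\<^sub>M = W M (Suc i)" using gc_zero_iff[OF M] M.submod_zero[OF W_submodule[OF M]] by simp
  thus "(cls SR e y \<odot>\<^sub>(GM M) f) i = gc M i (if e \<le> i then y \<odot>\<^sub>M z (i - e) else \<zero>\<^sub>M)"
    using gr_smult_cls_comp[OF M y z(1), of f i] z(2) by (simp add: GM_simps(4))
  show "(if e \<le> i then y \<odot>\<^sub>M z (i - e) else \<zero>\<^sub>M) \<in> W M i"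
    using W_mult[OF M y z(1), of "i - e"] M.submod_zero[OF W_submodule[OF M]] by auto
  show "cls SR e y \<odot>\<^sub>(GM M) f \<in> carrier (GM M)" using f cls_GR[OF y] by simp
qed

lemma homog_submodule: assumes Y: "stable_gr M Y" shows "submodule (homog M Y) GR (GM M)"
proof (rule N.submodI)
  note YD = stableD[OF stable_grD(1)[OF Y]]
  show "homog M Y \<subseteq> carrier (GM M)" by (auto simp: homog_def)
  show "\<zero>\<^sub>(GM M) \<in> homog M Y" using stable_grD(2)[OF Y] N.M.zero_closed by (auto simp: homog_def GM_zero[OF M])
  show add: "f \<oplus>\<^sub>(GM M) g \<in> homog M Y" if f: "f \<in> homog M Y" and g: "g \<in> homog M Y" for f g
  proof -
    have c: "f \<in> carrier (GM M)" "g \<in> carrier (GM M)" using f g by (auto simp: homog_def)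
    obtain z where z: "\<And>i. z i \<in> W M i" "f = (\<lambda>i. gc M i (z i))" by (rule GM_reps[OF M c(1)]) (rule that)
    obtain w where w: "\<And>i. w i \<in> W M i" "g = (\<lambda>i. gc M i (w i))" by (rule GM_reps[OF M c(2)]) (rule that)
    have eq: "(f \<oplus>\<^sub>(GM M) g) i = gc M i (z i \<oplus>\<^sub>M w i)" for i using gq_add[OF M z(1) w(1)] by (simp add: GM_simps direct_sum_simps z(2) w(2))
    have W: "z i \<oplus>\<^sub>M w i \<in> W M i" for i by (rule M.submod_add[OF W_submodule[OF M] z(1) w(1)])
    have "\<forall>i. z i \<in> Y i" "\<forall>i. w i \<in> Y i" using f g homog_iff[OF Y z(1) c(1)] homog_iff[OF Y w(1) c(2)] z(2) w(2) by simp_all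
    hence "\<forall>i. z i \<oplus>\<^sub>M w i \<in> Y i" using M.submod_add[OF YD(1)] by blast
    thus ?thesis using homog_iff[OF Y W _ eq] c by simp
  qed
  fix a f assume a: "a \<in> carrier GR" and f: "f \<in> homog M Y"
  have aD: "a \<in> carrier DS" using a by (simp add: GR_simps del: direct_sum_simps)
  have fc: "f \<in> carrier (GM M)" using f by (auto simp: homog_def)
  obtain z where z: "\<And>i. z i \<in> W M i" "f = (\<lambda>i. gc M i (z i))" by (rule GM_reps[OF M fc]) (rule that)
  have zY: "\<And>i. z i \<in> Y i" using f homog_iff[OF Y z(1) fc] z(2) by simp
  show "a \<odot>\<^sub>(GM M) f \<in> homog M Y"
  proof (rule homogeneous_induct[OF SR_module aD, where P = "\<lambda>a. a \<odot>\<^sub>(GM M) f \<in> homog M Y", unfolded WS_sub])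
    fix j b assume b: "b \<in> mp j"
    note r = smult_cls_reps[OF b z fc]
    have "b \<odot>\<^sub>M z (i - j) \<in> Y i" if "j \<le> i" for i using stable_mp[OF M stable_grD(1)[OF Y] b zY[of "i - j"]] that by simp
    hence "(if j \<le> i then b \<odot>\<^sub>M z (i - j) else \<zero>\<^sub>M) \<in> Y i" for i using M.submod_zero[OF YD(1)] by simp
    thus "cls SR j b \<odot>\<^sub>(GM M) f \<in> homog M Y" using homog_iff[OF Y r(2,3,1)] by simp
  next
    fix g h assume "g \<in> carrier DS" "h \<in> carrier DS" and gh: "g \<odot>\<^sub>(GM M) f \<in> homog M Y" "h \<odot>\<^sub>(GM M) f \<in> homog M Y"
    hence "g \<in> carrier GR" "h \<in> carrier GR" by (simp_all add: GR_simps del: direct_sum_simps)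
    from N.smult_l_distr[OF this fc] have "(g \<oplus>\<^sub>GR h) \<odot>\<^sub>(GM M) f \<in> homog M Y" using add[OF gh] by simp
    thus "(g \<oplus>\<^sub>DS h) \<odot>\<^sub>(GM M) f \<in> homog M Y" by (simp only: GR_simps)
  qed
qed

lemma homog_mono: "(\<And>p. Y p \<subseteq> Y' p) \<Longrightarrow> homog M Y \<subseteq> homog M Y'"
  by (auto simp: homog_def)

lemma adjoin_stable_gr: assumes "stable_gr M Y" "y \<in> mp e" shows "stable_gr M (adjoin M e y Y)"
  using adjoin_stable[OF M stable_grD(1)[OF assms(1)] assms(2)] assms(1) unfolding stable_gr_def by blast

text \<open>Sums are decomposed in each degree; the supports remain finite because the decomposition of a vanishing
  component is chosen to be trivial.\<close>

lemma homog_step: assumes Y: "stable_gr M Y" and y: "y \<in> mp e"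
  shows "N.msum (homog M Y) {cls SR e y \<odot>\<^sub>(GM M) g | g. g \<in> carrier (GM M)} = homog M (adjoin M e y Y)"
proof
  note F = adjoin_stable_gr[OF Y y] and YD = stableD[OF stable_grD(1)[OF Y]]
  have yR: "y \<in> carrier R" using mp_carrier[OF y] .
  show "N.msum (homog M Y) {cls SR e y \<odot>\<^sub>(GM M) g | g. g \<in> carrier (GM M)} \<subseteq> homog M (adjoin M e y Y)"
  proof (rule N.msum_least[OF homog_submodule[OF F]])
    show "homog M Y \<subseteq> homog M (adjoin M e y Y)" by (rule homog_mono[OF adjoin_stable(2)[OF M stable_grD(1)[OF Y] y]])
    show "{cls SR e y \<odot>\<^sub>(GM M) g | g. g \<in> carrier (GM M)} \<subseteq> homog M (adjoin M e y Y)"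
    proof
      fix h assume "h \<in> {cls SR e y \<odot>\<^sub>(GM M) g | g. g \<in> carrier (GM M)}"
      then obtain g where g: "g \<in> carrier (GM M)" "h = cls SR e y \<odot>\<^sub>(GM M) g" by blast
      obtain z where z: "\<And>i. z i \<in> W M i" "g = (\<lambda>i. gc M i (z i))" by (rule GM_reps[OF M g(1)]) (rule that)
      note r = smult_cls_reps[OF y z g(1)]
      have "y \<odot>\<^sub>M z (i - e) \<in> adjoin M e y Y i" if "e \<le> i" for i
        using M.msum_upper(2)[OF YD(1)[of i] M.smult_image_submodule[OF yR W_submodule[OF M, of "i - e"]]] z(1)[of "i - e"] that by (auto simp: adjoin_def)
      hence "(if e \<le> i then y \<odot>\<^sub>M z (i - e) else \<zero>\<^sub>M) \<in> adjoin M e y Y i" for i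
        using M.submod_zero[OF stableD(1)[OF stable_grD(1)[OF F]]] by simp
      thus "h \<in> homog M (adjoin M e y Y)" unfolding g(2) using homog_iff[OF F r(2,3,1)] by simp
    qed
  qed
  show "homog M (adjoin M e y Y) \<subseteq> N.msum (homog M Y) {cls SR e y \<odot>\<^sub>(GM M) g | g. g \<in> carrier (GM M)}"
  proof
    fix f assume f: "f \<in> homog M (adjoin M e y Y)"
    have fc: "f \<in> carrier (GM M)" using f by (auto simp: homog_def)
    obtain z where z: "\<And>i. z i \<in> W M i" "f = (\<lambda>i. gc M i (z i))" "finite {i. z i \<notin> W M (Suc i)}" by (rule GM_reps[OF M fc]) (rule that)
    have zY: "\<And>i. z i \<in> adjoin M e y Y i" using f homog_iff[OF F z(1) fc] z(2) by simp
    have "\<exists>u v. u \<in> Y i \<and> v \<in> W M (i - e) \<and> z i = u \<oplus>\<^sub>M (if e \<le> i then y \<odot>\<^sub>M v else \<zero>\<^sub>M) \<and> (z i \<in> W M (Suc i) \<longrightarrow> u = z i \<and> v = \<zero>\<^sub>M)" for i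
    proof (cases "z i \<in> W M (Suc i)")
      case True
      thus ?thesis using stable_grD(2)[OF Y True] W_carrier[OF M True] yR M.submod_zero[OF W_submodule[OF M]] by (intro exI[of _ "z i"] exI[of _ "\<zero>\<^sub>M"]) simp
    next
      case nz: False
      show ?thesis
      proof (cases "e \<le> i")
        case True
        thus ?thesis using zY[of i] nz by (auto simp: adjoin_def M.msum_def)
      next
        case False
        thus ?thesis using zY[of i] nz W_carrier[OF M z(1)] M.submod_zero[OF W_submodule[OF M]]
          by (intro exI[of _ "z i"] exI[of _ "\<zero>\<^sub>M"]) (simp add: adjoin_def)
      qed
    qed
    then obtain u v where uv: "\<And>i. u i \<in> Y i" "\<And>i. v i \<in> W M (i - e)" "\<And>i. z i = u i \<oplus>\<^sub>M (if e \<le> i then y \<odot>\<^sub>M v i else \<zero>\<^sub>M)"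
      "\<And>i. z i \<in> W M (Suc i) \<Longrightarrow> u i = z i" "\<And>i. z i \<in> W M (Suc i) \<Longrightarrow> v i = \<zero>\<^sub>M" by metis
    have uW: "u i \<in> W M i" for i using YD(2) uv(1) by blast
    have "{i. u i \<notin> W M (Suc i)} \<subseteq> {i. z i \<notin> W M (Suc i)}" using uv(4) by auto
    hence f1: "(\<lambda>i. gc M i (u i)) \<in> carrier (GM M)" using z(3) finite_subset uW by (intro GM_I[OF M]) blast+
    define v' where "v' j = v (j + e)" for j
    have vW: "v' j \<in> W M j" for j using uv(2)[of "j + e"] by (simp add: v'_def)
    have "(\<lambda>j. j + e) ` {j. v' j \<notin> W M (Suc j)} \<subseteq> {i. z i \<notin> W M (Suc i)}" using uv(5) M.submod_zero[OF W_submodule[OF M]] by (auto simp: v'_def)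
    hence "finite ((\<lambda>j. j + e) ` {j. v' j \<notin> W M (Suc j)})" using z(3) finite_subset by blast
    hence "finite {j. v' j \<notin> W M (Suc j)}" by (rule finite_imageD) simp
    hence g: "(\<lambda>j. gc M j (v' j)) \<in> carrier (GM M)" by (intro GM_I[OF M] vW)
    note r = smult_cls_reps[OF y vW refl g]
    have u1: "(\<lambda>i. gc M i (u i)) \<in> homog M Y" using homog_iff[OF Y uW f1] uv(1) by simp
    have "f = (\<lambda>i. gc M i (u i)) \<oplus>\<^sub>(GM M) (cls SR e y \<odot>\<^sub>(GM M) (\<lambda>j. gc M j (v' j)))"
    proof
      fix i
      have "((\<lambda>i. gc M i (u i)) \<oplus>\<^sub>(GM M) (cls SR e y \<odot>\<^sub>(GM M) (\<lambda>j. gc M j (v' j)))) i = gc M i (u i) \<oplus>\<^sub>(gq M i) (cls SR e y \<odot>\<^sub>(GM M) (\<lambda>j. gc M j (v' j))) i"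
        by (simp add: GM_simps direct_sum_simps)
      also have "\<dots> = gc M i (u i \<oplus>\<^sub>M (if e \<le> i then y \<odot>\<^sub>M v' (i - e) else \<zero>\<^sub>M))" unfolding r(1) by (rule gq_add[OF M uW r(2)])
      also have "\<dots> = f i" using uv(3)[of i] z(2) by (cases "e \<le> i") (simp_all add: v'_def)
      finally show "f i = ((\<lambda>i. gc M i (u i)) \<oplus>\<^sub>(GM M) (cls SR e y \<odot>\<^sub>(GM M) (\<lambda>j. gc M j (v' j)))) i" by simp
    qed
    thus "f \<in> N.msum (homog M Y) {cls SR e y \<odot>\<^sub>(GM M) g | g. g \<in> carrier (GM M)}" unfolding N.msum_def using u1 g by blast
  qed
qed

text \<open>Regularity of a homogeneous element can be tested on homogeneous elements.\<close>

lemma homog_reg: assumes Y: "stable_gr M Y" and y: "y \<in> mp e"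
  shows "(\<forall>p. \<forall>z\<in>W M p. y \<odot>\<^sub>M z \<in> Y (p + e) \<longrightarrow> z \<in> Y p) \<longleftrightarrow>
    (\<forall>f\<in>carrier (GM M). cls SR e y \<odot>\<^sub>(GM M) f \<in> homog M Y \<longrightarrow> f \<in> homog M Y)"
proof (intro iffI allI ballI impI)
  fix f assume reg: "\<forall>p. \<forall>z\<in>W M p. y \<odot>\<^sub>M z \<in> Y (p + e) \<longrightarrow> z \<in> Y p" and f: "f \<in> carrier (GM M)" and yf: "cls SR e y \<odot>\<^sub>(GM M) f \<in> homog M Y"
  obtain z where z: "\<And>i. z i \<in> W M i" "f = (\<lambda>i. gc M i (z i))" by (rule GM_reps[OF M f]) (rule that)
  note r = smult_cls_reps[OF y z f]
  have "(if e \<le> i then y \<odot>\<^sub>M z (i - e) else \<zero>\<^sub>M) \<in> Y i" for i using homog_iff[OF Y r(2,3,1)] yf by blast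
  from this[of "_ + e"] have "y \<odot>\<^sub>M z p \<in> Y (p + e)" for p by simp
  hence "\<forall>p. z p \<in> Y p" using reg z(1) by blast
  thus "f \<in> homog M Y" using homog_iff[OF Y z(1) f] z(2) by simp
next
  fix p z assume reg: "\<forall>f\<in>carrier (GM M). cls SR e y \<odot>\<^sub>(GM M) f \<in> homog M Y \<longrightarrow> f \<in> homog M Y" and z: "z \<in> W M p" "y \<odot>\<^sub>M z \<in> Y (p + e)"
  have c: "cls M p z \<in> carrier (GM M)" using cls_closed[OF M z(1)] by (simp add: GM_simps del: direct_sum_simps)
  have "cls SR e y \<odot>\<^sub>(GM M) cls M p z = cls M (p + e) (y \<odot>\<^sub>M z)" using gr_smult_cls[OF M y z(1)] by (simp add: GM_simps(4) add.commute)
  moreover have "cls M (p + e) (y \<odot>\<^sub>M z) \<in> homog M Y" using homog_cls[OF Y] W_mult[OF M y z(1)] z(2) by (simp add: add.commute)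
  ultimately show "z \<in> Y p" using reg c homog_cls[OF Y z(1)] by simp
qed

lemma filt_zero_stable_gr: "stable_gr M (filt_zero M)"
  using filt_zero_stable[OF M] by (simp add: stable_gr_def filt_zero_def)

lemma homog_sub_Y0: "homog M (filt_zero M) = {\<zero>\<^sub>(GM M)}"
proof
  show "{\<zero>\<^sub>(GM M)} \<subseteq> homog M (filt_zero M)" using N.submod_zero[OF homog_submodule[OF filt_zero_stable_gr]] by simp
  show "homog M (filt_zero M) \<subseteq> {\<zero>\<^sub>(GM M)}"
  proof
    fix f assume f: "f \<in> homog M (filt_zero M)"
    have fc: "f \<in> carrier (GM M)" using f by (auto simp: homog_def)
    obtain z where z: "\<And>i. z i \<in> W M i" "f = (\<lambda>i. gc M i (z i))" by (rule GM_reps[OF M fc]) (rule that)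
    have "z i \<in> W M (Suc i)" for i using f homog_iff[OF filt_zero_stable_gr z(1) fc] z(2) by (simp add: filt_zero_def)
    hence "gc M i (z i) = W M (Suc i)" for i using gc_zero_iff[OF M W_carrier[OF M z(1)]] by blast
    hence "f = (\<lambda>i. W M (Suc i))" using z(2) by simp
    thus "f \<in> {\<zero>\<^sub>(GM M)}" by (simp add: GM_zero[OF M])
  qed
qed

lemma filt_seq_stable_gr: "set xs \<subseteq> \<mm> \<Longrightarrow> stable_gr M (filt_seq M xs)"
proof (induction xs rule: rev_induct)
  case Nil thus ?case using filt_zero_stable_gr by (simp add: filt_seq_def)
next
  case (snoc x xs) thus ?case by (auto simp: filt_seq_snoc intro!: adjoin_stable_gr)
qed

lemma cls_set: "set xs \<subseteq> \<mm> \<Longrightarrow> set (map (cls SR 1) xs) \<subseteq> carrier GR"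
  using cls_GR[of _ 1] by auto

lemma homog_Yf: "set xs \<subseteq> \<mm> \<Longrightarrow> set_smult GR (GM M) (set (map (cls SR 1) xs)) = homog M (filt_seq M xs)"
proof (induction xs rule: rev_induct)
  case Nil thus ?case using homog_sub_Y0 by (simp add: filt_seq_def N.set_smult_empty)
next
  case (snoc x xs)
  hence xs: "set xs \<subseteq> \<mm>" "x \<in> mp 1" by auto
  have "set_smult GR (GM M) (set (map (cls SR 1) (xs @ [x]))) = N.msum (homog M (filt_seq M xs)) {cls SR 1 x \<odot>\<^sub>(GM M) g | g. g \<in> carrier (GM M)}"
    using N.set_smult_insert[OF cls_set[OF xs(1)] cls_GR[OF xs(2)]] snoc.IH[OF xs(1)] by simp
  also have "\<dots> = homog M (filt_seq M (xs @ [x]))" unfolding filt_seq_snoc by (rule homog_step[OF filt_seq_stable_gr[OF xs(1)] xs(2)])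
  finally show ?case .
qed

lemma filt_seq_0: "filt_seq M xs 0 = W M 1"
  by (induction xs rule: rev_induct) (simp_all add: filt_seq_def filt_zero_def adjoin_def)

lemma gr_regular_iff: assumes xs: "set xs \<subseteq> \<mm>"
  shows "(\<forall>i<length xs. \<forall>z\<in>carrier (GM M). map (cls SR 1) xs ! i \<odot>\<^sub>(GM M) z \<in> set_smult GR (GM M) (set (take i (map (cls SR 1) xs)))
      \<longrightarrow> z \<in> set_smult GR (GM M) (set (take i (map (cls SR 1) xs)))) \<longleftrightarrow>
    (\<forall>i<length xs. \<forall>p. \<forall>z\<in>W M p. xs ! i \<odot>\<^sub>M z \<in> filt_seq M (take i xs) (p + 1) \<longrightarrow> z \<in> filt_seq M (take i xs) p)"
proof -
  have "(\<forall>z\<in>carrier (GM M). map (cls SR 1) xs ! i \<odot>\<^sub>(GM M) z \<in> set_smult GR (GM M) (set (take i (map (cls SR 1) xs)))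
      \<longrightarrow> z \<in> set_smult GR (GM M) (set (take i (map (cls SR 1) xs)))) \<longleftrightarrow>
     (\<forall>p. \<forall>z\<in>W M p. xs ! i \<odot>\<^sub>M z \<in> filt_seq M (take i xs) (p + 1) \<longrightarrow> z \<in> filt_seq M (take i xs) p)" if i: "i < length xs" for i
  proof -
    have t: "set (take i xs) \<subseteq> \<mm>" "xs ! i \<in> mp 1" using xs set_take_subset[of i xs] nth_mem[OF i] by auto
    show ?thesis unfolding take_map homog_Yf[OF t(1)] homog_reg[OF filt_seq_stable_gr[OF t(1)] t(2)] using i by simp
  qed
  thus ?thesis by blast
qed

text \<open>In degree zero the submodule is zero, whereas \<open>M/\<mm>M\<close> is not, by Nakayama's lemma.\<close>

lemma gr_nontrivial: assumes fg: "fin_gen R M" and nz: "carrier M \<noteq> {\<zero>\<^sub>M}" and xs: "set xs \<subseteq> \<mm>"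
  shows "set_smult GR (GM M) (set (map (cls SR 1) xs)) \<noteq> carrier (GM M)"
proof -
  have "W M 1 \<noteq> carrier M" using nakayama[OF M fg] nz by blast
  then obtain z where z: "z \<in> carrier M" "z \<notin> W M 1" using W_carrier[OF M] by blast
  have z0: "z \<in> W M 0" using z(1) by (simp add: W_0[OF M])
  have "cls M 0 z \<in> carrier (GM M)" using cls_closed[OF M z0] by (simp add: GM_simps del: direct_sum_simps)
  moreover have "cls M 0 z \<notin> homog M (filt_seq M xs)" unfolding homog_cls[OF filt_seq_stable_gr[OF xs] z0] filt_seq_0 by (rule z(2))
  ultimately show ?thesis using homog_Yf[OF xs] by blast
qed

end

lemma set_smult_Idl: assumes "module G P" "X \<subseteq> carrier G" shows "set_smult G P (Idl\<^bsub>G\<^esub> X) = set_smult G P X"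
proof
  interpret P: module G P by fact
  have I: "ideal (Idl\<^bsub>G\<^esub> X) G" by (rule P.R.genideal_ideal[OF assms(2)])
  have sub: "X \<subseteq> Idl\<^bsub>G\<^esub> X" by (rule P.R.genideal_self[OF assms(2)])
  show "set_smult G P X \<subseteq> set_smult G P (Idl\<^bsub>G\<^esub> X)" by (rule P.set_smult_mono[OF sub]) (use ideal.Icarr[OF I] in blast)
  have S: "submodule (set_smult G P X) G P" by (rule P.set_smult_submodule[OF assms(2)])
  have id: "ideal {a \<in> carrier G. \<forall>z\<in>carrier P. a \<odot>\<^sub>P z \<in> set_smult G P X} G"
    by (rule P.R.submodule_idealI) (use P.submod_zero[OF S] P.submod_add[OF S] P.submod_smult[OF S] in \<open>auto simp: P.smult_l_distr P.smult_assoc1\<close>)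
  have "Idl\<^bsub>G\<^esub> X \<subseteq> {a \<in> carrier G. \<forall>z\<in>carrier P. a \<odot>\<^sub>P z \<in> set_smult G P X}"
    by (rule P.R.genideal_minimal[OF id]) (use assms(2) P.set_smult_mem in auto)
  thus "set_smult G P (Idl\<^bsub>G\<^esub> X) \<subseteq> set_smult G P X" by (intro P.set_smult_least[OF S]) blast
qed

text \<open>The homogeneous elements of the ideal I, as a stable family of the ring.\<close>

definition ideal_filt where "ideal_filt I e = {y \<in> mp e. cls SR e y \<in> I}"

lemma ideal_filt_stable: assumes I: "ideal I GR" shows "stable SR (ideal_filt I)"
  unfolding stable_def WS_sub
proof (intro allI conjI ballI)
  interpret G: cring GR by (rule GR_cring)
  interpret I: ideal I GR by (rule I)
  note cl = cls_add[OF SR_module, unfolded WS_sub] and c0 = cls_zero[OF SR_module, unfolded WS_sub]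
  note gs = gr_smult_cls[OF SR_module, unfolded WS_sub]
  fix e
  show "submodule (ideal_filt I e) R SR"
  proof (rule SF.submodI)
    show "ideal_filt I e \<subseteq> carrier SR" using mp_carrier by (auto simp: ideal_filt_def)
    show "\<zero>\<^sub>SR \<in> ideal_filt I e" using c0[of \<zero> e] I.zero_closed by (simp add: ideal_filt_def mp_closed GR_simps del: direct_sum_simps)
    show "a \<oplus>\<^sub>SR b \<in> ideal_filt I e" if "a \<in> ideal_filt I e" "b \<in> ideal_filt I e" for a b
      using that cl[of a e b] I.a_closed[of "cls SR e a" "cls SR e b"] by (simp add: ideal_filt_def mp_closed GR_simps del: direct_sum_simps)
    show "a \<odot>\<^sub>SR b \<in> ideal_filt I e" if "a \<in> carrier R" "b \<in> ideal_filt I e" for a b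
      using that gs[of a 0 b e] I.I_l_closed[of "cls SR e b" "cls SR 0 a"] cls_GR[of a 0] by (simp add: ideal_filt_def mp_closed GR_simps del: direct_sum_simps)
  qed
  show "ideal_filt I e \<subseteq> mp e" by (auto simp: ideal_filt_def)
  fix t y assume t: "t \<in> \<mm>" and y: "y \<in> ideal_filt I e"
  have "t \<otimes> y \<in> mp (1 + e)" using mp_mult[of t 1 y e] t y by (simp add: ideal_filt_def)
  thus "t \<odot>\<^sub>SR y \<in> ideal_filt I (Suc e)"
    using t y gs[of t 1 y e] I.I_l_closed[of "cls SR e y" "cls SR 1 t"] cls_GR[of t 1] by (simp add: ideal_filt_def GR_simps del: direct_sum_simps)
qed

context
  fixes M :: "('a, 'm, 'n) module_scheme" and xs
  assumes M: "module R M" and fg: "fin_gen R M" and nz: "carrier M \<noteq> {\<zero>\<^sub>M}" and xs: "set xs \<subseteq> \<mm>"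
begin

interpretation M: module R M by (rule M)
interpretation N: module GR "GM M" by (rule GM_module[OF M])
interpretation NF: fmodule GR "GM M" by (rule N.fmodule)

abbreviation "xbar \<equiv> map (cls SR 1) xs"
abbreviation "I \<equiv> Idl\<^bsub>GR\<^esub> (set xbar)"

lemma xbar_set: "set xbar \<subseteq> carrier GR" by (rule cls_set[OF M xs])

lemma regular_in_I: assumes ys: "set ys \<subseteq> I"
  shows "regular_on GR (GM M) ys \<longleftrightarrow> (\<forall>i<length ys. \<forall>z\<in>carrier (GM M).
     ys ! i \<odot>\<^sub>(GM M) z \<in> set_smult GR (GM M) (set (take i ys)) \<longrightarrow> z \<in> set_smult GR (GM M) (set (take i ys)))"
proof -
  have IR: "I \<subseteq> carrier GR" using ideal.Icarr[OF N.R.genideal_ideal[OF xbar_set]] by blast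
  have "set_smult GR (GM M) (set ys) \<subseteq> set_smult GR (GM M) (set xbar)"
    using N.set_smult_mono[OF ys IR] set_smult_Idl[OF GM_module[OF M] xbar_set] by simp
  moreover have "set_smult GR (GM M) (set xbar) \<subseteq> carrier (GM M)" using N.submod_carrier[OF N.set_smult_submodule[OF xbar_set]] by blast
  ultimately have "set_smult GR (GM M) (set ys) \<noteq> carrier (GM M)" using gr_nontrivial[OF M fg nz xs] by blast
  thus ?thesis using N.regular_on_iff[of ys] ys IR by blast
qed

text \<open>Vanishing of Koszul homology in the highest degree means that no nonzero element is annihilated by all
  initial forms, so \<open>homogeneous_avoidance\<close> gives the next element. Dividing it out shortens the range of
  vanishing by one degree.\<close>

lemma regular_seq_exists:
  assumes e: "\<And>n. n > int (length xs) - int l \<Longrightarrow> NF.koszul_exact xbar {\<zero>\<^sub>(GM M)} n"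
  shows "\<exists>ys. length ys = l \<and> set ys \<subseteq> I \<and> regular_on GR (GM M) ys"
proof -
  have Iid: "ideal I GR" by (rule N.R.genideal_ideal[OF xbar_set])
  have IR: "I \<subseteq> carrier GR" using ideal.Icarr[OF Iid] by blast
  have "\<exists>ys Y. length ys = i \<and> set ys \<subseteq> I \<and> regular_on GR (GM M) ys \<and> stable_gr M Y \<and> homog M Y = set_smult GR (GM M) (set ys) \<and>
     (\<forall>n > int (length xs) - int (l - i). NF.koszul_exact xbar (homog M Y) n)" if "i \<le> l" for i using that
  proof (induction i)
    case 0
    have "set_smult GR (GM M) (set []) = homog M (filt_zero M)" using N.set_smult_empty homog_sub_Y0[OF M] by simp
    thus ?case using e filt_zero_stable_gr[OF M] homog_sub_Y0[OF M] regular_in_I[of "[]"] by (intro exI[of _ "[]"] exI[of _ "filt_zero M"]) simp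
  next
    case (Suc i)
    then obtain ys Y where IH: "length ys = i" "set ys \<subseteq> I" "regular_on GR (GM M) ys" "stable_gr M Y" "homog M Y = set_smult GR (GM M) (set ys)"
      "\<And>n. n > int (length xs) - int (l - i) \<Longrightarrow> NF.koszul_exact xbar (homog M Y) n" by auto
    note S = homog_submodule[OF M IH(4)]
    have top: "NF.koszul_exact xbar (homog M Y) (int (length xbar))" using IH(6) Suc.prems by simp
    have soc: "z \<in> Y p" if z: "z \<in> W M p" and x: "\<And>x. x \<in> set xs \<Longrightarrow> x \<odot>\<^sub>M z \<in> Y (Suc p)" for p z
    proof -
      have c: "cls M p z \<in> carrier (GM M)" using cls_closed[OF M z] by (simp add: GM_simps del: direct_sum_simps)
      have "y \<odot>\<^sub>(GM M) cls M p z \<in> homog M Y" if yx: "y \<in> set xbar" for y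
      proof -
        obtain x where xx: "x \<in> set xs" "y = cls SR 1 x" using yx by auto
        have x1: "x \<in> mp 1" using xx xs by auto
        have "y \<odot>\<^sub>(GM M) cls M p z = cls M (Suc p) (x \<odot>\<^sub>M z)" using gr_smult_cls[OF M x1 z] xx(2) by (simp add: GM_simps(4))
        thus ?thesis using homog_cls[OF M IH(4), of "x \<odot>\<^sub>M z" "Suc p"] W_mult[OF M x1 z] x[OF xx(1)] by simp
      qed
      hence "cls M p z \<in> homog M Y" by (rule NF.koszul_exact_top[OF xbar_set S top c])
      thus ?thesis using homog_cls[OF M IH(4) z] by simp
    qed
    have J1: "x \<in> ideal_filt I 1" if "x \<in> set xs" for x
      using that xs N.R.genideal_self[OF xbar_set] by (auto simp: ideal_filt_def)
    obtain e y where y: "y \<in> ideal_filt I e" "\<forall>p. \<forall>z\<in>W M p. y \<odot>\<^sub>M z \<in> Y (p + e) \<longrightarrow> z \<in> Y p"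
      using homogeneous_avoidance[OF M fg stable_grD(1)[OF IH(4)] xs ideal_filt_stable[OF Iid] J1 soc] by blast
    have ym: "y \<in> mp e" and yI: "cls SR e y \<in> I" using y(1) by (auto simp: ideal_filt_def)
    have reg: "f \<in> homog M Y" if "f \<in> carrier (GM M)" "cls SR e y \<odot>\<^sub>(GM M) f \<in> homog M Y" for f
      using y(2) homog_reg[OF M IH(4) ym] that by blast
    let ?ys = "ys @ [cls SR e y]"
    have st: "homog M (adjoin M e y Y) = N.msum (homog M Y) {cls SR e y \<odot>\<^sub>(GM M) g | g. g \<in> carrier (GM M)}" using homog_step[OF M IH(4) ym] by simp
    have ysR: "set ys \<subseteq> carrier GR" using IH(2) IR by blast
    have 1: "homog M (adjoin M e y Y) = set_smult GR (GM M) (set ?ys)"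
      unfolding st IH(5) using N.set_smult_insert[OF ysR cls_GR[OF ym]] by simp
    have ysI: "set ?ys \<subseteq> I" using IH(2) yI by simp
    have 2: "regular_on GR (GM M) ?ys" unfolding regular_in_I[OF ysI]
    proof (intro allI impI ballI)
      fix j z assume j: "j < length ?ys" and z: "z \<in> carrier (GM M)" "?ys ! j \<odot>\<^sub>(GM M) z \<in> set_smult GR (GM M) (set (take j ?ys))"
      show "z \<in> set_smult GR (GM M) (set (take j ?ys))"
      proof (cases "j < length ys")
        case True
        thus ?thesis using z IH(3)[unfolded regular_in_I[OF IH(2)]] by (simp add: nth_append)
      next
        case False
        hence "j = length ys" using j by simp
        thus ?thesis using z reg IH(5) by simp
      qed
    qed
    have 3: "NF.koszul_exact xbar (homog M (adjoin M e y Y)) n" if n: "n > int (length xs) - int (l - Suc i)" for n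
      unfolding st
    proof (rule NF.koszul_exact_down[OF xbar_set S cls_GR[OF ym] reg])
      show "NF.koszul_exact xbar (homog M Y) n" "NF.koszul_exact xbar (homog M Y) (n - 1)" using IH(6) n Suc.prems by (simp_all add: of_nat_diff)
    qed
    show ?case using IH(1) ysI 1 2 3 adjoin_stable_gr[OF M IH(4) ym] by (intro exI[of _ ?ys] exI[of _ "adjoin M e y Y"]) simp
  qed
  thus ?thesis by blast
qed

theorem grade_eq:
  assumes r: "\<not> NF.koszul_exact xbar {\<zero>\<^sub>(GM M)} (int r)" "\<And>n. n > int r \<Longrightarrow> NF.koszul_exact xbar {\<zero>\<^sub>(GM M)} n"
  shows "r \<le> length xs" and "grade GR I (GM M) = ereal (real (length xs) - real r)"
proof -
  show rc: "r \<le> length xs" using NF.koszul_exact_vanish[of "int r" xbar, OF _ xbar_set N.zero_submodule] r(1) by fastforce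
  have "length ys \<le> length xs - r" if "set ys \<subseteq> I" "regular_on GR (GM M) ys" for ys
  proof (rule ccontr)
    assume "\<not> length ys \<le> length xs - r"
    hence "int (length xbar) < int r + int (length ys)" by simp
    from NF.koszul_exact_regular[OF xbar_set that(1) _ this] show False using r(1) that(2)[unfolded regular_in_I[OF that(1)]] by blast
  qed
  moreover obtain ys where "length ys = length xs - r" "set ys \<subseteq> I" "regular_on GR (GM M) ys"
    using regular_seq_exists[of "length xs - r"] r(2) rc by (auto simp: of_nat_diff)
  ultimately have "Sup {ereal (real (length ys)) | ys. set ys \<subseteq> I \<and> regular_on GR (GM M) ys} = ereal (real (length xs - r))"
    by (intro antisym Sup_least Sup_upper) (auto intro!: exI[of _ ys])
  thus "grade GR I (GM M) = ereal (real (length xs) - real r)"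
    using gr_nontrivial[OF M fg nz xs] set_smult_Idl[OF GM_module[OF M] xbar_set] rc by (simp add: grade_def of_nat_diff)
qed

end

end

section \<open>Koszul modules modulo a regular sequence\<close>

context noeth_local begin

lemma lin_exact_neg: assumes c: "coord_res S d \<epsilon> M L" and n: "n < 0" shows "lin_exact (\<lambda>n. FM (S n)) d n"
  unfolding lin_exact_iff[OF c]
proof (intro allI, unfold SF.exact_mod_def, intro ballI impI)
  note [simp] = SF.differentialD[OF coord_resD(3)[OF c]]
  fix i z assume "z \<in> FS S n i"
  hence "z = \<zero>\<^sub>U" using FrD(1)[OF FS_Fr, of z S n i] FrD(2)[OF FS_Fr, of z S n i] coord_resD(2)[OF c n] by (auto simp: fun_mod_simps)
  thus "\<exists>w\<in>FS S (n + 1) i. z \<ominus>\<^sub>U d (n + 1) w \<in> FS' S n i"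
    using SF.UM.submod_zero[OF FS_submodule] by (intro bexI[of _ "\<zero>\<^sub>U"]) (simp_all add: FS'_def SF.UM.M.minus_zero)
qed

text \<open>All boundaries in degree zero have coordinates in \<open>\<mm>\<close>, and basis vectors do not.\<close>

lemma lin_exact_zero: assumes M: "module R M" and c: "coord_res S d \<epsilon> M L" and nz: "carrier M \<noteq> {\<zero>\<^sub>M}" shows "\<not> lin_exact (\<lambda>n. FM (S n)) d 0"
proof
  interpret M: module R M by fact
  interpret e: lin_map R U M \<epsilon> by (intro lin_mapI U_module M coord_resD(7)[OF c])
  note dD = SF.differentialD[OF coord_resD(3)[OF c]] and D = coord_resD[OF c]
  assume "lin_exact (\<lambda>n. FM (S n)) d 0"
  hence l: "SF.exact_mod (FS S) (FS' S) d 0 0" using lin_exact_iff[OF c] by blast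
  have mem: "z k \<in> \<mm>" if z: "z \<in> Fr (S 0)" for z k
  proof -
    have z0: "z \<in> FS S 0 0" using z FrD(1)[OF z] by (simp add: FS_def)
    have "d 0 z \<in> Fr (S (- 1))" using D(4)[OF z] by simp
    hence "d 0 z = \<zero>\<^sub>U" using FrD(1)[of "d 0 z" "S (- 1)"] FrD(2)[of "d 0 z" "S (- 1)"] D(2)[of "- 1"] by (auto simp: fun_mod_simps)
    hence "d 0 z \<in> FS' S (0 - 1) 0" using SF.UM.submod_zero[OF FS_submodule] by (simp add: FS'_def)
    then obtain w where w: "w \<in> FS S 1 0" "z \<ominus>\<^sub>U d 1 w \<in> FS' S 0 0" using l z0 unfolding SF.exact_mod_def by fastforce
    have wF: "w \<in> Fr (S 1)" by (rule FS_Fr[OF w(1)])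
    have "a \<ominus>\<^sub>SR b = a \<ominus> b" for a b by (simp add: a_minus_def a_inv_def m_inv_def)
    hence "z k \<ominus> d 1 w k \<in> \<mm>" using w(2) FrD(3)[OF z] dD(1)[OF FrD(3)[OF wF], of 1]
      by (simp add: FS'_def FS_def SF.fun_mod_minus)
    moreover have "d 1 w k \<in> \<mm>" by (rule D(5)[OF wF])
    ultimately have "(z k \<ominus> d 1 w k) \<oplus> d 1 w k \<in> \<mm>" by (rule mm.a_closed)
    moreover have "(z k \<ominus> d 1 w k) \<oplus> d 1 w k = z k" using FrD(1)[OF z, of k] mm.Icarr[OF D(5)[OF wF, of k]] by (simp add: move_minus)
    ultimately show ?thesis by simp
  qed
  have "S 0 = {}"
  proof (rule ccontr)
    assume "S 0 \<noteq> {}"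
    then obtain k where k: "k \<in> S 0" by blast
    from mem[OF uv_Fr[OF k], of k] show False using one_notin by (simp add: uv_def)
  qed
  hence "z = \<zero>\<^sub>U" if "z \<in> Fr (S 0)" for z using FrD(1)[OF that] FrD(2)[OF that] by (auto simp: fun_mod_simps)
  hence "z = \<zero>\<^sub>M" if "z \<in> carrier M" for z using that D(8) e.zero by (metis imageE)
  thus False using nz M.M.zero_closed by blast
qed

lemma Sup_zero_iff: assumes "\<not> P 0" "\<And>n::int. n < 0 \<Longrightarrow> P n"
  shows "Sup {ereal (real_of_int n) | n. \<not> P n} = 0 \<longleftrightarrow> (\<forall>n>0. P n)"
proof
  assume s: "Sup {ereal (real_of_int n) | n. \<not> P n} = 0"
  show "\<forall>n>0. P n"
  proof (intro allI impI, rule ccontr)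
    fix n :: int assume "n > 0" "\<not> P n"
    hence "ereal (real_of_int n) \<le> Sup {ereal (real_of_int n) | n. \<not> P n}" by (intro Sup_upper) blast
    thus False using s \<open>n > 0\<close> by (simp add: zero_ereal_def)
  qed
next
  assume a: "\<forall>n>0. P n"
  have "n = 0" if "\<not> P n" for n using a assms(2) that by (metis linorder_neqE)
  hence "{ereal (real_of_int n) | n. \<not> P n} = {0}" using assms(1) by force
  thus "Sup {ereal (real_of_int n) | n. \<not> P n} = 0" by simp
qed

text \<open>As the module is not zero, the linear part has homology in degree zero; it has none in negative degrees.\<close>

lemma koszul_iff:
  fixes P :: "('a, 'p, 'q) module_scheme"
  assumes P: "module R P" and F: "minimal_free_resolution R \<mm> P (\<lambda>n. FM (S n)) d"
    and M: "module R M" and c: "coord_res S d \<epsilon> M L" and nz: "carrier M \<noteq> {\<zero>\<^sub>M}"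
  shows "koszul_module R \<mm> P \<longleftrightarrow> (\<forall>n>0. lin_exact (\<lambda>n. FM (S n)) d n)"
  unfolding koszul_module_def lin_defect_eq[OF P F]
  by (rule Sup_zero_iff[where P = "lin_exact (\<lambda>n. FM (S n)) d", OF lin_exact_zero[OF M c nz] lin_exact_neg[OF c]])

context
  fixes M :: "('a, 'm, 'n) module_scheme" and xs
  assumes M: "module R M" and fg: "fin_gen R M" and xs: "set xs \<subseteq> \<mm>"
begin

interpretation M: module R M by (rule M)
interpretation N: module GR "GM M" by (rule GM_module[OF M])
interpretation NF: fmodule GR "GM M" by (rule N.fmodule)

abbreviation "xb \<equiv> map (cls SR 1) xs"
abbreviation "MxM \<equiv> quot_module M (set_smult R M (set xs))"

lemma xsR: "set xs \<subseteq> carrier R" using xs mm.Icarr by blast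

lemma regular_nontrivial: assumes r: "regular_on R M xs" shows "carrier M \<noteq> {\<zero>\<^sub>M}"
proof
  assume z: "carrier M = {\<zero>\<^sub>M}"
  note S = M.set_smult_submodule[OF xsR]
  have "set_smult R M (set xs) = carrier M"
  proof
    show "set_smult R M (set xs) \<subseteq> carrier M" using M.submod_carrier[OF S] by (rule subsetI)
    show "carrier M \<subseteq> set_smult R M (set xs)" unfolding z using M.submod_zero[OF S] by simp
  qed
  thus False using r by (simp add: regular_on_def)
qed

lemma gr_regular_nontrivial: "regular_on GR (GM M) xb \<Longrightarrow> carrier M \<noteq> {\<zero>\<^sub>M}"
proof
  assume r: "regular_on GR (GM M) xb" and z: "carrier M = {\<zero>\<^sub>M}"
  note Ns = N.set_smult_submodule[OF cls_set[OF M xs]]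
  have "f = \<zero>\<^sub>(GM M)" if f: "f \<in> carrier (GM M)" for f
  proof -
    obtain u where u: "\<And>i. u i \<in> W M i" "f = (\<lambda>i. gc M i (u i))" by (rule GM_reps[OF M f]) (rule that)
    have "u i = \<zero>\<^sub>M" for i using W_carrier[OF M u(1)] z by blast
    hence "gc M i (u i) = W M (Suc i)" for i using gc_zero_iff[OF M M.M.zero_closed] M.submod_zero[OF W_submodule[OF M]] by simp
    thus ?thesis by (simp add: u(2) GM_zero[OF M])
  qed
  hence "set_smult GR (GM M) (set xb) = carrier (GM M)" using N.submod_zero[OF Ns] N.submod_carrier[OF Ns] by blast
  thus False using r by (simp add: regular_on_def)
qed

lemma gr_regular_iff': assumes nz: "carrier M \<noteq> {\<zero>\<^sub>M}"
  shows "regular_on GR (GM M) xb \<longleftrightarrow> (\<forall>i<length xb. \<forall>z\<in>carrier (GM M).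
     xb ! i \<odot>\<^sub>(GM M) z \<in> set_smult GR (GM M) (set (take i xb)) \<longrightarrow> z \<in> set_smult GR (GM M) (set (take i xb)))"
  using N.regular_on_iff[OF cls_set[OF M xs]] gr_nontrivial[OF M fg nz xs] by blast

lemma lift_regular: assumes g: "regular_on GR (GM M) xb" shows "regular_on R M xs"
proof -
  have nz: "carrier M \<noteq> {\<zero>\<^sub>M}" by (rule gr_regular_nontrivial[OF g])
  have "z \<in> filt_seq M (take i xs) p" if "i < length xs" "z \<in> W M p" "xs ! i \<odot>\<^sub>M z \<in> filt_seq M (take i xs) (Suc p)" for i p z
    using g[unfolded gr_regular_iff'[OF nz]] gr_regular_iff[OF M xs] that by simp
  from regular_of_gr_regular[OF M fg xs this]
  have 1: "\<forall>i<length xs. \<forall>z\<in>carrier M. xs ! i \<odot>\<^sub>M z \<in> set_smult R M (set (take i xs)) \<longrightarrow> z \<in> set_smult R M (set (take i xs))" by blast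
  have "set_smult R M (set xs) \<subseteq> W M 1"
    by (rule M.set_smult_least[OF W_submodule[OF M]]) (use xs W_mult1[OF M, of _ _ 0] in \<open>auto simp: W_0[OF M]\<close>)
  moreover have "W M 1 \<subset> carrier M" using nakayama[OF M fg] nz W_carrier[OF M] by blast
  ultimately have "set_smult R M (set xs) \<noteq> carrier M" by blast
  thus ?thesis using M.regular_on_iff[OF xsR] 1 by blast
qed

context
  fixes S d \<epsilon>
  assumes reg: "regular_on R M xs" and c: "coord_res S d \<epsilon> M {\<zero>\<^sub>M}"
begin

abbreviation "k \<equiv> length xs"
abbreviation "SC \<equiv> (cone_idx ^^ k) S"
abbreviation "DC \<equiv> SF.cones d xs"

lemma nz: "carrier M \<noteq> {\<zero>\<^sub>M}" by (rule regular_nontrivial[OF reg])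

lemma reg': "i < length xs \<Longrightarrow> z \<in> carrier M \<Longrightarrow> xs ! i \<odot>\<^sub>M z \<in> set_smult R M (set (take i xs)) \<Longrightarrow> z \<in> set_smult R M (set (take i xs))"
  using reg unfolding M.regular_on_iff[OF xsR] by blast

lemma cone_coord_res: "\<exists>\<eta>. coord_res SC DC \<eta> M (set_smult R M (set xs))"
  by (rule coord_res_cones[OF M c xs reg'])

lemma M_res: "minimal_free_resolution R \<mm> M (\<lambda>n. FM (S n)) d"
  by (rule coord_res_min_res[OF c M M M.lin_maps_id]) simp_all

lemma L: "submodule (set_smult R M (set xs)) R M" by (rule M.set_smult_submodule[OF xsR])

lemma MxM_res: "minimal_free_resolution R \<mm> MxM (\<lambda>n. FM (SC n)) DC"
proof -
  obtain \<eta> where e: "coord_res SC DC \<eta> M (set_smult R M (set xs))" using cone_coord_res by blast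
  show ?thesis
  proof (rule coord_res_min_res[OF e M M.quot_module_module[OF L], where \<pi> = "\<lambda>z. set_smult R M (set xs) +>\<^bsub>M\<^esub> z"])
    show "(\<lambda>z. set_smult R M (set xs) +>\<^bsub>M\<^esub> z) \<in> lin_maps R M MxM"
      by (auto simp: lin_maps_def M.quot_carrier M.quot_simps(1,2)[OF L])
    show "(\<lambda>z. set_smult R M (set xs) +>\<^bsub>M\<^esub> z) ` carrier M = carrier MxM" by (auto simp: M.quot_carrier)
    show "set_smult R M (set xs) +>\<^bsub>M\<^esub> z = \<zero>\<^sub>MxM \<longleftrightarrow> z \<in> set_smult R M (set xs)" if "z \<in> carrier M" for z
      using M.coset_eq_H[OF L that] by (simp add: M.quot_simps(3))
  qed
qed

lemma M_koszul: "koszul_module R \<mm> M \<longleftrightarrow> (\<forall>n>0. \<forall>i. SF.exact_mod (FS S) (FS' S) d n i)"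
  using koszul_iff[OF M M_res M c nz] lin_exact_iff[OF c] by simp

lemma cone_lin_exact: "lin_exact (\<lambda>n. FM (SC n)) DC n \<longleftrightarrow> (\<forall>i. SF.exact_mod (cone_filts k (FS S)) (cone_filts k (FS' S)) DC n i)"
  using cone_coord_res lin_exact_iff by (metis FS_cone_idxs)

lemma MxM_koszul: "koszul_module R \<mm> MxM \<longleftrightarrow> (\<forall>n>0. \<forall>i. SF.exact_mod (cone_filts k (FS S)) (cone_filts k (FS' S)) DC n i)"
proof -
  obtain \<eta> where e: "coord_res SC DC \<eta> M (set_smult R M (set xs))" using cone_coord_res by blast
  show ?thesis using koszul_iff[OF M.quot_module_module[OF L] MxM_res M e nz] cone_lin_exact by simp
qed

lemma koszul_descends: assumes "koszul_module R \<mm> MxM" shows "koszul_module R \<mm> M"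
proof -
  have "SF.exact_mod (cone_filts 0 (FS S)) (cone_filts 0 (FS' S)) (SF.cones d (take 0 xs)) n i" if "n > 0" for n i
  proof (rule SF.cones_exact_mod_rev[OF coord_resD(3)[OF c] FS_filt_sys[OF c] FS'_filt_sys[OF c] xs _ _ _ _ that])
    show "\<mm> \<subseteq> carrier R" using mm.Icarr by blast
    show "FS S n i \<subseteq> FS' S n i" if "i < n" for n i using that by (auto simp: FS_def FS'_def)
    show "SF.exact_mod (cone_filts (length xs) (FS S)) (cone_filts (length xs) (FS' S)) DC n i" if "n > 0" for n i
      using assms that unfolding MxM_koszul by blast
  qed simp
  thus ?thesis unfolding M_koszul by (intro allI impI) simp
qed

context
  assumes Mk: "koszul_module R \<mm> M"
begin

text \<open>The linear part of the resolution of the quotient has the homology of the Koszul complex.\<close>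

lemma cone_koszul_exact: "lin_exact (\<lambda>n. FM (SC n)) DC n \<longleftrightarrow> NF.koszul_exact xb {\<zero>\<^sub>(GM M)} n"
proof -
  have mR: "\<mm> \<subseteq> carrier R" using mm.Icarr by blast
  have "SF.exact_mod (aug_filt S \<epsilon> M) (FS' S) d n i" for n i
    by (rule aug_filt_exact[OF M c]) (use Mk in \<open>simp add: M_koszul\<close>)
  note cmp = SF.cones_exact_mod_compare[OF coord_resD(3)[OF c] FS_filt_sys[OF c] FS'_filt_sys[OF c] aug_filt_sys[OF M c] xs mR aug_filt_sub(2)[OF M c] aug_filt_sub(1)[OF M c] this]
  show ?thesis unfolding cone_lin_exact lifts_exact[OF M c xs] cmp ..
qed

text \<open>If Koszul homology vanishes in degree one for each initial segment, the sequence is regular; conversely a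
  regular sequence has no Koszul homology in positive degrees.\<close>

lemma MxM_koszul_iff: "koszul_module R \<mm> MxM \<longleftrightarrow> regular_on GR (GM M) xb"
proof
  assume a: "koszul_module R \<mm> MxM"
  have e: "NF.koszul_exact xb {\<zero>\<^sub>(GM M)} n" if "n > 0" for n using a that unfolding MxM_koszul cone_koszul_exact[symmetric] cone_lin_exact by blast
  show "regular_on GR (GM M) xb" unfolding gr_regular_iff'[OF nz]
  proof (intro allI impI ballI)
    fix i z assume i: "i < length xb" and z: "z \<in> carrier (GM M)" "xb ! i \<odot>\<^sub>(GM M) z \<in> set_smult GR (GM M) (set (take i xb))"
    have mR: "\<mm> \<subseteq> carrier R" using mm.Icarr by blast
    have "SF.exact_mod (cone_filts (Suc i) (FS S)) (cone_filts (Suc i) (aug_filt S \<epsilon> M)) (SF.cones d (take (Suc i) xs)) 1 j" for j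
    proof (rule SF.cones_exact_mod_rev[OF coord_resD(3)[OF c] FS_filt_sys[OF c] aug_filt_sys[OF M c] xs mR])
      show "FS S n i \<subseteq> aug_filt S \<epsilon> M n i" if "i < n" for n i by (rule aug_filt_small[OF M c that])
      show "SF.exact_mod (cone_filts (length xs) (FS S)) (cone_filts (length xs) (aug_filt S \<epsilon> M)) DC n i" if "n > 0" for n i
        using e[OF that] lifts_exact[OF M c xs] by blast
    qed (use i in simp_all)
    moreover have l: "length (take (Suc i) xs) = Suc i" using i by simp
    moreover have txs: "set (take (Suc i) xs) \<subseteq> \<mm>" using xs set_take_subset[of "Suc i" xs] by blast
    ultimately have "NF.koszul_exact (map (cls SR 1) (take (Suc i) xs)) {\<zero>\<^sub>(GM M)} 1" unfolding lifts_exact[OF M c txs] l by blast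
    hence e1: "NF.koszul_exact (take i xb @ [xb ! i]) {\<zero>\<^sub>(GM M)} 1" using i by (simp add: take_Suc_conv_app_nth take_map)
    show "z \<in> set_smult GR (GM M) (set (take i xb))"
      by (rule NF.koszul_exact_regular_last[OF _ _ e1 z]) (use cls_set[OF M xs] set_take_subset[of i xb] nth_mem[OF i] in blast)+
  qed
next
  assume "regular_on GR (GM M) xb"
  hence r: "\<And>i z. i < length xb \<Longrightarrow> z \<in> carrier (GM M) \<Longrightarrow> xb ! i \<odot>\<^sub>(GM M) z \<in> set_smult GR (GM M) (set (take i xb)) \<Longrightarrow> z \<in> set_smult GR (GM M) (set (take i xb))"
    unfolding gr_regular_iff'[OF nz] by blast
  note xb = cls_set[OF M xs]
  have "NF.koszul_exact xb {\<zero>\<^sub>(GM M)} n" if "n > 0" for n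
    by (rule NF.koszul_exact_regular[OF xb N.R.genideal_self[OF xb] r]) (use that in simp_all)
  thus "koszul_module R \<mm> MxM" unfolding MxM_koszul cone_lin_exact[symmetric] cone_koszul_exact by blast
qed

lemma lin_defect_MxM: "lin_defect R \<mm> MxM = ereal (real (length xs)) - grade GR (Idl\<^bsub>GR\<^esub> (set xb)) (GM M)"
proof -
  obtain \<eta> where e: "coord_res SC DC \<eta> M (set_smult R M (set xs))" using cone_coord_res by blast
  let ?E = "NF.koszul_exact xb {\<zero>\<^sub>(GM M)}"
  have E0: "\<not> ?E 0" using lin_exact_zero[OF M e nz] by (simp add: cone_koszul_exact)
  have En: "?E n" if "n < 0 \<or> int (length xs) < n" for n using NF.koszul_exact_vanish[OF _ cls_set[OF M xs] N.zero_submodule] that by simp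
  define r where "r = (GREATEST r. \<not> ?E (int r))"
  have b: "q \<le> length xs" if "\<not> ?E (int q)" for q using En[of "int q"] that by fastforce
  have r1: "\<not> ?E (int r)" unfolding r_def by (rule GreatestI_nat[of "\<lambda>r. \<not> ?E (int r)" 0]) (use E0 b in auto)
  have r2: "q \<le> r" if "\<not> ?E (int q)" for q unfolding r_def by (rule Greatest_le_nat[of "\<lambda>r. \<not> ?E (int r)"]) (use that b in auto)
  have r3: "n \<le> int r" if "\<not> ?E n" for n
  proof -
    have "n \<ge> 0" using En[of n] that by fastforce
    then obtain q where "n = int q" by (metis nonneg_int_cases)
    thus ?thesis using r2 that by simp
  qed
  have "lin_defect R \<mm> MxM = Sup {ereal (real_of_int i) | i. \<not> ?E i}"
    using lin_defect_eq[OF M.quot_module_module[OF L] MxM_res] by (simp add: cone_koszul_exact)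
  also have "\<dots> = ereal (real r)"
  proof (rule antisym)
    show "Sup {ereal (real_of_int i) | i. \<not> ?E i} \<le> ereal (real r)"
    proof (rule Sup_least)
      fix y assume "y \<in> {ereal (real_of_int i) | i. \<not> ?E i}"
      then obtain i where "y = ereal (real_of_int i)" "\<not> ?E i" by blast
      thus "y \<le> ereal (real r)" using r3[of i] by simp
    qed
    show "ereal (real r) \<le> Sup {ereal (real_of_int i) | i. \<not> ?E i}"
      by (rule Sup_upper) (use r1 in \<open>auto intro!: exI[of _ "int r"]\<close>)
  qed
  moreover have "grade GR (Idl\<^bsub>GR\<^esub> (set xb)) (GM M) = ereal (real (length xs) - real r)"
    by (rule grade_eq(2)[OF M fg nz xs r1]) (use r3 in \<open>meson not_le\<close>)
  ultimately show ?thesis by simp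
qed

end

end

theorem koszul_regular:
  "(regular_on R M xs \<and> koszul_module R \<mm> M \<longrightarrow>
      lin_defect R \<mm> MxM = ereal (real (length xs)) - grade GR (Idl\<^bsub>GR\<^esub> (set xb)) (GM M) \<and>
      (koszul_module R \<mm> MxM \<longleftrightarrow> regular_on GR (GM M) xb)) \<and>
   (regular_on R M xs \<and> koszul_module R \<mm> MxM \<longrightarrow> koszul_module R \<mm> M) \<and>
   (regular_on GR (GM M) xb \<longrightarrow> (koszul_module R \<mm> M \<longleftrightarrow> koszul_module R \<mm> MxM))"
proof -
  obtain S d \<epsilon> where c: "coord_res S d \<epsilon> M {\<zero>\<^sub>M}" using coord_res_exists[OF M fg] by blast
  show ?thesis using lin_defect_MxM[OF _ c] MxM_koszul_iff[OF _ c] koszul_descends[OF _ c] lift_regular by blast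
qed

end

end

theorem theorem2p13:
  fixes R :: "('a, 'r) ring_scheme" and \<mm> :: "'a set"
    and xs :: "'a list" and M :: "('a, 'b, 'n) module_scheme"
  defines "A \<equiv> gr_ring R \<mm>"
    and "N \<equiv> gr_module R \<mm> M"
    and "xbar \<equiv> map (gr_class R \<mm> (self_module R) 1) xs"
    and "MxM \<equiv> quot_module M (set_smult R M (set xs))"
  assumes "noetherian_local_ring R \<mm>"
    and "set xs \<subseteq> \<mm>"
    and "module R M"
    and "fin_gen R M"
  shows
    "(regular_on R M xs \<and> koszul_module R \<mm> M \<longrightarrow>
        lin_defect R \<mm> MxM = ereal (real (length xs)) - grade A (Idl\<^bsub>A\<^esub> (set xbar)) N \<and>
        (koszul_module R \<mm> MxM \<longleftrightarrow> regular_on A N xbar)) \<and>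
     (regular_on R M xs \<and> koszul_module R \<mm> MxM \<longrightarrow> koszul_module R \<mm> M) \<and>
     (regular_on A N xbar \<longrightarrow> (koszul_module R \<mm> M \<longleftrightarrow> koszul_module R \<mm> MxM))"
  unfolding A_def N_def xbar_def MxM_def
  by (rule noeth_local.koszul_regular[OF noeth_local.intro]) fact+

end
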